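(* (Type $B(m,N-m)$, $m\ge1$.) Assume $N\ge2$ and $1\le m\le N-1$. Let $\chi$ be a bi-homomorphism on $\Pi$, write $q_{ij}=\chi(\alpha_i,\alpha_j)$, and let $\hat q:=q_{NN}$. Assume that $\hat q\in\mathbb{K}^\times_\infty$ and: $q_{ii}=\hat q^{-2}$ for $1\le i<N-m$; $q_{N-m,N-m}=-1$; $q_{ii}=\hat q^2$ for $N-m<i<N$; for $1\le i\le N-1$, $q_{i,i+1}q_{i+1,i}=\hat q^{2}$ if $i+1\le N-m$ and $q_{i,i+1}q_{i+1,i}=\hat q^{-2}$ if $i+1>N-m$; and $q_{ij}q_{ji}=1$ if $|i-j|\ge2$. Let $\Lambda\in\mathrm{Ch}(U^0(\chi))$ and $g(\Lambda):=\prod_{i=N-m}^N\Lambda(K_{\alpha_i}L_{-\alpha_i})$. Then $\dim\mathcal{L}_\chi(\Lambda)<\infty$ if and only if the following three conditions all hold: (i) for every $i\in I\setminus\{N-m\}$ there is an integer $r_i\ge0$ with $\Lambda(K_{\alpha_i}L_{-\alpha_i})=q_{ii}^{r_i}$; (ii) $g(\Lambda)\in\{\hat q^{-2x}\mid x\in\mathbb{Z},\ 0\le x\le m-1\}\cup\{(-\hat q)^{-(y+2m)}\mid y\in\mathbb{Z}_{\ge0}\}$; (iii) if $g(\Lambda)=\hat q^{-2x}$ for some integer $x$ with $0\le x\le m-1$, then $\Lambda(K_{\alpha_i}L_{-\alpha_i})=1$ for all $i$ with $N-m+x+1\le i\le N$.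
   Context: $\mathbb{K}$ is a field of characteristic $0$, $\mathbb{K}^\times=\mathbb{K}\setminus\{0\}$, and $\mathbb{K}^\times_\infty$ is the set of elements of $\mathbb{K}^\times$ that are not roots of unity. $N\ge1$ is an integer, $I=\{1,\dots,N\}$, $\Pi=\{\alpha_i\mid i\in I\}$, $\mathbb{Z}\Pi=\bigoplus_{i\in I}\mathbb{Z}\alpha_i$ (free $\mathbb{Z}$-module), $\mathbb{Z}_{\ge0}\Pi=\bigoplus_{i\in I}\mathbb{Z}_{\ge0}\alpha_i$. A bi-homomorphism on $\Pi$ is a map $\chi:\mathbb{Z}\Pi\times\mathbb{Z}\Pi\to\mathbb{K}^\times$ with $\chi(\alpha,\beta+\gamma)=\chi(\alpha,\beta)\chi(\alpha,\gamma)$ and $\chi(\alpha+\beta,\gamma)=\chi(\alpha,\gamma)\chi(\beta,\gamma)$. Generalized quantum group $U(\chi)$: $\tilde U=\tilde U(\chi)$ is the unital associative $\mathbb{K}$-algebra with generators $\tilde K_\alpha,\tilde L_\alpha$ ($\alpha\in\mathbb{Z}\Pi$), $\tilde E_i,\tilde F_i$ ($i\in I$) and relations $\tilde K_0=\tilde L_0=1$, $\tilde K_\alpha\tilde K_\beta=\tilde K_{\alpha+\beta}$, $\tilde L_\alpha\tilde L_\beta=\tilde L_{\alpha+\beta}$, $\tilde K_\alpha\tilde L_\beta=\tilde L_\beta\tilde K_\alpha$, $\tilde K_\alpha\tilde E_i=\chi(\alpha,\alpha_i)\tilde E_i\tilde K_\alpha$, $\tilde L_\alpha\tilde E_i=\chi(-\alpha_i,\alpha)\tilde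 E_i\tilde L_\alpha$, $\tilde K_\alpha\tilde F_i=\chi(\alpha,-\alpha_i)\tilde F_i\tilde K_\alpha$, $\tilde L_\alpha\tilde F_i=\chi(\alpha_i,\alpha)\tilde F_i\tilde L_\alpha$, $\tilde E_i\tilde F_j-\tilde F_j\tilde E_i=\delta_{ij}(-\tilde K_{\alpha_i}+\tilde L_{\alpha_i})$. It is $\mathbb{Z}\Pi$-graded with $\tilde K_\alpha,\tilde L_\alpha$ in degree $0$, $\tilde E_i$ in degree $\alpha_i$, $\tilde F_i$ in degree $-\alpha_i$. $\tilde U^0,\tilde U^+,\tilde U^-$ are the unital subalgebras generated by the $\tilde K_\alpha,\tilde L_\alpha$, by the $\tilde E_i$, and by the $\tilde F_i$. Define subspaces $\tilde{\mathcal I}^-_{-\alpha}\subseteq\tilde U^-_{-\alpha}$ ($\alpha\in\mathbb{Z}_{\ge0}\Pi$) inductively: $\tilde{\mathcal I}^-_0=0$ and, for $\alpha\ne0$, $\tilde{\mathcal I}^-_{-\alpha}$ is the set of $Y\in\tilde U^-_{-\alpha}$ with $[\tilde E_i,Y]\in\tilde{\mathcal I}^-_{-\alpha+\alpha_i}\tilde K_{\alpha_i}+\tilde{\mathcal I}^-_{-\alpha+\alpha_i}\tilde L_{\alpha_i}$ for all $i$ with $\alpha-\alpha_i\in\mathbb{Z}_{\ge0}\Pi$. Put $\tilde{\mathcal I}^-=\bigoplus_\alpha\tilde{\mathcal I}^-_{-\alpha}$ and $\tilde{\mathcal J}^-=\mathrm{Span}_{\mathbb{K}}(\tilde{\mathcal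 I}^-\tilde U^0\tilde U^+)$ (an ideal). Let $\tilde\Omega$ be the algebra automorphism of $\tilde U$ with $\tilde K_\alpha\mapsto\tilde K_{-\alpha}$, $\tilde L_\alpha\mapsto\tilde L_{-\alpha}$, $\tilde E_i\mapsto\tilde F_i\tilde L_{-\alpha_i}$, $\tilde F_i\mapsto\tilde K_{-\alpha_i}\tilde E_i$. Then $U(\chi)=\tilde U/(\tilde{\mathcal J}^-+\tilde\Omega(\tilde{\mathcal J}^-))$. Images of generators are written $K_\alpha,L_\alpha,E_i,F_i$; $U^0(\chi),U^\pm(\chi)$ are the images of $\tilde U^0,\tilde U^\pm$. Multiplication $U^-\otimes U^0\otimes U^+\to U$ is a linear isomorphism and the $K_\alpha L_\beta$ form a basis of $U^0$. Highest weight modules: $\mathrm{Ch}(U^0(\chi))$ is the set of unital $\mathbb{K}$-algebra homomorphisms $U^0(\chi)\to\mathbb{K}$. For $\Lambda\in\mathrm{Ch}(U^0(\chi))$, $\mathcal{M}_\chi(\Lambda)$ is the Verma module: generated by $\tilde v_\Lambda\neq0$ with $Z\tilde v_\Lambda=\Lambda(Z)\tilde v_\Lambda$ ($Z\in U^0$), $E_i\tilde v_\Lambda=0$ ($i\in I$), and $U^-\to\mathcal{M}_\chi(\Lambda)$, $Y\mapsto Y\tilde v_\Lambda$ bijective; it is graded by $\mathcal{M}_\chi(\Lambda)_\alpha=U^-_\alpha\tilde v_\Lambda$. $\mathcal{L}_\chi(\Lambda)$ is the quotient of $\mathcal{M}_\chi(\Lambda)$ by its maximal proper $\mathbb{Z}\Pi$-graded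 submodule. *)

theory Defs
  imports "HOL-Library.Poly_Mapping" "HOL-Algebra.QuotRing" "HOL-Algebra.Subrings"
    "HOL-Algebra.Module" "HOL-Algebra.Algebraic_Closure_Type"
begin

subsection \<open>Algebras and modules\<close>

text \<open>
  The ground field is a type \<open>'k :: field_char_0\<close>; as a HOL-Algebra ring it is
  \<open>ring_of_type_algebra\<close>. Associative \<open>'k\<close>-algebras, \<open>'k\<close>-vector spaces and left modules over a
  (noncommutative) algebra are all records \<open>('c, 'a) module\<close>: for algebras and vector spaces
  \<open>'c = 'k\<close>, for left modules \<open>'c\<close> is the element type of the algebra and the fields
  \<open>mult\<close> and \<open>one\<close> carry no meaning. The locale \<open>module\<close> of HOL-Algebra is restricted to
  commutative rings and is not used; the locale \<open>submodule\<close> has no such restriction.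
\<close>

definition with_smult :: "('a, 'z) ring_scheme \<Rightarrow> ('c \<Rightarrow> 'a \<Rightarrow> 'a) \<Rightarrow> ('c, 'a) module" where
  "with_smult R f = \<lparr>carrier = carrier R, monoid.mult = monoid.mult R, one = one R,
     ring.zero = ring.zero R, add = add R, module.smult = f\<rparr>"

text \<open>Used for a submodule \<open>W\<close> of a module and for a two-sided ideal \<open>W\<close> of an algebra.\<close>

definition quot :: "('c, 'a, 'z) module_scheme \<Rightarrow> 'a set \<Rightarrow> ('c, 'a set) module" where
  "quot M W = with_smult (M Quot W) (\<lambda>c C. \<Union>x\<in>C. W +>\<^bsub>M\<^esub> (c \<odot>\<^bsub>M\<^esub> x))"

definition regular_module :: "('a, 'z) ring_scheme \<Rightarrow> ('a, 'a) module" where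
  "regular_module A = with_smult A (monoid.mult A)"

definition underlying_space :: "('k, 'a) module \<Rightarrow> ('a, 'v) module \<Rightarrow> ('k, 'v) module" where
  "underlying_space A M = with_smult M (\<lambda>c v. (c \<odot>\<^bsub>A\<^esub> \<one>\<^bsub>A\<^esub>) \<odot>\<^bsub>M\<^esub> v)"

definition kspan :: "('k::field_char_0, 'v) module \<Rightarrow> 'v set \<Rightarrow> 'v set" where
  "kspan V S = \<Inter>{W. submodule W ring_of_type_algebra V \<and> S \<subseteq> W}"

definition finite_dimensional :: "('k::field_char_0, 'v) module \<Rightarrow> bool" where
  "finite_dimensional V \<longleftrightarrow> (\<exists>B. finite B \<and> B \<subseteq> carrier V \<and> kspan V B = carrier V)"

definition generated_subalgebra :: "('k::field_char_0, 'a) module \<Rightarrow> 'a set \<Rightarrow> 'a set" where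
  "generated_subalgebra A S =
     \<Inter>{B. subring B A \<and> submodule B ring_of_type_algebra A \<and> S \<subseteq> B}"

definition generated_left_ideal :: "('a, 'z) ring_scheme \<Rightarrow> 'a set \<Rightarrow> 'a set" where
  "generated_left_ideal A S = \<Inter>{W. submodule W A (regular_module A) \<and> S \<subseteq> W}"

definition alg_hom :: "('k, 'a) module \<Rightarrow> ('k, 'b) module \<Rightarrow> ('a \<Rightarrow> 'b) set" where
  "alg_hom A B = {h \<in> ring_hom A B. \<forall>c. \<forall>x \<in> carrier A. h (c \<odot>\<^bsub>A\<^esub> x) = c \<odot>\<^bsub>B\<^esub> h x}"

subsection \<open>The root lattice and bi-homomorphisms\<close>

type_synonym weight = "nat \<Rightarrow>\<^sub>0 int"

definition ZPi :: "nat \<Rightarrow> weight set" where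
  "ZPi N = {a. Poly_Mapping.keys a \<subseteq> {1..N}}"

definition ZPi_nonneg :: "nat \<Rightarrow> weight set" where
  "ZPi_nonneg N = {a \<in> ZPi N. \<forall>i. 0 \<le> Poly_Mapping.lookup a i}"

definition simple_root :: "nat \<Rightarrow> weight" where
  "simple_root i = Poly_Mapping.single i 1"

definition bihom :: "nat \<Rightarrow> (weight \<Rightarrow> weight \<Rightarrow> 'k::field_char_0) \<Rightarrow> bool" where
  "bihom N \<chi> \<longleftrightarrow>
     (\<forall>a \<in> ZPi N. \<forall>b \<in> ZPi N. \<chi> a b \<noteq> 0) \<and>
     (\<forall>a \<in> ZPi N. \<forall>b \<in> ZPi N. \<forall>c \<in> ZPi N. \<chi> a (b + c) = \<chi> a b * \<chi> a c) \<and>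
     (\<forall>a \<in> ZPi N. \<forall>b \<in> ZPi N. \<forall>c \<in> ZPi N. \<chi> (a + b) c = \<chi> a c * \<chi> b c)"

definition not_root_of_unity :: "'k::field_char_0 \<Rightarrow> bool" where
  "not_root_of_unity q \<longleftrightarrow> q \<noteq> 0 \<and> (\<forall>n::nat. 0 < n \<longrightarrow> q ^ n \<noteq> 1)"

subsection \<open>The free algebra\<close>

datatype generator = GenK weight | GenL weight | GenE nat | GenF nat

fun generators :: "nat \<Rightarrow> generator set" where
  "generators N = GenK ` ZPi N \<union> GenL ` ZPi N \<union> GenE ` {1..N} \<union> GenF ` {1..N}"

text \<open>
  The free monoid, written additively so that the convolution product of finitely supported
  functions \<open>word \<Rightarrow>\<^sub>0 'k\<close> is the multiplication of the free algebra.
\<close>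

datatype word = Word (letters: "generator list")

instantiation word :: monoid_add
begin
definition "0 = Word []"
definition "u + v = Word (letters u @ letters v)"
instance by standard (simp_all add: zero_word_def plus_word_def)
end

fun generator_weight :: "generator \<Rightarrow> weight" where
  "generator_weight (GenK a) = 0"
| "generator_weight (GenL a) = 0"
| "generator_weight (GenE i) = simple_root i"
| "generator_weight (GenF i) = - simple_root i"

definition word_weight :: "word \<Rightarrow> weight" where
  "word_weight w = sum_list (map generator_weight (letters w))"

definition words :: "nat \<Rightarrow> word set" where
  "words N = {w. set (letters w) \<subseteq> generators N}"

definition free_algebra :: "nat \<Rightarrow> ('k::field_char_0, word \<Rightarrow>\<^sub>0 'k) module" where
  "free_algebra N = \<lparr>carrier = {x. Poly_Mapping.keys x \<subseteq> words N}, monoid.mult = (*),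
     one = 1, ring.zero = 0,
     add = (+), module.smult = (\<lambda>c x. Poly_Mapping.single 0 c * x)\<rparr>"

abbreviation gen :: "generator \<Rightarrow> (word \<Rightarrow>\<^sub>0 'k::field_char_0)" where
  "gen g \<equiv> Poly_Mapping.single (Word [g]) 1"

subsection \<open>The algebra with generators and defining relations\<close>

context
  fixes N :: nat and \<chi> :: "weight \<Rightarrow> weight \<Rightarrow> 'k::field_char_0"
begin

text \<open>An equation \<open>x = y\<close> between elements of the free algebra is recorded as \<open>x - y\<close>.\<close>

inductive_set relations :: "(word \<Rightarrow>\<^sub>0 'k) set" where
  K_zero: "gen (GenK 0) - 1 \<in> relations"
| L_zero: "gen (GenL 0) - 1 \<in> relations"
| KK: "a \<in> ZPi N \<Longrightarrow> b \<in> ZPi N \<Longrightarrow> gen (GenK a) * gen (GenK b) - gen (GenK (a + b)) \<in> relations"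
| LL: "a \<in> ZPi N \<Longrightarrow> b \<in> ZPi N \<Longrightarrow> gen (GenL a) * gen (GenL b) - gen (GenL (a + b)) \<in> relations"
| KL: "a \<in> ZPi N \<Longrightarrow> b \<in> ZPi N \<Longrightarrow>
    gen (GenK a) * gen (GenL b) - gen (GenL b) * gen (GenK a) \<in> relations"
| KE: "a \<in> ZPi N \<Longrightarrow> i \<in> {1..N} \<Longrightarrow>
    gen (GenK a) * gen (GenE i)
      - Poly_Mapping.single 0 (\<chi> a (simple_root i)) * (gen (GenE i) * gen (GenK a)) \<in> relations"
| LE: "a \<in> ZPi N \<Longrightarrow> i \<in> {1..N} \<Longrightarrow>
    gen (GenL a) * gen (GenE i)
      - Poly_Mapping.single 0 (\<chi> (- simple_root i) a) * (gen (GenE i) * gen (GenL a)) \<in> relations"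
| KF: "a \<in> ZPi N \<Longrightarrow> i \<in> {1..N} \<Longrightarrow>
    gen (GenK a) * gen (GenF i)
      - Poly_Mapping.single 0 (\<chi> a (- simple_root i)) * (gen (GenF i) * gen (GenK a)) \<in> relations"
| LF: "a \<in> ZPi N \<Longrightarrow> i \<in> {1..N} \<Longrightarrow>
    gen (GenL a) * gen (GenF i)
      - Poly_Mapping.single 0 (\<chi> (simple_root i) a) * (gen (GenF i) * gen (GenL a)) \<in> relations"
| EF: "i \<in> {1..N} \<Longrightarrow> j \<in> {1..N} \<Longrightarrow>
    (gen (GenE i) * gen (GenF j) - gen (GenF j) * gen (GenE i))
      - (if i = j then - gen (GenK (simple_root i)) + gen (GenL (simple_root i)) else 0)
    \<in> relations"

definition rel_ideal :: "(word \<Rightarrow>\<^sub>0 'k) set" where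
  "rel_ideal = genideal (free_algebra N) relations"

definition tU :: "('k, (word \<Rightarrow>\<^sub>0 'k) set) module" where
  "tU = quot (free_algebra N) rel_ideal"

definition tclass :: "(word \<Rightarrow>\<^sub>0 'k) \<Rightarrow> (word \<Rightarrow>\<^sub>0 'k) set" where
  "tclass x = rel_ideal +>\<^bsub>free_algebra N :: ('k, word \<Rightarrow>\<^sub>0 'k) module\<^esub> x"

definition tK :: "weight \<Rightarrow> (word \<Rightarrow>\<^sub>0 'k) set" where "tK a = tclass (gen (GenK a))"
definition tL :: "weight \<Rightarrow> (word \<Rightarrow>\<^sub>0 'k) set" where "tL a = tclass (gen (GenL a))"
definition tE :: "nat \<Rightarrow> (word \<Rightarrow>\<^sub>0 'k) set" where "tE i = tclass (gen (GenE i))"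
definition tF :: "nat \<Rightarrow> (word \<Rightarrow>\<^sub>0 'k) set" where "tF i = tclass (gen (GenF i))"

definition tU_zero :: "(word \<Rightarrow>\<^sub>0 'k) set set" where
  "tU_zero = generated_subalgebra tU (tK ` ZPi N \<union> tL ` ZPi N)"

definition tU_plus :: "(word \<Rightarrow>\<^sub>0 'k) set set" where
  "tU_plus = generated_subalgebra tU (tE ` {1..N})"

definition tU_minus :: "(word \<Rightarrow>\<^sub>0 'k) set set" where
  "tU_minus = generated_subalgebra tU (tF ` {1..N})"

definition tU_component :: "weight \<Rightarrow> (word \<Rightarrow>\<^sub>0 'k) set set" where
  "tU_component b = kspan tU {tclass (Poly_Mapping.single w 1) |w. w \<in> words N \<and> word_weight w = b}"

subsection \<open>The generalized quantum group\<close>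

text \<open>
  \<open>tI_minus_at a Y\<close> says that \<open>Y\<close> lies in the subspace of weight \<open>- a\<close>. The recursion descends
  along the height of \<open>a\<close>, so the least fixed point is its unique solution.
\<close>

inductive tI_minus_at :: "weight \<Rightarrow> (word \<Rightarrow>\<^sub>0 'k) set \<Rightarrow> bool" where
  zero: "tI_minus_at 0 \<zero>\<^bsub>tU\<^esub>"
| nonzero: "a \<in> ZPi_nonneg N \<Longrightarrow> a \<noteq> 0 \<Longrightarrow> Y \<in> tU_minus \<inter> tU_component (- a) \<Longrightarrow>
    (\<And>i. i \<in> {1..N} \<Longrightarrow> a - simple_root i \<in> ZPi_nonneg N \<Longrightarrow>
      \<exists>P Z. tI_minus_at (a - simple_root i) P \<and> tI_minus_at (a - simple_root i) Z \<and>
        (tE i \<otimes>\<^bsub>tU\<^esub> Y) \<ominus>\<^bsub>tU\<^esub> (Y \<otimes>\<^bsub>tU\<^esub> tE i) =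
          (P \<otimes>\<^bsub>tU\<^esub> tK (simple_root i)) \<oplus>\<^bsub>tU\<^esub> (Z \<otimes>\<^bsub>tU\<^esub> tL (simple_root i))) \<Longrightarrow>
    tI_minus_at a Y"

definition tI_minus :: "(word \<Rightarrow>\<^sub>0 'k) set set" where
  "tI_minus = kspan tU {Y. \<exists>a \<in> ZPi_nonneg N. tI_minus_at a Y}"

definition tJ_minus :: "(word \<Rightarrow>\<^sub>0 'k) set set" where
  "tJ_minus = kspan tU
     {Y \<otimes>\<^bsub>tU\<^esub> Z \<otimes>\<^bsub>tU\<^esub> P |Y Z P. Y \<in> tI_minus \<and> Z \<in> tU_zero \<and> P \<in> tU_plus}"

text \<open>The values on generators determine \<open>tOmega\<close> on the carrier of \<open>tU\<close>.\<close>

definition tOmega :: "(word \<Rightarrow>\<^sub>0 'k) set \<Rightarrow> (word \<Rightarrow>\<^sub>0 'k) set" where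
  "tOmega = (SOME h. h \<in> alg_hom tU tU \<and> bij_betw h (carrier tU) (carrier tU) \<and>
     (\<forall>a \<in> ZPi N. h (tK a) = tK (- a) \<and> h (tL a) = tL (- a)) \<and>
     (\<forall>i \<in> {1..N}. h (tE i) = tF i \<otimes>\<^bsub>tU\<^esub> tL (- simple_root i) \<and>
                   h (tF i) = tK (- simple_root i) \<otimes>\<^bsub>tU\<^esub> tE i))"

definition U_ideal :: "(word \<Rightarrow>\<^sub>0 'k) set set" where
  "U_ideal = tJ_minus <+>\<^bsub>tU\<^esub> (tOmega ` tJ_minus)"

definition U :: "('k, (word \<Rightarrow>\<^sub>0 'k) set set) module" where
  "U = quot tU U_ideal"

definition Uclass :: "(word \<Rightarrow>\<^sub>0 'k) set \<Rightarrow> (word \<Rightarrow>\<^sub>0 'k) set set" where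
  "Uclass x = U_ideal +>\<^bsub>tU\<^esub> x"

definition UK :: "weight \<Rightarrow> (word \<Rightarrow>\<^sub>0 'k) set set" where "UK a = Uclass (tK a)"
definition UL :: "weight \<Rightarrow> (word \<Rightarrow>\<^sub>0 'k) set set" where "UL a = Uclass (tL a)"
definition UE :: "nat \<Rightarrow> (word \<Rightarrow>\<^sub>0 'k) set set" where "UE i = Uclass (tE i)"

definition U_zero :: "(word \<Rightarrow>\<^sub>0 'k) set set set" where "U_zero = Uclass ` tU_zero"
definition U_minus :: "(word \<Rightarrow>\<^sub>0 'k) set set set" where "U_minus = Uclass ` tU_minus"

definition U_component :: "weight \<Rightarrow> (word \<Rightarrow>\<^sub>0 'k) set set set" where
  "U_component b = Uclass ` tU_component b"

subsection \<open>Highest weight modules\<close>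

definition Ch :: "((word \<Rightarrow>\<^sub>0 'k) set set \<Rightarrow> 'k) set" where
  "Ch = alg_hom (U\<lparr>carrier := U_zero\<rparr>) (with_smult ring_of_type_algebra (*))"

text \<open>
  The Verma module is the quotient of the regular module by the left ideal generated by the
  defining relations of its cyclic vector. By triangular decomposition \<open>Y \<mapsto> Y v\<close> is a bijection
  from \<open>U_minus\<close> onto it, which characterizes it up to isomorphism.
\<close>

definition Verma_ideal :: "((word \<Rightarrow>\<^sub>0 'k) set set \<Rightarrow> 'k) \<Rightarrow> (word \<Rightarrow>\<^sub>0 'k) set set set" where
  "Verma_ideal \<Lambda> = generated_left_ideal U
     (UE ` {1..N} \<union> {Z \<ominus>\<^bsub>U\<^esub> (\<Lambda> Z \<odot>\<^bsub>U\<^esub> \<one>\<^bsub>U\<^esub>) |Z. Z \<in> U_zero})"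

definition Verma :: "((word \<Rightarrow>\<^sub>0 'k) set set \<Rightarrow> 'k)
    \<Rightarrow> ((word \<Rightarrow>\<^sub>0 'k) set set, (word \<Rightarrow>\<^sub>0 'k) set set set) module" where
  "Verma \<Lambda> = quot (regular_module U) (Verma_ideal \<Lambda>)"

definition Verma_vector :: "((word \<Rightarrow>\<^sub>0 'k) set set \<Rightarrow> 'k) \<Rightarrow> (word \<Rightarrow>\<^sub>0 'k) set set set" where
  "Verma_vector \<Lambda> = Verma_ideal \<Lambda> +>\<^bsub>U\<^esub> \<one>\<^bsub>U\<^esub>"

definition Verma_component ::
  "((word \<Rightarrow>\<^sub>0 'k) set set \<Rightarrow> 'k) \<Rightarrow> weight \<Rightarrow> (word \<Rightarrow>\<^sub>0 'k) set set set set" where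
  "Verma_component \<Lambda> b =
     {Y \<odot>\<^bsub>Verma \<Lambda>\<^esub> Verma_vector \<Lambda> |Y. Y \<in> U_minus \<inter> U_component b}"

definition graded_submodule ::
  "((word \<Rightarrow>\<^sub>0 'k) set set \<Rightarrow> 'k) \<Rightarrow> (word \<Rightarrow>\<^sub>0 'k) set set set set \<Rightarrow> bool" where
  "graded_submodule \<Lambda> W \<longleftrightarrow> submodule W U (Verma \<Lambda>) \<and>
     W = kspan (underlying_space U (Verma \<Lambda>)) (\<Union>b \<in> ZPi N. W \<inter> Verma_component \<Lambda> b)"

definition maximal_graded_submodule ::
  "((word \<Rightarrow>\<^sub>0 'k) set set \<Rightarrow> 'k) \<Rightarrow> (word \<Rightarrow>\<^sub>0 'k) set set set set" where
  "maximal_graded_submodule \<Lambda> = (THE W. graded_submodule \<Lambda> W \<and> W \<noteq> carrier (Verma \<Lambda>) \<and>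
     (\<forall>W'. graded_submodule \<Lambda> W' \<and> W' \<noteq> carrier (Verma \<Lambda>) \<longrightarrow> W' \<subseteq> W))"

definition simple_module :: "((word \<Rightarrow>\<^sub>0 'k) set set \<Rightarrow> 'k)
    \<Rightarrow> ((word \<Rightarrow>\<^sub>0 'k) set set, (word \<Rightarrow>\<^sub>0 'k) set set set set) module" where
  "simple_module \<Lambda> = quot (Verma \<Lambda>) (maximal_graded_submodule \<Lambda>)"

definition KL :: "nat \<Rightarrow> (word \<Rightarrow>\<^sub>0 'k) set set" where
  "KL i = UK (simple_root i) \<otimes>\<^bsub>U\<^esub> UL (- simple_root i)"

end

end

theory Submission
  imports Defs "HOL-Library.Function_Algebras"
begin

text \<open>
  Let \<open>eps x\<close> be the coefficient of the highest weight vector in \<open>x \<cdot> v\<close>, for the action of the free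
  algebra on the Verma module of \<open>tU\<close>. The defining ideal of \<open>U(\<chi>)\<close> lies in the radical of the form
  \<open>(x, y) \<mapsto> eps (x * y)\<close>, so the simple module is the quotient of the free algebra by this radical.
  It is finite-dimensional iff it has finitely many weights.

  At an isotropic simple root \<open>\<beta>\<^sub>i\<close> an odd reflection gives a new base for which the module is again a
  highest weight module, with highest weight vector \<open>F\<^sub>i v\<close>, or \<open>v\<close> if \<open>F\<^sub>i v = 0\<close>. A chain of \<open>m\<close> such
  reflections turns \<open>\<xi>\<^sub>n = \<alpha>\<^sub>n + \<dots> + \<alpha>\<^sub>N\<close>, where \<open>n = N - m\<close>, into a simple root. A rank one computation at
  this root and at the simple roots other than \<open>\<alpha>\<^sub>n\<close> yields the conditions, as the lowering operators must be
  nilpotent. Conversely, under these conditions the lowering operators are locally nilpotent, so the set of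
  weights is stable under reflections whose composition negates the suitably shifted coordinates; all
  weights then lie between two opposite cones and are finite in number.
\<close>

subsection \<open>Quotients presented by subsets of a ring\<close>

text \<open>The constants in (ii) and (iii) come from counting odd reflections. One has
  \<open>\<chi> (\<xi> n) (\<xi> n) = - inverse qh\<close>, and each reflection that really moves
  the highest weight multiplies the eigenvalue of \<open>K L\<close> at \<open>\<xi> n\<close> by
  \<open>qh ^ 2\<close>. If all \<open>m\<close> of them do, rank one demands that
  \<open>g * qh ^ (2 * m)\<close> be a power of \<open>- inverse qh\<close>, which is the second set
  in (ii). If the first trivial reflection comes after \<open>x\<close> effective ones, its
  triviality pins the eigenvalue to \<open>qh powi (- 2 * x)\<close> up to the later even labels,
  and nilpotency then forces those labels to vanish: this is the first set in (ii) together with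
  (iii). The main obstacle is that an odd reflection changes the base and the generators. The module
  is therefore axiomatised by its weight spaces, its torus and its irreducibility, which survive a
  reflection. Irreducibility also supplies the relations among lowering operators: an operator that
  lowers weights and commutes with all raising operators vanishes, and this yields the vanishing
  squares of isotropic operators, commutation up to scalars and the quantum Serre relations.\<close>

definition additive_subgroup_set :: "'r::ab_group_add set \<Rightarrow> bool" where
  "additive_subgroup_set S \<longleftrightarrow> 0 \<in> S \<and> (\<forall>x\<in>S. \<forall>y\<in>S. x - y \<in> S)"

lemma additive_subgroup_setD:
  assumes "additive_subgroup_set S"
  shows "0 \<in> S" "x \<in> S \<Longrightarrow> y \<in> S \<Longrightarrow> x - y \<in> S" "x \<in> S \<Longrightarrow> - x \<in> S" "x \<in> S \<Longrightarrow> y \<in> S \<Longrightarrow> x + y \<in> S"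
proof -
  show 0: "0 \<in> S" and d: "\<And>x y. x \<in> S \<Longrightarrow> y \<in> S \<Longrightarrow> x - y \<in> S"
    using assms by (auto simp: additive_subgroup_set_def)
  show m: "\<And>x. x \<in> S \<Longrightarrow> - x \<in> S" using d[OF 0] by simp
  show "x \<in> S \<Longrightarrow> y \<in> S \<Longrightarrow> x + y \<in> S" using d[of x "- y"] m[of y] by simp
qed

text \<open>Every record-based algebra or module below is a quotient of a subset \<open>A\<close> of the free algebra, whose type has
  type-class arithmetic; \<open>presents M p A R\<close> transfers the additive structure of \<open>M\<close> to \<open>A\<close>.\<close>

definition presents :: "('a, 'z) ring_scheme \<Rightarrow> ('r::ab_group_add \<Rightarrow> 'a) \<Rightarrow> 'r set \<Rightarrow> 'r set \<Rightarrow> bool" where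
  "presents M p A R \<longleftrightarrow> additive_subgroup_set A \<and> additive_subgroup_set R \<and> R \<subseteq> A \<and>
     carrier M = p ` A \<and> \<zero>\<^bsub>M\<^esub> = p 0 \<and> (\<forall>x\<in>A. \<forall>y\<in>A. p x \<oplus>\<^bsub>M\<^esub> p y = p (x + y)) \<and>
     (\<forall>x\<in>A. \<forall>y\<in>A. p x = p y \<longleftrightarrow> x - y \<in> R)"

lemma presentsD:
  assumes "presents M p A R"
  shows "additive_subgroup_set A" "additive_subgroup_set R" "R \<subseteq> A" "carrier M = p ` A" "\<zero>\<^bsub>M\<^esub> = p 0"
    "x \<in> A \<Longrightarrow> y \<in> A \<Longrightarrow> p x \<oplus>\<^bsub>M\<^esub> p y = p (x + y)"
    "x \<in> A \<Longrightarrow> y \<in> A \<Longrightarrow> p x = p y \<longleftrightarrow> x - y \<in> R"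
  using assms by (auto simp: presents_def)

lemma presents_zero_iff: "presents M p A R \<Longrightarrow> x \<in> A \<Longrightarrow> p x = \<zero>\<^bsub>M\<^esub> \<longleftrightarrow> x \<in> R"
  using presentsD(5,7)[of M p A R] presentsD(1)[of M p A R] additive_subgroup_setD(1)[of A] by force

lemma presents_comm_group:
  assumes M: "presents M p A R"
  shows "comm_group (add_monoid M)"
proof (rule comm_groupI)
  note D = presentsD[OF M] additive_subgroup_setD[OF presentsD(1)[OF M]]
  fix x y z assume "x \<in> carrier (add_monoid M)" "y \<in> carrier (add_monoid M)" "z \<in> carrier (add_monoid M)"
  then obtain a b c where "a \<in> A" "b \<in> A" "c \<in> A" "x = p a" "y = p b" "z = p c" by (auto simp: D(4))
  thus "x \<otimes>\<^bsub>add_monoid M\<^esub> y \<otimes>\<^bsub>add_monoid M\<^esub> z = x \<otimes>\<^bsub>add_monoid M\<^esub> (y \<otimes>\<^bsub>add_monoid M\<^esub> z)"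
    by (simp add: D(6) D(11) add.assoc)
next
  note D = presentsD[OF M] additive_subgroup_setD[OF presentsD(1)[OF M]]
  fix x y assume "x \<in> carrier (add_monoid M)" "y \<in> carrier (add_monoid M)"
  then obtain a b where "a \<in> A" "b \<in> A" "x = p a" "y = p b" by (auto simp: D(4))
  thus "x \<otimes>\<^bsub>add_monoid M\<^esub> y \<in> carrier (add_monoid M)"
      "x \<otimes>\<^bsub>add_monoid M\<^esub> y = y \<otimes>\<^bsub>add_monoid M\<^esub> x"
    by (simp_all add: D(4,6) D(11) add.commute)
next
  note D = presentsD[OF M] additive_subgroup_setD[OF presentsD(1)[OF M]]
  show "\<one>\<^bsub>add_monoid M\<^esub> \<in> carrier (add_monoid M)" by (simp add: D)
  fix x assume "x \<in> carrier (add_monoid M)"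
  then obtain a where a: "a \<in> A" "x = p a" by (auto simp: D(4))
  thus "\<one>\<^bsub>add_monoid M\<^esub> \<otimes>\<^bsub>add_monoid M\<^esub> x = x" by (simp add: D(5,6,8))
  have "p (- a) \<in> carrier (add_monoid M)" "p (- a) \<otimes>\<^bsub>add_monoid M\<^esub> x = \<one>\<^bsub>add_monoid M\<^esub>"
    using a by (simp_all add: D(4,5,6) D(10))
  thus "\<exists>y\<in>carrier (add_monoid M). y \<otimes>\<^bsub>add_monoid M\<^esub> x = \<one>\<^bsub>add_monoid M\<^esub>" by blast
qed

lemma presents_a_inv:
  assumes M: "presents M p A R" and a: "a \<in> A"
  shows "\<ominus>\<^bsub>M\<^esub> (p a) = p (- a)"
proof -
  note D = presentsD[OF M] additive_subgroup_setD[OF presentsD(1)[OF M]]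
  interpret comm_group "add_monoid M" by (rule presents_comm_group[OF M])
  have "inv\<^bsub>add_monoid M\<^esub> (p a) = p (- a)"
    by (rule inv_equality) (use a D(10) in \<open>simp_all add: D(4,5,6)\<close>)
  thus ?thesis by (simp add: a_inv_def)
qed

lemma presents_a_minus:
  assumes M: "presents M p A R" and "a \<in> A" "b \<in> A"
  shows "p a \<ominus>\<^bsub>M\<^esub> p b = p (a - b)"
  using assms presentsD(6)[OF M, of a "- b"] additive_subgroup_setD(3)[OF presentsD(1)[OF M]]
  by (simp add: a_minus_def presents_a_inv)

lemma presents_coset:
  assumes "presents M p A R" "S \<subseteq> A" "x \<in> A"
  shows "p ` S +>\<^bsub>M\<^esub> p x = (\<lambda>s. p (s + x)) ` S"
proof -
  have "p s \<oplus>\<^bsub>M\<^esub> p x = p (s + x)" if "s \<in> S" for s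
    using presentsD(6)[OF assms(1)] assms(2,3) that by blast
  thus ?thesis by (auto simp: a_r_coset_def r_coset_def)
qed

lemma presents_coset_eq_iff:
  assumes M: "presents M p A R" and S: "additive_subgroup_set S" "R \<subseteq> S" "S \<subseteq> A" and x: "x \<in> A" and y: "y \<in> A"
  shows "p ` S +>\<^bsub>M\<^esub> p x = p ` S +>\<^bsub>M\<^esub> p y \<longleftrightarrow> x - y \<in> S"
proof
  note D = presentsD[OF M] and A = additive_subgroup_setD[OF presentsD(1)[OF M]] and S' = additive_subgroup_setD[OF S(1)]
  assume "p ` S +>\<^bsub>M\<^esub> p x = p ` S +>\<^bsub>M\<^esub> p y"
  hence eq: "(\<lambda>s. p (s + x)) ` S = (\<lambda>s. p (s + y)) ` S"
    by (simp add: presents_coset[OF M S(3)] x y)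
  have "p (0 + x) \<in> (\<lambda>s. p (s + y)) ` S" unfolding eq[symmetric] using S'(1) by blast
  then obtain s where s: "s \<in> S" "p x = p (s + y)" by auto
  hence "x - (s + y) \<in> R" using D(7)[of x "s + y"] x y A(4) S(3) by auto
  hence "(x - (s + y)) + s \<in> S" using S(2) s S'(4) by blast
  thus "x - y \<in> S" by simp
next
  note D = presentsD[OF M] and S' = additive_subgroup_setD[OF S(1)]
  assume xy: "x - y \<in> S"
  have "(\<lambda>s. p (s + x)) ` S = (\<lambda>s. p (s + y)) ` S"
  proof (intro equalityI subsetI)
    fix z assume "z \<in> (\<lambda>s. p (s + x)) ` S"
    then obtain s where "s \<in> S" "z = p ((s + (x - y)) + y)" by auto
    thus "z \<in> (\<lambda>s. p (s + y)) ` S" using S'(4) xy by blast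
  next
    fix z assume "z \<in> (\<lambda>s. p (s + y)) ` S"
    then obtain s where "s \<in> S" "z = p ((s - (x - y)) + x)" by auto
    thus "z \<in> (\<lambda>s. p (s + x)) ` S" using S'(2) xy by blast
  qed
  thus "p ` S +>\<^bsub>M\<^esub> p x = p ` S +>\<^bsub>M\<^esub> p y" by (simp add: presents_coset[OF M S(3)] x y)
qed

lemma quot_sel:
  "carrier (quot M W) = a_rcosets\<^bsub>M\<^esub> W" "\<zero>\<^bsub>quot M W\<^esub> = W" "add (quot M W) = set_add M"
  "monoid.mult (quot M W) = rcoset_mult M W" "\<one>\<^bsub>quot M W\<^esub> = W +>\<^bsub>M\<^esub> \<one>\<^bsub>M\<^esub>"
  "module.smult (quot M W) = (\<lambda>c C. \<Union>x\<in>C. W +>\<^bsub>M\<^esub> (c \<odot>\<^bsub>M\<^esub> x))"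
  by (simp_all add: quot_def with_smult_def FactRing_def)

context
  fixes M :: "('c, 'a, 'z) module_scheme" and p :: "'r::ab_group_add \<Rightarrow> 'a" and A R S
  assumes M: "presents M p A R" and S: "additive_subgroup_set S" "R \<subseteq> S" "S \<subseteq> A"
begin

lemma presents_quot: "presents (quot M (p ` S)) (\<lambda>x. p ` S +>\<^bsub>M\<^esub> p x) A S"
  unfolding presents_def
proof (intro conjI ballI)
  note D = presentsD[OF M] and A = additive_subgroup_setD[OF presentsD(1)[OF M]] and S' = additive_subgroup_setD[OF S(1)]
  show "additive_subgroup_set A" "additive_subgroup_set S" "S \<subseteq> A" using D S by auto
  show "carrier (quot M (p ` S)) = (\<lambda>x. p ` S +>\<^bsub>M\<^esub> p x) ` A"
    by (auto simp: quot_sel A_RCOSETS_def' D(4))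
  show "\<zero>\<^bsub>quot M (p ` S)\<^esub> = p ` S +>\<^bsub>M\<^esub> p 0"
    using A(1) by (simp add: quot_sel presents_coset[OF M S(3)])
  fix x y assume x: "x \<in> A" and y: "y \<in> A"
  show "p ` S +>\<^bsub>M\<^esub> p x = p ` S +>\<^bsub>M\<^esub> p y \<longleftrightarrow> x - y \<in> S"
    by (rule presents_coset_eq_iff[OF M S x y])
  have add: "p (s + x) \<oplus>\<^bsub>M\<^esub> p (t + y) = p ((s + t) + (x + y))" if "s \<in> S" "t \<in> S" for s t
    using D(6)[of "s + x" "t + y"] A(4) that S(3) x y by (simp add: subset_iff algebra_simps)
  have "(\<lambda>s. p (s + x)) ` S <+>\<^bsub>M\<^esub> (\<lambda>s. p (s + y)) ` S = (\<lambda>s. p (s + (x + y))) ` S"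
  proof (intro equalityI subsetI)
    fix z assume "z \<in> (\<lambda>s. p (s + x)) ` S <+>\<^bsub>M\<^esub> (\<lambda>s. p (s + y)) ` S"
    then obtain s t where "s \<in> S" "t \<in> S" "z = p ((s + t) + (x + y))"
      using add by (auto simp: set_add_def set_mult_def)
    thus "z \<in> (\<lambda>s. p (s + (x + y))) ` S" using S'(4) by blast
  next
    fix z assume "z \<in> (\<lambda>s. p (s + (x + y))) ` S"
    then obtain s where s: "s \<in> S" "z = p ((s + 0) + (x + y))" by auto
    hence "z = p (s + x) \<oplus>\<^bsub>M\<^esub> p (0 + y)" using add[of s 0] S'(1) by simp
    thus "z \<in> (\<lambda>s. p (s + x)) ` S <+>\<^bsub>M\<^esub> (\<lambda>s. p (s + y)) ` S"
      using s S'(1) by (force simp: set_add_def set_mult_def)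
  qed
  thus "(p ` S +>\<^bsub>M\<^esub> p x) \<oplus>\<^bsub>quot M (p ` S)\<^esub> (p ` S +>\<^bsub>M\<^esub> p y) = p ` S +>\<^bsub>M\<^esub> p (x + y)"
    using A(4) x y by (simp add: quot_sel presents_coset[OF M S(3)])
qed

text \<open>The action on a coset is encoded as a union over its members. Additivity of
  \<open>f\<close> and stability of \<open>S\<close> make all members contribute the same coset, so
  the union collapses to one. Field scalars and multiplication by algebra elements are both
  instances of \<open>f\<close>.\<close>

lemma quot_smult:
  assumes f: "\<And>x. x \<in> A \<Longrightarrow> f x \<in> A" "\<And>x. x \<in> A \<Longrightarrow> c \<odot>\<^bsub>M\<^esub> p x = p (f x)"
    "\<And>x y. x \<in> A \<Longrightarrow> y \<in> A \<Longrightarrow> f (x + y) = f x + f y" "\<And>x. x \<in> S \<Longrightarrow> f x \<in> S" and x: "x \<in> A"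
  shows "c \<odot>\<^bsub>quot M (p ` S)\<^esub> (p ` S +>\<^bsub>M\<^esub> p x) = p ` S +>\<^bsub>M\<^esub> p (f x)"
proof -
  note A = additive_subgroup_setD[OF presentsD(1)[OF M]] and S' = additive_subgroup_setD[OF S(1)]
  have "p ` S +>\<^bsub>M\<^esub> (c \<odot>\<^bsub>M\<^esub> p (s + x)) = p ` S +>\<^bsub>M\<^esub> p (f x)" if s: "s \<in> S" for s
  proof -
    have sA: "s \<in> A" using s S(3) by blast
    have "p ` S +>\<^bsub>M\<^esub> p (f (s + x)) = p ` S +>\<^bsub>M\<^esub> p (f x)"
      unfolding presents_coset_eq_iff[OF M S f(1)[OF A(4)[OF sA x]] f(1)[OF x]]
      using f(3)[OF sA x] f(4)[OF s] by simp
    thus ?thesis using f(2)[OF A(4)[OF sA x]] by simp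
  qed
  thus ?thesis using S'(1) by (auto simp: quot_sel presents_coset[OF M S(3) x])
qed

end

definition subring_set :: "'r::ring_1 set \<Rightarrow> bool" where
  "subring_set A \<longleftrightarrow> additive_subgroup_set A \<and> 1 \<in> A \<and> (\<forall>x\<in>A. \<forall>y\<in>A. x * y \<in> A)"

definition ideal_set :: "'r::ring_1 set \<Rightarrow> 'r set \<Rightarrow> bool" where
  "ideal_set A S \<longleftrightarrow> additive_subgroup_set S \<and> S \<subseteq> A \<and> (\<forall>a\<in>A. \<forall>s\<in>S. a * s \<in> S \<and> s * a \<in> S)"

definition presents_ring :: "('a, 'z) ring_scheme \<Rightarrow> ('r::ring_1 \<Rightarrow> 'a) \<Rightarrow> 'r set \<Rightarrow> 'r set \<Rightarrow> bool" where
  "presents_ring M p A R \<longleftrightarrow> presents M p A R \<and> subring_set A \<and> ideal_set A R \<and> \<one>\<^bsub>M\<^esub> = p 1 \<and>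
     (\<forall>x\<in>A. \<forall>y\<in>A. p x \<otimes>\<^bsub>M\<^esub> p y = p (x * y))"

lemma presents_ringD:
  assumes "presents_ring M p A R"
  shows "presents M p A R" "\<one>\<^bsub>M\<^esub> = p 1" "x \<in> A \<Longrightarrow> y \<in> A \<Longrightarrow> p x \<otimes>\<^bsub>M\<^esub> p y = p (x * y)"
    "1 \<in> A" "x \<in> A \<Longrightarrow> y \<in> A \<Longrightarrow> x * y \<in> A" "x \<in> A \<Longrightarrow> r \<in> R \<Longrightarrow> x * r \<in> R" "x \<in> A \<Longrightarrow> r \<in> R \<Longrightarrow> r * x \<in> R"
  using assms by (auto simp: presents_ring_def subring_set_def ideal_set_def)

text \<open>Products of cosets are unions over all choices of representatives; two choices differ by
  an element of the two-sided ideal \<open>S\<close>, so the union is a single coset.\<close>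

lemma presents_ring_quot:
  fixes M :: "('c, 'a, 'z) module_scheme"
  assumes M: "presents_ring M p A R" and I: "ideal_set A S" "R \<subseteq> S"
  shows "presents_ring (quot M (p ` S)) (\<lambda>x. p ` S +>\<^bsub>M\<^esub> p x) A S"
  unfolding presents_ring_def
proof (intro conjI ballI)
  note D = presents_ringD[OF M]
  have S: "additive_subgroup_set S" "R \<subseteq> S" "S \<subseteq> A" using I by (auto simp: ideal_set_def)
  note A = additive_subgroup_setD[OF presentsD(1)[OF D(1)]] and S' = additive_subgroup_setD[OF S(1)]
  have Sl: "a * s \<in> S" "s * a \<in> S" if "a \<in> A" "s \<in> S" for a s using I that by (auto simp: ideal_set_def)
  show "presents (quot M (p ` S)) (\<lambda>x. p ` S +>\<^bsub>M\<^esub> p x) A S" by (rule presents_quot[OF D(1) S])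
  show "subring_set A" "ideal_set A S" using M I by (auto simp: presents_ring_def)
  show "\<one>\<^bsub>quot M (p ` S)\<^esub> = p ` S +>\<^bsub>M\<^esub> p 1" by (simp add: quot_sel D(2))
  fix x y assume x: "x \<in> A" and y: "y \<in> A"
  have "p ` S +>\<^bsub>M\<^esub> (p (s + x) \<otimes>\<^bsub>M\<^esub> p (t + y)) = p ` S +>\<^bsub>M\<^esub> p (x * y)" if st: "s \<in> S" "t \<in> S" for s t
  proof -
    have stA: "s + x \<in> A" "t + y \<in> A" using st S(3) A(4) x y by auto
    have "p ` S +>\<^bsub>M\<^esub> p ((s + x) * (t + y)) = p ` S +>\<^bsub>M\<^esub> p (x * y)"
      unfolding presents_coset_eq_iff[OF D(1) S D(5)[OF stA] D(5)[OF x y]]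
      using S'(4)[OF Sl(2)[OF stA(2) st(1)] Sl(1)[OF x st(2)]] by (simp add: algebra_simps)
    thus ?thesis using D(3)[OF stA] by simp
  qed
  thus "(p ` S +>\<^bsub>M\<^esub> p x) \<otimes>\<^bsub>quot M (p ` S)\<^esub> (p ` S +>\<^bsub>M\<^esub> p y) = p ` S +>\<^bsub>M\<^esub> p (x * y)"
    using S'(1) by (auto simp: quot_sel rcoset_mult_def presents_coset[OF D(1) S(3)] x y)
qed

lemma presents_ring_ring:
  assumes M: "presents_ring M p A R"
  shows "ring M"
proof (rule ringI)
  note D = presents_ringD[OF M] and P = presentsD[OF presents_ringD(1)[OF M]]
    and A = additive_subgroup_setD[OF presentsD(1)[OF presents_ringD(1)[OF M]]]
  show "abelian_group M"
    using presents_comm_group[OF D(1)] by (simp add: abelian_group_def abelian_group_axioms_def abelian_monoid_def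
      comm_group.axioms(1))
  show "monoid M"
    by (rule monoidI) (auto simp: P(4) D(2,3,4,5) mult.assoc)
  fix x y z assume "x \<in> carrier M" "y \<in> carrier M" "z \<in> carrier M"
  then obtain a b c where "a \<in> A" "b \<in> A" "c \<in> A" "x = p a" "y = p b" "z = p c" by (auto simp: P(4))
  thus "(x \<oplus>\<^bsub>M\<^esub> y) \<otimes>\<^bsub>M\<^esub> z = x \<otimes>\<^bsub>M\<^esub> z \<oplus>\<^bsub>M\<^esub> y \<otimes>\<^bsub>M\<^esub> z"
    "z \<otimes>\<^bsub>M\<^esub> (x \<oplus>\<^bsub>M\<^esub> y) = z \<otimes>\<^bsub>M\<^esub> x \<oplus>\<^bsub>M\<^esub> z \<otimes>\<^bsub>M\<^esub> y"
    by (simp_all add: P(6) D(3,5) A(4) algebra_simps)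
qed

text \<open>\<open>S\<close> is an arbitrary set of representatives, so only its saturation under
  \<open>R\<close> is determined by the image; hence the preimage on the right instead of
  \<open>S\<close>.\<close>

lemma presents_subgroup_iff:
  assumes M: "presents M p A R" and S: "S \<subseteq> A"
  shows "subgroup (p ` S) (add_monoid M) \<longleftrightarrow> additive_subgroup_set {x \<in> A. p x \<in> p ` S}"
proof
  note D = presentsD[OF M] and A = additive_subgroup_setD[OF presentsD(1)[OF M]]
  assume s: "subgroup (p ` S) (add_monoid M)"
  show "additive_subgroup_set {x \<in> A. p x \<in> p ` S}"
    unfolding additive_subgroup_set_def
  proof (intro conjI ballI)
    show "0 \<in> {x \<in> A. p x \<in> p ` S}" using subgroup.one_closed[OF s] A(1) by (simp add: D(5))
    fix x y assume "x \<in> {x \<in> A. p x \<in> p ` S}" "y \<in> {x \<in> A. p x \<in> p ` S}"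
    hence xy: "x \<in> A" "y \<in> A" "p x \<in> p ` S" "p y \<in> p ` S" by auto
    have "p (- y) \<in> p ` S" using subgroup.m_inv_closed[OF s xy(4)] presents_a_inv[OF M xy(2)] by (simp add: a_inv_def)
    hence "p x \<oplus>\<^bsub>M\<^esub> p (- y) \<in> p ` S" using subgroup.m_closed[OF s xy(3)] by simp
    thus "x - y \<in> {x \<in> A. p x \<in> p ` S}" using xy A D(6)[OF xy(1) A(3)[OF xy(2)]] by simp
  qed
next
  note D = presentsD[OF M] and A = additive_subgroup_setD[OF presentsD(1)[OF M]]
  assume s: "additive_subgroup_set {x \<in> A. p x \<in> p ` S}"
  note s' = additive_subgroup_setD[OF s]
  show "subgroup (p ` S) (add_monoid M)"
  proof (unfold_locales, goal_cases)
    case 1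
    thus ?case using S by (auto simp: D(4))
  next
    case (2 x y)
    then obtain a b where ab: "a \<in> S" "b \<in> S" "x = p a" "y = p b" by auto
    hence "a + b \<in> {x \<in> A. p x \<in> p ` S}" using S by (intro s'(4)) auto
    moreover have "p a \<oplus>\<^bsub>M\<^esub> p b = p (a + b)" using ab D(6) S by blast
    ultimately show ?case using ab by simp
  next
    case 3
    thus ?case using s'(1) by (simp add: D(5))
  next
    case (4 x)
    then obtain a where a: "a \<in> S" "x = p a" by auto
    hence "- a \<in> {x \<in> A. p x \<in> p ` S}" using S by (intro s'(3)) auto
    thus ?case using a S presents_a_inv[OF M, of a] by (auto simp: a_inv_def)
  qed
qed

subsection \<open>The free algebra\<close>

type_synonym 'k walg = "word \<Rightarrow>\<^sub>0 'k"

definition sc :: "'k::field_char_0 \<Rightarrow> 'k walg \<Rightarrow> 'k walg" where "sc c x = Poly_Mapping.single 0 c * x"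

abbreviation mon :: "word \<Rightarrow> 'k::field_char_0 walg" where "mon w \<equiv> Poly_Mapping.single w 1"

lemma sc_single: "sc c (Poly_Mapping.single w d) = Poly_Mapping.single w (c * d)"
  by (simp add: sc_def mult_single)

lemma pm_expand: "x = (\<Sum>w\<in>Poly_Mapping.keys x. Poly_Mapping.single w (Poly_Mapping.lookup x w))"
  by (rule poly_mapping_eqI) (simp add: lookup_sum lookup_single when_def sum.delta in_keys_iff)

lemma single_central: "x * Poly_Mapping.single (0::word) c = Poly_Mapping.single 0 (c::'k::field_char_0) * x"
proof -
  have "(\<Sum>w\<in>K. Poly_Mapping.single w (f w)) * Poly_Mapping.single (0::word) c
     = Poly_Mapping.single 0 c * (\<Sum>w\<in>K. Poly_Mapping.single w (f w))" for K and f :: "word \<Rightarrow> 'k"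
    by (simp add: sum_distrib_left sum_distrib_right mult_single mult.commute)
  from this[of "\<lambda>w. Poly_Mapping.lookup x w" "Poly_Mapping.keys x"] show ?thesis
    using pm_expand[of x] by simp
qed

lemma sc_mult_left: "sc c x * y = sc c (x * y)" by (simp add: sc_def mult.assoc)
lemma sc_mult_right: "x * sc c y = sc c (x * y)"
  by (simp add: sc_def single_central flip: mult.assoc)
lemma sc_lookup: "Poly_Mapping.lookup (sc c x) w = c * Poly_Mapping.lookup x w"
proof -
  have "sc c x = Poly_Mapping.map ((*) c) x" by (simp add: sc_def mult_map_scale_conv_mult)
  thus ?thesis by (simp add: Poly_Mapping.map.rep_eq when_def)
qed

global_interpretation FA: vector_space "sc :: 'k::field_char_0 \<Rightarrow> 'k walg \<Rightarrow> 'k walg"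
  by unfold_locales
    (simp_all add: sc_def distrib_left distrib_right single_add mult_single flip: mult.assoc)

lemma sc_one_mult: "sc c 1 * x = sc c x" by (simp add: sc_mult_left)

lemma pm_expand_sc: "(x :: 'k::field_char_0 walg) = (\<Sum>w\<in>Poly_Mapping.keys x. sc (Poly_Mapping.lookup x w) (mon w))"
  using pm_expand[of x] by (simp add: sc_single)

lemma span_mon: "FA.span (mon ` W :: 'k::field_char_0 walg set) = {x. Poly_Mapping.keys x \<subseteq> W}"
proof (intro equalityI subsetI)
  fix x assume "x \<in> FA.span (mon ` W)"
  thus "x \<in> {x. Poly_Mapping.keys x \<subseteq> W}"
  proof (induction rule: FA.span_induct_alt)
    case (step c x y)
    then obtain w where "w \<in> W" "x = mon w" by blast
    thus ?case using step Poly_Mapping.keys_add[of "Poly_Mapping.single w c" y]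
      by (auto simp: sc_single split: if_splits)
  qed simp
next
  fix x :: "'k walg" assume "x \<in> {x. Poly_Mapping.keys x \<subseteq> W}"
  hence "(\<Sum>w\<in>Poly_Mapping.keys x. sc (Poly_Mapping.lookup x w) (mon w)) \<in> FA.span (mon ` W)"
    by (intro FA.span_sum FA.span_scale FA.span_base) auto
  thus "x \<in> FA.span (mon ` W)" using pm_expand_sc[of x] by simp
qed

text \<open>The linear extension of a map on words, written as a finite sum over the
  support.\<close>

definition lin :: "(word \<Rightarrow> 'k::field_char_0 walg) \<Rightarrow> 'k walg \<Rightarrow> 'k walg" where
  "lin f x = (\<Sum>w\<in>Poly_Mapping.keys x. sc (Poly_Mapping.lookup x w) (f w))"

lemma lin_superset:
  assumes "finite S" "Poly_Mapping.keys x \<subseteq> S"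
  shows "lin f x = (\<Sum>w\<in>S. sc (Poly_Mapping.lookup x w) (f w))"
  unfolding lin_def using assms
  by (intro sum.mono_neutral_left) (auto simp: in_keys_iff)

lemma lin_add: "lin f (x + y) = lin f x + lin f y"
proof -
  let ?S = "Poly_Mapping.keys x \<union> Poly_Mapping.keys y"
  have "lin f (x + y) = (\<Sum>w\<in>?S. sc (Poly_Mapping.lookup (x + y) w) (f w))"
    using Poly_Mapping.keys_add[of x y] by (intro lin_superset) auto
  also have "\<dots> = lin f x + lin f y"
    by (simp add: lin_superset[of ?S x] lin_superset[of ?S y] lookup_add FA.scale_left_distrib sum.distrib)
  finally show ?thesis .
qed

lemma lin_sc: "lin f (sc c x) = sc c (lin f x)"
proof -
  have "lin f (sc c x) = (\<Sum>w\<in>Poly_Mapping.keys x. sc (Poly_Mapping.lookup (sc c x) w) (f w))"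
    by (intro lin_superset) (auto simp: in_keys_iff sc_lookup)
  thus ?thesis by (simp add: lin_def sc_lookup FA.scale_sum_right)
qed

lemma lin_0 [simp]: "lin f 0 = 0" by (simp add: lin_def)
lemma lin_mon [simp]: "lin f (mon w) = f w" by (simp add: lin_def)
lemma lin_uminus: "lin f (- x) = - lin f x" using lin_sc[of f "-1" x] by simp
lemma lin_diff: "lin f (x - y) = lin f x - lin f y" using lin_add[of f x "- y"] by (simp add: lin_uminus)

lemma mon_mult: "mon u * mon w = mon (u + w)" by (simp add: mult_single)
lemma mon_0: "mon 0 = 1" by simp

lemma mon_Word_Cons: "mon (Word (g # gs)) = gen g * mon (Word gs)"
  by (simp add: mult_single plus_word_def)
lemma mon_Word_Nil: "mon (Word []) = 1" by (simp flip: zero_word_def)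

definition Acar :: "nat \<Rightarrow> 'k::field_char_0 walg set" where "Acar N = {x. Poly_Mapping.keys x \<subseteq> words N}"

lemma Acar_span: "Acar N = FA.span (mon ` words N)" by (simp add: Acar_def span_mon)

lemma words_simps: "0 \<in> words N" "Word [] \<in> words N" "u \<in> words N \<Longrightarrow> w \<in> words N \<Longrightarrow> u + w \<in> words N"
  "Word (g # gs) \<in> words N \<longleftrightarrow> g \<in> generators N \<and> Word gs \<in> words N"
  by (auto simp: words_def zero_word_def plus_word_def simp del: generators.simps)

lemma Acar_subspace: "FA.subspace (Acar N)" unfolding Acar_span by (rule FA.subspace_span)

lemma Acar_mult: assumes "x \<in> Acar N" "y \<in> Acar N" shows "x * y \<in> Acar N"
  using assms keys_mult[of x y] words_simps(3) by (auto simp: Acar_def) blast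

lemma Acar_closed [simp]:
  "0 \<in> Acar N" "1 \<in> Acar N" "x \<in> Acar N \<Longrightarrow> y \<in> Acar N \<Longrightarrow> x + y \<in> Acar N"
  "x \<in> Acar N \<Longrightarrow> y \<in> Acar N \<Longrightarrow> x - y \<in> Acar N" "x \<in> Acar N \<Longrightarrow> - x \<in> Acar N"
  "x \<in> Acar N \<Longrightarrow> sc c x \<in> Acar N" "w \<in> words N \<Longrightarrow> mon w \<in> Acar N"
proof -
  show "0 \<in> Acar N" by (rule FA.subspace_0[OF Acar_subspace])
  show "1 \<in> Acar N" by (simp add: Acar_def words_simps)
  show "w \<in> words N \<Longrightarrow> mon w \<in> Acar N" by (simp add: Acar_def)
qed (rule FA.subspace_add[OF Acar_subspace] FA.subspace_diff[OF Acar_subspace] FA.subspace_neg[OF Acar_subspace]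
   FA.subspace_scale[OF Acar_subspace]; assumption)+

declare Acar_mult [simp]

lemma gen_Acar [simp]: "g \<in> generators N \<Longrightarrow> gen g \<in> Acar N"
  by (simp add: words_simps del: generators.simps)

lemma subspace_additive: "FA.subspace S \<Longrightarrow> additive_subgroup_set S"
  by (auto simp: additive_subgroup_set_def FA.subspace_0 FA.subspace_diff)

lemma free_algebra_sel:
  "carrier (free_algebra N) = Acar N" "\<zero>\<^bsub>free_algebra N\<^esub> = 0" "\<one>\<^bsub>free_algebra N\<^esub> = 1"
  "x \<oplus>\<^bsub>free_algebra N\<^esub> y = x + y" "x \<otimes>\<^bsub>free_algebra N\<^esub> y = x * y" "c \<odot>\<^bsub>free_algebra N\<^esub> x = sc c x"
  by (simp_all add: free_algebra_def Acar_def sc_def)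

lemma subring_set_Acar: "subring_set (Acar N)"
  by (simp add: subring_set_def subspace_additive[OF Acar_subspace])

lemma presents_ring_free_algebra: "presents_ring (free_algebra N) (\<lambda>x. x) (Acar N) {0}"
  unfolding presents_ring_def presents_def
  by (simp add: free_algebra_sel subspace_additive[OF Acar_subspace] subring_set_Acar ideal_set_def additive_subgroup_set_def)

lemma ideal_free_algebra_iff: "ideal S (free_algebra N) \<longleftrightarrow> ideal_set (Acar N) S"
proof
  assume "ideal S (free_algebra N)"
  then interpret ideal S "free_algebra N" .
  have sub: "S \<subseteq> Acar N" using a_subset by (simp add: free_algebra_sel)
  have "S = (\<lambda>x. x) ` S" by simp
  hence "additive_subgroup_set {x \<in> Acar N. x \<in> S}"
    using presents_subgroup_iff[OF presents_ringD(1)[OF presents_ring_free_algebra] sub] a_subgroup by simp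
  moreover have "{x \<in> Acar N. x \<in> S} = S" using sub by blast
  ultimately show "ideal_set (Acar N) S"
    using sub I_l_closed I_r_closed by (simp add: ideal_set_def free_algebra_sel)
next
  assume S: "ideal_set (Acar N) S"
  hence sub: "S \<subseteq> Acar N" by (simp add: ideal_set_def)
  have "{x \<in> Acar N. x \<in> S} = S" using sub by blast
  hence "subgroup S (add_monoid (free_algebra N))"
    using presents_subgroup_iff[OF presents_ringD(1)[OF presents_ring_free_algebra] sub] S by (simp add: ideal_set_def)
  thus "ideal S (free_algebra N)"
    using S by (intro idealI presents_ring_ring[OF presents_ring_free_algebra]) (auto simp: free_algebra_sel ideal_set_def)
qed

lemma carrier_ring_of_type [simp]: "carrier (ring_of_type_algebra :: 'k::field_char_0 ring) = UNIV"
  by (simp add: ring_of_type_algebra_def)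

definition presents_space :: "('k::field_char_0, 'a) module \<Rightarrow> ('k walg \<Rightarrow> 'a) \<Rightarrow> 'k walg set \<Rightarrow> 'k walg set \<Rightarrow> bool" where
  "presents_space M p A R \<longleftrightarrow> presents M p A R \<and> FA.subspace A \<and> (\<forall>x\<in>A. \<forall>c. c \<odot>\<^bsub>M\<^esub> p x = p (sc c x))"

lemma submodule_image_iff:
  assumes M: "presents_space M p A R" and S: "S \<subseteq> A"
  shows "submodule (p ` S) ring_of_type_algebra M \<longleftrightarrow> FA.subspace {x \<in> A. p x \<in> p ` S}"
proof -
  have P: "presents M p A R" and A: "FA.subspace A" and sm: "\<And>x c. x \<in> A \<Longrightarrow> c \<odot>\<^bsub>M\<^esub> p x = p (sc c x)"
    using M by (auto simp: presents_space_def)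
  have "FA.subspace {x \<in> A. p x \<in> p ` S} \<longleftrightarrow>
     additive_subgroup_set {x \<in> A. p x \<in> p ` S} \<and> (\<forall>c. \<forall>x\<in>S. p (sc c x) \<in> p ` S)"
  proof
    assume s: "FA.subspace {x \<in> A. p x \<in> p ` S}"
    have "p (sc c x) \<in> p ` S" if "x \<in> S" for c x
      using FA.subspace_scale[OF s, of x c] that S by auto
    thus "additive_subgroup_set {x \<in> A. p x \<in> p ` S} \<and> (\<forall>c. \<forall>x\<in>S. p (sc c x) \<in> p ` S)"
      using subspace_additive[OF s] by blast
  next
    assume s: "additive_subgroup_set {x \<in> A. p x \<in> p ` S} \<and> (\<forall>c. \<forall>x\<in>S. p (sc c x) \<in> p ` S)"
    show "FA.subspace {x \<in> A. p x \<in> p ` S}"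
    proof (rule FA.subspaceI)
      fix c x assume "x \<in> {x \<in> A. p x \<in> p ` S}"
      then obtain y where y: "x \<in> A" "y \<in> S" "p x = p y" by auto
      have "p (sc c x) = c \<odot>\<^bsub>M\<^esub> p y" using sm[OF y(1)] y(3) by simp
      also have "\<dots> = p (sc c y)" using sm y(2) S by blast
      finally show "sc c x \<in> {x \<in> A. p x \<in> p ` S}" using s y FA.subspace_scale[OF A] by simp
    qed (use additive_subgroup_setD[of "{x \<in> A. p x \<in> p ` S}"] s in auto)
  qed
  moreover have "submodule (p ` S) ring_of_type_algebra M \<longleftrightarrow>
     subgroup (p ` S) (add_monoid M) \<and> (\<forall>c. \<forall>x\<in>S. p (sc c x) \<in> p ` S)"
  proof -
    have "c \<odot>\<^bsub>M\<^esub> p x = p (sc c x)" if "x \<in> S" for x c using sm S that by blast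
    hence "(\<forall>a. \<forall>x\<in>p ` S. a \<odot>\<^bsub>M\<^esub> x \<in> p ` S) \<longleftrightarrow> (\<forall>c. \<forall>x\<in>S. p (sc c x) \<in> p ` S)" by simp
    thus ?thesis by (simp add: submodule_def submodule_axioms_def Ball_def)
  qed
  ultimately show ?thesis using presents_subgroup_iff[OF P S] by simp
qed

text \<open>A submodule containing the image of \<open>T\<close> pulls back to a subspace of
  \<open>A\<close> containing \<open>T\<close>, hence containing \<open>FA.span T\<close>;
  conversely the image of the span is itself a submodule. This reduces every span in a quotient
  record to a span in the free algebra.\<close>

lemma kspan_image:
  assumes M: "presents_space M p A R" and T: "T \<subseteq> A"
  shows "kspan M (p ` T) = p ` FA.span T"
proof
  have P: "presents M p A R" and A: "FA.subspace A" and sm: "\<And>x c. x \<in> A \<Longrightarrow> c \<odot>\<^bsub>M\<^esub> p x = p (sc c x)"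
    using M by (auto simp: presents_space_def)
  have sub: "FA.span T \<subseteq> A" by (rule FA.span_minimal[OF T A])
  have "FA.subspace {x \<in> A. p x \<in> p ` FA.span T}"
  proof (rule FA.subspaceI)
    show "0 \<in> {x \<in> A. p x \<in> p ` FA.span T}" using FA.span_zero FA.subspace_0[OF A] by auto
    fix x c assume "x \<in> {x \<in> A. p x \<in> p ` FA.span T}"
    then obtain a where a: "x \<in> A" "a \<in> FA.span T" "p x = p a" by auto
    have "p (sc c x) = p (sc c a)" using sm a sub by (metis subsetD)
    thus "sc c x \<in> {x \<in> A. p x \<in> p ` FA.span T}"
      using a FA.subspace_scale[OF A] FA.span_scale[OF a(2), of c] by auto
    fix y assume "y \<in> {x \<in> A. p x \<in> p ` FA.span T}"
    then obtain b where b: "y \<in> A" "b \<in> FA.span T" "p y = p b" by auto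
    have "p (x + y) = p x \<oplus>\<^bsub>M\<^esub> p y" by (rule presentsD(6)[OF P, symmetric]) (use a b in auto)
    also have "\<dots> = p (a + b)" using presentsD(6)[OF P] a b sub by auto
    finally show "x + y \<in> {x \<in> A. p x \<in> p ` FA.span T}"
      using a b FA.subspace_add[OF A] FA.span_add[OF a(2) b(2)] by auto
  qed
  hence "submodule (p ` FA.span T) ring_of_type_algebra M" by (simp add: submodule_image_iff[OF M sub])
  thus "kspan M (p ` T) \<subseteq> p ` FA.span T"
    unfolding kspan_def using FA.span_superset by (intro Inter_lower) auto
  show "p ` FA.span T \<subseteq> kspan M (p ` T)"
    unfolding kspan_def
  proof (intro Inter_greatest, clarify)
    fix W x assume W: "submodule W ring_of_type_algebra M" "p ` T \<subseteq> W" and x: "x \<in> FA.span T"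
    define S where "S = {x \<in> A. p x \<in> W}"
    have "subgroup W (add_monoid M)" using W(1) by (simp add: submodule_def)
    hence "W \<subseteq> carrier M" using subgroup.subset by fastforce
    hence WS: "W = p ` S" using presentsD(4)[OF P] by (auto simp: S_def)
    have SA: "S \<subseteq> A" by (auto simp: S_def)
    have "{x \<in> A. p x \<in> p ` S} = S" unfolding WS[symmetric] by (simp add: S_def)
    moreover have "FA.subspace {x \<in> A. p x \<in> p ` S}"
      using submodule_image_iff[OF M SA] W(1)[unfolded WS] by blast
    ultimately have "FA.subspace S" by simp
    moreover have "T \<subseteq> S" using W(2) T by (auto simp: S_def)
    ultimately have "FA.span T \<subseteq> S" by (intro FA.span_minimal)
    thus "p x \<in> W" using x WS by blast
  qed
qed

lemma finite_dimensional_iff: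
  assumes M: "presents_space M p A R"
  shows "finite_dimensional M \<longleftrightarrow> (\<exists>T. finite T \<and> T \<subseteq> A \<and> (\<forall>x\<in>A. \<exists>t\<in>FA.span T. x - t \<in> R))"
proof -
  have P: "presents M p A R" and A: "FA.subspace A" using M by (auto simp: presents_space_def)
  have "finite_dimensional M \<longleftrightarrow> (\<exists>T. finite T \<and> T \<subseteq> A \<and> kspan M (p ` T) = p ` A)"
    unfolding finite_dimensional_def presentsD(4)[OF P]
  proof
    assume "\<exists>B. finite B \<and> B \<subseteq> p ` A \<and> kspan M B = p ` A"
    then obtain B where "finite B" "B \<subseteq> p ` A" "kspan M B = p ` A" by blast
    thus "\<exists>T. finite T \<and> T \<subseteq> A \<and> kspan M (p ` T) = p ` A"
      using finite_subset_image[of B p A] by blast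
  qed blast
  also have "\<dots> \<longleftrightarrow> (\<exists>T. finite T \<and> T \<subseteq> A \<and> (\<forall>x\<in>A. \<exists>t\<in>FA.span T. x - t \<in> R))"
  proof (intro ex_cong1 conj_cong refl)
    fix T assume T: "T \<subseteq> A"
    have sub: "FA.span T \<subseteq> A" by (rule FA.span_minimal[OF T A])
    have eq: "p x = p t \<longleftrightarrow> x - t \<in> R" if "x \<in> A" "t \<in> FA.span T" for x t
      using presentsD(7)[OF P] that sub by blast
    have "p ` FA.span T = p ` A \<longleftrightarrow> (\<forall>x\<in>A. \<exists>t\<in>FA.span T. p x = p t)" using sub by blast
    thus "kspan M (p ` T) = p ` A \<longleftrightarrow> (\<forall>x\<in>A. \<exists>t\<in>FA.span T. x - t \<in> R)"
      unfolding kspan_image[OF M T] using eq by blast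
  qed
  finally show ?thesis .
qed

lemma presents_space_quot:
  assumes M: "presents_space M p A R" and S: "FA.subspace S" "R \<subseteq> S" "S \<subseteq> A"
  shows "presents_space (quot M (p ` S)) (\<lambda>x. p ` S +>\<^bsub>M\<^esub> p x) A S"
proof -
  have P: "presents M p A R" and A: "FA.subspace A" and sm: "\<And>x c. x \<in> A \<Longrightarrow> c \<odot>\<^bsub>M\<^esub> p x = p (sc c x)"
    using M by (auto simp: presents_space_def)
  show ?thesis
    unfolding presents_space_def
    using presents_quot[OF P subspace_additive[OF S(1)] S(2,3)] A
      quot_smult[OF P subspace_additive[OF S(1)] S(2,3), of "sc c" c for c] FA.subspace_scale[OF A] FA.subspace_scale[OF S(1)] sm
    by (auto simp: FA.scale_right_distrib)
qed

text \<open>Because \<open>B\<close> contains \<open>R\<close>, it is the full preimage of its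
  image, and its closure properties pass to the quotient.\<close>

lemma generated_subalgebra_least:
  assumes M: "presents_space M p A R" and Mr: "presents_ring M p A R"
    and B: "subring_set B" "FA.subspace B" "B \<subseteq> A" "R \<subseteq> B" and S: "S \<subseteq> p ` B"
  shows "generated_subalgebra M S \<subseteq> p ` B"
proof -
  note P = presentsD[OF presents_ringD(1)[OF Mr]] and D = presents_ringD[OF Mr]
  interpret ring M by (rule presents_ring_ring[OF Mr])
  have eq: "{x \<in> A. p x \<in> p ` B} = B"
  proof (intro equalityI subsetI)
    fix x assume "x \<in> {x \<in> A. p x \<in> p ` B}"
    then obtain b where b: "x \<in> A" "b \<in> B" "p x = p b" by auto
    hence "x - b \<in> B" using P(7)[of x b] B by auto
    hence "(x - b) + b \<in> B" using b(2) FA.subspace_add[OF B(2)] by blast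
    thus "x \<in> B" by simp
  qed (use B in auto)
  have "submodule (p ` B) ring_of_type_algebra M" using submodule_image_iff[OF M B(3)] B(2) eq by simp
  moreover have "subring (p ` B) M"
  proof (rule subringI)
    show "p ` B \<subseteq> carrier M" using B P by auto
    show "\<one>\<^bsub>M\<^esub> \<in> p ` B" using B D by (auto simp: subring_set_def)
    fix x assume "x \<in> p ` B"
    then obtain a where a: "a \<in> B" "x = p a" by auto
    thus "\<ominus>\<^bsub>M\<^esub> x \<in> p ` B"
      using presents_a_inv[OF D(1), of a] B FA.subspace_neg[OF B(2)] by auto
    fix y assume "y \<in> p ` B"
    then obtain b where b: "b \<in> B" "y = p b" by auto
    have "x \<otimes>\<^bsub>M\<^esub> y = p (a * b)" using a b D(3)[of a b] B by auto
    thus "x \<otimes>\<^bsub>M\<^esub> y \<in> p ` B" using a b B(1) by (auto simp: subring_set_def)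
    have "x \<oplus>\<^bsub>M\<^esub> y = p (a + b)" using a b P(6)[of a b] B by auto
    thus "x \<oplus>\<^bsub>M\<^esub> y \<in> p ` B" using a b FA.subspace_add[OF B(2)] by auto
  qed
  ultimately show ?thesis unfolding generated_subalgebra_def using S by blast
qed

lemma generated_subalgebra_closed:
  "x \<in> S \<Longrightarrow> x \<in> generated_subalgebra M S"
  "\<one>\<^bsub>M\<^esub> \<in> generated_subalgebra M S"
  "x \<in> generated_subalgebra M S \<Longrightarrow> y \<in> generated_subalgebra M S \<Longrightarrow> x \<otimes>\<^bsub>M\<^esub> y \<in> generated_subalgebra M S"
  "x \<in> generated_subalgebra M S \<Longrightarrow> y \<in> generated_subalgebra M S \<Longrightarrow> x \<oplus>\<^bsub>M\<^esub> y \<in> generated_subalgebra M S"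
  "x \<in> generated_subalgebra M S \<Longrightarrow> c \<odot>\<^bsub>M\<^esub> x \<in> generated_subalgebra M S"
  unfolding generated_subalgebra_def
  by (auto simp: subring_def submodule_def submodule_axioms_def
     intro: submonoid.one_closed submonoid.m_closed dest: subgroup.m_closed)

subsection \<open>The algebra with generators and defining relations\<close>

lemma ZPi_closed [simp]:
  "0 \<in> ZPi N" "a \<in> ZPi N \<Longrightarrow> b \<in> ZPi N \<Longrightarrow> a + b \<in> ZPi N" "a \<in> ZPi N \<Longrightarrow> - a \<in> ZPi N"
  "a \<in> ZPi N \<Longrightarrow> b \<in> ZPi N \<Longrightarrow> a - b \<in> ZPi N" "i \<in> {1..N} \<Longrightarrow> simple_root i \<in> ZPi N"
  by (auto simp: ZPi_def simple_root_def keys_add[THEN subsetD] in_keys_iff lookup_add lookup_minus subset_iff)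
    (metis (no_types, lifting) add_0)+

text \<open>A bi-homomorphism is controlled on \<open>ZPi N\<close> only; precomposed with this projection it becomes a total bicharacter.\<close>

definition restrict_weight :: "nat \<Rightarrow> weight \<Rightarrow> weight" where
  "restrict_weight N a = (\<Sum>i\<in>{1..N}. Poly_Mapping.single i (Poly_Mapping.lookup a i))"

lemma lookup_restrict_weight:
  "Poly_Mapping.lookup (restrict_weight N a) i = (if i \<in> {1..N} then Poly_Mapping.lookup a i else 0)"
  by (simp add: restrict_weight_def lookup_sum lookup_single when_def sum.delta)

lemma restrict_weight_ZPi [simp]: "restrict_weight N a \<in> ZPi N"
  by (auto simp: ZPi_def in_keys_iff lookup_restrict_weight split: if_splits)

lemma restrict_weight_id [simp]: "a \<in> ZPi N \<Longrightarrow> restrict_weight N a = a"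
  by (rule poly_mapping_eqI) (auto simp: lookup_restrict_weight ZPi_def in_keys_iff)

lemma restrict_weight_add: "restrict_weight N (a + b) = restrict_weight N a + restrict_weight N b"
  by (rule poly_mapping_eqI) (auto simp: lookup_restrict_weight lookup_add)

lemma word_weight_simps [simp]:
  "word_weight 0 = 0" "word_weight (Word []) = 0" "word_weight (Word (g # gs)) = generator_weight g + word_weight (Word gs)"
  "word_weight (u + w) = word_weight u + word_weight w"
  by (simp_all add: word_weight_def zero_word_def plus_word_def)

lemma generator_weight_ZPi: "g \<in> generators N \<Longrightarrow> generator_weight g \<in> ZPi N"
  by auto

lemma word_weight_ZPi:
  assumes "w \<in> words N" shows "word_weight w \<in> ZPi N"
proof (cases w)
  case (Word gs)
  have "set gs \<subseteq> generators N \<Longrightarrow> word_weight (Word gs) \<in> ZPi N"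
    by (induction gs) (auto simp: generator_weight_ZPi simp del: generators.simps)
  thus ?thesis using assms Word by (simp add: words_def)
qed

locale quantum_group =
  fixes N :: nat and \<chi> :: "weight \<Rightarrow> weight \<Rightarrow> 'k::field_char_0"
  assumes bihom: "bihom N \<chi>"
begin

definition XX :: "weight \<Rightarrow> weight \<Rightarrow> 'k" where "XX a b = \<chi> (restrict_weight N a) (restrict_weight N b)"

lemma X_add: "XX (a + b) d = XX a d * XX b d" "XX a (b + d) = XX a b * XX a d"
  using bihom by (simp_all add: XX_def restrict_weight_add bihom_def)

lemma X_nz: "XX a b \<noteq> 0" using bihom by (simp add: XX_def bihom_def)

lemma X_0 [simp]: "XX 0 a = 1" "XX a 0 = 1"
  using X_add(1)[of 0 0 a] X_add(2)[of a 0 0] X_nz by (metis add_0 mult_cancel_right1)+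

lemma X_minus: "XX (- a) b = inverse (XX a b)" "XX a (- b) = inverse (XX a b)"
  using X_add(1)[of a "-a" b] X_add(2)[of a b "-b"] by (auto intro: inverse_unique[symmetric])

lemma X_diff: "XX (a - b) d = XX a d / XX b d" "XX d (a - b) = XX d a / XX d b"
  using X_add(1)[of a "-b" d] X_add(2)[of d a "-b"] by (simp_all add: X_minus divide_inverse)

abbreviation A :: "'k walg set" where "A \<equiv> Acar N"
abbreviation gK :: "weight \<Rightarrow> 'k walg" where "gK a \<equiv> gen (GenK a)"
abbreviation gL :: "weight \<Rightarrow> 'k walg" where "gL a \<equiv> gen (GenL a)"
abbreviation gE :: "nat \<Rightarrow> 'k walg" where "gE i \<equiv> gen (GenE i)"
abbreviation gF :: "nat \<Rightarrow> 'k walg" where "gF i \<equiv> gen (GenF i)"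
abbreviation \<alpha> :: "nat \<Rightarrow> weight" where "\<alpha> \<equiv> simple_root"

lemma gens_A [simp]:
  "a \<in> ZPi N \<Longrightarrow> gK a \<in> A" "a \<in> ZPi N \<Longrightarrow> gL a \<in> A" "i \<in> {1..N} \<Longrightarrow> gE i \<in> A" "i \<in> {1..N} \<Longrightarrow> gF i \<in> A"
  by (rule gen_Acar; auto)+

abbreviation RI :: "'k walg set" where "RI \<equiv> rel_ideal N \<chi>"

text \<open>The given relations with values of \<open>\<chi>\<close> at negated roots replaced by
  inverses of \<open>XX\<close>, so that all scalars live in one multiplicative calculus.\<close>

inductive_set rels :: "'k walg set" where
  K_zero: "gK 0 - 1 \<in> rels"
| L_zero: "gL 0 - 1 \<in> rels"
| KK: "a \<in> ZPi N \<Longrightarrow> b \<in> ZPi N \<Longrightarrow> gK a * gK b - gK (a + b) \<in> rels"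
| LL: "a \<in> ZPi N \<Longrightarrow> b \<in> ZPi N \<Longrightarrow> gL a * gL b - gL (a + b) \<in> rels"
| KL: "a \<in> ZPi N \<Longrightarrow> b \<in> ZPi N \<Longrightarrow> gK a * gL b - gL b * gK a \<in> rels"
| KE: "a \<in> ZPi N \<Longrightarrow> i \<in> {1..N} \<Longrightarrow> gK a * gE i - sc (XX a (\<alpha> i)) (gE i * gK a) \<in> rels"
| LE: "a \<in> ZPi N \<Longrightarrow> i \<in> {1..N} \<Longrightarrow> gL a * gE i - sc (inverse (XX (\<alpha> i) a)) (gE i * gL a) \<in> rels"
| KF: "a \<in> ZPi N \<Longrightarrow> i \<in> {1..N} \<Longrightarrow> gK a * gF i - sc (inverse (XX a (\<alpha> i))) (gF i * gK a) \<in> rels"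
| LF: "a \<in> ZPi N \<Longrightarrow> i \<in> {1..N} \<Longrightarrow> gL a * gF i - sc (XX (\<alpha> i) a) (gF i * gL a) \<in> rels"
| EF: "i \<in> {1..N} \<Longrightarrow> j \<in> {1..N} \<Longrightarrow>
    gE i * gF j - gF j * gE i - (if i = j then gL (\<alpha> i) - gK (\<alpha> i) else 0) \<in> rels"

lemma X_eq: "a \<in> ZPi N \<Longrightarrow> b \<in> ZPi N \<Longrightarrow> XX a b = \<chi> a b" by (simp add: XX_def)

lemma chi_minus_X:
  assumes "a \<in> ZPi N" "b \<in> ZPi N"
  shows "\<chi> (- a) b = inverse (XX a b)" "\<chi> a (- b) = inverse (XX a b)"
  using assms X_minus[of a b] X_eq[of "- a" b] X_eq[of a "- b"] by simp_all

lemma rels_eq: "rels = relations N \<chi>"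
proof (intro equalityI subsetI)
  fix x assume "x \<in> rels"
  thus "x \<in> relations N \<chi>"
  proof cases
    case (EF i j)
    have "(gE i * gF j - gF j * gE i) - (if i = j then - gK (\<alpha> i) + gL (\<alpha> i) else 0) \<in> relations N \<chi>"
      using EF by (intro relations.EF) auto
    thus ?thesis using EF by (cases "i = j") simp_all
  qed (use relations.intros[where N = N and \<chi> = \<chi>] chi_minus_X X_eq in \<open>auto simp: sc_def simp del: One_nat_def\<close>)
next
  fix x assume "x \<in> relations N \<chi>"
  thus "x \<in> rels"
  proof cases
    case (EF i j)
    thus ?thesis using rels.EF[of i j] by (cases "i = j") simp_all
  next
    case (KE a i)
    thus ?thesis using rels.KE[of a i] X_eq[of a "\<alpha> i"] by (simp add: sc_def)
  next
    case (LE a i)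
    thus ?thesis using rels.LE[of a i] chi_minus_X[of "\<alpha> i" a] by (simp add: sc_def)
  next
    case (KF a i)
    thus ?thesis using rels.KF[of a i] chi_minus_X[of a "\<alpha> i"] by (simp add: sc_def)
  next
    case (LF a i)
    thus ?thesis using rels.LF[of a i] X_eq[of "\<alpha> i" a] by (simp add: sc_def)
  qed (use rels.intros in auto)
qed

lemma rels_A: "rels \<subseteq> A"
proof
  fix x assume "x \<in> rels"
  thus "x \<in> A" by cases auto
qed

lemma RI_ideal: "ideal_set A RI" and rels_RI: "rels \<subseteq> RI"
proof -
  interpret R: ring "free_algebra N :: ('k, 'k walg) module"
    by (rule presents_ring_ring[OF presents_ring_free_algebra])
  have "rels \<subseteq> carrier (free_algebra N)" using rels_A by (simp add: free_algebra_sel)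
  from R.genideal_ideal[OF this] R.genideal_self[OF this]
  show "ideal_set A RI" "rels \<subseteq> RI" by (simp_all add: rel_ideal_def rels_eq ideal_free_algebra_iff)
qed

lemma RI_least: assumes "ideal_set A S" "rels \<subseteq> S" shows "RI \<subseteq> S"
proof -
  interpret R: ring "free_algebra N :: ('k, 'k walg) module"
    by (rule presents_ring_ring[OF presents_ring_free_algebra])
  show ?thesis
    using R.genideal_minimal[of S rels] assms by (simp add: rel_ideal_def rels_eq ideal_free_algebra_iff)
qed

lemma RI_A: "x \<in> RI \<Longrightarrow> x \<in> A" using RI_ideal by (auto simp: ideal_set_def)

lemma ideal_set_closed:
  assumes "ideal_set A S"
  shows "0 \<in> S" "x \<in> S \<Longrightarrow> y \<in> S \<Longrightarrow> x + y \<in> S" "x \<in> S \<Longrightarrow> y \<in> S \<Longrightarrow> x - y \<in> S" "x \<in> S \<Longrightarrow> - x \<in> S"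
   "a \<in> A \<Longrightarrow> x \<in> S \<Longrightarrow> a * x \<in> S" "a \<in> A \<Longrightarrow> x \<in> S \<Longrightarrow> x * a \<in> S" "x \<in> S \<Longrightarrow> sc c x \<in> S" "x \<in> S \<Longrightarrow> x \<in> A"
proof -
  have s: "additive_subgroup_set S" using assms by (simp add: ideal_set_def)
  show "0 \<in> S" "x \<in> S \<Longrightarrow> y \<in> S \<Longrightarrow> x + y \<in> S" "x \<in> S \<Longrightarrow> y \<in> S \<Longrightarrow> x - y \<in> S" "x \<in> S \<Longrightarrow> - x \<in> S"
    using additive_subgroup_setD[OF s] by blast+
  show "a \<in> A \<Longrightarrow> x \<in> S \<Longrightarrow> a * x \<in> S" "a \<in> A \<Longrightarrow> x \<in> S \<Longrightarrow> x * a \<in> S" "x \<in> S \<Longrightarrow> x \<in> A"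
    using assms by (auto simp: ideal_set_def)
  assume "x \<in> S"
  hence "sc c 1 * x \<in> S" using assms Acar_closed(2,6) by (auto simp: ideal_set_def)
  thus "sc c x \<in> S" by (simp add: sc_one_mult)
qed

lemma ideal_set_subspace: "ideal_set A S \<Longrightarrow> FA.subspace S"
  using ideal_set_closed by (intro FA.subspaceI) auto

lemmas RI_closed = ideal_set_closed[OF RI_ideal]

lemmas rel_intros = rels.intros[THEN subsetD[OF rels_RI]]

definition cong :: "'k walg \<Rightarrow> 'k walg \<Rightarrow> bool" (infix \<open>\<approx>\<close> 50) where "x \<approx> y \<longleftrightarrow> x - y \<in> RI"

lemma cong_refl [simp]: "x \<approx> x" using RI_closed(1) by (simp add: cong_def)
lemma cong_sym: "x \<approx> y \<Longrightarrow> y \<approx> x" using RI_closed(4)[of "x - y"] by (simp add: cong_def)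
lemma cong_trans [trans]: "x \<approx> y \<Longrightarrow> y \<approx> z \<Longrightarrow> x \<approx> z" using RI_closed(2)[of "x - y" "y - z"] by (simp add: cong_def)
lemma cong_add: "x \<approx> y \<Longrightarrow> x' \<approx> y' \<Longrightarrow> x + x' \<approx> y + y'"
  using RI_closed(2)[of "x - y" "x' - y'"] by (simp add: cong_def algebra_simps)
lemma cong_diff: "x \<approx> y \<Longrightarrow> x' \<approx> y' \<Longrightarrow> x - x' \<approx> y - y'"
  using RI_closed(3)[of "x - y" "x' - y'"] by (simp add: cong_def algebra_simps)
lemma cong_sc: "x \<approx> y \<Longrightarrow> sc c x \<approx> sc c y"
  using RI_closed(7)[of "x - y" c] by (simp add: cong_def FA.scale_right_diff_distrib)
lemma cong_mult_left: "a \<in> A \<Longrightarrow> x \<approx> y \<Longrightarrow> a * x \<approx> a * y"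
  using RI_closed(5)[of a "x - y"] by (simp add: cong_def algebra_simps)
lemma cong_mult_right: "a \<in> A \<Longrightarrow> x \<approx> y \<Longrightarrow> x * a \<approx> y * a"
  using RI_closed(6)[of a "x - y"] by (simp add: cong_def algebra_simps)
lemma cong_mult: "x \<approx> y \<Longrightarrow> x' \<approx> y' \<Longrightarrow> x' \<in> A \<Longrightarrow> y \<in> A \<Longrightarrow> x * x' \<approx> y * y'"
  using cong_trans[OF cong_mult_right cong_mult_left] by blast

lemma rel_cong:
  "gK 0 \<approx> 1" "gL 0 \<approx> 1"
  "a \<in> ZPi N \<Longrightarrow> b \<in> ZPi N \<Longrightarrow> gK a * gK b \<approx> gK (a + b)"
  "a \<in> ZPi N \<Longrightarrow> b \<in> ZPi N \<Longrightarrow> gL a * gL b \<approx> gL (a + b)"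
  "a \<in> ZPi N \<Longrightarrow> b \<in> ZPi N \<Longrightarrow> gK a * gL b \<approx> gL b * gK a"
  "a \<in> ZPi N \<Longrightarrow> i \<in> {1..N} \<Longrightarrow> gK a * gE i \<approx> sc (XX a (\<alpha> i)) (gE i * gK a)"
  "a \<in> ZPi N \<Longrightarrow> i \<in> {1..N} \<Longrightarrow> gL a * gE i \<approx> sc (inverse (XX (\<alpha> i) a)) (gE i * gL a)"
  "a \<in> ZPi N \<Longrightarrow> i \<in> {1..N} \<Longrightarrow> gK a * gF i \<approx> sc (inverse (XX a (\<alpha> i))) (gF i * gK a)"
  "a \<in> ZPi N \<Longrightarrow> i \<in> {1..N} \<Longrightarrow> gL a * gF i \<approx> sc (XX (\<alpha> i) a) (gF i * gL a)"
  "i \<in> {1..N} \<Longrightarrow> j \<in> {1..N} \<Longrightarrow>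
    gE i * gF j \<approx> gF j * gE i + (if i = j then gL (\<alpha> i) - gK (\<alpha> i) else 0)"
  unfolding cong_def using rel_intros by (simp_all add: diff_diff_eq)

abbreviation T :: "('k, 'k walg set) module" where "T \<equiv> tU N \<chi>"
abbreviation tc :: "'k walg \<Rightarrow> 'k walg set" where "tc \<equiv> tclass N \<chi>"

lemma tc_fun: "tc = (\<lambda>x. RI +>\<^bsub>free_algebra N\<^esub> x)"
  by (rule ext) (simp add: tclass_def)

lemma presents_ring_tU: "presents_ring T tc A RI"
  using presents_ring_quot[OF presents_ring_free_algebra RI_ideal] RI_closed(1)
  by (simp add: tU_def tc_fun)

lemma presents_space_tU: "presents_space T tc A RI"
proof -
  have "presents_space (free_algebra N :: ('k, 'k walg) module) (\<lambda>x. x) A {0}"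
    by (simp add: presents_space_def free_algebra_sel Acar_subspace presents_ringD(1)[OF presents_ring_free_algebra])
  from presents_space_quot[OF this ideal_set_subspace[OF RI_ideal]] RI_closed(1) RI_A
  show ?thesis by (simp add: tU_def tc_fun subset_iff)
qed

lemma tc_sc: "x \<in> A \<Longrightarrow> c \<odot>\<^bsub>T\<^esub> tc x = tc (sc c x)"
  using presents_space_tU by (simp add: presents_space_def)

lemmas tU_ring = presents_ringD[OF presents_ring_tU]
lemmas tU_add = presentsD[OF presents_ringD(1)[OF presents_ring_tU]]

lemma tc_eq: "x \<in> A \<Longrightarrow> y \<in> A \<Longrightarrow> tc x = tc y \<longleftrightarrow> x \<approx> y"
  by (simp add: tU_add(7) cong_def)

end

subsection \<open>Its Verma modules\<close>

lemma span_linear_eq: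
  assumes "\<And>x y. f (x + y) = f x + f y" "\<And>c x. f (sc c x) = sc c (f x)"
    and "\<And>x y. g (x + y) = g x + g y" "\<And>c x. g (sc c x) = sc c (g x)"
    and "\<And>w. w \<in> W \<Longrightarrow> f (mon w) = g (mon w)" and x: "x \<in> FA.span (mon ` W)"
  shows "f x = g x"
  using x
proof (induction rule: FA.span_induct_alt)
  case base
  show ?case using assms(2)[of 0 0] assms(4)[of 0 0] by simp
qed (use assms in auto)

lemma span_linear_mem:
  assumes "\<And>x y. f (x + y) = f x + f y" "\<And>c x. f (sc c x) = sc c (f x)"
    and "\<And>w. w \<in> W \<Longrightarrow> f (mon w) \<in> S" "FA.subspace S" and x: "x \<in> FA.span (mon ` W)"
  shows "f x \<in> S"
  using x
proof (induction rule: FA.span_induct_alt)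
  case base
  show ?case using assms(2)[of 0 0] FA.subspace_0[OF assms(4)] by simp
next
  case (step c x y)
  thus ?case using assms by (auto intro!: FA.subspace_add[OF assms(4)] FA.subspace_scale[OF assms(4)])
qed

definition fwords :: "nat \<Rightarrow> word set" where
  "fwords N = {Word (map GenF js) |js. set js \<subseteq> {1..N}}"

lemma fwords_induct [consumes 1, case_names Nil Cons]:
  assumes "w \<in> fwords N" "P (Word [])"
    "\<And>j gs. j \<in> {1..N} \<Longrightarrow> Word gs \<in> fwords N \<Longrightarrow> P (Word gs) \<Longrightarrow> P (Word (GenF j # gs))"
  shows "P w"
proof -
  obtain js where js: "set js \<subseteq> {1..N}" "w = Word (map GenF js)" using assms(1) by (auto simp: fwords_def)
  have "set js \<subseteq> {1..N} \<Longrightarrow> P (Word (map GenF js))"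
  proof (induction js)
    case (Cons j js)
    have "Word (map GenF js) \<in> fwords N" using Cons.prems by (auto simp: fwords_def)
    thus ?case using assms(3)[of j "map GenF js"] Cons by simp
  qed (simp add: assms(2))
  thus ?thesis using js by simp
qed

lemma fwords_Nil [simp]: "Word [] \<in> fwords N" "0 \<in> fwords N"
  by (force simp: fwords_def zero_word_def)+

lemma fwords_Cons [simp]: "Word (GenF j # gs) \<in> fwords N \<longleftrightarrow> j \<in> {1..N} \<and> Word gs \<in> fwords N"
proof
  assume "Word (GenF j # gs) \<in> fwords N"
  thus "j \<in> {1..N} \<and> Word gs \<in> fwords N" by (auto simp: fwords_def Cons_eq_map_conv)
next
  assume "j \<in> {1..N} \<and> Word gs \<in> fwords N"
  then obtain js where "j \<in> {1..N}" "set js \<subseteq> {1..N}" "gs = map GenF js" by (auto simp: fwords_def)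
  thus "Word (GenF j # gs) \<in> fwords N" unfolding fwords_def by (intro CollectI exI[of _ "j # js"]) auto
qed

lemma fwords_words: "w \<in> fwords N \<Longrightarrow> w \<in> words N"
  by (auto simp: fwords_def words_def subset_iff image_iff)

definition VF :: "nat \<Rightarrow> 'k::field_char_0 walg set" where "VF N = FA.span (mon ` fwords N)"
definition VFw :: "nat \<Rightarrow> weight \<Rightarrow> 'k::field_char_0 walg set" where
  "VFw N \<mu> = FA.span (mon ` {w \<in> fwords N. word_weight w = \<mu>})"
definition Aw :: "nat \<Rightarrow> weight \<Rightarrow> 'k::field_char_0 walg set" where
  "Aw N \<mu> = FA.span (mon ` {w \<in> words N. word_weight w = \<mu>})"

lemma subspaces: "FA.subspace (VF N)" "FA.subspace (VFw N \<mu>)" "FA.subspace (Aw N \<mu>)"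
  by (simp_all add: VF_def VFw_def Aw_def FA.subspace_span)

lemma VFw_VF: "VFw N \<mu> \<subseteq> VF N" and VF_Acar: "VF N \<subseteq> Acar N" and VFw_Aw: "VFw N \<mu> \<subseteq> Aw N \<mu>" and Aw_Acar: "Aw N \<mu> \<subseteq> Acar N"
  unfolding VF_def VFw_def Aw_def Acar_span by (intro FA.span_mono; auto intro: fwords_words)+

lemma VF_1: "1 \<in> VFw N 0"
proof -
  have "mon (Word []) \<in> VFw N 0" unfolding VFw_def by (rule FA.span_base) auto
  thus ?thesis by (simp add: mon_Word_Nil)
qed

lemma VF_1': "1 \<in> VF N" using VF_1 VFw_VF by blast

lemma gF_mult_VFw:
  assumes "j \<in> {1..N}" "x \<in> VFw N \<mu>" shows "gen (GenF j) * x \<in> VFw N (\<mu> - simple_root j)"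
proof -
  have "gen (GenF j) * mon w \<in> VFw N (\<mu> - simple_root j)" if "w \<in> fwords N" "word_weight w = \<mu>" for w
  proof -
    have "mon (Word (GenF j # letters w)) \<in> VFw N (\<mu> - simple_root j)"
      unfolding VFw_def using that assms(1) by (intro FA.span_base) (cases w, auto)
    thus ?thesis by (simp add: mult_single plus_word_def)
  qed
  note mem = this
    show ?thesis
    by (rule span_linear_mem[of "\<lambda>x. gen (GenF j) * x" "{w \<in> fwords N. word_weight w = \<mu>}"])
      (use mem assms(2) subspaces(2) in \<open>auto simp: VFw_def distrib_left sc_mult_right\<close>)
qed

lemma Aw_mult: assumes "x \<in> Aw N \<mu>" "y \<in> Aw N \<nu>" shows "x * y \<in> Aw N (\<mu> + \<nu>)"
proof -
  have 1: "mon u * y \<in> Aw N (\<mu> + \<nu>)" if "u \<in> words N" "word_weight u = \<mu>" for u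
  proof -
    have "mon u * mon w \<in> Aw N (\<mu> + \<nu>)" if "w \<in> words N" "word_weight w = \<nu>" for w
      unfolding Aw_def mon_mult using that \<open>u \<in> words N\<close> \<open>word_weight u = \<mu>\<close> words_simps(3)
      by (intro FA.span_base) auto
    note mem = this
      show ?thesis
      by (rule span_linear_mem[of "\<lambda>x. mon u * x" "{w \<in> words N. word_weight w = \<nu>}"])
        (use mem assms(2) subspaces(3) in \<open>auto simp: Aw_def distrib_left sc_mult_right\<close>)
  qed
  show ?thesis
    by (rule span_linear_mem[of "\<lambda>x. x * y" "{w \<in> words N. word_weight w = \<mu>}"])
      (use 1 assms(1) subspaces(3) in \<open>auto simp: Aw_def distrib_right sc_mult_left\<close>)
qed

text \<open>\<open>kap\<close> and \<open>ell\<close> stand for the values of a torus character on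
  \<open>K_a\<close> and \<open>L_a\<close>. They are taken on all weights, so that the module
  structure is free of membership side conditions.\<close>

locale verma_action = quantum_group N \<chi>
  for N and \<chi> :: "weight \<Rightarrow> weight \<Rightarrow> 'k::field_char_0" +
  fixes kap ell :: "weight \<Rightarrow> 'k"
  assumes kap_add: "kap (a + b) = kap a * kap b" and kap_nz: "kap a \<noteq> 0"
    and ell_add: "ell (a + b) = ell a * ell b" and ell_nz: "ell a \<noteq> 0"
begin

lemma kap_0 [simp]: "kap 0 = 1" and ell_0 [simp]: "ell 0 = 1"
  using kap_add[of 0 0] kap_nz[of 0] ell_add[of 0 0] ell_nz[of 0] by auto

text \<open>\<open>kev\<close> and \<open>lev\<close> are the eigenvalues of \<open>K_a\<close> and
  \<open>L_a\<close> on vectors of weight \<open>\<mu>\<close>: moving them past the letters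
  \<open>F_i\<close> of a word collects exactly these factors of \<open>\<chi>\<close>.\<close>

definition kev :: "weight \<Rightarrow> weight \<Rightarrow> 'k" where "kev a \<mu> = kap a * XX a \<mu>"
definition lev :: "weight \<Rightarrow> weight \<Rightarrow> 'k" where "lev a \<mu> = ell a / XX \<mu> a"

text \<open>\<open>E_i\<close> applied to a word of letters \<open>F_j\<close>: it is commuted to
  the right until it reaches the highest weight vector, which it kills. Each letter
  \<open>F_i\<close> passed leaves \<open>L - K\<close> acting on the remaining word by a scalar.
  The value \<open>0\<close> on words starting with another letter is a default; such words lie
  outside the module.\<close>

fun eact :: "nat \<Rightarrow> generator list \<Rightarrow> 'k walg" where
  "eact i (GenF j # gs) = gF j * eact i gs +
     (if i = j then sc (lev (\<alpha> i) (word_weight (Word gs)) - kev (\<alpha> i) (word_weight (Word gs))) (mon (Word gs)) else 0)"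
| "eact i gs = 0"

fun act :: "generator \<Rightarrow> 'k walg \<Rightarrow> 'k walg" where
  "act (GenF j) = (\<lambda>x. gF j * x)"
| "act (GenE i) = lin (\<lambda>w. eact i (letters w))"
| "act (GenK a) = lin (\<lambda>w. sc (kev a (word_weight w)) (mon w))"
| "act (GenL a) = lin (\<lambda>w. sc (lev a (word_weight w)) (mon w))"

lemma act_add: "act g (x + y) = act g x + act g y" and act_sc: "act g (sc c x) = sc c (act g x)"
  by (cases g; simp add: distrib_left sc_mult_right lin_add lin_sc)+

definition actw :: "word \<Rightarrow> 'k walg \<Rightarrow> 'k walg" where "actw w = foldr act (letters w)"

lemma actw_simps [simp]:
  "actw 0 x = x" "actw (Word []) x = x" "actw (Word (g # gs)) x = act g (actw (Word gs) x)"
  "actw (u + w) x = actw u (actw w x)"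
  by (simp_all add: actw_def zero_word_def plus_word_def)

lemma actw_add: "actw w (x + y) = actw w x + actw w y" and actw_sc: "actw w (sc c x) = sc c (actw w x)"
proof -
  have "foldr act gs (x + y) = foldr act gs x + foldr act gs y" "foldr act gs (sc c x) = sc c (foldr act gs x)" for gs
    by (induction gs) (simp_all add: act_add act_sc)
  thus "actw w (x + y) = actw w x + actw w y" "actw w (sc c x) = sc c (actw w x)" by (simp_all add: actw_def)
qed

text \<open>The free algebra acts on all of itself by these formulas, but the Verma module of
  \<open>tU\<close> is the subspace \<open>VF N\<close> spanned by words in the \<open>F_i\<close>;
  the relations are checked there.\<close>

definition rho :: "'k walg \<Rightarrow> 'k walg \<Rightarrow> 'k walg" where "rho x u = lin (\<lambda>w. actw w u) x"

lemma rho_add: "rho (x + y) u = rho x u + rho y u" and rho_sc: "rho (sc c x) u = sc c (rho x u)"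
  and rho_0 [simp]: "rho 0 u = 0" and rho_mon [simp]: "rho (mon w) u = actw w u"
  and rho_diff: "rho (x - y) u = rho x u - rho y u"
  by (simp_all add: rho_def lin_add lin_sc lin_diff lin_uminus)

lemma rho_add_right: "rho x (u + v) = rho x u + rho x v" and rho_sc_right: "rho x (sc c u) = sc c (rho x u)"
  by (simp_all add: rho_def lin_def actw_add actw_sc FA.scale_right_distrib sum.distrib FA.scale_sum_right
      mult.commute)

lemma rho_0_right [simp]: "rho x 0 = 0" using rho_sc_right[of x 0 0] by simp

lemma rho_gen: "rho (gen g) u = act g u" using rho_mon[of "Word [g]"] by simp

lemma rho_1 [simp]: "rho 1 u = u" using rho_mon[of 0 u] by simp

lemma rho_mult: "rho (x * y) u = rho x (rho y u)"
proof -
  have UNIV: "z \<in> FA.span (mon ` UNIV)" for z :: "'k walg" by (simp add: span_mon)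
  have 1: "rho (mon w * y) u = rho (mon w) (rho y u)" for w
    by (rule span_linear_eq[where W = UNIV and x = y])
      (simp_all add: UNIV distrib_left sc_mult_right rho_add rho_sc rho_add_right rho_sc_right mon_mult actw_add actw_sc)
  show ?thesis
    by (rule span_linear_eq[where W = UNIV and x = x])
      (simp_all add: UNIV distrib_right sc_mult_left rho_add rho_sc 1[simplified])
qed

lemma act_K: "x \<in> VFw N \<mu> \<Longrightarrow> act (GenK a) x = sc (kev a \<mu>) x"
  unfolding VFw_def
  by (rule span_linear_eq[where W = "{w \<in> fwords N. word_weight w = \<mu>}"])
     (auto simp: lin_add lin_sc FA.scale_right_distrib mult.commute)

lemma act_L: "x \<in> VFw N \<mu> \<Longrightarrow> act (GenL a) x = sc (lev a \<mu>) x"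
  unfolding VFw_def
  by (rule span_linear_eq[where W = "{w \<in> fwords N. word_weight w = \<mu>}"])
     (auto simp: lin_add lin_sc FA.scale_right_distrib mult.commute)

lemma eact_VFw:
  assumes "w \<in> fwords N" "i \<in> {1..N}"
  shows "eact i (letters w) \<in> VFw N (word_weight w + \<alpha> i)"
  using assms(1)
proof (induction rule: fwords_induct)
  case (Cons j gs)
  have "gF j * eact i gs \<in> VFw N (word_weight (Word (GenF j # gs)) + \<alpha> i)"
    using gF_mult_VFw[OF Cons(1,3)] by (simp add: algebra_simps)
  moreover have "mon (Word gs) \<in> VFw N (word_weight (Word (GenF j # gs)) + \<alpha> i)" if "i = j"
    unfolding VFw_def using Cons that by (intro FA.span_base) auto
  ultimately show ?case by (auto intro!: FA.subspace_add[OF subspaces(2)] FA.subspace_scale[OF subspaces(2)])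
qed (simp add: FA.subspace_0[OF subspaces(2)])

lemma act_E_VFw:
  assumes "i \<in> {1..N}" "x \<in> VFw N \<mu>" shows "act (GenE i) x \<in> VFw N (\<mu> + \<alpha> i)"
  using assms(2) unfolding VFw_def[of N \<mu>]
  by (rule span_linear_mem[rotated -1]) (use eact_VFw assms(1) subspaces(2) in \<open>auto simp: lin_add lin_sc\<close>)

lemma act_VFw:
  assumes "g \<in> generators N" "x \<in> VFw N \<mu>" shows "act g x \<in> VFw N (\<mu> + generator_weight g)"
proof (cases g)
  case (GenF j)
  thus ?thesis using gF_mult_VFw[of j N x \<mu>] assms by auto
next
  case (GenE i)
  thus ?thesis using act_E_VFw[of i x \<mu>] assms by auto
qed (use act_K[OF assms(2)] act_L[OF assms(2)] assms(2) in \<open>auto intro: FA.subspace_scale[OF subspaces(2)] simp del: act.simps\<close>)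

lemma act_EF:
  assumes "i \<in> {1..N}" "j \<in> {1..N}" "x \<in> VFw N \<mu>"
  shows "act (GenE i) (gF j * x) = gF j * act (GenE i) x +
    (if i = j then sc (lev (\<alpha> i) \<mu> - kev (\<alpha> i) \<mu>) x else 0)"
  using assms(3) unfolding VFw_def
proof (rule span_linear_eq[rotated -1])
  fix w assume w: "w \<in> {w \<in> fwords N. word_weight w = \<mu>}"
  have "gF j * mon w = mon (Word (GenF j # letters w))" by (cases w) (simp add: mult_single plus_word_def)
  thus "act (GenE i) (gF j * mon w) = gF j * act (GenE i) (mon w) +
     (if i = j then sc (lev (\<alpha> i) \<mu> - kev (\<alpha> i) \<mu>) (mon w) else 0)"
    using w by (cases w) auto
qed (auto simp: distrib_left sc_mult_right lin_add lin_sc FA.scale_right_distrib mult.commute)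

lemma kev_lev_shift:
  "kev a (\<mu> + \<nu>) = kev a \<mu> * XX a \<nu>" "lev a (\<mu> + \<nu>) = lev a \<mu> / XX \<nu> a"
  "kev a (\<mu> - \<nu>) = kev a \<mu> / XX a \<nu>" "lev a (\<mu> - \<nu>) = lev a \<mu> * XX \<nu> a"
  "kev (a + b) \<mu> = kev a \<mu> * kev b \<mu>" "lev (a + b) \<mu> = lev a \<mu> * lev b \<mu>" "kev 0 \<mu> = 1" "lev 0 \<mu> = 1"
  by (simp_all add: kev_def lev_def X_add X_diff kap_add ell_add)

lemma rho_rels_VFw:
  assumes "r \<in> rels" "x \<in> VFw N \<mu>" shows "rho r x = 0"
  using assms(1)
proof cases
  case (EF i j)
  thus ?thesis using act_EF[OF EF(2,3) assms(2)] act_K[OF assms(2), of "\<alpha> i"] act_L[OF assms(2), of "\<alpha> i"]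
    by (auto simp: rho_diff rho_mult rho_gen FA.scale_left_diff_distrib simp del: act.simps(2-4))
next
  case (KE a i)
  have "act (GenE i) x \<in> VFw N (\<mu> + \<alpha> i)" by (rule act_E_VFw[OF KE(3) assms(2)])
  thus ?thesis using KE act_K[OF assms(2)] act_K[of "act (GenE i) x" "\<mu> + \<alpha> i"]
    by (simp add: rho_diff rho_mult rho_sc rho_gen act_sc kev_lev_shift mult.commute del: act.simps)
next
  case (LE a i)
  have "act (GenE i) x \<in> VFw N (\<mu> + \<alpha> i)" by (rule act_E_VFw[OF LE(3) assms(2)])
  thus ?thesis using LE act_L[OF assms(2)] act_L[of "act (GenE i) x" "\<mu> + \<alpha> i"]
    by (simp add: rho_diff rho_mult rho_sc rho_gen act_sc kev_lev_shift mult.commute divide_inverse del: act.simps)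
next
  case (KF a i)
  have "act (GenF i) x \<in> VFw N (\<mu> - \<alpha> i)" using gF_mult_VFw[OF KF(3) assms(2)] by simp
  thus ?thesis using KF act_K[OF assms(2)] act_K[of "act (GenF i) x" "\<mu> - \<alpha> i"]
    by (simp add: rho_diff rho_mult rho_sc rho_gen act_sc kev_lev_shift mult.commute divide_inverse del: act.simps)
next
  case (LF a i)
  have "act (GenF i) x \<in> VFw N (\<mu> - \<alpha> i)" using gF_mult_VFw[OF LF(3) assms(2)] by simp
  thus ?thesis using LF act_L[OF assms(2)] act_L[of "act (GenF i) x" "\<mu> - \<alpha> i"]
    by (simp add: rho_diff rho_mult rho_sc rho_gen act_sc kev_lev_shift mult.commute divide_inverse del: act.simps)
qed (use act_K[OF assms(2)] act_L[OF assms(2)] in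
  \<open>simp_all add: rho_diff rho_mult rho_gen act_sc kev_lev_shift mult.commute del: act.simps\<close>)

lemma actw_VFw: assumes "w \<in> words N" "x \<in> VFw N \<mu>" shows "actw w x \<in> VFw N (\<mu> + word_weight w)"
proof -
  obtain gs where w: "w = Word gs" by (cases w)
  have "Word gs \<in> words N \<Longrightarrow> actw (Word gs) x \<in> VFw N (\<mu> + word_weight (Word gs))"
  proof (induction gs)
    case (Cons g gs)
    thus ?case using act_VFw[of g "actw (Word gs) x" "\<mu> + word_weight (Word gs)"]
      by (simp add: words_simps algebra_simps del: generators.simps)
  qed (simp add: assms)
  thus ?thesis using assms w by simp
qed

lemma rho_VFw: assumes "y \<in> Aw N \<nu>" "x \<in> VFw N \<mu>" shows "rho y x \<in> VFw N (\<mu> + \<nu>)"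
  using assms(1) unfolding Aw_def
  by (rule span_linear_mem[rotated -1]) (use actw_VFw[OF _ assms(2)] subspaces in \<open>auto simp: rho_add rho_sc\<close>)

lemma VF_induct [consumes 1, case_names zero add]:
  assumes "x \<in> VF N" "P 0" "\<And>\<mu> u x. u \<in> VFw N \<mu> \<Longrightarrow> x \<in> VF N \<Longrightarrow> P x \<Longrightarrow> P (u + x)"
  shows "P x"
proof -
  have "x \<in> VF N \<and> P x"
    using assms(1) unfolding VF_def
  proof (induction rule: FA.span_induct_alt)
    case base
    show ?case using assms(2) by (simp add: FA.span_zero)
  next
    case (step c u y)
    then obtain w where w: "w \<in> fwords N" "u = mon w" by auto
    have u: "sc c u \<in> VFw N (word_weight w)"
      unfolding VFw_def w(2) using w(1) by (intro FA.span_scale FA.span_base) auto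
    have "sc c u + y \<in> VF N"
      using u VFw_VF step unfolding VF_def[symmetric] by (intro FA.subspace_add[OF subspaces(1)]) auto
    thus ?case using assms(3)[OF u] step unfolding VF_def[symmetric] by blast
  qed
  thus ?thesis ..
qed

lemma actw_VF: assumes "w \<in> words N" "x \<in> VF N" shows "actw w x \<in> VF N"
  using assms(2)
proof (induction rule: VF_induct)
  case zero
  show ?case using actw_sc[of w 0 0] FA.subspace_0[OF subspaces(1)] by simp
next
  case (add \<mu> u x)
  thus ?case using actw_VFw[OF assms(1) add(1)] VFw_VF by (auto simp: actw_add intro!: FA.subspace_add[OF subspaces(1)])
qed

lemma rho_VF: assumes "y \<in> A" "x \<in> VF N" shows "rho y x \<in> VF N"
  using assms(1) unfolding Acar_span
  by (rule span_linear_mem[rotated -1]) (use actw_VF[OF _ assms(2)] subspaces in \<open>auto simp: rho_add rho_sc\<close>)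

text \<open>The elements acting by zero on \<open>VF N\<close> form a two-sided ideal, because
  \<open>VF N\<close> is stable under the action; it contains the relations, so minimality of the
  generated ideal applies.\<close>

lemma rho_RI: assumes "r \<in> RI" "x \<in> VF N" shows "rho r x = 0"
proof -
  define S where "S = {r \<in> A. \<forall>x \<in> VF N. rho r x = 0}"
  have "ideal_set A S"
    unfolding ideal_set_def additive_subgroup_set_def S_def using rho_VF
    by (auto simp: rho_diff rho_mult)
  moreover have "rels \<subseteq> S"
  proof
    fix r assume r: "r \<in> rels"
    have "rho r x = 0" if "x \<in> VF N" for x
      using that by (induction rule: VF_induct) (simp_all add: rho_add_right rho_rels_VFw[OF r])
    thus "r \<in> S" using r rels_A by (auto simp: S_def)
  qed
  ultimately show ?thesis using RI_least[of S] assms by (auto simp: S_def)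
qed

text \<open>The coefficient of the highest weight vector \<open>v\<close> in \<open>x \<cdot> v\<close>.\<close>

definition eps :: "'k walg \<Rightarrow> 'k" where "eps x = Poly_Mapping.lookup (rho x 1) 0"

lemma eps_add: "eps (x + y) = eps x + eps y" and eps_sc: "eps (sc c x) = c * eps x"
  and eps_diff: "eps (x - y) = eps x - eps y" and eps_0 [simp]: "eps 0 = 0" and eps_1 [simp]: "eps 1 = 1"
  by (simp_all add: eps_def rho_add rho_sc rho_diff lookup_add lookup_minus sc_lookup)

text \<open>The radical of the form \<open>(x, y) \<mapsto> eps (x * y)\<close>: the annihilator of the highest weight vector
  of the simple module.\<close>

definition radical :: "'k walg set" where "radical = {x \<in> A. \<forall>y\<in>A. eps (y * x) = 0}"

lemma radical_subspace: "FA.subspace radical"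
  by (rule FA.subspaceI) (auto simp: radical_def distrib_left sc_mult_right eps_add eps_sc)

lemma radical_left: "a \<in> A \<Longrightarrow> x \<in> radical \<Longrightarrow> a * x \<in> radical"
  by (auto simp: radical_def simp flip: mult.assoc)

lemma radicalI: "x \<in> A \<Longrightarrow> rho x 1 = 0 \<Longrightarrow> x \<in> radical"
  by (simp add: radical_def eps_def rho_mult)

lemma one_notin_radical: "1 \<notin> radical"
proof
  assume "1 \<in> radical"
  hence "eps (1 * 1) = 0" unfolding radical_def using Acar_closed(2) by blast
  thus False by simp
qed

lemma RI_radical: "RI \<subseteq> radical"
  using RI_A VF_1' by (auto intro!: radicalI rho_RI)

lemma VFw_lookup_0: assumes "x \<in> VFw N \<mu>" "\<mu> \<noteq> 0" shows "Poly_Mapping.lookup x 0 = 0"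
proof -
  have "Poly_Mapping.keys x \<subseteq> {w \<in> fwords N. word_weight w = \<mu>}"
    using assms(1) by (simp add: VFw_def span_mon)
  thus ?thesis using assms(2) by (auto simp: in_keys_iff subset_iff)
qed

text \<open>The coordinates of the weight of a word in the \<open>F_i\<close> add up to minus its
  length, so no cancellation can produce weight zero.\<close>

lemma fwords_weight_0: assumes "w \<in> fwords N" "word_weight w = 0" shows "w = 0"
proof -
  obtain js where js: "set js \<subseteq> {1..N}" "w = Word (map GenF js)" using assms(1) by (auto simp: fwords_def)
  have "(\<Sum>i\<in>{1..N}. Poly_Mapping.lookup (word_weight (Word (map GenF js))) i) = - int (length js)"
    if "set js \<subseteq> {1..N}" for js
    using that
    by (induction js) (auto simp: lookup_add simple_root_def lookup_minus lookup_single when_def sum.distrib sum_negf sum_subtractf sum.delta)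
  from this[OF js(1)] assms(2) js(2) have "js = []" by simp
  thus ?thesis using js(2) by (simp add: zero_word_def)
qed

lemma VFw_0: assumes "x \<in> VFw N 0" shows "x = sc (Poly_Mapping.lookup x 0) 1"
proof -
  have "Poly_Mapping.keys x \<subseteq> {0}"
    using assms fwords_weight_0 by (auto simp: VFw_def span_mon)
  thus ?thesis by (intro poly_mapping_eqI) (auto simp: sc_lookup lookup_one when_def in_keys_iff subset_iff)
qed

end

subsection \<open>Grading and triangular parts\<close>

definition proj :: "weight \<Rightarrow> 'k::field_char_0 walg \<Rightarrow> 'k walg" where
  "proj \<mu> = lin (\<lambda>w. if word_weight w = \<mu> then mon w else 0)"

lemma proj_add: "proj \<mu> (x + y) = proj \<mu> x + proj \<mu> y" and proj_sc: "proj \<mu> (sc c x) = sc c (proj \<mu> x)"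
  and proj_diff: "proj \<mu> (x - y) = proj \<mu> x - proj \<mu> y" and proj_0 [simp]: "proj \<mu> 0 = 0"
  by (simp_all add: proj_def lin_add lin_sc lin_diff)

lemma proj_mon: "proj \<mu> (mon w) = (if word_weight w = \<mu> then mon w else 0)" by (simp add: proj_def)

lemma proj_mon_mult: "proj \<mu> (mon w * x) = mon w * proj (\<mu> - word_weight w) x"
proof -
  have UNIV: "x \<in> FA.span (mon ` UNIV)" by (simp add: span_mon)
  show ?thesis
    by (rule span_linear_eq[where f = "\<lambda>x. proj \<mu> (mon w * x)" and g = "\<lambda>x. mon w * proj (\<mu> - word_weight w) x", OF _ _ _ _ _ UNIV])
      (auto simp: distrib_left sc_mult_right proj_add proj_sc mon_mult proj_mon algebra_simps)
qed

lemma proj_mult_mon: "proj \<mu> (x * mon w) = proj (\<mu> - word_weight w) x * mon w"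
proof -
  have UNIV: "x \<in> FA.span (mon ` UNIV)" by (simp add: span_mon)
  show ?thesis
    by (rule span_linear_eq[where f = "\<lambda>x. proj \<mu> (x * mon w)" and g = "\<lambda>x. proj (\<mu> - word_weight w) x * mon w", OF _ _ _ _ _ UNIV])
      (auto simp: distrib_right sc_mult_left proj_add proj_sc mon_mult proj_mon algebra_simps)
qed

lemma proj_Aw: "x \<in> Aw N \<nu> \<Longrightarrow> proj \<mu> x = (if \<mu> = \<nu> then x else 0)"
  unfolding Aw_def
  by (rule span_linear_eq[where f = "proj \<mu>" and g = "\<lambda>x. if \<mu> = \<nu> then x else 0"])
    (auto simp: proj_add proj_sc proj_mon)

lemma proj_VF: "x \<in> VF N \<Longrightarrow> proj \<mu> x \<in> VFw N \<mu>"
  unfolding VF_def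
  by (rule span_linear_mem[where f = "proj \<mu>" and W = "fwords N"])
    (auto simp: proj_add proj_sc proj_mon VFw_def FA.span_zero intro: FA.span_base)

lemma gen_Aw: "g \<in> generators N \<Longrightarrow> gen g \<in> Aw N (generator_weight g)"
  unfolding Aw_def by (rule FA.span_base) (auto simp: words_simps simp del: generators.simps)

lemma Aw_1: "1 \<in> Aw N 0"
proof -
  have "mon (Word []) \<in> Aw N 0" unfolding Aw_def by (rule FA.span_base) (auto simp: words_simps)
  thus ?thesis by (simp add: mon_Word_Nil)
qed

lemma VFw_mult: assumes "x \<in> VFw N \<mu>" "y \<in> VFw N \<nu>" shows "x * y \<in> VFw N (\<mu> + \<nu>)"
proof -
  have "mon u * y \<in> VFw N (word_weight u + \<nu>)" if "u \<in> fwords N" for u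
    using that
  proof (induction rule: fwords_induct)
    case Nil
    thus ?case using assms by (simp add: mon_Word_Nil)
  next
    case (Cons j gs)
    have "gen (GenF j) * (mon (Word gs) * y) \<in> VFw N (word_weight (Word gs) + \<nu> - simple_root j)"
      using gF_mult_VFw[OF Cons(1,3)] .
    thus ?case unfolding mon_Word_Cons[of "GenF j" gs] by (simp add: algebra_simps)
  qed
  hence mem: "mon u * y \<in> VFw N (\<mu> + \<nu>)" if "u \<in> {w \<in> fwords N. word_weight w = \<mu>}" for u using that by blast
  show ?thesis
    by (rule span_linear_mem[of "\<lambda>x. x * y" "{w \<in> fwords N. word_weight w = \<mu>}", OF _ _ mem subspaces(2)])
      (use assms(1) in \<open>simp_all add: VFw_def[of N \<mu>] distrib_right sc_mult_left\<close>)
qed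

definition klwords :: "nat \<Rightarrow> word set" where
  "klwords N = {Word gs |gs. set gs \<subseteq> GenK ` ZPi N \<union> GenL ` ZPi N}"
definition ewords :: "nat \<Rightarrow> word set" where
  "ewords N = {Word (map GenE js) |js. set js \<subseteq> {1..N}}"

lemma klwords_simps [simp]:
  "Word [] \<in> klwords N" "0 \<in> klwords N" "u \<in> klwords N \<Longrightarrow> w \<in> klwords N \<Longrightarrow> u + w \<in> klwords N"
  "a \<in> ZPi N \<Longrightarrow> Word [GenK a] \<in> klwords N" "a \<in> ZPi N \<Longrightarrow> Word [GenL a] \<in> klwords N"
  by (auto simp: klwords_def zero_word_def plus_word_def)

lemma klwords_words: "w \<in> klwords N \<Longrightarrow> w \<in> words N"
  by (auto simp: klwords_def words_def)

lemma ewords_words: "w \<in> ewords N \<Longrightarrow> w \<in> words N"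
  by (auto simp: ewords_def words_def subset_iff image_iff)

lemma klwords_induct [consumes 1, case_names Nil Cons]:
  assumes "w \<in> klwords N" "P (Word [])"
    "\<And>g gs. g \<in> GenK ` ZPi N \<union> GenL ` ZPi N \<Longrightarrow> Word gs \<in> klwords N \<Longrightarrow> P (Word gs) \<Longrightarrow> P (Word (g # gs))"
  shows "P w"
proof -
  obtain gs where gs: "set gs \<subseteq> GenK ` ZPi N \<union> GenL ` ZPi N" "w = Word gs" using assms(1) by (auto simp: klwords_def)
  have "P (Word gs)" using gs(1)
    by (induction gs) (auto intro!: assms(2) assms(3) simp: klwords_def)
  thus ?thesis using gs by simp
qed

lemma ewords_induct [consumes 1, case_names Nil Cons]:
  assumes "w \<in> ewords N" "P (Word [])"
    "\<And>j gs. j \<in> {1..N} \<Longrightarrow> Word gs \<in> ewords N \<Longrightarrow> P (Word gs) \<Longrightarrow> P (Word (GenE j # gs))"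
  shows "P w"
proof -
  obtain js where js: "set js \<subseteq> {1..N}" "w = Word (map GenE js)" using assms(1) by (auto simp: ewords_def)
  have "set js \<subseteq> {1..N} \<Longrightarrow> P (Word (map GenE js))"
  proof (induction js)
    case (Cons j js)
    have "Word (map GenE js) \<in> ewords N" using Cons.prems by (auto simp: ewords_def)
    thus ?case using assms(3)[of j "map GenE js"] Cons by simp
  qed (simp add: assms(2))
  thus ?thesis using js by simp
qed

lemma ewords_Nil [simp]: "Word [] \<in> ewords N" "0 \<in> ewords N"
  by (force simp: ewords_def zero_word_def)+

lemma ewords_Cons: "j \<in> {1..N} \<Longrightarrow> Word gs \<in> ewords N \<Longrightarrow> Word (GenE j # gs) \<in> ewords N"
proof -
  assume "j \<in> {1..N}" "Word gs \<in> ewords N"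
  then obtain js where "j \<in> {1..N}" "set js \<subseteq> {1..N}" "gs = map GenE js" by (auto simp: ewords_def)
  thus "Word (GenE j # gs) \<in> ewords N" unfolding ewords_def by (intro CollectI exI[of _ "j # js"]) auto
qed

lemma ewords_plus: "u \<in> ewords N \<Longrightarrow> w \<in> ewords N \<Longrightarrow> u + w \<in> ewords N"
proof -
  assume "u \<in> ewords N" "w \<in> ewords N"
  then obtain js ks where "set js \<subseteq> {1..N}" "set ks \<subseteq> {1..N}" "u = Word (map GenE js)" "w = Word (map GenE ks)"
    by (auto simp: ewords_def)
  thus "u + w \<in> ewords N" unfolding ewords_def by (intro CollectI exI[of _ "js @ ks"]) (auto simp: plus_word_def)
qed

context quantum_group
begin

lemma rels_homogeneous: "r \<in> rels \<Longrightarrow> \<exists>\<nu>. r \<in> Aw N \<nu>"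
proof -
  have K: "gK a \<in> Aw N 0" and L: "gL a \<in> Aw N 0" if "a \<in> ZPi N" for a
    using gen_Aw[of "GenK a" N] gen_Aw[of "GenL a" N] that by auto
  have E: "gE i \<in> Aw N (\<alpha> i)" and F: "gF i \<in> Aw N (- \<alpha> i)" if "i \<in> {1..N}" for i
    using gen_Aw[of "GenE i" N] gen_Aw[of "GenF i" N] that by auto
  note diff = FA.subspace_diff[OF subspaces(3)] and scale = FA.subspace_scale[OF subspaces(3)]
  assume "r \<in> rels"
  thus ?thesis
  proof cases
    case K_zero
    thus ?thesis using diff[OF K[OF ZPi_closed(1)] Aw_1] by blast
  next
    case L_zero
    thus ?thesis using diff[OF L[OF ZPi_closed(1)] Aw_1] by blast
  next
    case (KK a b)
    have "gK a * gK b \<in> Aw N 0" using Aw_mult[OF K K, of a b] KK by simp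
    thus ?thesis using KK diff K ZPi_closed(2) by blast
  next
    case (LL a b)
    have "gL a * gL b \<in> Aw N 0" using Aw_mult[OF L L, of a b] LL by simp
    thus ?thesis using LL diff L ZPi_closed(2) by blast
  next
    case (KL a b)
    have "gK a * gL b \<in> Aw N 0" "gL b * gK a \<in> Aw N 0" using Aw_mult[OF K L, of a b] Aw_mult[OF L K, of b a] KL by simp_all
    thus ?thesis using KL diff by blast
  next
    case (KE a i)
    have "gK a * gE i \<in> Aw N (\<alpha> i)" "gE i * gK a \<in> Aw N (\<alpha> i)"
      using Aw_mult[OF K E, of a i] Aw_mult[OF E K, of i a] KE by auto
    thus ?thesis using KE diff scale by blast
  next
    case (LE a i)
    have "gL a * gE i \<in> Aw N (\<alpha> i)" "gE i * gL a \<in> Aw N (\<alpha> i)"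
      using Aw_mult[OF L E, of a i] Aw_mult[OF E L, of i a] LE by auto
    thus ?thesis using LE diff scale by blast
  next
    case (KF a i)
    have "gK a * gF i \<in> Aw N (- \<alpha> i)" "gF i * gK a \<in> Aw N (- \<alpha> i)"
      using Aw_mult[OF K F, of a i] Aw_mult[OF F K, of i a] KF by auto
    thus ?thesis using KF diff scale by blast
  next
    case (LF a i)
    have "gL a * gF i \<in> Aw N (- \<alpha> i)" "gF i * gL a \<in> Aw N (- \<alpha> i)"
      using Aw_mult[OF L F, of a i] Aw_mult[OF F L, of i a] LF by auto
    thus ?thesis using LF diff scale by blast
  next
    case (EF i j)
    have "gE i * gF j \<in> Aw N (\<alpha> i - \<alpha> j)" "gF j * gE i \<in> Aw N (\<alpha> i - \<alpha> j)"
      using Aw_mult[OF E F, of i j] Aw_mult[OF F E, of j i] EF by auto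
    moreover have "(if i = j then gL (\<alpha> i) - gK (\<alpha> i) else 0) \<in> Aw N (\<alpha> i - \<alpha> j)"
      using diff[OF L K] EF FA.subspace_0[OF subspaces(3)] by auto
    ultimately show ?thesis using EF diff by blast
  qed
qed

lemma ideal_set_generators:
  assumes S: "FA.subspace S" "S \<subseteq> A"
    and "\<And>g s. g \<in> generators N \<Longrightarrow> s \<in> S \<Longrightarrow> gen g * s \<in> S"
    and "\<And>g s. g \<in> generators N \<Longrightarrow> s \<in> S \<Longrightarrow> s * gen g \<in> S"
  shows "ideal_set A S"
proof -
  have "Word gs \<in> words N \<Longrightarrow> \<forall>s\<in>S. mon (Word gs) * s \<in> S \<and> s * mon (Word gs) \<in> S" for gs
  proof (induction gs)
    case Nil
    show ?case by (simp add: mon_Word_Nil)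
  next
    case (Cons g gs)
    thus ?case unfolding mon_Word_Cons[of g gs] words_simps(4) using assms(3,4)
      by (simp add: mult.assoc) (simp flip: mult.assoc)
  qed
  hence w: "mon w * s \<in> S" "s * mon w \<in> S" if "w \<in> words N" "s \<in> S" for w s
    using that by (cases w; simp)+
  have "a * s \<in> S" if "a \<in> A" "s \<in> S" for a s
    using that(1) unfolding Acar_span
    by (rule span_linear_mem[where f = "\<lambda>a. a * s", rotated -1])
      (use w that S in \<open>auto simp: distrib_right sc_mult_left\<close>)
  moreover have "s * a \<in> S" if "a \<in> A" "s \<in> S" for a s
    using that(1) unfolding Acar_span
    by (rule span_linear_mem[where f = "\<lambda>a. s * a", rotated -1])
      (use w that S in \<open>auto simp: distrib_left sc_mult_right\<close>)
  ultimately show ?thesis using S by (auto simp: ideal_set_def subspace_additive)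
qed

text \<open>The relations are homogeneous, and multiplication by a letter only shifts the
  components. Hence the elements all of whose components lie in \<open>RI\<close> form an ideal
  containing the relations.\<close>

lemma proj_RI: assumes "x \<in> RI" shows "proj \<mu> x \<in> RI"
proof -
  define S where "S = {x \<in> A. \<forall>\<mu>. proj \<mu> x \<in> RI}"
  have sub: "FA.subspace S"
    by (rule FA.subspaceI) (auto simp: S_def proj_add proj_sc RI_closed)
  have "ideal_set A S"
  proof (rule ideal_set_generators[OF sub])
    show "S \<subseteq> A" by (auto simp: S_def)
    fix g s assume "g \<in> generators N" "s \<in> S"
    thus "gen g * s \<in> S" "s * gen g \<in> S"
      using gen_Acar[of g N] by (auto simp: S_def proj_mon_mult proj_mult_mon RI_closed simp del: generators.simps)
  qed
  moreover have "rels \<subseteq> S"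
  proof
    fix r assume r: "r \<in> rels"
    then obtain \<nu> where "r \<in> Aw N \<nu>" using rels_homogeneous by blast
    thus "r \<in> S" using r rels_A rels_RI proj_Aw[of r N \<nu>] by (auto simp: S_def RI_closed(1))
  qed
  ultimately show ?thesis using RI_least assms by (auto simp: S_def)
qed

abbreviation Uplus :: "'k walg set" where "Uplus \<equiv> FA.span (mon ` ewords N)"
abbreviation Uzero :: "'k walg set" where "Uzero \<equiv> FA.span (mon ` klwords N)"

lemma span_words_A: "W \<subseteq> words N \<Longrightarrow> FA.span (mon ` W) \<subseteq> A"
  unfolding Acar_span by (intro FA.span_mono) auto

lemma span_words_mult:
  assumes "\<And>u w. u \<in> W \<Longrightarrow> w \<in> W \<Longrightarrow> u + w \<in> W" and x: "x \<in> FA.span (mon ` W)" and y: "y \<in> FA.span (mon ` W)"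
  shows "x * y \<in> FA.span (mon ` W)"
proof -
  have 1: "mon u * y \<in> FA.span (mon ` W)" if u: "u \<in> W" for u
    by (rule span_linear_mem[where f = "\<lambda>y. mon u * y", OF _ _ _ FA.subspace_span y])
      (use assms(1) u in \<open>auto simp: distrib_left sc_mult_right mon_mult intro!: FA.span_base\<close>)
  show ?thesis
    by (rule span_linear_mem[where f = "\<lambda>x. x * y", OF _ _ _ FA.subspace_span x])
      (use 1 in \<open>auto simp: distrib_right sc_mult_left\<close>)
qed

text \<open>The span of the words in \<open>G\<close> is closed under products, and its saturation
  \<open>B\<close> under \<open>\<approx>\<close> also contains \<open>RI\<close>; minimality of the
  generated subalgebra applies to \<open>B\<close>. Conversely each such word is a product of the
  given generators.\<close>

lemma generated_subalgebra_words:
  assumes G: "G \<subseteq> generators N"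
  shows "generated_subalgebra T ((\<lambda>g. tc (gen g)) ` G) = tc ` FA.span (mon ` {w. set (letters w) \<subseteq> G})"
    (is "_ = tc ` FA.span (mon ` ?W)")
proof
  have W: "?W \<subseteq> words N" using G by (auto simp: words_def)
  have plus: "u + w \<in> ?W" if "u \<in> ?W" "w \<in> ?W" for u w using that by (auto simp: plus_word_def)
  let ?V = "FA.span (mon ` ?W)"
  define B where "B = {x \<in> A. \<exists>y\<in>?V. x \<approx> y}"
  have VA: "?V \<subseteq> A" by (rule span_words_A[OF W])
  have subsp: "FA.subspace B"
  proof (rule FA.subspaceI)
    show "0 \<in> B" using FA.span_zero[of "mon ` ?W"] by (auto simp: B_def intro!: bexI[of _ 0])
    fix x y c assume "x \<in> B" "y \<in> B"
    then obtain x' y' where "x \<in> A" "y \<in> A" "x + y \<in> A" "sc c x \<in> A" "x' \<in> ?V" "y' \<in> ?V" "x \<approx> x'" "y \<approx> y'"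
      by (auto simp: B_def)
    thus "x + y \<in> B" "sc c x \<in> B"
      using cong_add[of x x' y y'] cong_sc[of x x' c] FA.span_add[of x' _ y'] FA.span_scale[of x' _ c]
      unfolding B_def by blast+
  qed
  have "1 \<in> ?V"
  proof -
    have "mon (Word []) \<in> ?V" by (rule FA.span_base) auto
    thus ?thesis by (simp add: mon_Word_Nil)
  qed
  hence "1 \<in> B" by (auto simp: B_def intro!: bexI[of _ 1])
  moreover have "x * y \<in> B" if xy: "x \<in> B" "y \<in> B" for x y
  proof -
    obtain x' y' where "x \<in> A" "y \<in> A" "x' \<in> ?V" "y' \<in> ?V" "x \<approx> x'" "y \<approx> y'" using xy by (auto simp: B_def)
    thus ?thesis using cong_mult[of x x' y y'] span_words_mult[OF plus, of x' y'] VA by (auto simp: B_def)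
  qed
  ultimately have "subring_set B" using subspace_additive[OF subsp] by (simp add: subring_set_def)
  moreover have "RI \<subseteq> B" using RI_A FA.span_zero by (auto simp: B_def cong_def intro!: bexI[of _ 0])
  moreover have "(\<lambda>g. tc (gen g)) ` G \<subseteq> tc ` B"
  proof (intro image_subsetI imageI)
    fix g assume "g \<in> G"
    hence "gen g \<in> ?V" by (intro FA.span_base) auto
    thus "gen g \<in> B" using VA cong_refl unfolding B_def by blast
  qed
  ultimately have "generated_subalgebra T ((\<lambda>g. tc (gen g)) ` G) \<subseteq> tc ` B"
    using subsp by (intro generated_subalgebra_least[OF presents_space_tU presents_ring_tU]) (auto simp: B_def)
  also have "tc ` B \<subseteq> tc ` ?V"
  proof
    fix Y assume "Y \<in> tc ` B"
    then obtain x y where "x \<in> A" "y \<in> ?V" "x \<approx> y" "Y = tc x" by (auto simp: B_def)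
    thus "Y \<in> tc ` ?V" using tc_eq[of x y] VA by blast
  qed
  finally show "generated_subalgebra T ((\<lambda>g. tc (gen g)) ` G) \<subseteq> tc ` ?V" .
  have word: "tc (mon (Word gs)) \<in> generated_subalgebra T ((\<lambda>g. tc (gen g)) ` G)" if "set gs \<subseteq> G" for gs
    using that
  proof (induction gs)
    case Nil
    show ?case using generated_subalgebra_closed(2)[of T] by (simp add: mon_Word_Nil tU_ring(2))
  next
    case (Cons g gs)
    have "gen g \<in> A" "mon (Word gs) \<in> A" using Cons.prems G by (auto simp: words_def intro!: gen_Acar Acar_closed(7))
    have "tc (gen g) \<in> generated_subalgebra T ((\<lambda>g. tc (gen g)) ` G)"
      using Cons.prems by (intro generated_subalgebra_closed(1)) auto
    moreover have "tc (mon (Word gs)) \<in> generated_subalgebra T ((\<lambda>g. tc (gen g)) ` G)" using Cons by simp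
    ultimately have "tc (gen g) \<otimes>\<^bsub>T\<^esub> tc (mon (Word gs)) \<in> generated_subalgebra T ((\<lambda>g. tc (gen g)) ` G)"
      by (rule generated_subalgebra_closed(3))
    thus ?case unfolding mon_Word_Cons[of g gs] using tU_ring(3)[OF \<open>gen g \<in> A\<close> \<open>mon (Word gs) \<in> A\<close>] by simp
  qed
  show "tc ` ?V \<subseteq> generated_subalgebra T ((\<lambda>g. tc (gen g)) ` G)"
  proof (rule image_subsetI)
    fix x :: "'k walg" assume "x \<in> ?V"
    hence "x \<in> A \<and> tc x \<in> generated_subalgebra T ((\<lambda>g. tc (gen g)) ` G)"
    proof (induction rule: FA.span_induct_alt)
      case base
      have "tc 0 = 0 \<odot>\<^bsub>T\<^esub> \<one>\<^bsub>T\<^esub>" by (simp add: tU_ring(2) tc_sc)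
      thus ?case using generated_subalgebra_closed(5)[OF generated_subalgebra_closed(2)[of T], where c = 0] by simp
    next
      case (step c x y)
      then obtain w where "set (letters w) \<subseteq> G" "x = mon w" by auto
      then obtain gs where gs: "set gs \<subseteq> G" "x = mon (Word gs)" by (cases w) auto
      hence x: "x \<in> A" using G by (auto simp: words_def)
      have "tc (sc c x + y) = (c \<odot>\<^bsub>T\<^esub> tc x) \<oplus>\<^bsub>T\<^esub> tc y"
        using x step by (simp add: tc_sc tU_add(6))
      moreover have "(c \<odot>\<^bsub>T\<^esub> tc x) \<oplus>\<^bsub>T\<^esub> tc y \<in> generated_subalgebra T ((\<lambda>g. tc (gen g)) ` G)"
        using word[OF gs(1)] gs(2) step
        by (intro generated_subalgebra_closed(4)[of _ T] generated_subalgebra_closed(5)[of _ T]) auto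
      ultimately show ?case using step x by simp
    qed
    thus "tc x \<in> generated_subalgebra T ((\<lambda>g. tc (gen g)) ` G)" ..
  qed
qed

lemma tU_minus_eq: "tU_minus N \<chi> = tc ` VF N"
proof -
  have "{w. set (letters w) \<subseteq> GenF ` {1..N}} = fwords N"
  proof (intro equalityI subsetI)
    fix w assume "w \<in> {w. set (letters w) \<subseteq> GenF ` {1..N}}"
    moreover have "set gs \<subseteq> GenF ` {1..N} \<Longrightarrow> Word gs \<in> fwords N" for gs by (induction gs) auto
    ultimately show "w \<in> fwords N" by (cases w) simp
  qed (auto simp: fwords_def intro!: imageI)
  thus ?thesis using generated_subalgebra_words[of "GenF ` {1..N}"]
    by (simp add: tU_minus_def tF_def VF_def image_image subset_iff)
qed

lemma tU_plus_eq: "tU_plus N \<chi> = tc ` Uplus"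
proof -
  have "{w. set (letters w) \<subseteq> GenE ` {1..N}} = ewords N"
  proof (intro equalityI subsetI)
    fix w assume "w \<in> {w. set (letters w) \<subseteq> GenE ` {1..N}}"
    moreover have "set gs \<subseteq> GenE ` {1..N} \<Longrightarrow> Word gs \<in> ewords N" for gs
      by (induction gs) (auto intro!: ewords_Cons)
    ultimately show "w \<in> ewords N" by (cases w) simp
  qed (auto simp: ewords_def intro!: imageI)
  thus ?thesis using generated_subalgebra_words[of "GenE ` {1..N}"]
    by (simp add: tU_plus_def tE_def image_image subset_iff)
qed

lemma tU_zero_eq: "tU_zero N \<chi> = tc ` Uzero"
proof -
  have "{w. set (letters w) \<subseteq> GenK ` ZPi N \<union> GenL ` ZPi N} = klwords N"
  proof (intro equalityI subsetI)
    fix w assume "w \<in> {w. set (letters w) \<subseteq> GenK ` ZPi N \<union> GenL ` ZPi N}"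
    thus "w \<in> klwords N" by (cases w) (auto simp: klwords_def)
  qed (auto simp: klwords_def)
  thus ?thesis using generated_subalgebra_words[of "GenK ` ZPi N \<union> GenL ` ZPi N"]
    by (simp add: tU_zero_def tK_def tL_def image_image image_Un subset_iff)
qed

lemma tU_component_eq: "tU_component N \<chi> \<mu> = tc ` Aw N \<mu>"
proof -
  have "{tc (mon w) |w. w \<in> words N \<and> word_weight w = \<mu>} = tc ` mon ` {w \<in> words N. word_weight w = \<mu>}" by blast
  moreover have "mon ` {w \<in> words N. word_weight w = \<mu>} \<subseteq> A" by auto
  ultimately show ?thesis
    using kspan_image[OF presents_space_tU] by (simp add: tU_component_def Aw_def)
qed

end

subsection \<open>The ideal generated by the negative part\<close>

lemma ZPi_nonnegD: "a \<in> ZPi_nonneg N \<Longrightarrow> a \<in> ZPi N" by (simp add: ZPi_nonneg_def)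

lemma ZPi_nonneg_simps [simp]:
  "0 \<in> ZPi_nonneg N" "a \<in> ZPi_nonneg N \<Longrightarrow> i \<in> {1..N} \<Longrightarrow> a + simple_root i \<in> ZPi_nonneg N"
  by (auto simp: ZPi_nonneg_def lookup_add simple_root_def lookup_single when_def ZPi_closed)
    (use ZPi_closed(2)[OF _ ZPi_closed(5)] in \<open>auto simp: simple_root_def\<close>)

lemma ZPi_nonneg_diff_iff:
  assumes "a \<in> ZPi_nonneg N" "i \<in> {1..N}"
  shows "a - simple_root i \<in> ZPi_nonneg N \<longleftrightarrow> Poly_Mapping.lookup a i \<noteq> 0"
proof -
  have "0 \<le> Poly_Mapping.lookup a j" for j using assms(1) by (simp add: ZPi_nonneg_def)
  note nn = this
  have Z: "a - simple_root i \<in> ZPi N" using assms ZPi_nonnegD by auto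
  show ?thesis
  proof
    assume "a - simple_root i \<in> ZPi_nonneg N"
    hence "0 \<le> Poly_Mapping.lookup (a - simple_root i) i" unfolding ZPi_nonneg_def by blast
    thus "Poly_Mapping.lookup a i \<noteq> 0" by (simp add: lookup_minus simple_root_def)
  next
    assume "Poly_Mapping.lookup a i \<noteq> 0"
    hence "0 \<le> Poly_Mapping.lookup (a - simple_root i) j" for j
      using nn[of j] nn[of i] by (auto simp: lookup_minus simple_root_def lookup_single when_def)
    thus "a - simple_root i \<in> ZPi_nonneg N" using Z by (simp add: ZPi_nonneg_def)
  qed
qed

definition weight_height :: "nat \<Rightarrow> weight \<Rightarrow> int" where
  "weight_height N a = (\<Sum>i\<in>{1..N}. Poly_Mapping.lookup a i)"

lemma weight_height_add: "weight_height N (a + b) = weight_height N a + weight_height N b"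
  by (simp add: weight_height_def lookup_add sum.distrib)

lemma weight_height_simple: "i \<in> {1..N} \<Longrightarrow> weight_height N (simple_root i) = 1"
  by (simp add: weight_height_def simple_root_def lookup_single when_def sum.delta)

lemma weight_height_nonneg: "a \<in> ZPi_nonneg N \<Longrightarrow> 0 \<le> weight_height N a"
  by (simp add: weight_height_def ZPi_nonneg_def sum_nonneg)

text \<open>The recursion behind \<open>tI_minus_at\<close> lowers the height by one, so this is its
  natural induction.\<close>

lemma nonneg_height_induct [consumes 1, case_names step]:
  assumes "a \<in> ZPi_nonneg N"
    and "\<And>a. a \<in> ZPi_nonneg N \<Longrightarrow>
      (\<And>i. i \<in> {1..N} \<Longrightarrow> a - simple_root i \<in> ZPi_nonneg N \<Longrightarrow> P (a - simple_root i)) \<Longrightarrow> P a"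
  shows "P a"
  using assms(1)
proof (induction "nat (weight_height N a)" arbitrary: a rule: less_induct)
  case less
  show ?case
  proof (rule assms(2)[OF less.prems])
    fix i assume i: "i \<in> {1..N}" "a - simple_root i \<in> ZPi_nonneg N"
    have "weight_height N a = weight_height N (a - simple_root i) + 1"
      using weight_height_add[of N "a - simple_root i" "simple_root i"] weight_height_simple[OF i(1)] by simp
    thus "P (a - simple_root i)"
      using weight_height_nonneg[OF i(2)] i(2) by (intro less.hyps) auto
  qed
qed

context quantum_group
begin

lemma cong_A_iff: "x \<approx> y \<Longrightarrow> x \<in> A \<longleftrightarrow> y \<in> A"
proof -
  assume "x \<approx> y"
  hence d: "x - y \<in> A" using RI_A by (simp add: cong_def)
  show ?thesis using Acar_closed(3)[OF d, of y] Acar_closed(4)[of x N, OF _ d] by auto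
qed

lemma graded_A: "x \<in> VF N \<Longrightarrow> x \<in> A" "x \<in> VFw N \<mu> \<Longrightarrow> x \<in> A" "x \<in> Aw N \<mu> \<Longrightarrow> x \<in> A"
  by (blast intro: subsetD[OF VF_Acar] subsetD[OF VFw_VF] subsetD[OF Aw_Acar])+

lemma K_move_word:
  assumes "w \<in> words N" "b \<in> ZPi N"
  shows "gK b * mon w \<approx> sc (XX b (word_weight w)) (mon w * gK b)"
    "gL b * mon w \<approx> sc (inverse (XX (word_weight w) b)) (mon w * gL b)"
proof -
  have K: "gK b * gen g \<approx> sc (XX b (generator_weight g)) (gen g * gK b)"
    and L: "gL b * gen g \<approx> sc (inverse (XX (generator_weight g) b)) (gen g * gL b)" if "g \<in> generators N" for g
  proof -
    have KKc: "gK b * gK a \<approx> gK a * gK b" "gL b * gL a \<approx> gL a * gL b" if "a \<in> ZPi N" for a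
    proof -
      have "gK b * gK a \<approx> gK (a + b)" "gL b * gL a \<approx> gL (a + b)"
        using rel_cong(3,4)[of b a] that assms(2) by (simp_all add: add.commute)
      thus "gK b * gK a \<approx> gK a * gK b" "gL b * gL a \<approx> gL a * gL b"
        using cong_trans[OF _ cong_sym[OF rel_cong(3)[of a b]]] cong_trans[OF _ cong_sym[OF rel_cong(4)[of a b]]]
          that assms(2) by auto
    qed
    show "gK b * gen g \<approx> sc (XX b (generator_weight g)) (gen g * gK b)"
      using that assms(2) KKc rel_cong(5,6,8) by (cases g) (auto simp: X_minus)
    show "gL b * gen g \<approx> sc (inverse (XX (generator_weight g) b)) (gen g * gL b)"
      using that assms(2) KKc cong_sym[OF rel_cong(5)] rel_cong(7,9) by (cases g) (auto simp: X_minus)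
  qed
  obtain gs where w: "w = Word gs" by (cases w)
  have "Word gs \<in> words N \<Longrightarrow> gK b * mon (Word gs) \<approx> sc (XX b (word_weight (Word gs))) (mon (Word gs) * gK b) \<and>
    gL b * mon (Word gs) \<approx> sc (inverse (XX (word_weight (Word gs)) b)) (mon (Word gs) * gL b)" for gs
  proof (induction gs)
    case Nil
    thus ?case by (simp add: mon_Word_Nil)
  next
    case (Cons g gs)
    hence g: "g \<in> generators N" "Word gs \<in> words N" by (simp_all add: words_simps del: generators.simps)
    hence gA: "gen g \<in> A" "mon (Word gs) \<in> A" by (simp_all del: generators.simps)
    have step: "c * (gen g * mon (Word gs)) \<approx> sc (d * e) (gen g * mon (Word gs) * c)"
      if "c * gen g \<approx> sc d (gen g * c)" "c * mon (Word gs) \<approx> sc e (mon (Word gs) * c)" for c d e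
    proof -
      have "c * gen g * mon (Word gs) \<approx> sc d (gen g * c) * mon (Word gs)" by (rule cong_mult_right[OF gA(2) that(1)])
      also have "sc d (gen g * c) * mon (Word gs) = sc d (gen g * (c * mon (Word gs)))"
        by (simp add: sc_mult_left mult.assoc)
      also have "\<dots> \<approx> sc d (gen g * sc e (mon (Word gs) * c))"
        by (rule cong_sc[OF cong_mult_left[OF gA(1) that(2)]])
      finally show ?thesis by (simp add: sc_mult_right mult.assoc)
    qed
    show ?case
      using step[OF K[OF g(1)], of "XX b (word_weight (Word gs))"] step[OF L[OF g(1)], of "inverse (XX (word_weight (Word gs)) b)"]
        Cons.IH[OF g(2)]
      unfolding mon_Word_Cons[of g gs] by (simp add: X_add)
  qed
  thus "gK b * mon w \<approx> sc (XX b (word_weight w)) (mon w * gK b)"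
    "gL b * mon w \<approx> sc (inverse (XX (word_weight w) b)) (mon w * gL b)"
    using assms(1) w by simp_all
qed

lemma cong_linear:
  assumes "\<And>x y. f (x + y) = f x + f y" "\<And>c x. f (sc c x) = sc c (f x)"
    and "\<And>x y. g (x + y) = g x + g y" "\<And>c x. g (sc c x) = sc c (g x)"
    and "\<And>w. w \<in> W \<Longrightarrow> f (mon w) \<approx> g (mon w)" and x: "x \<in> FA.span (mon ` W)"
  shows "f x \<approx> g x"
proof -
  have "f x - g x \<in> RI"
    by (rule span_linear_mem[where f = "\<lambda>x. f x - g x", OF _ _ _ ideal_set_subspace[OF RI_ideal] x])
      (use assms in \<open>auto simp: cong_def FA.scale_right_diff_distrib\<close>)
  thus ?thesis by (simp add: cong_def)
qed

lemma K_move: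
  assumes "x \<in> Aw N \<mu>" "b \<in> ZPi N"
  shows "gK b * x \<approx> sc (XX b \<mu>) (x * gK b)" "gL b * x \<approx> sc (inverse (XX \<mu> b)) (x * gL b)"
proof -
  note x = assms(1)[unfolded Aw_def]
  show "gK b * x \<approx> sc (XX b \<mu>) (x * gK b)"
    by (rule cong_linear[where f = "\<lambda>x. gK b * x" and g = "\<lambda>x. sc (XX b \<mu>) (x * gK b)", OF _ _ _ _ _ x])
      (use K_move_word assms(2) in \<open>auto simp: distrib_left distrib_right sc_mult_left sc_mult_right FA.scale_right_distrib mult.commute\<close>)
  show "gL b * x \<approx> sc (inverse (XX \<mu> b)) (x * gL b)"
    by (rule cong_linear[where f = "\<lambda>x. gL b * x" and g = "\<lambda>x. sc (inverse (XX \<mu> b)) (x * gL b)", OF _ _ _ _ _ x])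
      (use K_move_word assms(2) in \<open>auto simp: distrib_left distrib_right sc_mult_left sc_mult_right FA.scale_right_distrib mult.commute\<close>)
qed

definition Iat :: "weight \<Rightarrow> 'k walg set" where "Iat a = {y \<in> A. tI_minus_at N \<chi> a (tc y)}"
text \<open>Outside the positive cone the subspace is taken to be \<open>RI\<close>, the zero of
  \<open>tU\<close>. The commutator of \<open>E_i\<close> with an element of \<open>Iat a\<close>
  then has one form, whether or not \<open>\<alpha> i\<close> can be subtracted from
  \<open>a\<close>.\<close>

definition Jset :: "weight \<Rightarrow> 'k walg set" where "Jset b = (if b \<in> ZPi_nonneg N then Iat b else RI)"

lemma Iat_A: "y \<in> Iat a \<Longrightarrow> y \<in> A" by (simp add: Iat_def)

lemma Iat_cong: "y \<in> Iat a \<Longrightarrow> y \<approx> y' \<Longrightarrow> y' \<in> Iat a"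
  using tc_eq[of y y'] cong_A_iff[of y y'] by (simp add: Iat_def)

lemma Iat_0: "Iat 0 = RI"
proof (intro equalityI subsetI)
  fix y assume "y \<in> Iat 0"
  hence y: "y \<in> A" "tI_minus_at N \<chi> 0 (tc y)" by (auto simp: Iat_def)
  from y(2) have "tc y = \<zero>\<^bsub>T\<^esub>" by cases auto
  thus "y \<in> RI" using presents_zero_iff[OF tU_ring(1) y(1)] by simp
next
  fix y assume y: "y \<in> RI"
  hence "tc y = \<zero>\<^bsub>T\<^esub>" using presents_zero_iff[OF tU_ring(1) RI_A] by simp
  thus "y \<in> Iat 0" using y RI_A tI_minus_at.zero by (simp add: Iat_def)
qed

lemma tI_minus_at_class: assumes "tI_minus_at N \<chi> b P" obtains p where "p \<in> Iat b" "P = tc p"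
proof -
  have "\<exists>p\<in>A. P = tc p"
    using assms
  proof cases
    case zero
    thus ?thesis using tU_add(5) by (auto intro!: bexI[of _ 0])
  next
    case nonzero
    thus ?thesis using graded_A(1) by (auto simp: tU_minus_eq)
  qed
  thus ?thesis using that assms by (auto simp: Iat_def)
qed

lemma tU_comm_eq:
  assumes "y \<in> A" "p \<in> A" "z \<in> A" "i \<in> {1..N}"
  shows "(tE N \<chi> i \<otimes>\<^bsub>T\<^esub> tc y) \<ominus>\<^bsub>T\<^esub> (tc y \<otimes>\<^bsub>T\<^esub> tE N \<chi> i) =
      (tc p \<otimes>\<^bsub>T\<^esub> tK N \<chi> (\<alpha> i)) \<oplus>\<^bsub>T\<^esub> (tc z \<otimes>\<^bsub>T\<^esub> tL N \<chi> (\<alpha> i)) \<longleftrightarrow>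
    gE i * y - y * gE i \<approx> p * gK (\<alpha> i) + z * gL (\<alpha> i)"
proof -
  have "\<alpha> i \<in> ZPi N" using assms(4) by simp
  thus ?thesis using assms presents_a_minus[OF tU_ring(1)]
    by (simp add: tE_def tK_def tL_def tU_ring(3) tU_add(6) tc_eq)
qed

lemma Iat_iff:
  assumes a: "a \<in> ZPi_nonneg N" "a \<noteq> 0" and y: "y \<in> A"
  shows "y \<in> Iat a \<longleftrightarrow> (\<exists>y'\<in>VFw N (- a). y \<approx> y') \<and>
    (\<forall>i\<in>{1..N}. a - \<alpha> i \<in> ZPi_nonneg N \<longrightarrow>
      (\<exists>p\<in>Iat (a - \<alpha> i). \<exists>z\<in>Iat (a - \<alpha> i). gE i * y - y * gE i \<approx> p * gK (\<alpha> i) + z * gL (\<alpha> i)))"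
proof
  assume "y \<in> Iat a"
  hence "tI_minus_at N \<chi> a (tc y)" by (simp add: Iat_def)
  thus "(\<exists>y'\<in>VFw N (- a). y \<approx> y') \<and> (\<forall>i\<in>{1..N}. a - \<alpha> i \<in> ZPi_nonneg N \<longrightarrow>
      (\<exists>p\<in>Iat (a - \<alpha> i). \<exists>z\<in>Iat (a - \<alpha> i). gE i * y - y * gE i \<approx> p * gK (\<alpha> i) + z * gL (\<alpha> i)))"
  proof cases
    case zero
    thus ?thesis using a by simp
  next
    case nonzero
    from nonzero(3) obtain u c where u: "u \<in> VF N" "tc y = tc u" and c: "c \<in> Aw N (- a)" "tc y = tc c"
      by (auto simp: tU_minus_eq tU_component_eq)
    have A: "u \<in> A" "c \<in> A" using u c graded_A by auto
    have "tc u = tc c" using u c by simp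
    hence "u - c \<in> RI" using tU_add(7)[OF A] by blast
    \<comment> \<open>The class has a representative \<open>u\<close> in the negative part and a
      representative \<open>c\<close> in the weight component. Projecting \<open>u - c\<close>,
      which lies in the graded ideal \<open>RI\<close>, to degree \<open>- a\<close> yields a single
      representative of both kinds.\<close>
    hence "proj (- a) u - c \<in> RI"
      using proj_RI[of "u - c" "- a"] proj_Aw[OF c(1), of "- a"] by (simp add: proj_diff)
    hence 1: "proj (- a) u \<approx> c" by (simp add: cong_def)
    have 2: "y \<approx> c" using c y A by (simp add: tc_eq)
    have "y \<approx> proj (- a) u" by (rule cong_trans[OF 2 cong_sym[OF 1]])
    moreover have "proj (- a) u \<in> VFw N (- a)" by (rule proj_VF[OF u(1)])
    moreover have "\<exists>p\<in>Iat (a - \<alpha> i). \<exists>z\<in>Iat (a - \<alpha> i). gE i * y - y * gE i \<approx> p * gK (\<alpha> i) + z * gL (\<alpha> i)"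
      if i: "i \<in> {1..N}" "a - \<alpha> i \<in> ZPi_nonneg N" for i
    proof -
      from nonzero(4)[OF i] obtain P Z where PZ: "tI_minus_at N \<chi> (a - \<alpha> i) P" "tI_minus_at N \<chi> (a - \<alpha> i) Z"
        "(tE N \<chi> i \<otimes>\<^bsub>T\<^esub> tc y) \<ominus>\<^bsub>T\<^esub> (tc y \<otimes>\<^bsub>T\<^esub> tE N \<chi> i) =
          (P \<otimes>\<^bsub>T\<^esub> tK N \<chi> (\<alpha> i)) \<oplus>\<^bsub>T\<^esub> (Z \<otimes>\<^bsub>T\<^esub> tL N \<chi> (\<alpha> i))" by blast
      obtain p where p: "p \<in> Iat (a - \<alpha> i)" "P = tc p" using tI_minus_at_class PZ(1) .
      obtain z where z: "z \<in> Iat (a - \<alpha> i)" "Z = tc z" using tI_minus_at_class PZ(2) .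
      have "gE i * y - y * gE i \<approx> p * gK (\<alpha> i) + z * gL (\<alpha> i)"
        using PZ(3) tU_comm_eq[OF y Iat_A[OF p(1)] Iat_A[OF z(1)] i(1)] p(2) z(2) by simp
      thus ?thesis using p z by blast
    qed
    ultimately show ?thesis by blast
  qed
next
  assume r: "(\<exists>y'\<in>VFw N (- a). y \<approx> y') \<and> (\<forall>i\<in>{1..N}. a - \<alpha> i \<in> ZPi_nonneg N \<longrightarrow>
      (\<exists>p\<in>Iat (a - \<alpha> i). \<exists>z\<in>Iat (a - \<alpha> i). gE i * y - y * gE i \<approx> p * gK (\<alpha> i) + z * gL (\<alpha> i)))"
  then obtain y' where y': "y' \<in> VFw N (- a)" "y \<approx> y'" by blast
  hence "tc y = tc y'" using tc_eq[of y y'] cong_A_iff[OF y'(2)] y by simp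
  hence "tc y \<in> tU_minus N \<chi> \<inter> tU_component N \<chi> (- a)"
    using y'(1)
    by (auto simp: tU_minus_eq tU_component_eq intro!: imageI subsetD[OF VFw_VF] subsetD[OF VFw_Aw])
  hence "tI_minus_at N \<chi> a (tc y)"
  proof (rule tI_minus_at.nonzero[OF a])
    fix i assume i: "i \<in> {1..N}" "a - \<alpha> i \<in> ZPi_nonneg N"
    then obtain p z where pz: "p \<in> Iat (a - \<alpha> i)" "z \<in> Iat (a - \<alpha> i)"
      "gE i * y - y * gE i \<approx> p * gK (\<alpha> i) + z * gL (\<alpha> i)" using r by blast
    hence "tI_minus_at N \<chi> (a - \<alpha> i) (tc p)" "tI_minus_at N \<chi> (a - \<alpha> i) (tc z)"
        "(tE N \<chi> i \<otimes>\<^bsub>T\<^esub> tc y) \<ominus>\<^bsub>T\<^esub> (tc y \<otimes>\<^bsub>T\<^esub> tE N \<chi> i) =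
          (tc p \<otimes>\<^bsub>T\<^esub> tK N \<chi> (\<alpha> i)) \<oplus>\<^bsub>T\<^esub> (tc z \<otimes>\<^bsub>T\<^esub> tL N \<chi> (\<alpha> i))"
      using tU_comm_eq[OF y Iat_A[OF pz(1)] Iat_A[OF pz(2)] i(1)] by (simp_all add: Iat_def)
    thus "\<exists>P Z. tI_minus_at N \<chi> (a - \<alpha> i) P \<and> tI_minus_at N \<chi> (a - \<alpha> i) Z \<and>
        (tE N \<chi> i \<otimes>\<^bsub>T\<^esub> tc y) \<ominus>\<^bsub>T\<^esub> (tc y \<otimes>\<^bsub>T\<^esub> tE N \<chi> i) =
          (P \<otimes>\<^bsub>T\<^esub> tK N \<chi> (\<alpha> i)) \<oplus>\<^bsub>T\<^esub> (Z \<otimes>\<^bsub>T\<^esub> tL N \<chi> (\<alpha> i))"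
      by blast
  qed
  thus "y \<in> Iat a" using y by (simp add: Iat_def)
qed

lemma Iat_VFw: assumes "a \<in> ZPi_nonneg N" "y \<in> Iat a" obtains y' where "y' \<in> VFw N (- a)" "y \<approx> y'"
proof (cases "a = 0")
  case True
  hence "y \<approx> 0" using assms Iat_0 by (simp add: cong_def)
  thus ?thesis using that FA.subspace_0[OF subspaces(2)] by blast
next
  case False
  thus ?thesis using Iat_iff[OF assms(1) False Iat_A[OF assms(2)]] assms(2) that by blast
qed

text \<open>All letters of the words involved differ from \<open>F_i\<close>, and \<open>E_i\<close>
  commutes with those. The induction also records that the \<open>i\<close>-th coordinate of a
  weight is never positive, so that total coordinate zero excludes each single occurrence.\<close>

lemma E_commute_missing:
  assumes "y \<in> VFw N (- a)" "i \<in> {1..N}" "Poly_Mapping.lookup a i = 0"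
  shows "gE i * y \<approx> y * gE i"
proof -
  have "Poly_Mapping.lookup (word_weight w) i \<le> 0 \<and>
     (Poly_Mapping.lookup (word_weight w) i = 0 \<longrightarrow> gE i * mon w \<approx> mon w * gE i)" if "w \<in> fwords N" for w
    using that
  proof (induction rule: fwords_induct)
    case Nil
    show ?case by (simp add: mon_Word_Nil)
  next
    case (Cons j gs)
    have l: "Poly_Mapping.lookup (word_weight (Word (GenF j # gs))) i =
       Poly_Mapping.lookup (word_weight (Word gs)) i - (if i = j then 1 else 0)"
      by (simp add: lookup_add lookup_minus simple_root_def lookup_single when_def)
    have "gE i * mon (Word (GenF j # gs)) \<approx> mon (Word (GenF j # gs)) * gE i"
      if "i \<noteq> j" "gE i * mon (Word gs) \<approx> mon (Word gs) * gE i"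
    proof -
      have A: "mon (Word gs) \<in> A" "gF j \<in> A" using Cons fwords_words by auto
      have "gE i * gF j \<approx> gF j * gE i" using rel_cong(10)[OF assms(2) Cons(1)] that by simp
      from cong_mult_right[OF A(1) this]
      have "gE i * mon (Word (GenF j # gs)) \<approx> gF j * (gE i * mon (Word gs))"
        unfolding mon_Word_Cons[of "GenF j" gs] by (simp add: mult.assoc)
      also have "\<dots> \<approx> gF j * (mon (Word gs) * gE i)" by (rule cong_mult_left[OF A(2) that(2)])
      finally show ?thesis unfolding mon_Word_Cons[of "GenF j" gs] by (simp add: mult.assoc)
    qed
    thus ?case using Cons l by auto
  qed
  note w = this
  show ?thesis
    by (rule cong_linear[where f = "\<lambda>y. gE i * y" and g = "\<lambda>y. y * gE i", OF _ _ _ _ _ assms(1)[unfolded VFw_def]])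
      (use w assms(3) in \<open>auto simp: distrib_left distrib_right sc_mult_left sc_mult_right\<close>)
qed

lemma Iat_subspace: "a \<in> ZPi_nonneg N \<Longrightarrow> FA.subspace (Iat a)"
proof (induction a rule: nonneg_height_induct)
  case (step a)
  note nn = step(1) and IH = step(2)
  show ?case
  proof (cases "a = 0")
    case True
    thus ?thesis using Iat_0 ideal_set_subspace[OF RI_ideal] by simp
  next
    case False
    note iff = Iat_iff[OF nn False]
    note V = FA.subspace_0[OF subspaces(2)] FA.subspace_add[OF subspaces(2)] FA.subspace_scale[OF subspaces(2)]
    show ?thesis
    proof (rule FA.subspaceI)
      have "\<exists>p\<in>Iat (a - \<alpha> i). \<exists>z\<in>Iat (a - \<alpha> i). gE i * 0 - 0 * gE i \<approx> p * gK (\<alpha> i) + z * gL (\<alpha> i)"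
        if "i \<in> {1..N}" "a - \<alpha> i \<in> ZPi_nonneg N" for i
        using FA.subspace_0[OF IH[OF that]] by (intro bexI[of _ 0]) auto
      thus "0 \<in> Iat a" using V(1) by (auto simp: iff intro!: bexI[of _ 0])
      fix x assume x: "x \<in> Iat a"
      have x': "\<exists>x'\<in>VFw N (- a). x \<approx> x'" "i \<in> {1..N} \<Longrightarrow> a - \<alpha> i \<in> ZPi_nonneg N \<Longrightarrow>
          \<exists>p\<in>Iat (a - \<alpha> i). \<exists>z\<in>Iat (a - \<alpha> i). gE i * x - x * gE i \<approx> p * gK (\<alpha> i) + z * gL (\<alpha> i)" for i
        using x iff[OF Iat_A[OF x]] by blast+
      show "sc c x \<in> Iat a" for c
        unfolding iff[OF Acar_closed(6)[OF Iat_A[OF x], of c]]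
      proof (intro conjI ballI impI)
        show "\<exists>y'\<in>VFw N (- a). sc c x \<approx> y'" using x'(1) V(3) cong_sc by blast
        fix i assume i: "i \<in> {1..N}" "a - \<alpha> i \<in> ZPi_nonneg N"
        from x'(2)[OF this] obtain p z where pz: "p\<in>Iat (a - \<alpha> i)" "z\<in>Iat (a - \<alpha> i)"
          "gE i * x - x * gE i \<approx> p * gK (\<alpha> i) + z * gL (\<alpha> i)" by blast
        have "gE i * sc c x - sc c x * gE i \<approx> sc c p * gK (\<alpha> i) + sc c z * gL (\<alpha> i)"
          using cong_sc[OF pz(3), of c]
          by (simp add: sc_mult_left sc_mult_right FA.scale_right_distrib FA.scale_right_diff_distrib)
        thus "\<exists>p\<in>Iat (a - \<alpha> i). \<exists>z\<in>Iat (a - \<alpha> i). gE i * sc c x - sc c x * gE i \<approx> p * gK (\<alpha> i) + z * gL (\<alpha> i)"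
          using FA.subspace_scale[OF IH[OF i]] pz(1,2) by blast
      qed
      fix y assume y: "y \<in> Iat a"
      have y': "\<exists>y'\<in>VFw N (- a). y \<approx> y'" "i \<in> {1..N} \<Longrightarrow> a - \<alpha> i \<in> ZPi_nonneg N \<Longrightarrow>
          \<exists>p\<in>Iat (a - \<alpha> i). \<exists>z\<in>Iat (a - \<alpha> i). gE i * y - y * gE i \<approx> p * gK (\<alpha> i) + z * gL (\<alpha> i)" for i
        using y iff[OF Iat_A[OF y]] by blast+
      show "x + y \<in> Iat a"
        unfolding iff[OF Acar_closed(3)[OF Iat_A[OF x] Iat_A[OF y]]]
      proof (intro conjI ballI impI)
        show "\<exists>y'\<in>VFw N (- a). x + y \<approx> y'" using x'(1) y'(1) V(2) cong_add by blast
        fix i assume i: "i \<in> {1..N}" "a - \<alpha> i \<in> ZPi_nonneg N"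
        from x'(2)[OF this] obtain p z where pz: "p\<in>Iat (a - \<alpha> i)" "z\<in>Iat (a - \<alpha> i)"
          "gE i * x - x * gE i \<approx> p * gK (\<alpha> i) + z * gL (\<alpha> i)" by blast
        from y'(2)[OF i] obtain p' z' where pz': "p'\<in>Iat (a - \<alpha> i)" "z'\<in>Iat (a - \<alpha> i)"
          "gE i * y - y * gE i \<approx> p' * gK (\<alpha> i) + z' * gL (\<alpha> i)" by blast
        have "gE i * (x + y) - (x + y) * gE i \<approx> (p + p') * gK (\<alpha> i) + (z + z') * gL (\<alpha> i)"
          using cong_add[OF pz(3) pz'(3)] by (simp add: algebra_simps)
        thus "\<exists>p\<in>Iat (a - \<alpha> i). \<exists>z\<in>Iat (a - \<alpha> i). gE i * (x + y) - (x + y) * gE i \<approx> p * gK (\<alpha> i) + z * gL (\<alpha> i)"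
          using FA.subspace_add[OF IH[OF i]] pz(1,2) pz'(1,2) by blast
      qed
    qed
  qed
qed

lemma RI_Iat: "a \<in> ZPi_nonneg N \<Longrightarrow> x \<in> RI \<Longrightarrow> x \<in> Iat a"
  using Iat_cong[of 0 a x] FA.subspace_0[OF Iat_subspace] cong_sym[of x 0] by (simp add: cong_def)

lemma Jset_simps:
  "FA.subspace (Jset b)" "x \<in> RI \<Longrightarrow> x \<in> Jset b" "x \<in> Jset b \<Longrightarrow> x \<in> A"
  "b \<in> ZPi_nonneg N \<Longrightarrow> Jset b = Iat b"
  using Iat_subspace ideal_set_subspace[OF RI_ideal] RI_Iat Iat_A RI_A by (auto simp: Jset_def split: if_splits)

text \<open>The defining condition of \<open>Iat\<close> when \<open>\<alpha> i\<close> can be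
  subtracted, and plain commutation when no \<open>F_i\<close> occurs, merged into one statement by
  means of \<open>Jset\<close>.\<close>

lemma Iat_E_comm:
  assumes a: "a \<in> ZPi_nonneg N" and y: "y \<in> Iat a" and i: "i \<in> {1..N}"
  obtains p z where "p \<in> Jset (a - \<alpha> i)" "z \<in> Jset (a - \<alpha> i)" "gE i * y \<approx> y * gE i + p * gK (\<alpha> i) + z * gL (\<alpha> i)"
proof (cases "a - \<alpha> i \<in> ZPi_nonneg N")
  case True
  hence "a \<noteq> 0" using ZPi_nonneg_diff_iff[OF a i] by auto
  from Iat_iff[OF a this Iat_A[OF y]] y True i obtain p z where
    pz: "p \<in> Iat (a - \<alpha> i)" "z \<in> Iat (a - \<alpha> i)" "gE i * y - y * gE i \<approx> p * gK (\<alpha> i) + z * gL (\<alpha> i)" by blast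
  from cong_add[OF cong_refl[of "y * gE i"] pz(3)] show ?thesis
    using pz(1,2) True by (intro that[of p z]) (simp_all add: Jset_simps(4) add.assoc)
next
  case False
  obtain y' where y': "y' \<in> VFw N (- a)" "y \<approx> y'" using Iat_VFw[OF a y] .
  have "Poly_Mapping.lookup a i = 0" using ZPi_nonneg_diff_iff[OF a i] False by simp
  from E_commute_missing[OF y'(1) i this] have 1: "gE i * y' \<approx> y' * gE i" .
  have 2: "gE i * y \<approx> gE i * y'" "y' * gE i \<approx> y * gE i"
    using cong_mult_left[OF _ y'(2)] cong_mult_right[OF _ cong_sym[OF y'(2)]] i by auto
  have "gE i * y \<approx> y * gE i" by (rule cong_trans[OF cong_trans[OF 2(1) 1] 2(2)])
  thus ?thesis using Jset_simps(2) RI_closed(1) by (intro that[of 0 0]) auto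
qed

lemma Iat_K_move:
  assumes a: "a \<in> ZPi_nonneg N" and y: "y \<in> Iat a" and b: "b \<in> ZPi N"
  shows "gK b * y \<approx> sc (XX b (- a)) (y * gK b)" "gL b * y \<approx> sc (inverse (XX (- a) b)) (y * gL b)"
proof -
  obtain y' where y': "y' \<in> VFw N (- a)" "y \<approx> y'" using Iat_VFw[OF a y] .
  have w: "y' \<in> Aw N (- a)" using y'(1) VFw_Aw by blast
  have "g * y \<approx> sc c (y * g)" if g: "g \<in> A" "g * y' \<approx> sc c (y' * g)" for g c
    using cong_trans[OF cong_trans[OF cong_mult_left[OF g(1) y'(2)] g(2)] cong_sc[OF cong_mult_right[OF g(1) cong_sym[OF y'(2)]]]] .
  thus "gK b * y \<approx> sc (XX b (- a)) (y * gK b)" "gL b * y \<approx> sc (inverse (XX (- a) b)) (y * gL b)"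
    using K_move[OF w b] b by auto
qed

text \<open>Write \<open>[E_i, F_j y] = F_j [E_i, y] + [E_i, F_j] y\<close> and push torus elements
  to the right. The coefficients of \<open>K\<close> and \<open>L\<close> lie in the required
  subspaces by induction on the height, or are multiples of \<open>y\<close> itself when
  \<open>i = j\<close>. Left multiplication serves the left ideal property of \<open>D\<close>,
  right multiplication absorbs letters \<open>F_j\<close> arriving from the right.\<close>

lemma Iat_F_mult:
  assumes j: "j \<in> {1..N}" and a: "a \<in> ZPi_nonneg N"
  shows "y \<in> Iat a \<Longrightarrow> gF j * y \<in> Iat (a + \<alpha> j) \<and> y * gF j \<in> Iat (a + \<alpha> j)"
  using a
proof (induction a arbitrary: y rule: nonneg_height_induct)
  case (step a)
  note a = step(1) and IH = step(2) and y = step(3)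
  have yA: "y \<in> A" and FA: "gF j \<in> A" using Iat_A[OF y] j by auto
  let ?b = "a + \<alpha> j"
  have b: "?b \<in> ZPi_nonneg N" using a j by simp
  have "0 \<le> weight_height N a" by (rule weight_height_nonneg[OF a])
  hence "weight_height N ?b \<noteq> 0" using weight_height_simple[OF j] by (simp add: weight_height_add)
  hence b0: "?b \<noteq> 0" by (auto simp: weight_height_def)
  have FJ: "gF j * p \<in> Iat (?b - \<alpha> i)" "p * gF j \<in> Iat (?b - \<alpha> i)"
    if "i \<in> {1..N}" "?b - \<alpha> i \<in> ZPi_nonneg N" "p \<in> Jset (a - \<alpha> i)" for p i
  proof -
    have eq: "?b - \<alpha> i = a - \<alpha> i + \<alpha> j" by simp
    show "gF j * p \<in> Iat (?b - \<alpha> i)" "p * gF j \<in> Iat (?b - \<alpha> i)"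
      using that IH[of i p] RI_Iat[OF that(2)] RI_closed(5,6) FA unfolding eq Jset_def by (auto split: if_splits)
  qed
  obtain y' where y': "y' \<in> VFw N (- a)" "y \<approx> y'" using Iat_VFw[OF a y] .
  have Fw: "gF j \<in> VFw N (- \<alpha> j)" using gF_mult_VFw[OF j VF_1] by simp
  have 1: "\<exists>x\<in>VFw N (- ?b). gF j * y \<approx> x" "\<exists>x\<in>VFw N (- ?b). y * gF j \<approx> x"
    using VFw_mult[OF Fw y'(1)] VFw_mult[OF y'(1) Fw] cong_mult_left[OF FA y'(2)] cong_mult_right[OF FA y'(2)]
    by (auto simp: add.commute)
  have 2: "(\<exists>p\<in>Iat (?b - \<alpha> i). \<exists>z\<in>Iat (?b - \<alpha> i).
       gE i * (gF j * y) - gF j * y * gE i \<approx> p * gK (\<alpha> i) + z * gL (\<alpha> i)) \<and>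
     (\<exists>p\<in>Iat (?b - \<alpha> i). \<exists>z\<in>Iat (?b - \<alpha> i).
       gE i * (y * gF j) - y * gF j * gE i \<approx> p * gK (\<alpha> i) + z * gL (\<alpha> i))"
    if i: "i \<in> {1..N}" "?b - \<alpha> i \<in> ZPi_nonneg N" for i
  proof -
    obtain p z where pz: "p \<in> Jset (a - \<alpha> i)" "z \<in> Jset (a - \<alpha> i)"
       "gE i * y \<approx> y * gE i + p * gK (\<alpha> i) + z * gL (\<alpha> i)" using Iat_E_comm[OF a y i(1)] .
    have A: "p \<in> A" "z \<in> A" "gE i \<in> A" "gK (\<alpha> i) \<in> A" "gL (\<alpha> i) \<in> A" using pz Jset_simps(3) i by auto
    define d :: "'k walg" where "d = (if i = j then gL (\<alpha> i) - gK (\<alpha> i) else 0)"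
    have EF: "gE i * gF j \<approx> gF j * gE i + d" unfolding d_def by (rule rel_cong(10)[OF i(1) j])
    note sub = FA.subspace_add[OF Iat_subspace[OF i(2)]] FA.subspace_diff[OF Iat_subspace[OF i(2)]]
       FA.subspace_scale[OF Iat_subspace[OF i(2)]]
    have yI: "i = j \<Longrightarrow> y \<in> Iat (?b - \<alpha> i)" using y by simp
    define cK where "cK = XX (\<alpha> i) (- a)"
    define cL where "cL = inverse (XX (- a) (\<alpha> i))"
    have yK: "gK (\<alpha> i) * y \<approx> sc cK (y * gK (\<alpha> i))" "gL (\<alpha> i) * y \<approx> sc cL (y * gL (\<alpha> i))"
      unfolding cK_def cL_def by (rule Iat_K_move[OF a y], use i in simp)+
    have "gE i * (gF j * y) - gF j * y * gE i = (gE i * gF j) * y - gF j * y * gE i" by (simp add: mult.assoc)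
    also have "\<dots> \<approx> (gF j * gE i + d) * y - gF j * y * gE i"
      by (rule cong_diff[OF cong_mult_right[OF yA EF] cong_refl])
    also have "\<dots> = gF j * (gE i * y) + d * y - gF j * y * gE i" by (simp add: algebra_simps)
    also have "\<dots> \<approx> gF j * (y * gE i + p * gK (\<alpha> i) + z * gL (\<alpha> i)) + d * y - gF j * y * gE i"
      by (rule cong_diff[OF cong_add[OF cong_mult_left[OF FA pz(3)] cong_refl] cong_refl])
    also have "\<dots> = (gF j * p) * gK (\<alpha> i) + (gF j * z) * gL (\<alpha> i) + d * y" by (simp add: algebra_simps)
    also have "\<dots> \<approx> (gF j * p - (if i = j then sc cK y else 0)) * gK (\<alpha> i) + (gF j * z + (if i = j then sc cL y else 0)) * gL (\<alpha> i)"
    proof (cases "i = j")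
      case True
      have "d * y \<approx> sc cL (y * gL (\<alpha> i)) - sc cK (y * gK (\<alpha> i))"
        unfolding d_def using True cong_diff[OF yK(2,1)] by (simp add: left_diff_distrib)
      from cong_add[OF cong_refl[of "(gF j * p) * gK (\<alpha> i) + (gF j * z) * gL (\<alpha> i)"] this]
      show ?thesis using True by (simp add: algebra_simps sc_mult_left)
    qed (simp add: d_def)
    finally have left: "gE i * (gF j * y) - gF j * y * gE i \<approx> (gF j * p - (if i = j then sc cK y else 0)) * gK (\<alpha> i)
       + (gF j * z + (if i = j then sc cL y else 0)) * gL (\<alpha> i)" .
    have KF: "gK (\<alpha> i) * gF j \<approx> sc (inverse (XX (\<alpha> i) (\<alpha> j))) (gF j * gK (\<alpha> i))"
      "gL (\<alpha> i) * gF j \<approx> sc (XX (\<alpha> j) (\<alpha> i)) (gF j * gL (\<alpha> i))"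
      using rel_cong(8,9) i(1) j by auto
    define eK where "eK = inverse (XX (\<alpha> i) (\<alpha> j))"
    define eL where "eL = XX (\<alpha> j) (\<alpha> i)"
    have "gE i * (y * gF j) - y * gF j * gE i = (gE i * y) * gF j - y * (gF j * gE i)" by (simp add: mult.assoc)
    also have "\<dots> \<approx> (y * gE i + p * gK (\<alpha> i) + z * gL (\<alpha> i)) * gF j - y * (gE i * gF j - d)"
    proof -
      have "gF j * gE i \<approx> gE i * gF j - d"
        using cong_sym[OF cong_diff[OF EF cong_refl[of d]]] by simp
      thus ?thesis by (intro cong_diff cong_mult_right[OF FA pz(3)] cong_mult_left[OF yA])
    qed
    also have "\<dots> = p * (gK (\<alpha> i) * gF j) + z * (gL (\<alpha> i) * gF j) + y * d" by (simp add: algebra_simps)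
    also have "\<dots> \<approx> p * sc eK (gF j * gK (\<alpha> i)) + z * sc eL (gF j * gL (\<alpha> i)) + y * d"
      unfolding eK_def eL_def
      by (intro cong_add cong_refl cong_mult_left[OF A(1) KF(1)] cong_mult_left[OF A(2) KF(2)])
    also have "\<dots> = (sc eK (p * gF j) - (if i = j then y else 0)) * gK (\<alpha> i)
       + (sc eL (z * gF j) + (if i = j then y else 0)) * gL (\<alpha> i)"
      by (simp add: d_def sc_mult_left sc_mult_right algebra_simps)
    finally have right: "gE i * (y * gF j) - y * gF j * gE i \<approx> (sc eK (p * gF j) - (if i = j then y else 0)) * gK (\<alpha> i)
       + (sc eL (z * gF j) + (if i = j then y else 0)) * gL (\<alpha> i)" .
    have "gF j * p - (if i = j then sc cK y else 0) \<in> Iat (?b - \<alpha> i)" "gF j * z + (if i = j then sc cL y else 0) \<in> Iat (?b - \<alpha> i)"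
      "sc eK (p * gF j) - (if i = j then y else 0) \<in> Iat (?b - \<alpha> i)" "sc eL (z * gF j) + (if i = j then y else 0) \<in> Iat (?b - \<alpha> i)"
      using FJ[OF i pz(1)] FJ[OF i pz(2)] sub yI by (auto split: if_split)
    thus ?thesis using left right by blast
  qed
  show ?case
    using 1 2 Iat_iff[OF b b0, of "gF j * y"] Iat_iff[OF b b0, of "y * gF j"] yA FA by auto
qed

lemma words_A [simp]: "w \<in> klwords N \<Longrightarrow> mon w \<in> A" "w \<in> ewords N \<Longrightarrow> mon w \<in> A"
  using klwords_words ewords_words by auto

text \<open>The scalar is nonzero, so torus words can be moved in either direction.\<close>

lemma klword_move:
  assumes "z \<in> klwords N"
    and gens: "\<And>b. b \<in> ZPi N \<Longrightarrow> \<exists>d. d \<noteq> 0 \<and> gK b * y \<approx> sc d (y * gK b)"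
      "\<And>b. b \<in> ZPi N \<Longrightarrow> \<exists>d. d \<noteq> 0 \<and> gL b * y \<approx> sc d (y * gL b)"
  shows "\<exists>c. c \<noteq> 0 \<and> mon z * y \<approx> sc c (y * mon z)"
  using assms(1)
proof (induction rule: klwords_induct)
  case Nil
  show ?case by (intro exI[of _ 1]) (simp add: mon_Word_Nil)
next
  case (Cons g gs)
  then obtain c where c: "c \<noteq> 0" "mon (Word gs) * y \<approx> sc c (y * mon (Word gs))" by blast
  obtain d where d: "d \<noteq> 0" "gen g * y \<approx> sc d (y * gen g)" using Cons(1) gens by blast
  have A: "gen g \<in> A" "mon (Word gs) \<in> A" using Cons(1,2) by auto
  have "mon (Word (g # gs)) * y = gen g * (mon (Word gs) * y)"
    by (simp only: mon_Word_Cons[of g gs] mult.assoc)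
  also have "\<dots> \<approx> gen g * sc c (y * mon (Word gs))" by (rule cong_mult_left[OF A(1) c(2)])
  also have "\<dots> = sc c ((gen g * y) * mon (Word gs))" by (simp add: sc_mult_right mult.assoc)
  also have "\<dots> \<approx> sc c (sc d (y * gen g) * mon (Word gs))" by (rule cong_sc[OF cong_mult_right[OF A(2) d(2)]])
  also have "\<dots> = sc (c * d) (y * mon (Word (g # gs)))"
    by (simp add: mon_Word_Cons[of g gs] sc_mult_left mult.assoc)
  finally show ?case using c d by (intro exI[of _ "c * d"]) auto
qed

lemma klword_E:
  assumes "z \<in> klwords N" "i \<in> {1..N}"
  shows "\<exists>c. c \<noteq> 0 \<and> mon z * gE i \<approx> sc c (gE i * mon z)"
  by (rule klword_move[OF assms(1)])
    (meson rel_cong(6,7) X_nz assms(2) inverse_nonzero_iff_nonzero)+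

lemma klword_F:
  assumes "z \<in> klwords N" "i \<in> {1..N}"
  shows "\<exists>c. c \<noteq> 0 \<and> mon z * gF i \<approx> sc c (gF i * mon z)"
  by (rule klword_move[OF assms(1)])
    (meson rel_cong(8,9) X_nz assms(2) inverse_nonzero_iff_nonzero)+

lemma klword_Iat:
  assumes "z \<in> klwords N" "a \<in> ZPi_nonneg N" "y \<in> Iat a"
  shows "\<exists>c. c \<noteq> 0 \<and> mon z * y \<approx> sc c (y * mon z)"
  by (rule klword_move[OF assms(1)])
    (meson Iat_K_move[OF assms(2,3)] X_nz inverse_nonzero_iff_nonzero)+

text \<open>Representatives of the factor \<open>U^0 U^+\<close> in the definition of
  \<open>tJ_minus\<close>. Its stability under torus words and under \<open>E_i\<close> is what
  makes the span \<open>D\<close> an ideal.\<close>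

definition UU :: "'k walg set" where "UU = FA.span {mon z * mon p |z p. z \<in> klwords N \<and> p \<in> ewords N}"

text \<open>The preimage of \<open>tJ_minus\<close> in the free algebra; \<open>RU\<close> and \<open>SV\<close> below are those of \<open>U_ideal\<close> and \<open>Verma_ideal\<close>.\<close>

definition D :: "'k walg set" where
  "D = FA.span {y * (mon z * mon p) |a y z p. a \<in> ZPi_nonneg N \<and> y \<in> Iat a \<and> z \<in> klwords N \<and> p \<in> ewords N}"

lemma D_subspace: "FA.subspace D" by (simp add: D_def FA.subspace_span)

lemma D_base: "a \<in> ZPi_nonneg N \<Longrightarrow> y \<in> Iat a \<Longrightarrow> z \<in> klwords N \<Longrightarrow> p \<in> ewords N \<Longrightarrow> y * (mon z * mon p) \<in> D"
  unfolding D_def by (rule FA.span_base) blast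

lemma D_base_UU: assumes "a \<in> ZPi_nonneg N" "y \<in> Iat a" "u \<in> UU" shows "y * u \<in> D"
  using assms(3) unfolding UU_def
proof (induction rule: FA.span_induct_alt)
  case base
  show ?case using FA.subspace_0[OF D_subspace] by simp
next
  case (step c u v)
  thus ?case using D_base[OF assms(1,2)] FA.subspace_add[OF D_subspace] FA.subspace_scale[OF D_subspace]
    by (auto simp: distrib_left sc_mult_right)
qed

lemma D_A: "x \<in> D \<Longrightarrow> x \<in> A"
proof -
  have "D \<subseteq> A" unfolding D_def by (rule FA.span_minimal[OF _ Acar_subspace]) (auto dest: Iat_A)
  thus "x \<in> D \<Longrightarrow> x \<in> A" by blast
qed

lemma RI_D: "x \<in> RI \<Longrightarrow> x \<in> D"
  using D_base[of 0 x 0 0] Iat_0 by simp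

lemma D_cong: "x \<approx> y \<Longrightarrow> y \<in> D \<Longrightarrow> x \<in> D"
  using FA.subspace_add[OF D_subspace RI_D, of "x - y" y] by (simp add: cong_def)

lemma UU_A: "x \<in> UU \<Longrightarrow> x \<in> A"
proof -
  have "UU \<subseteq> A" unfolding UU_def by (rule FA.span_minimal[OF _ Acar_subspace]) auto
  thus "x \<in> UU \<Longrightarrow> x \<in> A" by blast
qed

lemma UU_base: "z \<in> klwords N \<Longrightarrow> p \<in> ewords N \<Longrightarrow> mon z * mon p \<in> UU"
  unfolding UU_def by (rule FA.span_base) blast

lemma UU_subspace: "FA.subspace UU" by (simp add: UU_def FA.subspace_span)

lemma UU_word: "z \<in> klwords N \<Longrightarrow> u \<in> UU \<Longrightarrow> mon z * u \<in> UU"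
proof -
  assume z: "z \<in> klwords N" and "u \<in> UU"
  from this(2) show ?thesis
    unfolding UU_def
  proof (induction rule: FA.span_induct_alt)
    case base
    show ?case by (simp add: FA.span_zero)
  next
    case (step c u v)
    then obtain z' p where u: "z' \<in> klwords N" "p \<in> ewords N" "u = mon z' * mon p" by blast
    have "mon z * u = mon (z + z') * mon p" using u by (simp add: mon_mult add.assoc)
    hence "mon z * u \<in> UU" using u z by (simp add: UU_base del: mult_single)
    thus ?case using step by (simp add: distrib_left sc_mult_right UU_def FA.span_add FA.span_scale)
  qed
qed

lemma E_UU: assumes i: "i \<in> {1..N}" and u: "u \<in> UU" shows "\<exists>u'\<in>UU. gE i * u \<approx> u'"
  using u unfolding UU_def
proof (induction rule: FA.span_induct_alt)
  case base
  show ?case by (intro bexI[of _ 0]) (auto simp: FA.span_zero)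
next
  case (step c u v)
  then obtain z p where u: "z \<in> klwords N" "p \<in> ewords N" "u = mon z * mon p" by blast
  obtain d where d: "d \<noteq> 0" "mon z * gE i \<approx> sc d (gE i * mon z)" using klword_E[OF u(1) i] by blast
  have "gE i * mon z \<approx> sc (inverse d) (mon z * gE i)"
    using cong_sc[OF cong_sym[OF d(2)], of "inverse d"] d(1) by simp
  from cong_mult_right[OF words_A(2)[OF u(2)] this]
  have "gE i * u \<approx> sc (inverse d) (mon z * (gE i * mon p))" by (simp only: u(3) sc_mult_left mult.assoc)
  moreover have "gE i * mon p \<in> mon ` ewords N"
    using ewords_Cons[OF i, of "letters p"] u(2) by (cases p) (auto simp: mult_single plus_word_def)
  ultimately obtain p' where p': "p' \<in> ewords N" "gE i * u \<approx> sc (inverse d) (mon z * mon p')" by auto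
  from step obtain v' where v': "v' \<in> FA.span {mon z * mon p |z p. z \<in> klwords N \<and> p \<in> ewords N}" "gE i * v \<approx> v'" by blast
  have "gE i * (sc c u + v) \<approx> sc c (sc (inverse d) (mon z * mon p')) + v'"
    using cong_add[OF cong_sc[OF p'(2)] v'(2)] by (simp only: distrib_left sc_mult_right)
  moreover have "sc c (sc (inverse d) (mon z * mon p')) + v' \<in> FA.span {mon z * mon p |z p. z \<in> klwords N \<and> p \<in> ewords N}"
    using v'(1) UU_base[OF u(1) p'(1)] unfolding UU_def by (intro FA.span_add FA.span_scale)
  ultimately show ?case by blast
qed

text \<open>Commuting \<open>F_j\<close> to the left through a raising word leaves torus elements
  between raising letters; \<open>E_UU\<close> sorts these into \<open>UU\<close>.\<close>

lemma eword_F: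
  assumes "p \<in> ewords N" and j: "j \<in> {1..N}"
  shows "\<exists>u\<in>UU. mon p * gF j \<approx> gF j * mon p + u"
  using assms(1)
proof (induction rule: ewords_induct)
  case Nil
  show ?case by (intro bexI[of _ 0]) (auto simp: mon_Word_Nil FA.subspace_0[OF UU_subspace])
next
  case (Cons i gs)
  then obtain u where u: "u \<in> UU" "mon (Word gs) * gF j \<approx> gF j * mon (Word gs) + u" by blast
  obtain u' where u': "u' \<in> UU" "gE i * u \<approx> u'" using E_UU[OF Cons(1) u(1)] by blast
  define d :: "'k walg" where "d = (if i = j then gL (\<alpha> i) - gK (\<alpha> i) else 0)"
  have dU: "d * mon (Word gs) \<in> UU"
    using UU_base[of "Word [GenL (\<alpha> i)]" "Word gs"] UU_base[of "Word [GenK (\<alpha> i)]" "Word gs"] Cons(1,2)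
      FA.subspace_diff[OF UU_subspace] FA.subspace_0[OF UU_subspace]
    by (auto simp: d_def left_diff_distrib)
  have A: "gE i \<in> A" "mon (Word gs) \<in> A" using Cons(1,2) by auto
  have "mon (Word (GenE i # gs)) * gF j = gE i * (mon (Word gs) * gF j)"
    by (simp only: mon_Word_Cons[of "GenE i" gs] mult.assoc)
  also have "\<dots> \<approx> gE i * (gF j * mon (Word gs) + u)" by (rule cong_mult_left[OF A(1) u(2)])
  also have "\<dots> = (gE i * gF j) * mon (Word gs) + gE i * u" by (simp only: distrib_left mult.assoc)
  also have "\<dots> \<approx> (gF j * gE i + d) * mon (Word gs) + u'"
    unfolding d_def by (rule cong_add[OF cong_mult_right[OF A(2) rel_cong(10)[OF Cons(1) j]] u'(2)])
  also have "\<dots> = gF j * mon (Word (GenE i # gs)) + (d * mon (Word gs) + u')"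
    by (simp only: mon_Word_Cons[of "GenE i" gs] distrib_right mult.assoc add.assoc)
  finally show ?case using FA.subspace_add[OF UU_subspace dU u'(1)] by blast
qed

lemma D_linear:
  assumes "\<And>x y. f (x + y) = f x + f y" "\<And>c x. f (sc c x) = sc c (f x)" "FA.subspace S"
    and "\<And>a y z p. a \<in> ZPi_nonneg N \<Longrightarrow> y \<in> Iat a \<Longrightarrow> z \<in> klwords N \<Longrightarrow> p \<in> ewords N \<Longrightarrow> f (y * (mon z * mon p)) \<in> S"
    and "x \<in> D"
  shows "f x \<in> S"
  using assms(5) unfolding D_def
proof (induction rule: FA.span_induct_alt)
  case base
  show ?case using assms(2)[of 0 0] FA.subspace_0[OF assms(3)] by simp
next
  case (step c x y)
  thus ?case using assms(4) FA.subspace_add[OF assms(3)] FA.subspace_scale[OF assms(3)]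
    by (auto simp: assms(1,2))
qed

lemma Jset_UU: assumes "p \<in> Jset b" "u \<in> UU" shows "p * u \<in> D"
proof (cases "b \<in> ZPi_nonneg N")
  case True
  thus ?thesis using assms D_base_UU by (simp add: Jset_def)
next
  case False
  thus ?thesis using assms RI_D RI_closed(6) UU_A by (simp add: Jset_def)
qed

text \<open>From the left, torus words rescale, \<open>F_j\<close> is absorbed by
  \<open>Iat_F_mult\<close>, and \<open>E_i\<close> is moved past \<open>y\<close> by
  \<open>Iat_E_comm\<close>. From the right, torus words move past the raising word,
  \<open>E_i\<close> prolongs it, and \<open>F_j\<close> is moved left until it meets
  \<open>y\<close> and is absorbed there.\<close>

lemma D_ideal: "ideal_set A D"
proof (rule ideal_set_generators[OF D_subspace])
  show "D \<subseteq> A" using D_A by blast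
next
  fix g s assume g: "g \<in> generators N" and s: "s \<in> D"
  have "gen g * (y * (mon z * mon p)) \<in> D"
    if a: "a \<in> ZPi_nonneg N" and y: "y \<in> Iat a" and z: "z \<in> klwords N" and p: "p \<in> ewords N" for a y z p
  proof -
    have U: "mon z * mon p \<in> UU" by (rule UU_base[OF z p])
    have KL: "gen g * (y * (mon z * mon p)) \<in> D" if w: "w \<in> klwords N" "(gen g :: 'k walg) = mon w" for w
    proof -
      obtain c where "mon w * y \<approx> sc c (y * mon w)" using klword_Iat[OF w(1) a y] by blast
      from cong_mult_right[OF UU_A[OF U] this]
      have "gen g * (y * (mon z * mon p)) \<approx> sc c (y * (mon w * (mon z * mon p)))"
        by (simp only: w(2) sc_mult_left mult.assoc)
      moreover have "y * (mon w * (mon z * mon p)) \<in> D" by (rule D_base_UU[OF a y UU_word[OF w(1) U]])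
      ultimately show ?thesis using D_cong FA.subspace_scale[OF D_subspace] by blast
    qed
    show ?thesis
    proof (cases g)
      case (GenK b)
      thus ?thesis using KL[of "Word [g]"] g by auto
    next
      case (GenL b)
      thus ?thesis using KL[of "Word [g]"] g by auto
    next
      case (GenF j)
      hence j: "j \<in> {1..N}" using g by auto
      have "gF j * y * (mon z * mon p) \<in> D"
        by (rule D_base[OF _ _ z p, of "a + \<alpha> j"]) (use Iat_F_mult[OF j a y] a j in auto)
      thus ?thesis using GenF by (simp only: mult.assoc)
    next
      case (GenE i)
      hence i: "i \<in> {1..N}" using g by auto
      obtain q r where qr: "q \<in> Jset (a - \<alpha> i)" "r \<in> Jset (a - \<alpha> i)"
        "gE i * y \<approx> y * gE i + q * gK (\<alpha> i) + r * gL (\<alpha> i)" using Iat_E_comm[OF a y i] .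
      obtain u where u: "u \<in> UU" "gE i * (mon z * mon p) \<approx> u" using E_UU[OF i U] by blast
      have w: "Word [GenK (\<alpha> i)] \<in> klwords N" "Word [GenL (\<alpha> i)] \<in> klwords N" using i by simp_all
      have "gE i * (y * (mon z * mon p)) = (gE i * y) * (mon z * mon p)" by (simp only: mult.assoc)
      also have "\<dots> \<approx> (y * gE i + q * gK (\<alpha> i) + r * gL (\<alpha> i)) * (mon z * mon p)"
        by (rule cong_mult_right[OF UU_A[OF U] qr(3)])
      also have "\<dots> = y * (gE i * (mon z * mon p)) + q * (gK (\<alpha> i) * (mon z * mon p)) + r * (gL (\<alpha> i) * (mon z * mon p))"
        by (simp only: distrib_right mult.assoc)
      also have "\<dots> \<approx> y * u + q * (gK (\<alpha> i) * (mon z * mon p)) + r * (gL (\<alpha> i) * (mon z * mon p))"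
        by (intro cong_add cong_refl cong_mult_left[OF Iat_A[OF y] u(2)])
      finally have 1: "gE i * (y * (mon z * mon p)) \<approx> y * u + q * (gK (\<alpha> i) * (mon z * mon p)) + r * (gL (\<alpha> i) * (mon z * mon p))" .
      have "y * u + q * (gK (\<alpha> i) * (mon z * mon p)) + r * (gL (\<alpha> i) * (mon z * mon p)) \<in> D"
        by (intro FA.subspace_add[OF D_subspace] D_base_UU[OF a y u(1)] Jset_UU[OF qr(1) UU_word[OF w(1) U]]
          Jset_UU[OF qr(2) UU_word[OF w(2) U]])
      from D_cong[OF 1 this] show ?thesis by (simp only: GenE)
    qed
  qed
  thus "gen g * s \<in> D"
    by (intro D_linear[where f = "\<lambda>s. gen g * s", OF _ _ D_subspace _ s]) (auto simp: distrib_left sc_mult_right)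
next
  fix g s assume g: "g \<in> generators N" and s: "s \<in> D"
  have "(y * (mon z * mon p)) * gen g \<in> D"
    if a: "a \<in> ZPi_nonneg N" and y: "y \<in> Iat a" and z: "z \<in> klwords N" and p: "p \<in> ewords N" for a y z p
  proof -
    have yzA: "y * mon z \<in> A" using Iat_A[OF y] z by simp
    have KL: "(y * (mon z * mon p)) * gen g \<in> D"
      if "w \<in> klwords N" "(gen g :: 'k walg) = mon w" "gen g * mon p \<approx> sc c (mon p * gen g)" "c \<noteq> 0" for w c
    proof -
      have "mon p * gen g \<approx> sc (inverse c) (gen g * mon p)"
        using cong_sc[OF cong_sym[OF that(3)], of "inverse c"] that(4) by simp
      from cong_mult_left[OF yzA this]
      have 1: "(y * (mon z * mon p)) * gen g \<approx> sc (inverse c) (y * (mon (z + w) * mon p))"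
        by (simp only: sc_mult_right mult.assoc that(2) mon_mult[symmetric])
      have "sc (inverse c) (y * (mon (z + w) * mon p)) \<in> D"
        by (intro FA.subspace_scale[OF D_subspace] D_base[OF a y _ p]) (use z that in auto)
      thus ?thesis by (rule D_cong[OF 1])
    qed
    show ?thesis
    proof (cases g)
      case (GenK b)
      hence b: "b \<in> ZPi N" using g by auto
      show ?thesis
        by (rule KL[of "Word [GenK b]"]) (use GenK b K_move_word(1)[OF ewords_words[OF p] b] X_nz in auto)
    next
      case (GenL b)
      hence b: "b \<in> ZPi N" using g by auto
      show ?thesis
        by (rule KL[of "Word [GenL b]"]) (use GenL b K_move_word(2)[OF ewords_words[OF p] b] X_nz in auto)
    next
      case (GenE i)
      hence i: "Word [GenE i] \<in> ewords N" using g by (auto intro!: ewords_Cons)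
      have "y * (mon z * mon (p + Word [GenE i])) \<in> D" by (rule D_base[OF a y z ewords_plus[OF p i]])
      thus ?thesis using GenE by (simp only: mon_mult[symmetric] mult.assoc)
    next
      case (GenF j)
      hence j: "j \<in> {1..N}" using g by auto
      obtain u where u: "u \<in> UU" "mon p * gF j \<approx> gF j * mon p + u" using eword_F[OF p j] by blast
      obtain c where c: "mon z * gF j \<approx> sc c (gF j * mon z)" using klword_F[OF z j] by blast
      have "y * mon z * (mon p * gF j) \<approx> y * mon z * (gF j * mon p + u)" by (rule cong_mult_left[OF yzA u(2)])
      also have "\<dots> = y * ((mon z * gF j) * mon p) + y * (mon z * u)" by (simp only: distrib_left mult.assoc)
      also have "\<dots> \<approx> y * (sc c (gF j * mon z) * mon p) + y * (mon z * u)"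
        by (intro cong_add cong_refl cong_mult_left[OF Iat_A[OF y]] cong_mult_right[OF words_A(2)[OF p] c])
      also have "\<dots> = sc c ((y * gF j) * (mon z * mon p)) + y * (mon z * u)"
        by (simp only: sc_mult_left sc_mult_right mult.assoc)
      finally have 1: "y * mon z * (mon p * gF j) \<approx> sc c ((y * gF j) * (mon z * mon p)) + y * (mon z * u)" .
      have "(y * gF j) * (mon z * mon p) \<in> D"
        by (rule D_base[OF _ _ z p, of "a + \<alpha> j"]) (use Iat_F_mult[OF j a y] a j in auto)
      moreover have "y * (mon z * u) \<in> D" by (rule D_base_UU[OF a y UU_word[OF z u(1)]])
      ultimately have "sc c ((y * gF j) * (mon z * mon p)) + y * (mon z * u) \<in> D"
        by (intro FA.subspace_add[OF D_subspace] FA.subspace_scale[OF D_subspace])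
      from D_cong[OF 1 this] show ?thesis using GenF by (simp only: mult.assoc)
    qed
  qed
  thus "s * gen g \<in> D"
    by (intro D_linear[where f = "\<lambda>s. s * gen g", OF _ _ D_subspace _ s]) (auto simp: distrib_right sc_mult_left)
qed

lemma tI_minus_eq: "tI_minus N \<chi> = tc ` FA.span (\<Union>a\<in>ZPi_nonneg N. Iat a)"
proof -
  have "{Y. \<exists>a \<in> ZPi_nonneg N. tI_minus_at N \<chi> a Y} = tc ` (\<Union>a\<in>ZPi_nonneg N. Iat a)"
  proof (intro equalityI subsetI)
    fix Y assume "Y \<in> {Y. \<exists>a \<in> ZPi_nonneg N. tI_minus_at N \<chi> a Y}"
    then obtain a where a: "a \<in> ZPi_nonneg N" "tI_minus_at N \<chi> a Y" by blast
    obtain y where "y \<in> Iat a" "Y = tc y" using tI_minus_at_class a(2) .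
    thus "Y \<in> tc ` (\<Union>a\<in>ZPi_nonneg N. Iat a)" using a by blast
  qed (auto simp: Iat_def)
  moreover have "(\<Union>a\<in>ZPi_nonneg N. Iat a) \<subseteq> A" using Iat_A by blast
  ultimately show ?thesis using kspan_image[OF presents_space_tU, of "\<Union>a\<in>ZPi_nonneg N. Iat a"]
    by (simp add: tI_minus_def)
qed

lemma tJ_minus_eq: "tJ_minus N \<chi> = tc ` D"
proof -
  let ?I = "FA.span (\<Union>a\<in>ZPi_nonneg N. Iat a)"
  define S where "S = {y * z * p |y z p. y \<in> ?I \<and> z \<in> Uzero \<and> p \<in> Uplus}"
  have IA: "?I \<subseteq> A" using FA.span_minimal[OF _ Acar_subspace, of "\<Union>a\<in>ZPi_nonneg N. Iat a" N] Iat_A by blast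
  have ZA: "Uzero \<subseteq> A" and PA: "Uplus \<subseteq> A" by (rule span_words_A, use klwords_words ewords_words in blast)+
  have SA: "S \<subseteq> A" using subsetD[OF IA] subsetD[OF ZA] subsetD[OF PA] by (auto simp: S_def)
  have "{Y \<otimes>\<^bsub>T\<^esub> Z \<otimes>\<^bsub>T\<^esub> P |Y Z P. Y \<in> tI_minus N \<chi> \<and> Z \<in> tU_zero N \<chi> \<and> P \<in> tU_plus N \<chi>} = tc ` S"
  proof (intro equalityI subsetI)
    fix W assume "W \<in> {Y \<otimes>\<^bsub>T\<^esub> Z \<otimes>\<^bsub>T\<^esub> P |Y Z P. Y \<in> tI_minus N \<chi> \<and> Z \<in> tU_zero N \<chi> \<and> P \<in> tU_plus N \<chi>}"
    then obtain y z p where yzp: "y \<in> ?I" "z \<in> Uzero" "p \<in> Uplus" "W = tc y \<otimes>\<^bsub>T\<^esub> tc z \<otimes>\<^bsub>T\<^esub> tc p"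
      by (auto simp: tI_minus_eq tU_zero_eq tU_plus_eq)
    have "W = tc (y * z * p)" using yzp subsetD[OF IA] subsetD[OF ZA] subsetD[OF PA] by (auto simp: tU_ring(3))
    thus "W \<in> tc ` S" using yzp by (auto simp: S_def)
  next
    fix W assume "W \<in> tc ` S"
    then obtain y z p where yzp: "y \<in> ?I" "z \<in> Uzero" "p \<in> Uplus" "W = tc (y * z * p)" by (auto simp: S_def)
    have "W = tc y \<otimes>\<^bsub>T\<^esub> tc z \<otimes>\<^bsub>T\<^esub> tc p" using yzp subsetD[OF IA] subsetD[OF ZA] subsetD[OF PA] by (auto simp: tU_ring(3))
    thus "W \<in> {Y \<otimes>\<^bsub>T\<^esub> Z \<otimes>\<^bsub>T\<^esub> P |Y Z P. Y \<in> tI_minus N \<chi> \<and> Z \<in> tU_zero N \<chi> \<and> P \<in> tU_plus N \<chi>}"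
      using yzp by (auto simp: tI_minus_eq tU_zero_eq tU_plus_eq)
  qed
  hence "tJ_minus N \<chi> = tc ` FA.span S"
    using kspan_image[OF presents_space_tU SA] by (simp add: tJ_minus_def)
  moreover have "FA.span S = D"
  proof
    have "y * z * p \<in> D" if "y \<in> ?I" "z \<in> Uzero" "p \<in> Uplus" for y z p
    proof -
      have 1: "y * (mon z * mon p) \<in> D" if "y \<in> ?I" "z \<in> klwords N" "p \<in> ewords N" for y z p
        using that(1)
      proof (induction rule: FA.span_induct_alt)
        case base
        show ?case using FA.subspace_0[OF D_subspace] by simp
      next
        case (step c x y)
        thus ?case using D_base[OF _ _ that(2,3)] FA.subspace_add[OF D_subspace] FA.subspace_scale[OF D_subspace]
          by (auto simp: distrib_right sc_mult_left)
      qed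
      have 2: "y * (mon z * p) \<in> D" if "z \<in> klwords N" for z
        by (rule span_linear_mem[where f = "\<lambda>p. y * (mon z * p)", OF _ _ _ D_subspace \<open>p \<in> Uplus\<close>])
          (use 1[OF \<open>y \<in> ?I\<close> that] in \<open>auto simp: distrib_left sc_mult_right\<close>)
      have "y * (z * p) \<in> D"
        by (rule span_linear_mem[where f = "\<lambda>z. y * (z * p)", OF _ _ _ D_subspace \<open>z \<in> Uzero\<close>])
          (use 2 in \<open>auto simp: distrib_left distrib_right sc_mult_right sc_mult_left\<close>)
      thus ?thesis by (simp only: mult.assoc)
    qed
    thus "FA.span S \<subseteq> D" by (intro FA.span_minimal[OF _ D_subspace]) (auto simp: S_def)
    show "D \<subseteq> FA.span S" unfolding D_def
    proof (rule FA.span_mono, clarify)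
      fix a y z p assume *: "a \<in> ZPi_nonneg N" "y \<in> Iat a" "z \<in> klwords N" "p \<in> ewords N"
      have "y \<in> ?I" "mon z \<in> Uzero" "mon p \<in> Uplus" using * by (auto intro!: FA.span_base)
      thus "y * (mon z * mon p) \<in> S" unfolding S_def by (simp only: mult.assoc[symmetric]) blast
    qed
  qed
  ultimately show ?thesis by simp
qed

end

subsection \<open>The automorphism and the quotient\<close>

text \<open>The unital endomorphism of the free algebra with prescribed values on letters.\<close>

definition word_hom :: "(generator \<Rightarrow> 'k::field_char_0 walg) \<Rightarrow> 'k walg \<Rightarrow> 'k walg" where
  "word_hom f = lin (\<lambda>w. prod_list (map f (letters w)))"

lemma word_hom_simps:
  "word_hom f (x + y) = word_hom f x + word_hom f y" "word_hom f (x - y) = word_hom f x - word_hom f y"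
  "word_hom f (sc c x) = sc c (word_hom f x)" "word_hom f (gen g) = f g" "word_hom f 1 = 1" "word_hom f 0 = 0"
proof -
  show "word_hom f 1 = 1"
    unfolding word_hom_def mon_0[symmetric] lin_mon by (simp add: zero_word_def mon_Word_Nil)
qed (simp_all add: word_hom_def lin_add lin_diff lin_sc)

lemma word_hom_mult: "word_hom f (x * y) = word_hom f x * word_hom f y"
proof -
  have UNIV: "z \<in> FA.span (mon ` UNIV)" for z :: "'a walg" by (simp add: span_mon)
  have 1: "word_hom f (mon w * y) = word_hom f (mon w) * word_hom f y" for w
    by (rule span_linear_eq[where f = "\<lambda>y. word_hom f (mon w * y)" and g = "\<lambda>y. word_hom f (mon w) * word_hom f y", OF _ _ _ _ _ UNIV])
      (simp_all add: distrib_left sc_mult_right word_hom_simps mon_mult, simp add: word_hom_def plus_word_def)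
  show ?thesis
    by (rule span_linear_eq[where f = "\<lambda>x. word_hom f (x * y)" and g = "\<lambda>x. word_hom f x * word_hom f y", OF _ _ _ _ _ UNIV])
      (simp_all add: distrib_right sc_mult_left word_hom_simps(1,3) 1)
qed

lemma word_hom_Acar:
  fixes f :: "generator \<Rightarrow> 'k::field_char_0 walg"
  assumes "\<And>g. g \<in> generators N \<Longrightarrow> f g \<in> Acar N" "x \<in> Acar N"
  shows "word_hom f x \<in> Acar N"
proof -
  have "set gs \<subseteq> generators N \<Longrightarrow> prod_list (map f gs) \<in> Acar N" for gs
    by (induction gs) (simp_all add: assms(1) del: generators.simps)
  hence w: "word_hom f (mon w) \<in> Acar N" if "w \<in> words N" for w
    using that by (simp add: word_hom_def words_def)
  show ?thesis
    using assms(2) unfolding Acar_span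
    by (rule span_linear_mem[where f = "word_hom f", OF word_hom_simps(1,3) _ FA.subspace_span, rotated])
      (use w in \<open>simp add: Acar_span\<close>)
qed

context quantum_group
begin

lemma word_hom_cong_id:
  assumes "x \<in> A" "\<And>g. g \<in> generators N \<Longrightarrow> word_hom f (gen g) \<approx> gen g" "\<And>g. g \<in> generators N \<Longrightarrow> f g \<in> A"
  shows "word_hom f x \<approx> x"
proof -
  have "set gs \<subseteq> generators N \<Longrightarrow> word_hom f (mon (Word gs)) \<approx> mon (Word gs)" for gs
  proof (induction gs)
    case Nil
    show ?case by (simp add: mon_Word_Nil word_hom_simps)
  next
    case (Cons g gs)
    hence g: "g \<in> generators N" "Word gs \<in> words N" by (auto simp: words_def simp del: generators.simps)
    have "word_hom f (mon (Word (g # gs))) = word_hom f (gen g) * word_hom f (mon (Word gs))"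
      unfolding mon_Word_Cons[of g gs] by (rule word_hom_mult)
    also have "\<dots> \<approx> gen g * mon (Word gs)"
      by (rule cong_mult[OF assms(2)[OF g(1)] Cons.IH])
        (use Cons.prems g word_hom_Acar[OF assms(3)] in \<open>auto simp del: generators.simps\<close>)
    finally show ?case unfolding mon_Word_Cons[of g gs] .
  qed
  hence "word_hom f (mon w) \<approx> mon w" if "w \<in> words N" for w
    using that by (cases w) (simp add: words_def)
  from cong_linear[where f = "word_hom f" and g = "\<lambda>x. x", OF word_hom_simps(1,3) refl refl this] assms(1) show ?thesis
    by (simp add: Acar_span)
qed

lemma gK_inverse: "a \<in> ZPi N \<Longrightarrow> gK a * gK (- a) \<approx> 1" "a \<in> ZPi N \<Longrightarrow> gK (- a) * gK a \<approx> 1"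
  "a \<in> ZPi N \<Longrightarrow> gL a * gL (- a) \<approx> 1" "a \<in> ZPi N \<Longrightarrow> gL (- a) * gL a \<approx> 1"
  using cong_trans[OF rel_cong(3)[of a "- a"]] cong_trans[OF rel_cong(3)[of "- a" a]]
    cong_trans[OF rel_cong(4)[of a "- a"]] cong_trans[OF rel_cong(4)[of "- a" a]] rel_cong(1,2) by auto

text \<open>A conjugated form of the \<open>EF\<close> relation. For \<open>i = j\<close> the torus
  factors cancel: \<open>K_{-a} (L_a - K_a) L_{-a} = K_{-a} - L_{-a}\<close>. The indices
  \<open>k\<close> and \<open>l\<close> are left open because the automorphism and its inverse use
  them in opposite order.\<close>

lemma EF_conj:
  assumes i: "i \<in> {1..N}" and j: "j \<in> {1..N}" and k: "k \<in> {1..N}" and l: "l \<in> {1..N}" and eq: "i = j \<Longrightarrow> k = i \<and> l = i"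
  shows "gK (- \<alpha> k) * (gF i * gE j) * gL (- \<alpha> l) \<approx>
    gK (- \<alpha> k) * (gE j * gF i) * gL (- \<alpha> l) + (if i = j then gL (- \<alpha> i) - gK (- \<alpha> i) else 0)"
proof -
  have A: "gK (- \<alpha> k) \<in> A" "gL (- \<alpha> l) \<in> A" using k l by simp_all
  define d :: "'k walg" where "d = (if j = i then gL (\<alpha> j) - gK (\<alpha> j) else 0)"
  have 1: "gK (- \<alpha> k) * (gE j * gF i) * gL (- \<alpha> l) \<approx> gK (- \<alpha> k) * (gF i * gE j + d) * gL (- \<alpha> l)"
    unfolding d_def by (rule cong_mult_right[OF A(2) cong_mult_left[OF A(1) rel_cong(10)[OF j i]]])
  have 2: "gK (- \<alpha> k) * d * gL (- \<alpha> l) \<approx> - (if i = j then gL (- \<alpha> i) - gK (- \<alpha> i) else 0)"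
  proof (cases "i = j")
    case True
    hence kl: "k = i" "l = i" using eq by auto
    have B: "gK (- \<alpha> i) \<in> A" "gL (- \<alpha> i) \<in> A" "gL (\<alpha> i) \<in> A" using i by simp_all
    have "gK (- \<alpha> i) * (gL (\<alpha> i) * gL (- \<alpha> i)) - (gK (- \<alpha> i) * gK (\<alpha> i)) * gL (- \<alpha> i) \<approx>
      gK (- \<alpha> i) * 1 - 1 * gL (- \<alpha> i)"
      by (rule cong_diff[OF cong_mult_left[OF B(1) gK_inverse(3)] cong_mult_right[OF B(2) gK_inverse(2)]]) (use i in simp_all)
    moreover have "gK (- \<alpha> k) * d * gL (- \<alpha> l) =
        gK (- \<alpha> i) * (gL (\<alpha> i) * gL (- \<alpha> i)) - (gK (- \<alpha> i) * gK (\<alpha> i)) * gL (- \<alpha> i)"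
      by (simp only: kl d_def True simp_thms if_True left_diff_distrib right_diff_distrib mult.assoc)
    ultimately show ?thesis using True by simp
  next
    case False
    thus ?thesis by (simp add: d_def)
  qed
  have "gK (- \<alpha> k) * (gE j * gF i) * gL (- \<alpha> l) + (if i = j then gL (- \<alpha> i) - gK (- \<alpha> i) else 0) \<approx>
    (gK (- \<alpha> k) * (gF i * gE j) * gL (- \<alpha> l) + gK (- \<alpha> k) * d * gL (- \<alpha> l)) + (if i = j then gL (- \<alpha> i) - gK (- \<alpha> i) else 0)"
    using cong_add[OF 1 cong_refl] by (simp only: distrib_left distrib_right)
  also have "\<dots> \<approx> (gK (- \<alpha> k) * (gF i * gE j) * gL (- \<alpha> l) + - (if i = j then gL (- \<alpha> i) - gK (- \<alpha> i) else 0)) + (if i = j then gL (- \<alpha> i) - gK (- \<alpha> i) else 0)"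
    by (rule cong_add[OF cong_add[OF cong_refl 2] cong_refl])
  also have "\<dots> = gK (- \<alpha> k) * (gF i * gE j) * gL (- \<alpha> l)" by simp
  finally show ?thesis by (rule cong_sym)
qed

lemma gen_Aw': "a \<in> ZPi N \<Longrightarrow> gK a \<in> Aw N 0" "a \<in> ZPi N \<Longrightarrow> gL a \<in> Aw N 0"
  "i \<in> {1..N} \<Longrightarrow> gE i \<in> Aw N (\<alpha> i)" "i \<in> {1..N} \<Longrightarrow> gF i \<in> Aw N (- \<alpha> i)"
  using gen_Aw[of "GenK a" N] gen_Aw[of "GenL a" N] gen_Aw[of "GenE i" N] gen_Aw[of "GenF i" N] by auto

text \<open>One criterion for both \<open>om\<close> and \<open>om_inv\<close>. Inverting torus
  elements while sending \<open>E_i\<close> and \<open>F_i\<close> to weights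
  \<open>- \<alpha> i\<close> and \<open>\<alpha> i\<close> leaves all commutation scalars
  unchanged, since \<open>XX (- a) (- b) = XX a b\<close>; the \<open>EF\<close> relation has to be
  supplied separately.\<close>

lemma torus_inverting_RI:
  assumes KL: "\<And>a. f (GenK a) = gK (- a)" "\<And>a. f (GenL a) = gL (- a)"
    and E: "\<And>i. i \<in> {1..N} \<Longrightarrow> f (GenE i) \<in> Aw N (- \<alpha> i)" and F: "\<And>i. i \<in> {1..N} \<Longrightarrow> f (GenF i) \<in> Aw N (\<alpha> i)"
    and EF: "\<And>i j. i \<in> {1..N} \<Longrightarrow> j \<in> {1..N} \<Longrightarrow>
      f (GenE i) * f (GenF j) \<approx> f (GenF j) * f (GenE i) + (if i = j then gL (- \<alpha> i) - gK (- \<alpha> i) else 0)"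
  shows "x \<in> RI \<Longrightarrow> word_hom f x \<in> RI"
proof -
  have fA: "f g \<in> A" if "g \<in> generators N" for g
    using that KL graded_A(3)[OF E] graded_A(3)[OF F] by auto
  define S where "S = {x \<in> A. word_hom f x \<in> RI}"
  have "ideal_set A S"
    using word_hom_Acar[of N f, OF fA]
    by (auto simp: S_def ideal_set_def additive_subgroup_set_def word_hom_simps word_hom_mult RI_closed simp del: generators.simps)
  moreover have "rels \<subseteq> S"
  proof
    fix r assume r: "r \<in> rels"
    hence "word_hom f r \<in> RI"
    proof cases
      case K_zero
      thus ?thesis using rel_intros(1) by (simp add: word_hom_simps KL)
    next
      case L_zero
      thus ?thesis using rel_intros(2) by (simp add: word_hom_simps KL)
    next
      case (KK a b)
      thus ?thesis using rel_intros(3)[of "- a" "- b"] by (simp add: word_hom_simps word_hom_mult KL)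
    next
      case (LL a b)
      thus ?thesis using rel_intros(4)[of "- a" "- b"] by (simp add: word_hom_simps word_hom_mult KL)
    next
      case (KL a b)
      thus ?thesis using rel_intros(5)[of "- a" "- b"] by (simp add: word_hom_simps word_hom_mult assms(1,2))
    next
      case (KE a i)
      thus ?thesis using K_move(1)[OF E, of i "- a"] by (simp add: word_hom_simps word_hom_mult KL cong_def X_minus)
    next
      case (LE a i)
      thus ?thesis using K_move(2)[OF E, of i "- a"] by (simp add: word_hom_simps word_hom_mult KL cong_def X_minus)
    next
      case (KF a i)
      thus ?thesis using K_move(1)[OF F, of i "- a"] by (simp add: word_hom_simps word_hom_mult KL cong_def X_minus)
    next
      case (LF a i)
      thus ?thesis using K_move(2)[OF F, of i "- a"] by (simp add: word_hom_simps word_hom_mult KL cong_def X_minus)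
    next
      case (EF i j)
      thus ?thesis using assms(5)[of i j] by (auto simp: word_hom_simps word_hom_mult KL cong_def diff_diff_eq)
    qed
    thus "r \<in> S" using r rels_A by (auto simp: S_def)
  qed
  ultimately show "x \<in> RI \<Longrightarrow> word_hom f x \<in> RI" using RI_least[of S] by (auto simp: S_def)
qed

fun om_gen :: "generator \<Rightarrow> 'k walg" where
  "om_gen (GenK a) = gK (- a)"
| "om_gen (GenL a) = gL (- a)"
| "om_gen (GenE i) = gF i * gL (- \<alpha> i)"
| "om_gen (GenF i) = gK (- \<alpha> i) * gE i"

text \<open>Obtained by solving the formulas for \<open>om_gen\<close>: with \<open>a\<close> the
  \<open>i\<close>-th simple root, \<open>K_{-a} E_i\<close> is the image of \<open>F_i\<close>, so
  \<open>E_i\<close> is the image of \<open>K_{-a} F_i\<close>; similarly for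
  \<open>F_i\<close>.\<close>

fun om_inv_gen :: "generator \<Rightarrow> 'k walg" where
  "om_inv_gen (GenK a) = gK (- a)"
| "om_inv_gen (GenL a) = gL (- a)"
| "om_inv_gen (GenE i) = gK (- \<alpha> i) * gF i"
| "om_inv_gen (GenF i) = gE i * gL (- \<alpha> i)"

definition om :: "'k walg \<Rightarrow> 'k walg" where "om = word_hom om_gen"
definition om_inv :: "'k walg \<Rightarrow> 'k walg" where "om_inv = word_hom om_inv_gen"

lemmas om_simps = word_hom_simps[of om_gen, folded om_def] word_hom_mult[of om_gen, folded om_def]
lemmas om_inv_simps = word_hom_simps[of om_inv_gen, folded om_inv_def] word_hom_mult[of om_inv_gen, folded om_inv_def]

lemma om_gen_Aw:
  assumes "i \<in> {1..N}"
  shows "om_gen (GenE i) \<in> Aw N (- \<alpha> i)" "om_gen (GenF i) \<in> Aw N (\<alpha> i)"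
    "om_inv_gen (GenE i) \<in> Aw N (- \<alpha> i)" "om_inv_gen (GenF i) \<in> Aw N (\<alpha> i)"
proof -
  have Z: "- \<alpha> i \<in> ZPi N" using assms by simp
  show "om_gen (GenE i) \<in> Aw N (- \<alpha> i)" "om_gen (GenF i) \<in> Aw N (\<alpha> i)"
    "om_inv_gen (GenE i) \<in> Aw N (- \<alpha> i)" "om_inv_gen (GenF i) \<in> Aw N (\<alpha> i)"
    using Aw_mult[OF gen_Aw'(4)[OF assms] gen_Aw'(2)[OF Z]] Aw_mult[OF gen_Aw'(1)[OF Z] gen_Aw'(3)[OF assms]]
      Aw_mult[OF gen_Aw'(1)[OF Z] gen_Aw'(4)[OF assms]] Aw_mult[OF gen_Aw'(3)[OF assms] gen_Aw'(2)[OF Z]] by simp_all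
qed

lemma om_gen_A: "g \<in> generators N \<Longrightarrow> om_gen g \<in> A" "g \<in> generators N \<Longrightarrow> om_inv_gen g \<in> A"
  by auto

lemma om_A: "x \<in> A \<Longrightarrow> om x \<in> A" "x \<in> A \<Longrightarrow> om_inv x \<in> A"
  using word_hom_Acar[of N om_gen x] word_hom_Acar[of N om_inv_gen x] om_gen_A by (auto simp: om_def om_inv_def simp del: generators.simps)

lemma om_RI: assumes "x \<in> RI" shows "om x \<in> RI"
proof -
  have "om_gen (GenE i) * om_gen (GenF j) \<approx> om_gen (GenF j) * om_gen (GenE i) + (if i = j then gL (- \<alpha> i) - gK (- \<alpha> i) else 0)"
    if i: "i \<in> {1..N}" and j: "j \<in> {1..N}" for i j
  proof -
    have Z: "- \<alpha> i \<in> ZPi N" "- \<alpha> j \<in> ZPi N" using i j by simp_all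
    have A: "gF i \<in> A" "gE j \<in> A" "gL (- \<alpha> i) \<in> A" "gK (- \<alpha> j) \<in> A" using i j by simp_all
    have "gF i * gL (- \<alpha> i) * (gK (- \<alpha> j) * gE j) = gF i * (gL (- \<alpha> i) * gK (- \<alpha> j)) * gE j" by (simp only: mult.assoc)
    also have "\<dots> \<approx> gF i * (gK (- \<alpha> j) * gL (- \<alpha> i)) * gE j"
      by (rule cong_mult_right[OF A(2) cong_mult_left[OF A(1) cong_sym[OF rel_cong(5)[OF Z(2,1)]]]])
    also have "\<dots> = gF i * gK (- \<alpha> j) * (gL (- \<alpha> i) * gE j)" by (simp only: mult.assoc)
    also have "\<dots> \<approx> gF i * gK (- \<alpha> j) * sc (XX (\<alpha> j) (\<alpha> i)) (gE j * gL (- \<alpha> i))"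
      using cong_mult_left[OF _ K_move(2)[OF gen_Aw'(3)[OF j] Z(1)], of "gF i * gK (- \<alpha> j)"] A by (simp add: X_minus)
    also have "\<dots> = sc (XX (\<alpha> j) (\<alpha> i)) (gF i * gK (- \<alpha> j)) * (gE j * gL (- \<alpha> i))"
      by (simp only: sc_mult_left sc_mult_right)
    also have "\<dots> \<approx> gK (- \<alpha> j) * gF i * (gE j * gL (- \<alpha> i))"
      using cong_mult_right[OF _ cong_sym[OF K_move(1)[OF gen_Aw'(4)[OF i] Z(2)]], of "gE j * gL (- \<alpha> i)"] A by (simp add: X_minus)
    also have "\<dots> = gK (- \<alpha> j) * (gF i * gE j) * gL (- \<alpha> i)" by (simp only: mult.assoc)
    also have "\<dots> \<approx> gK (- \<alpha> j) * (gE j * gF i) * gL (- \<alpha> i) + (if i = j then gL (- \<alpha> i) - gK (- \<alpha> i) else 0)"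
      by (rule EF_conj[OF i j j i]) simp
    finally show ?thesis by (simp only: om_gen.simps mult.assoc)
  qed
  from torus_inverting_RI[of om_gen, OF _ _ om_gen_Aw(1,2) this assms] show ?thesis by (simp add: om_def)
qed

lemma om_inv_RI: assumes "x \<in> RI" shows "om_inv x \<in> RI"
proof -
  have "om_inv_gen (GenE i) * om_inv_gen (GenF j) \<approx> om_inv_gen (GenF j) * om_inv_gen (GenE i) + (if i = j then gL (- \<alpha> i) - gK (- \<alpha> i) else 0)"
    if i: "i \<in> {1..N}" and j: "j \<in> {1..N}" for i j
  proof -
    have Z: "- \<alpha> i \<in> ZPi N" "- \<alpha> j \<in> ZPi N" using i j by simp_all
    have A: "gF i \<in> A" "gE j \<in> A" "gL (- \<alpha> j) \<in> A" "gK (- \<alpha> i) \<in> A" using i j by simp_all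
    have "gE j * gL (- \<alpha> j) * (gK (- \<alpha> i) * gF i) = gE j * (gL (- \<alpha> j) * gK (- \<alpha> i)) * gF i" by (simp only: mult.assoc)
    also have "\<dots> \<approx> gE j * (gK (- \<alpha> i) * gL (- \<alpha> j)) * gF i"
      by (rule cong_mult_right[OF A(1) cong_mult_left[OF A(2) cong_sym[OF rel_cong(5)[OF Z(1,2)]]]])
    also have "\<dots> = gE j * gK (- \<alpha> i) * (gL (- \<alpha> j) * gF i)" by (simp only: mult.assoc)
    also have "\<dots> \<approx> gE j * gK (- \<alpha> i) * sc (inverse (XX (\<alpha> i) (\<alpha> j))) (gF i * gL (- \<alpha> j))"
      using cong_mult_left[OF _ K_move(2)[OF gen_Aw'(4)[OF i] Z(2)], of "gE j * gK (- \<alpha> i)"] A by (simp add: X_minus)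
    also have "\<dots> = sc (inverse (XX (\<alpha> i) (\<alpha> j))) (gE j * gK (- \<alpha> i)) * (gF i * gL (- \<alpha> j))"
      by (simp only: sc_mult_left sc_mult_right)
    also have "\<dots> \<approx> gK (- \<alpha> i) * gE j * (gF i * gL (- \<alpha> j))"
      using cong_mult_right[OF _ cong_sym[OF K_move(1)[OF gen_Aw'(3)[OF j] Z(1)]], of "gF i * gL (- \<alpha> j)"] A by (simp add: X_minus)
    finally have 1: "gE j * gL (- \<alpha> j) * (gK (- \<alpha> i) * gF i) \<approx> gK (- \<alpha> i) * (gE j * gF i) * gL (- \<alpha> j)"
      by (simp only: mult.assoc)
    have "gK (- \<alpha> i) * gF i * (gE j * gL (- \<alpha> j)) = gK (- \<alpha> i) * (gF i * gE j) * gL (- \<alpha> j)" by (simp only: mult.assoc)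
    also have "\<dots> \<approx> gK (- \<alpha> i) * (gE j * gF i) * gL (- \<alpha> j) + (if i = j then gL (- \<alpha> i) - gK (- \<alpha> i) else 0)"
      by (rule EF_conj[OF i j i j]) simp
    also have "\<dots> \<approx> gE j * gL (- \<alpha> j) * (gK (- \<alpha> i) * gF i) + (if i = j then gL (- \<alpha> i) - gK (- \<alpha> i) else 0)"
      by (rule cong_add[OF cong_sym[OF 1] cong_refl])
    finally show ?thesis by (simp only: om_inv_gen.simps)
  qed
  from torus_inverting_RI[of om_inv_gen, OF _ _ om_gen_Aw(3,4) this assms] show ?thesis by (simp add: om_inv_def)
qed

text \<open>A composite of two endomorphisms given on letters is again of this kind, so it suffices
  to compare on letters, where the torus elements cancel.\<close>

lemma om_om_inv: assumes "x \<in> A" shows "om (om_inv x) \<approx> x" "om_inv (om x) \<approx> x"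
proof -
  have c: "(word_hom f \<circ> word_hom h) y = word_hom (\<lambda>g. word_hom f (h g)) y" for f h :: "generator \<Rightarrow> 'k walg" and y
  proof -
    have UNIV: "z \<in> FA.span (mon ` UNIV)" for z :: "'k walg" by (simp add: span_mon)
    have "word_hom f (prod_list (map h gs)) = prod_list (map (\<lambda>g. word_hom f (h g)) gs)" for gs
      by (induction gs) (simp_all add: word_hom_simps word_hom_mult)
    hence m: "(word_hom f \<circ> word_hom h) (mon w) = word_hom (\<lambda>g. word_hom f (h g)) (mon w)" for w
      by (simp add: word_hom_def)
    show ?thesis
      by (rule span_linear_eq[where f = "word_hom f \<circ> word_hom h" and g = "word_hom (\<lambda>g. word_hom f (h g))", OF _ _ _ _ m UNIV])
        (simp_all add: word_hom_simps)
  qed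
  have KA: "gK (- \<alpha> i) * (gK (\<alpha> i) * y) \<approx> y" "gK (\<alpha> i) * (gK (- \<alpha> i) * y) \<approx> y"
    "y * (gL (- \<alpha> i) * gL (\<alpha> i)) \<approx> y" "y * (gL (\<alpha> i) * gL (- \<alpha> i)) \<approx> y" if "i \<in> {1..N}" "y \<in> A" for i y
    using cong_mult_right[OF that(2) gK_inverse(2)[of "\<alpha> i"]] cong_mult_right[OF that(2) gK_inverse(1)[of "\<alpha> i"]]
      cong_mult_left[OF that(2) gK_inverse(4)[of "\<alpha> i"]] cong_mult_left[OF that(2) gK_inverse(3)[of "\<alpha> i"]]
      ZPi_closed(5)[OF that(1)]
    by (simp_all only: mult.assoc mult_1_left mult_1_right simp_thms)
  have "word_hom (\<lambda>g. om (om_inv_gen g)) x \<approx> x"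
  proof (rule word_hom_cong_id[OF assms])
    fix g assume g: "g \<in> generators N"
    show "om (om_inv_gen g) \<in> A" using om_A om_gen_A g by blast
    have 1: "om (om_inv_gen (GenE i)) = gK (\<alpha> i) * (gK (- \<alpha> i) * gE i)" "om (om_inv_gen (GenF i)) = gF i * (gL (- \<alpha> i) * gL (\<alpha> i))" for i
      by (simp_all only: om_inv_gen.simps om_simps om_gen.simps minus_minus mult.assoc)
    have 2: "om (om_inv_gen (GenK a)) = gK a" "om (om_inv_gen (GenL a)) = gL a" for a
      by (simp_all only: om_inv_gen.simps om_simps om_gen.simps minus_minus)
    show "word_hom (\<lambda>g. om (om_inv_gen g)) (gen g) \<approx> gen g"
      unfolding word_hom_simps(4)
    proof (cases g)
      case (GenE i)
      have i: "i \<in> {1..N}" using g GenE by auto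
      show "om (om_inv_gen g) \<approx> gen g" unfolding GenE 1 by (rule KA(2)[OF i]) (use i in simp)
    next
      case (GenF i)
      have i: "i \<in> {1..N}" using g GenF by auto
      show "om (om_inv_gen g) \<approx> gen g" unfolding GenF 1 by (rule KA(3)[OF i]) (use i in simp)
    qed (simp_all only: 2 cong_refl)
  qed
  thus "om (om_inv x) \<approx> x" unfolding om_def om_inv_def by (simp only: c[of om_gen om_inv_gen x, unfolded o_apply])
  have "word_hom (\<lambda>g. om_inv (om_gen g)) x \<approx> x"
  proof (rule word_hom_cong_id[OF assms])
    fix g assume g: "g \<in> generators N"
    show "om_inv (om_gen g) \<in> A" using om_A om_gen_A g by blast
    have 1: "om_inv (om_gen (GenE i)) = gE i * (gL (- \<alpha> i) * gL (\<alpha> i))" "om_inv (om_gen (GenF i)) = gK (\<alpha> i) * (gK (- \<alpha> i) * gF i)" for i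
      by (simp_all only: om_gen.simps om_inv_simps om_inv_gen.simps minus_minus mult.assoc)
    have 2: "om_inv (om_gen (GenK a)) = gK a" "om_inv (om_gen (GenL a)) = gL a" for a
      by (simp_all only: om_gen.simps om_inv_simps om_inv_gen.simps minus_minus)
    show "word_hom (\<lambda>g. om_inv (om_gen g)) (gen g) \<approx> gen g"
      unfolding word_hom_simps(4)
    proof (cases g)
      case (GenE i)
      have i: "i \<in> {1..N}" using g GenE by auto
      show "om_inv (om_gen g) \<approx> gen g" unfolding GenE 1 by (rule KA(3)[OF i]) (use i in simp)
    next
      case (GenF i)
      have i: "i \<in> {1..N}" using g GenF by auto
      show "om_inv (om_gen g) \<approx> gen g" unfolding GenF 1 by (rule KA(2)[OF i]) (use i in simp)
    qed (simp_all only: 2 cong_refl)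
  qed
  thus "om_inv (om x) \<approx> x" unfolding om_def om_inv_def by (simp only: c[of om_inv_gen om_gen x, unfolded o_apply])
qed

lemma om_cong: "x \<approx> y \<Longrightarrow> om x \<approx> om y" "x \<approx> y \<Longrightarrow> om_inv x \<approx> om_inv y"
  using om_RI[of "x - y"] om_inv_RI[of "x - y"] by (simp_all add: cong_def om_simps om_inv_simps)

text \<open>A candidate for the choice in \<open>tOmega\<close>, defined on classes through an
  arbitrary representative; by \<open>om_cong\<close> the result does not depend on it.\<close>

definition omega_class :: "'k walg set \<Rightarrow> 'k walg set" where
  "omega_class Y = tc (om (SOME x. x \<in> A \<and> Y = tc x))"

lemma omega_class: assumes "x \<in> A" shows "omega_class (tc x) = tc (om x)"
proof -
  define x' where "x' = (SOME x'. x' \<in> A \<and> tc x = tc x')"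
  have x': "x' \<in> A" "tc x = tc x'" unfolding x'_def by (rule someI2[of _ x]; use assms in simp)+
  hence "om x' \<approx> om x" using om_cong(1) cong_sym tc_eq assms by blast
  hence "tc (om x') = tc (om x)" using tc_eq om_A(1) assms x'(1) by simp
  thus ?thesis by (simp only: omega_class_def x'_def)
qed

lemma gen_class: "tK N \<chi> a = tc (gK a)" "tL N \<chi> a = tc (gL a)" "tE N \<chi> i = tc (gE i)" "tF N \<chi> i = tc (gF i)"
  by (simp_all add: tK_def tL_def tE_def tF_def)

lemma omega_class_alg_hom: "omega_class \<in> alg_hom T T"
proof -
  have "omega_class \<in> ring_hom T T"
  proof (rule ring_hom_memI)
    fix x assume "x \<in> carrier T"
    then obtain a where a: "a \<in> A" "x = tc a" by (auto simp: tU_add(4))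
    thus "omega_class x \<in> carrier T" using om_A(1) by (auto simp: tU_add(4) omega_class)
    fix y assume "y \<in> carrier T"
    then obtain b where b: "b \<in> A" "y = tc b" by (auto simp: tU_add(4))
    show "omega_class (x \<otimes>\<^bsub>T\<^esub> y) = omega_class x \<otimes>\<^bsub>T\<^esub> omega_class y"
      "omega_class (x \<oplus>\<^bsub>T\<^esub> y) = omega_class x \<oplus>\<^bsub>T\<^esub> omega_class y"
      using a b om_A(1) by (simp_all add: omega_class tU_ring(3) tU_add(6) om_simps)
  next
    show "omega_class \<one>\<^bsub>T\<^esub> = \<one>\<^bsub>T\<^esub>" using omega_class[of 1] by (simp add: tU_ring(2) om_simps)
  qed
  thus ?thesis using om_A(1) by (auto simp: alg_hom_def tU_add(4) tc_sc omega_class om_simps)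
qed

lemma omega_class_bij: "bij_betw omega_class (carrier T) (carrier T)"
proof (rule bij_betw_imageI)
  show "inj_on omega_class (carrier T)"
  proof (rule inj_onI)
    fix x y assume xy: "x \<in> carrier T" "y \<in> carrier T" "omega_class x = omega_class y"
    then obtain a b where ab: "a \<in> A" "x = tc a" "b \<in> A" "y = tc b" by (auto simp: tU_add(4))
    hence "om a \<approx> om b" using xy(3) om_A(1) tc_eq by (simp add: omega_class)
    from cong_trans[OF cong_trans[OF cong_sym[OF om_om_inv(2)[OF ab(1)]] om_cong(2)[OF this]] om_om_inv(2)[OF ab(3)]]
    show "x = y" using ab tc_eq by simp
  qed
  have "tc y \<in> omega_class ` tc ` A" if "y \<in> A" for y
  proof -
    have "tc y = omega_class (tc (om_inv y))"
      using om_om_inv(1)[OF that] om_A that tc_eq cong_sym by (simp add: omega_class)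
    thus ?thesis using om_A(2)[OF that] by blast
  qed
  thus "omega_class ` carrier T = carrier T" using om_A(1) by (auto simp: tU_add(4) omega_class)
qed

text \<open>\<open>omega_class\<close> shows that the choice operator has a witness. Any witness
  agrees with \<open>om\<close> on generators, hence on words and, by linearity, everywhere, so
  \<open>tOmega\<close> is computed by \<open>om\<close>.\<close>

lemma tOmega_eq: assumes x: "x \<in> A" shows "tOmega N \<chi> (tc x) = tc (om x)"
proof -
  define P where "P h \<longleftrightarrow> h \<in> alg_hom T T \<and> bij_betw h (carrier T) (carrier T) \<and>
     (\<forall>a \<in> ZPi N. h (tK N \<chi> a) = tK N \<chi> (- a) \<and> h (tL N \<chi> a) = tL N \<chi> (- a)) \<and>
     (\<forall>i \<in> {1..N}. h (tE N \<chi> i) = tF N \<chi> i \<otimes>\<^bsub>T\<^esub> tL N \<chi> (- simple_root i) \<and>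
                   h (tF N \<chi> i) = tK N \<chi> (- simple_root i) \<otimes>\<^bsub>T\<^esub> tE N \<chi> i)" for h
  have "P omega_class"
    unfolding P_def gen_class
  proof (intro conjI ballI)
    show "omega_class \<in> alg_hom T T" "bij_betw omega_class (carrier T) (carrier T)"
      by (rule omega_class_alg_hom omega_class_bij)+
    fix a assume a: "a \<in> ZPi N"
    show "omega_class (tc (gK a)) = tc (gK (- a))" "omega_class (tc (gL a)) = tc (gL (- a))"
      using omega_class[of "gK a"] omega_class[of "gL a"] a by (simp_all add: om_simps(4))
  next
    fix i assume i: "i \<in> {1..N}"
    show "omega_class (tc (gE i)) = tc (gF i) \<otimes>\<^bsub>T\<^esub> tc (gL (- \<alpha> i))"
      "omega_class (tc (gF i)) = tc (gK (- \<alpha> i)) \<otimes>\<^bsub>T\<^esub> tc (gE i)"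
      using omega_class[of "gE i"] omega_class[of "gF i"] tU_ring(3)[of "gF i" "gL (- \<alpha> i)"]
        tU_ring(3)[of "gK (- \<alpha> i)" "gE i"] i by (simp_all add: om_simps(4))
  qed
  moreover have "tOmega N \<chi> = (SOME h. P h)" by (simp only: tOmega_def P_def)
  ultimately have P: "P (tOmega N \<chi>)" using someI[of P] by simp
  have hom: "tOmega N \<chi> (u \<otimes>\<^bsub>T\<^esub> v) = tOmega N \<chi> u \<otimes>\<^bsub>T\<^esub> tOmega N \<chi> v"
      "tOmega N \<chi> (u \<oplus>\<^bsub>T\<^esub> v) = tOmega N \<chi> u \<oplus>\<^bsub>T\<^esub> tOmega N \<chi> v" "tOmega N \<chi> \<one>\<^bsub>T\<^esub> = \<one>\<^bsub>T\<^esub>"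
      "tOmega N \<chi> (c \<odot>\<^bsub>T\<^esub> u) = c \<odot>\<^bsub>T\<^esub> tOmega N \<chi> u"
    if "u \<in> carrier T" "v \<in> carrier T" for u v c
  proof -
    have h: "tOmega N \<chi> \<in> ring_hom T T" "\<forall>c. \<forall>x\<in>carrier T. tOmega N \<chi> (c \<odot>\<^bsub>T\<^esub> x) = c \<odot>\<^bsub>T\<^esub> tOmega N \<chi> x"
      using P unfolding P_def alg_hom_def by blast+
    show "tOmega N \<chi> (u \<otimes>\<^bsub>T\<^esub> v) = tOmega N \<chi> u \<otimes>\<^bsub>T\<^esub> tOmega N \<chi> v"
      "tOmega N \<chi> (u \<oplus>\<^bsub>T\<^esub> v) = tOmega N \<chi> u \<oplus>\<^bsub>T\<^esub> tOmega N \<chi> v" "tOmega N \<chi> \<one>\<^bsub>T\<^esub> = \<one>\<^bsub>T\<^esub>"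
      "tOmega N \<chi> (c \<odot>\<^bsub>T\<^esub> u) = c \<odot>\<^bsub>T\<^esub> tOmega N \<chi> u"
      using ring_hom_mult[OF h(1) that] ring_hom_add[OF h(1) that] ring_hom_one[OF h(1)] h(2) that(1) by blast+
  qed
  have carr: "tc y \<in> carrier T" if "y \<in> A" for y using that by (simp add: tU_add(4))
  have P': "\<And>a. a \<in> ZPi N \<Longrightarrow> tOmega N \<chi> (tc (gK a)) = tc (gK (- a))" "\<And>a. a \<in> ZPi N \<Longrightarrow> tOmega N \<chi> (tc (gL a)) = tc (gL (- a))"
    "\<And>i. i \<in> {1..N} \<Longrightarrow> tOmega N \<chi> (tc (gE i)) = tc (gF i) \<otimes>\<^bsub>T\<^esub> tc (gL (- \<alpha> i))"
    "\<And>i. i \<in> {1..N} \<Longrightarrow> tOmega N \<chi> (tc (gF i)) = tc (gK (- \<alpha> i)) \<otimes>\<^bsub>T\<^esub> tc (gE i)"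
    using P unfolding P_def gen_class by blast+
  have g: "tOmega N \<chi> (tc (gen g)) = tc (om_gen g)" if "g \<in> generators N" for g
  proof (cases g)
    case (GenE i)
    hence "i \<in> {1..N}" using that by auto
    thus ?thesis using P'(3)[of i] tU_ring(3)[of "gF i" "gL (- \<alpha> i)"] GenE by simp
  next
    case (GenF i)
    hence "i \<in> {1..N}" using that by auto
    thus ?thesis using P'(4)[of i] tU_ring(3)[of "gK (- \<alpha> i)" "gE i"] GenF by simp
  qed (use that P'(1,2) in auto)
  have "set gs \<subseteq> generators N \<Longrightarrow> tOmega N \<chi> (tc (mon (Word gs))) = tc (om (mon (Word gs)))" for gs
  proof (induction gs)
    case Nil
    show ?case using hom(3)[OF carr carr, of 0 0] by (simp add: mon_Word_Nil tU_ring(2) om_simps)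
  next
    case (Cons g gs)
    hence g': "g \<in> generators N" "Word gs \<in> words N" by (auto simp: words_def simp del: generators.simps)
    hence A: "gen g \<in> A" "mon (Word gs) \<in> A" "om (mon (Word gs)) \<in> A" using om_A(1) by (simp_all del: generators.simps)
    have "tOmega N \<chi> (tc (gen g * mon (Word gs))) = tc (om_gen g) \<otimes>\<^bsub>T\<^esub> tc (om (mon (Word gs)))"
      using hom(1)[OF carr[OF A(1)] carr[OF A(2)]] Cons g[OF g'(1)] by (simp add: tU_ring(3)[OF A(1,2)] del: generators.simps mult_single)
    also have "\<dots> = tc (om (gen g * mon (Word gs)))"
      using tU_ring(3)[OF om_gen_A(1)[OF g'(1)] A(3)] by (simp add: om_simps(4,7) del: mult_single)
    finally show ?case unfolding mon_Word_Cons[of g gs] .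
  qed
  hence w: "tOmega N \<chi> (tc (mon w)) = tc (om (mon w))" if "w \<in> words N" for w
    using that by (cases w) (simp add: words_def)
  have "x \<in> A \<and> tOmega N \<chi> (tc x) = tc (om x)"
    using x unfolding Acar_span
  proof (induction rule: FA.span_induct_alt)
    case base
    \<comment> \<open>That zero is fixed comes from compatibility with the scalar
      \<open>0\<close>.\<close>
    have "tOmega N \<chi> (tc 0) \<in> carrier T" using P carr[of 0] by (auto simp: P_def bij_betw_def)
    then obtain z where z: "z \<in> A" "tOmega N \<chi> (tc 0) = tc z" by (auto simp: tU_add(4))
    have "tOmega N \<chi> (0 \<odot>\<^bsub>T\<^esub> tc 0) = 0 \<odot>\<^bsub>T\<^esub> tc z"
      using hom(4)[OF carr[of 0] carr[of 0], of 0] z(2) by simp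
    hence "tOmega N \<chi> (tc 0) = tc 0" using z(1) by (simp add: tc_sc)
    thus ?case by (simp add: FA.span_zero om_simps)
  next
    case (step c u y)
    then obtain v where v: "v \<in> words N" "u = mon v" by auto
    have A: "u \<in> A" "y \<in> A" "sc c u \<in> A" "om u \<in> A" "om y \<in> A" using v step[unfolded Acar_span[symmetric]] om_A(1) by auto
    have "tOmega N \<chi> (tc (sc c u + y)) = (c \<odot>\<^bsub>T\<^esub> tc (om u)) \<oplus>\<^bsub>T\<^esub> tc (om y)"
      using hom(2)[OF carr[OF A(3)] carr[OF A(2)]] hom(4)[OF carr[OF A(1)] carr[OF A(1)], of c] w[OF v(1)] v(2) step A
      by (simp add: tU_add(6) tc_sc)
    also have "\<dots> = tc (om (sc c u + y))" using A by (simp add: tc_sc tU_add(6) om_simps)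
    finally show ?case using A by (simp flip: Acar_span)
  qed
  thus ?thesis ..
qed

section \<open>The defining ideal of \<open>U(\<chi>)\<close> in the free algebra\<close>

definition RU :: "'k walg set" where "RU = {d + om d' |d d'. d \<in> D \<and> d' \<in> D}"

lemma RU_A: "x \<in> RU \<Longrightarrow> x \<in> A" using D_A om_A(1) by (auto simp: RU_def)

lemma RU_subspace: "FA.subspace RU"
proof (rule FA.subspaceI)
  show "0 \<in> RU" unfolding RU_def using FA.subspace_0[OF D_subspace] om_simps(6) by (intro CollectI exI[of _ 0]) auto
  fix x y c assume "x \<in> RU" "y \<in> RU"
  then obtain d d' e e' where *: "d \<in> D" "d' \<in> D" "e \<in> D" "e' \<in> D" "x = d + om d'" "y = e + om e'" by (auto simp: RU_def)
  have "x + y = (d + e) + om (d' + e')" "sc c x = sc c d + om (sc c d')"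
    using * by (simp_all add: om_simps FA.scale_right_distrib)
  thus "x + y \<in> RU" "sc c x \<in> RU"
    unfolding RU_def using * FA.subspace_add[OF D_subspace] FA.subspace_scale[OF D_subspace] by blast+
qed

lemma D_RU: "x \<in> D \<Longrightarrow> x \<in> RU" and om_D_RU: "x \<in> D \<Longrightarrow> om x \<in> RU"
proof -
  have 0: "0 \<in> D" using FA.subspace_0[OF D_subspace] .
  show "x \<in> D \<Longrightarrow> x \<in> RU" unfolding RU_def using 0 om_simps(6) by (intro CollectI exI[of _ x] exI[of _ 0]) auto
  show "x \<in> D \<Longrightarrow> om x \<in> RU" unfolding RU_def using 0 by (intro CollectI exI[of _ 0] exI[of _ x]) auto
qed

lemma RU_ideal: "ideal_set A RU"
  unfolding ideal_set_def
proof (intro conjI ballI subsetI)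
  show "additive_subgroup_set RU" by (rule subspace_additive[OF RU_subspace])
  show "x \<in> RU \<Longrightarrow> x \<in> A" for x by (rule RU_A)
  fix a s assume a: "a \<in> A" and "s \<in> RU"
  then obtain d d' where s: "d \<in> D" "d' \<in> D" "s = d + om d'" by (auto simp: RU_def)
  note add = FA.subspace_add[OF RU_subspace]
  have dA: "om d' \<in> A" using D_A om_A(1) s by blast
  \<comment> \<open>\<open>om\<close> is surjective only modulo \<open>RI\<close>. Replacing
    \<open>a\<close> by \<open>om (om_inv a)\<close> costs an error in \<open>RI\<close>, which lies
    in \<open>D\<close> and so in \<open>RU\<close>.\<close>
  have e: "a - om (om_inv a) \<in> RI" using cong_sym[OF om_om_inv(1)[OF a]] by (simp add: cong_def)
  note DI = ideal_set_closed[OF D_ideal]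
  have "a * s = a * d + ((a - om (om_inv a)) * om d' + om (om_inv a * d'))"
    by (simp add: s(3) om_simps algebra_simps)
  moreover have "a * d \<in> RU" "(a - om (om_inv a)) * om d' \<in> RU" "om (om_inv a * d') \<in> RU"
    using D_RU DI(5)[OF a s(1)] RI_D[OF RI_closed(6)[OF dA e]] om_D_RU[OF DI(5)[OF om_A(2)[OF a] s(2)]] by auto
  ultimately show "a * s \<in> RU" using add by simp
  have "s * a = d * a + (om d' * (a - om (om_inv a)) + om (d' * om_inv a))"
    by (simp add: s(3) om_simps algebra_simps)
  moreover have "d * a \<in> RU" "om d' * (a - om (om_inv a)) \<in> RU" "om (d' * om_inv a) \<in> RU"
    using D_RU DI(6)[OF a s(1)] RI_D[OF RI_closed(5)[OF dA e]] om_D_RU[OF DI(6)[OF om_A(2)[OF a] s(2)]] by auto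
  ultimately show "s * a \<in> RU" using add by simp
qed

lemma U_ideal_eq: "U_ideal N \<chi> = tc ` RU"
proof -
  have "tOmega N \<chi> ` tJ_minus N \<chi> = tc ` om ` D"
    unfolding tJ_minus_eq image_image using tOmega_eq D_A by (intro image_cong) auto
  moreover have "tc ` D <+>\<^bsub>T\<^esub> tc ` om ` D = tc ` RU"
  proof -
    have "tc d \<oplus>\<^bsub>T\<^esub> tc (om d') = tc (d + om d')" if "d \<in> D" "d' \<in> D" for d d'
      by (rule tU_add(6)) (use that D_A om_A(1) in blast)+
    hence "(\<Union>d\<in>D. \<Union>d'\<in>D. {tc d \<oplus>\<^bsub>T\<^esub> tc (om d')}) = (\<Union>d\<in>D. \<Union>d'\<in>D. {tc (d + om d')})" by simp
    moreover have "tc ` RU = (\<Union>d\<in>D. \<Union>d'\<in>D. {tc (d + om d')})" unfolding RU_def by blast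
    ultimately show ?thesis by (simp add: set_add_def set_mult_def)
  qed
  ultimately show ?thesis by (simp add: U_ideal_def tJ_minus_eq)
qed

abbreviation uc :: "'k walg \<Rightarrow> 'k walg set set" where "uc x \<equiv> Uclass N \<chi> (tc x)"

lemma uc_fun: "uc = (\<lambda>x. tc ` RU +>\<^bsub>T\<^esub> tc x)" by (simp add: Uclass_def U_ideal_eq)

lemma RI_RU: "RI \<subseteq> RU" using RI_D D_RU by blast

lemma presents_ring_U: "presents_ring (U N \<chi>) uc A RU"
  unfolding U_def U_ideal_eq uc_fun by (rule presents_ring_quot[OF presents_ring_tU RU_ideal RI_RU])

lemma presents_space_U: "presents_space (U N \<chi>) uc A RU"
  unfolding U_def U_ideal_eq uc_fun using RU_A
  by (intro presents_space_quot[OF presents_space_tU RU_subspace RI_RU]) auto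

lemma uc_sc: "x \<in> A \<Longrightarrow> c \<odot>\<^bsub>U N \<chi>\<^esub> uc x = uc (sc c x)"
  using presents_space_U by (simp add: presents_space_def)

lemmas U_ring = presents_ringD[OF presents_ring_U]
lemmas U_add = presentsD[OF presents_ringD(1)[OF presents_ring_U]]

lemma U_zero_eq: "U_zero N \<chi> = uc ` Uzero" by (simp add: U_zero_def tU_zero_eq image_image)
lemma U_minus_eq: "U_minus N \<chi> = uc ` VF N" by (simp add: U_minus_def tU_minus_eq image_image)
lemma U_component_eq: "U_component N \<chi> \<mu> = uc ` Aw N \<mu>" by (simp add: U_component_def tU_component_eq image_image)

end

section \<open>The defining ideal annihilates the simple module\<close>

context verma_action
begin

lemma act_0 [simp]: "act g 0 = 0" using act_sc[of g 0 0] by simp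

lemma act_E_1: "act (GenE i) 1 = 0"
proof -
  have "act (GenE i) (mon 0) = 0" unfolding act.simps lin_mon by (simp add: zero_word_def)
  thus ?thesis by (simp del: act.simps)
qed

lemma actw_ewords_1: "p \<in> ewords N \<Longrightarrow> p \<noteq> 0 \<Longrightarrow> actw p 1 = 0"
proof (induction rule: ewords_induct)
  case Nil
  thus ?case by (simp add: zero_word_def)
next
  case (Cons i gs)
  show ?case
  proof (cases "Word gs = 0")
    case True
    thus ?thesis using act_E_1 by (simp add: zero_word_def del: act.simps)
  next
    case False
    thus ?thesis using Cons by (simp del: act.simps)
  qed
qed

lemma klword_Aw: "z \<in> klwords N \<Longrightarrow> mon z \<in> Aw N 0"
proof -
  assume z: "z \<in> klwords N"
  hence "word_weight z = 0" by (induction rule: klwords_induct) auto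
  thus ?thesis unfolding Aw_def using z klwords_words by (intro FA.span_base) auto
qed

text \<open>If \<open>p\<close> is nonempty it kills the highest weight vector. If \<open>p\<close>
  is empty, \<open>y\<close> lowers the weight strictly unless \<open>a = 0\<close>, so no multiple
  of the highest weight vector can appear; and \<open>Iat 0 = RI\<close> acts by zero.\<close>

lemma eps_Iat:
  assumes a: "a \<in> ZPi_nonneg N" and y: "y \<in> Iat a" and z: "z \<in> klwords N" and p: "p \<in> ewords N"
  shows "eps (y * (mon z * mon p)) = 0"
proof (cases "p = 0")
  case False
  hence "rho (mon p) 1 = 0" using actw_ewords_1[OF p] by simp
  thus ?thesis by (simp only: eps_def rho_mult rho_0_right lookup_zero)
next
  case True
  obtain y' where y': "y' \<in> VFw N (- a)" "y \<approx> y'" using Iat_VFw[OF a y] .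
  have u: "rho (mon z) 1 \<in> VFw N 0" using rho_VFw[OF klword_Aw[OF z] VF_1] by simp
  have "rho (y - y') (rho (mon z) 1) = 0"
    by (rule rho_RI) (use y'(2) u VFw_VF in \<open>auto simp: cong_def simp del: rho_mon\<close>)
  hence eq: "rho y (rho (mon z) 1) = rho y' (rho (mon z) 1)" by (simp only: rho_diff right_minus_eq)
  have "Poly_Mapping.lookup (rho y (rho (mon z) 1)) 0 = 0"
  proof (cases "a = 0")
    case True
    hence "rho y (rho (mon z) 1) = 0" using y u VFw_VF Iat_0 by (intro rho_RI) auto
    thus ?thesis by simp
  next
    case False
    have "rho y' (rho (mon z) 1) \<in> VFw N (0 + - a)" using rho_VFw[OF subsetD[OF VFw_Aw y'(1)] u] .
    thus ?thesis using VFw_lookup_0[of _ "- a"] False by (simp only: eq) simp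
  qed
  thus ?thesis by (simp add: eps_def rho_mult True del: rho_mon)
qed

text \<open>Since \<open>D\<close> is an ideal, vanishing of \<open>eps\<close> on \<open>D\<close>
  already gives vanishing on all products \<open>y * x\<close>.\<close>

lemma D_radical: assumes "x \<in> D" shows "x \<in> radical"
proof -
  have "eps d = 0" if "d \<in> D" for d
    using that unfolding D_def
    by (induction rule: FA.span_induct_alt) (use eps_Iat in \<open>auto simp: eps_add eps_sc\<close>)
  thus ?thesis using assms D_A ideal_set_closed(5)[OF D_ideal] by (simp add: radical_def)
qed

text \<open>That \<open>om ` D\<close> annihilates \<open>v\<close> follows by commuting the factors of degree \<open>- a\<close> to the right, since \<open>om\<close> turns them into raising operators.\<close>

definition om_ann :: "'k walg set" where "om_ann = {x \<in> A. rho (om x) 1 = 0}"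

lemma om_ann_closed:
  "x \<in> om_ann \<Longrightarrow> y \<in> om_ann \<Longrightarrow> x + y \<in> om_ann" "x \<in> om_ann \<Longrightarrow> y \<in> om_ann \<Longrightarrow> x - y \<in> om_ann"
  "x \<in> om_ann \<Longrightarrow> sc c x \<in> om_ann" "a \<in> A \<Longrightarrow> x \<in> om_ann \<Longrightarrow> a * x \<in> om_ann" "x \<in> RI \<Longrightarrow> x \<in> om_ann"
  using RI_A om_RI rho_RI[OF _ VF_1'] by (auto simp: om_ann_def om_simps rho_add rho_diff rho_sc rho_mult)

lemma om_ann_subspace: "FA.subspace om_ann"
  using om_ann_closed RI_closed(1) by (intro FA.subspaceI) auto

lemma om_ann_cong: assumes "x \<approx> y" "y \<in> om_ann" shows "x \<in> om_ann"
  using om_ann_closed(1)[OF om_ann_closed(5)[of "x - y"] assms(2)] assms(1) by (simp add: cong_def)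

lemma fword_om_ann: "w \<in> fwords N \<Longrightarrow> w \<noteq> 0 \<Longrightarrow> mon w \<in> om_ann"
proof (induction rule: fwords_induct)
  case Nil
  thus ?case by (simp add: zero_word_def)
next
  case (Cons j gs)
  have A: "gF j \<in> A" "mon (Word gs) \<in> A" using Cons(1,2) fwords_words by auto
  show ?case
  proof (cases "Word gs = 0")
    case True
    have "om (gF j) = gK (- \<alpha> j) * gE j" by (simp only: om_simps(4) om_gen.simps)
    hence "rho (om (gF j)) 1 = rho (gK (- \<alpha> j)) (act (GenE j) 1)" by (simp only: rho_mult rho_gen)
    hence "rho (om (gF j)) 1 = 0" by (simp only: act_E_1 rho_0_right)
    thus ?thesis using A True by (simp add: om_ann_def zero_word_def)
  next
    case False
    from om_ann_closed(4)[OF A(1) Cons(3)[OF this]] show ?thesis unfolding mon_Word_Cons[of "GenF j" gs] .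
  qed
qed

lemma Iat_om_ann: assumes a: "a \<in> ZPi_nonneg N" and y: "y \<in> Iat a" shows "y \<in> om_ann"
proof (cases "a = 0")
  case True
  thus ?thesis using y Iat_0 om_ann_closed(5) by simp
next
  case False
  obtain y' where y': "y' \<in> VFw N (- a)" "y \<approx> y'" using Iat_VFw[OF a y] .
  have mem: "mon w \<in> om_ann" if w: "w \<in> {w \<in> fwords N. word_weight w = - a}" for w
    by (rule fword_om_ann) (use w False in auto)
  have "y' \<in> om_ann"
    by (rule span_linear_mem[where f = "\<lambda>x. x", OF _ _ mem om_ann_subspace y'(1)[unfolded VFw_def]]) auto
  thus ?thesis by (rule om_ann_cong[OF y'(2)])
qed

text \<open>\<open>om_ann\<close> is stable under left multiplication, so \<open>y\<close> has to
  travel to the right end. Passing \<open>E_i\<close> replaces \<open>y\<close> by elements of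
  \<open>Iat (a - \<alpha> i)\<close> with a torus factor and a shorter raising word, which is why
  the induction quantifies over \<open>a\<close>, \<open>y\<close> and \<open>z\<close>.\<close>

lemma Iat_words_om_ann:
  assumes "p \<in> ewords N"
  shows "\<forall>a\<in>ZPi_nonneg N. \<forall>y\<in>Iat a. \<forall>z\<in>klwords N. y * (mon z * mon p) \<in> om_ann"
  using assms
proof (induction rule: ewords_induct)
  case Nil
  show ?case
  proof (intro ballI)
    fix a y z assume a: "a \<in> ZPi_nonneg N" and y: "y \<in> Iat a" and z: "z \<in> klwords N"
    obtain c where c: "c \<noteq> 0" "mon z * y \<approx> sc c (y * mon z)" using klword_Iat[OF z a y] by blast
    have 1: "y * mon z \<approx> sc (inverse c) (mon z * y)"
      using cong_sc[OF cong_sym[OF c(2)], of "inverse c"] c(1) by simp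
    have "y * mon z \<in> om_ann"
      by (rule om_ann_cong[OF 1 om_ann_closed(3)[OF om_ann_closed(4)[OF words_A(1)[OF z] Iat_om_ann[OF a y]]]])
    thus "y * (mon z * mon (Word [])) \<in> om_ann" unfolding mon_Word_Nil by simp
  qed
next
  case (Cons i gs)
  show ?case
  proof (intro ballI)
    fix a y z assume a: "a \<in> ZPi_nonneg N" and y: "y \<in> Iat a" and z: "z \<in> klwords N"
    have i: "i \<in> {1..N}" and pA: "mon (Word gs) \<in> A" using Cons(1,2) by auto
    obtain c where c: "mon z * gE i \<approx> sc c (gE i * mon z)" using klword_E[OF z i] by blast
    obtain q r where qr: "q \<in> Jset (a - \<alpha> i)" "r \<in> Jset (a - \<alpha> i)"
      "gE i * y \<approx> y * gE i + q * gK (\<alpha> i) + r * gL (\<alpha> i)" using Iat_E_comm[OF a y i] .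
    have 1: "y * gE i \<approx> gE i * y - q * gK (\<alpha> i) - r * gL (\<alpha> i)"
      using cong_diff[OF cong_diff[OF cong_sym[OF qr(3)] cong_refl] cong_refl, of "q * gK (\<alpha> i)" "r * gL (\<alpha> i)"]
      by simp
    have zpA: "mon z * mon (Word gs) \<in> A" by (rule Acar_mult[OF words_A(1)[OF z] pA])
    have J: "q * (mon (Word [g] + z) * mon (Word gs)) \<in> om_ann"
      if q: "q \<in> Jset (a - \<alpha> i)" and g: "Word [g] \<in> klwords N" for q g
    proof (cases "a - \<alpha> i \<in> ZPi_nonneg N")
      case True
      thus ?thesis using Cons.IH q klwords_simps(3)[OF g z] by (simp add: Jset_simps(4) del: mult_single)
    next
      case False
      have "mon (Word [g] + z) * mon (Word gs) \<in> A"
        by (rule Acar_mult[OF words_A(1)[OF klwords_simps(3)[OF g z]] pA])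
      thus ?thesis using False q RI_closed(6) om_ann_closed(5) by (simp add: Jset_def)
    qed
    have "y * (mon z * mon (Word (GenE i # gs))) = y * ((mon z * gE i) * mon (Word gs))"
      unfolding mon_Word_Cons[of "GenE i" gs] by (simp only: mult.assoc)
    also have "\<dots> \<approx> y * (sc c (gE i * mon z) * mon (Word gs))"
      by (rule cong_mult_left[OF Iat_A[OF y] cong_mult_right[OF pA c]])
    also have "\<dots> = sc c ((y * gE i) * (mon z * mon (Word gs)))"
      by (simp only: sc_mult_left sc_mult_right mult.assoc)
    also have "\<dots> \<approx> sc c ((gE i * y - q * gK (\<alpha> i) - r * gL (\<alpha> i)) * (mon z * mon (Word gs)))"
      by (rule cong_sc[OF cong_mult_right[OF zpA 1]])
    also have "\<dots> = sc c (gE i * (y * (mon z * mon (Word gs))) - q * (mon (Word [GenK (\<alpha> i)] + z) * mon (Word gs))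
        - r * (mon (Word [GenL (\<alpha> i)] + z) * mon (Word gs)))"
      by (simp only: left_diff_distrib mult.assoc mon_mult[symmetric])
    finally have 2: "y * (mon z * mon (Word (GenE i # gs))) \<approx> \<dots>" .
    show "y * (mon z * mon (Word (GenE i # gs))) \<in> om_ann"
      by (rule om_ann_cong[OF 2], rule om_ann_closed(3), rule om_ann_closed(2), rule om_ann_closed(2),
          rule om_ann_closed(4)) (use Cons.IH a y z i J qr in auto)
  qed
qed

lemma om_D_radical: assumes "x \<in> D" shows "om x \<in> radical"
proof -
  have "x \<in> om_ann"
    by (rule D_linear[where f = "\<lambda>x. x", OF _ _ om_ann_subspace _ assms]) (use Iat_words_om_ann in auto)
  thus ?thesis using om_A(1) by (auto simp: om_ann_def intro!: radicalI)
qed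

lemma RU_radical: "RU \<subseteq> radical"
  using D_radical om_D_radical FA.subspace_add[OF radical_subspace] by (auto simp: RU_def)

end

subsection \<open>Highest weight modules\<close>

definition left_ideal_set :: "'r::ring_1 set \<Rightarrow> 'r set \<Rightarrow> bool" where
  "left_ideal_set A S \<longleftrightarrow> additive_subgroup_set S \<and> S \<subseteq> A \<and> (\<forall>a\<in>A. \<forall>s\<in>S. a * s \<in> S)"

lemma left_ideal_setD:
  assumes "left_ideal_set A S"
  shows "additive_subgroup_set S" "S \<subseteq> A" "a \<in> A \<Longrightarrow> s \<in> S \<Longrightarrow> a * s \<in> S"
    "s \<in> S \<Longrightarrow> s' \<in> S \<Longrightarrow> s + s' \<in> S" "s \<in> S \<Longrightarrow> s' \<in> S \<Longrightarrow> s - s' \<in> S" "0 \<in> S"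
  using assms additive_subgroup_setD[of S] by (auto simp: left_ideal_set_def)

lemma left_ideal_set_INT:
  assumes "\<And>i. i \<in> I \<Longrightarrow> left_ideal_set A (S i)" "I \<noteq> {}"
  shows "left_ideal_set A (\<Inter>i\<in>I. S i)"
  unfolding left_ideal_set_def additive_subgroup_set_def
proof (intro conjI ballI INT_I)
  show "(\<Inter>i\<in>I. S i) \<subseteq> A" using left_ideal_setD(2)[OF assms(1)] assms(2) by blast
  fix i assume i: "i \<in> I"
  note L = left_ideal_setD(3,5,6)[OF assms(1)[OF i]]
  show "0 \<in> S i" by (rule L(3))
  show "x - y \<in> S i" if "x \<in> (\<Inter>i\<in>I. S i)" "y \<in> (\<Inter>i\<in>I. S i)" for x y using that i L(2) by blast
  show "a * x \<in> S i" if "a \<in> A" "x \<in> (\<Inter>i\<in>I. S i)" for a x using that i L(1) by blast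
qed

context quantum_group
begin

definition presents_module :: "('k walg set set, 'a) module \<Rightarrow> ('k walg \<Rightarrow> 'a) \<Rightarrow> 'k walg set \<Rightarrow> bool" where
  "presents_module M p R \<longleftrightarrow> presents M p A R \<and> (\<forall>a\<in>A. \<forall>x\<in>A. uc a \<odot>\<^bsub>M\<^esub> p x = p (a * x))"

lemma presents_module_submodule:
  assumes M: "presents_module M p R" and S: "left_ideal_set A S" "R \<subseteq> S"
  shows "submodule (p ` S) (U N \<chi>) M"
proof -
  have P: "presents M p A R" and sm: "\<And>a x. a \<in> A \<Longrightarrow> x \<in> A \<Longrightarrow> uc a \<odot>\<^bsub>M\<^esub> p x = p (a * x)"
    using M by (auto simp: presents_module_def)
  note L = left_ideal_setD[OF S(1)] and D = presentsD[OF P]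
  have "{x \<in> A. p x \<in> p ` S} = S"
  proof (intro equalityI subsetI)
    fix x assume "x \<in> {x \<in> A. p x \<in> p ` S}"
    then obtain s where s: "x \<in> A" "s \<in> S" "p x = p s" by auto
    hence "x - s \<in> S" using D(7)[of x s] L(2) S(2) by blast
    thus "x \<in> S" using L(4)[of "x - s" s] s(2) by simp
  qed (use L(2) in auto)
  hence "subgroup (p ` S) (add_monoid M)" using presents_subgroup_iff[OF P L(2)] L(1) by simp
  moreover have "C \<odot>\<^bsub>M\<^esub> v \<in> p ` S" if C: "C \<in> carrier (U N \<chi>)" and v: "v \<in> p ` S" for C v
  proof -
    obtain a s where "a \<in> A" "C = uc a" "s \<in> S" "v = p s" using C v by (auto simp: U_add(4))
    thus ?thesis using sm[of a s] L(2,3) by auto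
  qed
  ultimately show ?thesis by (simp add: submodule_def submodule_axioms_def)
qed

lemma submodule_pullback:
  assumes M: "presents_module M p R" and W: "submodule W (U N \<chi>) M"
  defines "S \<equiv> {x \<in> A. p x \<in> W}"
  shows "W = p ` S" "left_ideal_set A S" "R \<subseteq> S"
proof -
  have P: "presents M p A R" and sm: "\<And>a x. a \<in> A \<Longrightarrow> x \<in> A \<Longrightarrow> uc a \<odot>\<^bsub>M\<^esub> p x = p (a * x)"
    using M by (auto simp: presents_module_def)
  note D = presentsD[OF P]
  have sg: "subgroup W (add_monoid M)" and cl: "\<And>C v. C \<in> carrier (U N \<chi>) \<Longrightarrow> v \<in> W \<Longrightarrow> C \<odot>\<^bsub>M\<^esub> v \<in> W"
    using W by (auto simp: submodule_def submodule_axioms_def)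
  have "W \<subseteq> carrier M" using subgroup.subset[OF sg] by simp
  thus W: "W = p ` S" by (auto simp: S_def D(4))
  have SA: "S \<subseteq> A" by (auto simp: S_def)
  have "{x \<in> A. p x \<in> p ` S} = S" unfolding W[symmetric] by (simp add: S_def)
  hence "additive_subgroup_set S" using presents_subgroup_iff[OF P SA] sg W by simp
  moreover have "a * s \<in> S" if a: "a \<in> A" and s: "s \<in> S" for a s
    using cl[of "uc a" "p s"] sm[OF a, of s] a s by (auto simp: S_def U_add(4))
  ultimately show "left_ideal_set A S" using SA by (simp add: left_ideal_set_def)
  show "R \<subseteq> S"
  proof
    fix x assume x: "x \<in> R"
    hence "p x = p 0" using D(3) D(7)[of x 0] by auto
    moreover have "p 0 \<in> W" using subgroup.one_closed[OF sg] by (simp add: D(5))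
    ultimately show "x \<in> S" using x D(3) by (auto simp: S_def)
  qed
qed

lemma presents_module_quot:
  assumes M: "presents_module M p R" and S: "left_ideal_set A S" "R \<subseteq> S"
  shows "presents_module (quot M (p ` S)) (\<lambda>x. p ` S +>\<^bsub>M\<^esub> p x) S"
proof -
  have P: "presents M p A R" and sm: "\<And>a x. a \<in> A \<Longrightarrow> x \<in> A \<Longrightarrow> uc a \<odot>\<^bsub>M\<^esub> p x = p (a * x)"
    using M by (auto simp: presents_module_def)
  note L = left_ideal_setD[OF S(1)]
  have "uc a \<odot>\<^bsub>quot M (p ` S)\<^esub> (p ` S +>\<^bsub>M\<^esub> p x) = p ` S +>\<^bsub>M\<^esub> p (a * x)" if a: "a \<in> A" and x: "x \<in> A" for a x
    by (rule quot_smult[OF P L(1) S(2) L(2), where f = "\<lambda>x. a * x"]) (use a x sm L in \<open>auto simp: distrib_left\<close>)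
  thus ?thesis unfolding presents_module_def using presents_quot[OF P L(1) S(2) L(2)] by blast
qed

lemma presents_module_regular: "presents_module (regular_module (U N \<chi>)) uc RU"
  using presents_ringD(1)[OF presents_ring_U] U_ring(3)
  by (simp add: presents_module_def presents_def regular_module_def with_smult_def)

lemma presents_module_space:
  assumes M: "presents_module M p R"
  shows "presents_space (underlying_space (U N \<chi>) M) p A R"
proof -
  have P: "presents M p A R" and sm: "\<And>a x. a \<in> A \<Longrightarrow> x \<in> A \<Longrightarrow> uc a \<odot>\<^bsub>M\<^esub> p x = p (a * x)"
    using M by (auto simp: presents_module_def)
  have "(c \<odot>\<^bsub>U N \<chi>\<^esub> \<one>\<^bsub>U N \<chi>\<^esub>) \<odot>\<^bsub>M\<^esub> p x = p (sc c x)" if "x \<in> A" for c x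
    using sm[of "sc c 1" x] that by (simp add: U_ring(2) uc_sc sc_one_mult)
  thus ?thesis using P Acar_subspace
    by (auto simp: presents_space_def presents_def underlying_space_def with_smult_def)
qed

lemma uc_cong: "x \<in> A \<Longrightarrow> y \<in> A \<Longrightarrow> x \<approx> y \<Longrightarrow> uc x = uc y"
  using U_add(7) RI_RU by (auto simp: cong_def)

end

locale highest_weight = quantum_group N \<chi>
  for N and \<chi> :: "weight \<Rightarrow> weight \<Rightarrow> 'k::field_char_0" +
  fixes \<Lambda> :: "'k walg set set \<Rightarrow> 'k"
  assumes Ch: "\<Lambda> \<in> Ch N \<chi>"
begin

lemma Uzero_A: "z \<in> Uzero \<Longrightarrow> z \<in> A"
  using span_words_A[of "klwords N"] klwords_words by blast

lemma Uzero_closed: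
  "1 \<in> Uzero" "a \<in> ZPi N \<Longrightarrow> gK a \<in> Uzero" "a \<in> ZPi N \<Longrightarrow> gL a \<in> Uzero" "z \<in> klwords N \<Longrightarrow> mon z \<in> Uzero"
  "x \<in> Uzero \<Longrightarrow> y \<in> Uzero \<Longrightarrow> x * y \<in> Uzero"
proof -
  show m: "mon z \<in> Uzero" if "z \<in> klwords N" for z using that by (intro FA.span_base) blast
  show "1 \<in> Uzero" using m[OF klwords_simps(1)] unfolding mon_Word_Nil .
  show "a \<in> ZPi N \<Longrightarrow> gK a \<in> Uzero" "a \<in> ZPi N \<Longrightarrow> gL a \<in> Uzero"
    using m[OF klwords_simps(4)] m[OF klwords_simps(5)] by blast+
  show "x \<in> Uzero \<Longrightarrow> y \<in> Uzero \<Longrightarrow> x * y \<in> Uzero"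
    by (rule span_words_mult[OF klwords_simps(3)])
qed

lemma Lambda_simps:
  "\<Lambda> (uc 1) = 1"
  "x \<in> Uzero \<Longrightarrow> y \<in> Uzero \<Longrightarrow> \<Lambda> (uc (x + y)) = \<Lambda> (uc x) + \<Lambda> (uc y)"
  "x \<in> Uzero \<Longrightarrow> y \<in> Uzero \<Longrightarrow> \<Lambda> (uc (x * y)) = \<Lambda> (uc x) * \<Lambda> (uc y)"
  "x \<in> Uzero \<Longrightarrow> \<Lambda> (uc (sc c x)) = c * \<Lambda> (uc x)"
proof -
  have h: "\<Lambda> \<in> ring_hom ((U N \<chi>)\<lparr>carrier := U_zero N \<chi>\<rparr>) (with_smult ring_of_type_algebra (*))"
    and s: "\<And>c u. u \<in> U_zero N \<chi> \<Longrightarrow> \<Lambda> (c \<odot>\<^bsub>U N \<chi>\<^esub> u) = c * \<Lambda> u"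
    using Ch by (auto simp: Ch_def alg_hom_def with_smult_def)
  show "\<Lambda> (uc 1) = 1" using ring_hom_one[OF h] by (simp add: with_smult_def ring_of_type_algebra_def U_ring(2))
  show "x \<in> Uzero \<Longrightarrow> y \<in> Uzero \<Longrightarrow> \<Lambda> (uc (x + y)) = \<Lambda> (uc x) + \<Lambda> (uc y)"
    using ring_hom_add[OF h, of "uc x" "uc y"] Uzero_A
    by (simp add: with_smult_def ring_of_type_algebra_def U_add(6) U_zero_eq)
  show "x \<in> Uzero \<Longrightarrow> y \<in> Uzero \<Longrightarrow> \<Lambda> (uc (x * y)) = \<Lambda> (uc x) * \<Lambda> (uc y)"
    using ring_hom_mult[OF h, of "uc x" "uc y"] Uzero_A
    by (simp add: with_smult_def ring_of_type_algebra_def U_ring(3) U_zero_eq)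
  show "x \<in> Uzero \<Longrightarrow> \<Lambda> (uc (sc c x)) = c * \<Lambda> (uc x)"
    using s[of "uc x" c] uc_sc[of x c] Uzero_A by (simp add: U_zero_eq)
qed

text \<open>Composing with \<open>restrict_weight\<close> extends \<open>kap\<close> and
  \<open>ell\<close> to characters of all weights, as \<open>verma_action\<close> requires.\<close>

definition kap :: "weight \<Rightarrow> 'k" where "kap a = \<Lambda> (UK N \<chi> (restrict_weight N a))"
definition ell :: "weight \<Rightarrow> 'k" where "ell a = \<Lambda> (UL N \<chi> (restrict_weight N a))"

lemma kap_eq: "a \<in> ZPi N \<Longrightarrow> kap a = \<Lambda> (uc (gK a))" "a \<in> ZPi N \<Longrightarrow> ell a = \<Lambda> (uc (gL a))"
  by (simp_all add: kap_def ell_def UK_def UL_def gen_class)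

lemma kap_ell_hom: "kap (a + b) = kap a * kap b" "ell (a + b) = ell a * ell b" "kap 0 = 1" "ell 0 = 1"
proof -
  let ?r = "restrict_weight N"
  have "uc (gK (?r a + ?r b)) = uc (gK (?r a) * gK (?r b))" "uc (gL (?r a + ?r b)) = uc (gL (?r a) * gL (?r b))"
    using rel_cong(3,4)[of "?r a" "?r b"] cong_sym by (intro uc_cong; simp)+
  thus "kap (a + b) = kap a * kap b" "ell (a + b) = ell a * ell b"
    using Lambda_simps(3)[OF Uzero_closed(2)[of "?r a"] Uzero_closed(2)[of "?r b"]]
      Lambda_simps(3)[OF Uzero_closed(3)[of "?r a"] Uzero_closed(3)[of "?r b"]]
    by (simp_all add: kap_def ell_def UK_def UL_def gen_class restrict_weight_add del: mult_single)
  have "uc (gK 0) = uc 1" "uc (gL 0) = uc 1" using rel_cong(1,2) by (intro uc_cong; simp)+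
  thus "kap 0 = 1" "ell 0 = 1" using kap_eq[of 0] Lambda_simps(1) by simp_all
qed

lemma kap_ell_nz: "kap a \<noteq> 0" "ell a \<noteq> 0"
  using kap_ell_hom(1)[of a "- a"] kap_ell_hom(2)[of a "- a"] kap_ell_hom(3,4) by auto

sublocale verma_action N \<chi> kap ell
  by unfold_locales (rule kap_ell_hom kap_ell_nz)+

lemma rho_Uzero: assumes "z \<in> Uzero" shows "rho z 1 = sc (\<Lambda> (uc z)) 1"
proof -
  have w: "rho (mon z) 1 = sc (\<Lambda> (uc (mon z))) 1" if "z \<in> klwords N" for z
    using that
  proof (induction rule: klwords_induct)
    case Nil
    show ?case unfolding mon_Word_Nil by (simp add: Lambda_simps)
  next
    case (Cons g gs)
    have g: "act g 1 = sc (\<Lambda> (uc (gen g))) 1"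
      using Cons(1) act_K[OF VF_1] act_L[OF VF_1] kap_eq by (auto simp: kev_def lev_def simp del: act.simps)
    have gU: "gen g \<in> Uzero" using Cons(1) Uzero_closed(2,3) by auto
    have "rho (mon (Word (g # gs))) 1 = sc (\<Lambda> (uc (mon (Word gs)))) (act g 1)"
      unfolding mon_Word_Cons[of g gs] rho_mult Cons.IH rho_sc_right rho_gen ..
    also have "\<dots> = sc (\<Lambda> (uc (gen g * mon (Word gs)))) 1"
      unfolding Lambda_simps(3)[OF gU Uzero_closed(4)[OF Cons(2)]] g by (simp add: mult.commute)
    finally show ?case unfolding mon_Word_Cons[of g gs] .
  qed
  have "z \<in> Uzero \<and> rho z 1 = sc (\<Lambda> (uc z)) 1"
    using assms
  proof (induction rule: FA.span_induct_alt)
    case base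
    show ?case using Lambda_simps(4)[OF Uzero_closed(1), of 0] by (simp add: FA.span_zero)
  next
    case (step c x y)
    then obtain v where v: "v \<in> klwords N" "x = mon v" by auto
    have x: "x \<in> Uzero" using Uzero_closed(4) v by simp
    have "rho (sc c x + y) 1 = sc (\<Lambda> (uc (sc c x + y))) 1"
      using w[OF v(1)] v(2) step x
      by (simp add: rho_add rho_sc Lambda_simps FA.span_scale FA.scale_left_distrib del: rho_mon)
    thus ?case using step x by (simp add: FA.span_add FA.span_scale)
  qed
  thus ?thesis ..
qed

definition SV :: "'k walg set" where "SV = {x \<in> A. uc x \<in> Verma_ideal N \<chi> \<Lambda>}"

abbreviation Vgens :: "'k walg set set set" where
  "Vgens \<equiv> UE N \<chi> ` {1..N} \<union> {Z \<ominus>\<^bsub>U N \<chi>\<^esub> (\<Lambda> Z \<odot>\<^bsub>U N \<chi>\<^esub> \<one>\<^bsub>U N \<chi>\<^esub>) |Z. Z \<in> U_zero N \<chi>}"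

lemma Vgens_eq: "Vgens = uc ` (gE ` {1..N} \<union> (\<lambda>z. z - sc (\<Lambda> (uc z)) 1) ` Uzero)"
proof -
  have "uc z \<ominus>\<^bsub>U N \<chi>\<^esub> (\<Lambda> (uc z) \<odot>\<^bsub>U N \<chi>\<^esub> \<one>\<^bsub>U N \<chi>\<^esub>) = uc (z - sc (\<Lambda> (uc z)) 1)" if "z \<in> Uzero" for z
    using presents_a_minus[OF U_ring(1)] Uzero_A[OF that] by (simp add: U_ring(2) uc_sc)
  hence "{Z \<ominus>\<^bsub>U N \<chi>\<^esub> (\<Lambda> Z \<odot>\<^bsub>U N \<chi>\<^esub> \<one>\<^bsub>U N \<chi>\<^esub>) |Z. Z \<in> U_zero N \<chi>} = uc ` (\<lambda>z. z - sc (\<Lambda> (uc z)) 1) ` Uzero"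
    unfolding U_zero_eq by (auto simp: image_iff)
  thus ?thesis by (simp add: UE_def gen_class image_Un image_image)
qed

lemma radical_left_ideal: "left_ideal_set A radical"
  using radical_left subspace_additive[OF radical_subspace] by (auto simp: left_ideal_set_def radical_def)

lemma Verma_gens_radical: "gE ` {1..N} \<union> (\<lambda>z. z - sc (\<Lambda> (uc z)) 1) ` Uzero \<subseteq> radical"
proof -
  have "gE i \<in> radical" if "i \<in> {1..N}" for i
    by (rule radicalI) (use that act_E_1 in \<open>simp_all add: rho_gen del: act.simps\<close>)
  moreover have "z - sc (\<Lambda> (uc z)) 1 \<in> radical" if "z \<in> Uzero" for z
    by (rule radicalI) (use that Uzero_A rho_Uzero in \<open>simp_all add: rho_diff rho_sc\<close>)
  ultimately show ?thesis by blast
qed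

text \<open>\<open>Verma_ideal\<close> is an intersection of submodules, and the image of
  \<open>radical\<close> is one of them because the highest weight relations hold modulo
  \<open>radical\<close>. This shows that the family is nonempty and bounds the
  intersection.\<close>

lemma SV: "Verma_ideal N \<chi> \<Lambda> = uc ` SV" "left_ideal_set A SV" "RU \<subseteq> SV" "SV \<subseteq> radical"
  "i \<in> {1..N} \<Longrightarrow> gE i \<in> SV" "z \<in> Uzero \<Longrightarrow> z - sc (\<Lambda> (uc z)) 1 \<in> SV"
proof -
  let ?G = "gE ` {1..N} \<union> (\<lambda>z. z - sc (\<Lambda> (uc z)) 1) ` Uzero"
  note M = presents_module_regular
  define \<W> where "\<W> = {W. submodule W (U N \<chi>) (regular_module (U N \<chi>)) \<and> uc ` ?G \<subseteq> W}"
  have V: "Verma_ideal N \<chi> \<Lambda> = \<Inter>\<W>" unfolding Verma_ideal_def generated_left_ideal_def \<W>_def Vgens_eq ..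
  have R: "uc ` radical \<in> \<W>"
    using presents_module_submodule[OF M radical_left_ideal RU_radical] Verma_gens_radical by (auto simp: \<W>_def)
  have L: "left_ideal_set A {x \<in> A. uc x \<in> W}" "RU \<subseteq> {x \<in> A. uc x \<in> W}" if "W \<in> \<W>" for W
    using submodule_pullback[OF M, of W] that by (simp_all add: \<W>_def)
  have SVI: "SV = (\<Inter>W\<in>\<W>. {x \<in> A. uc x \<in> W})" using R by (auto simp: SV_def V)
  show "left_ideal_set A SV" unfolding SVI by (rule left_ideal_set_INT[OF L(1)]) (use R in auto)
  show "RU \<subseteq> SV" unfolding SVI using L(2) by blast
  have rad: "{x \<in> A. uc x \<in> uc ` radical} = radical"
  proof (intro equalityI subsetI)
    fix x assume "x \<in> {x \<in> A. uc x \<in> uc ` radical}"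
    then obtain y where y: "x \<in> A" "y \<in> radical" "uc x = uc y" by blast
    hence "y \<in> A" by (simp add: radical_def)
    hence "x - y \<in> radical" using U_add(7)[of x y] y RU_radical by blast
    from FA.subspace_add[OF radical_subspace this y(2)] show "x \<in> radical" by simp
  qed (auto simp: radical_def)
  show "SV \<subseteq> radical" unfolding SVI using R rad by blast
  have "\<Inter>\<W> \<subseteq> uc ` A" using R by (auto simp: radical_def)
  thus "Verma_ideal N \<chi> \<Lambda> = uc ` SV" by (auto simp: V SV_def)
  have "?G \<subseteq> A" using Verma_gens_radical by (auto simp: radical_def)
  thus "i \<in> {1..N} \<Longrightarrow> gE i \<in> SV" "z \<in> Uzero \<Longrightarrow> z - sc (\<Lambda> (uc z)) 1 \<in> SV"
    unfolding SV_def V \<W>_def by blast+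
qed

end

section \<open>The radical as the maximal proper graded submodule\<close>

lemma lookup_proj: "Poly_Mapping.lookup (proj \<mu> x) w = (if word_weight w = \<mu> then Poly_Mapping.lookup x w else 0)"
proof -
  have UNIV: "x \<in> FA.span (mon ` UNIV)" by (simp add: span_mon)
  thus ?thesis
    by (induction rule: FA.span_induct_alt)
      (auto simp: proj_add proj_sc proj_mon lookup_add sc_lookup lookup_single when_def split: if_splits)
qed

lemma proj_sum: assumes "finite B" "word_weight ` Poly_Mapping.keys x \<subseteq> B" shows "x = (\<Sum>\<mu>\<in>B. proj \<mu> x)"
proof (rule poly_mapping_eqI)
  fix w
  have "Poly_Mapping.lookup (\<Sum>\<mu>\<in>B. proj \<mu> x) w = (if word_weight w \<in> B then Poly_Mapping.lookup x w else 0)"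
    using assms(1) by (simp add: lookup_sum lookup_proj sum.delta')
  thus "Poly_Mapping.lookup x w = Poly_Mapping.lookup (\<Sum>\<mu>\<in>B. proj \<mu> x) w"
    using assms(2) by (cases "w \<in> Poly_Mapping.keys x") (auto simp: in_keys_iff)
qed

context verma_action
begin

lemma eps_weight: assumes "x \<in> Aw N \<nu>" "\<nu> \<noteq> 0" shows "eps x = 0"
  using VFw_lookup_0[OF rho_VFw[OF assms(1) VF_1]] assms(2) by (simp add: eps_def)

lemma Aw_mon_mult: "w \<in> words N \<Longrightarrow> x \<in> Aw N \<mu> \<Longrightarrow> mon w * x \<in> Aw N (word_weight w + \<mu>)"
  by (rule Aw_mult) (auto simp: Aw_def intro: FA.span_base)

lemma radical_words: assumes "x \<in> A" "\<And>w. w \<in> words N \<Longrightarrow> eps (mon w * x) = 0" shows "x \<in> radical"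
proof -
  have "eps (y * x) = 0" if "y \<in> A" for y
    using that unfolding Acar_span
    by (induction rule: FA.span_induct_alt) (use assms(2) in \<open>auto simp: distrib_right sc_mult_left eps_add eps_sc\<close>)
  thus ?thesis using assms(1) by (simp add: radical_def)
qed

lemma proj_VF_Aw: "x \<in> VF N \<Longrightarrow> proj \<mu> x \<in> Aw N \<mu>"
  using proj_VF[of x N \<mu>] VFw_Aw by blast

lemma proj_A: "x \<in> A \<Longrightarrow> proj \<mu> x \<in> Aw N \<mu>"
  unfolding Acar_span
  by (rule span_linear_mem[where f = "proj \<mu>" and W = "words N"])
    (auto simp: proj_add proj_sc proj_mon Aw_def FA.span_zero FA.subspace_span intro: FA.span_base)

text \<open>Pairing with a word \<open>w\<close> detects only the component of weight
  \<open>- word_weight w\<close>. So \<open>eps (mon w * proj \<mu> x)\<close> is either zero or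
  equal to \<open>eps (mon w * x)\<close>.\<close>

lemma radical_proj: assumes "x \<in> radical" shows "proj \<mu> x \<in> radical"
proof (rule radical_words)
  have xA: "x \<in> A" using assms by (simp add: radical_def)
  show "proj \<mu> x \<in> A" using graded_A(3)[OF proj_A[OF xA]] .
  fix w assume w: "w \<in> words N"
  show "eps (mon w * proj \<mu> x) = 0"
  proof (cases "word_weight w + \<mu> = 0")
    case False
    thus ?thesis by (rule eps_weight[OF Aw_mon_mult[OF w proj_A[OF xA]]])
  next
    case True
    define B where "B = insert \<mu> (word_weight ` Poly_Mapping.keys x)"
    have x: "x = (\<Sum>\<nu>\<in>B. proj \<nu> x)" by (rule proj_sum) (auto simp: B_def)
    have "eps (mon w * sum f B') = (\<Sum>\<nu>\<in>B'. eps (mon w * f \<nu>))" if "finite B'" for f :: "weight \<Rightarrow> 'k walg" and B'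
      using that by (induction B') (simp_all add: distrib_left eps_add)
    hence "eps (mon w * x) = (\<Sum>\<nu>\<in>B. eps (mon w * proj \<nu> x))" by (subst x) (simp add: B_def)
    also have "\<dots> = (\<Sum>\<nu>\<in>B. if \<nu> = \<mu> then eps (mon w * proj \<mu> x) else 0)"
    proof (intro sum.cong refl)
      fix \<nu>
      show "eps (mon w * proj \<nu> x) = (if \<nu> = \<mu> then eps (mon w * proj \<mu> x) else 0)"
      proof (cases "\<nu> = \<mu>")
        case False
        hence "word_weight w + \<nu> \<noteq> 0" using True by (metis add_left_cancel)
        thus ?thesis using eps_weight[OF Aw_mon_mult[OF w proj_A[OF xA]]] False by simp
      qed simp
    qed
    also have "\<dots> = eps (mon w * proj \<mu> x)" by (simp add: B_def sum.delta')
    finally show ?thesis using assms w by (simp add: radical_def)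
  qed
qed

end

context highest_weight
begin

lemmas SV_left = left_ideal_setD[OF SV(2)]

lemma RI_SV: "x \<in> RI \<Longrightarrow> x \<in> SV" using RI_RU SV(3) by blast

lemma SV_trans: "x - y \<in> SV \<Longrightarrow> y - z \<in> SV \<Longrightarrow> x - z \<in> SV"
  using SV_left(4)[of "x - y" "y - z"] by simp

lemma cong_SV: "x \<approx> y \<Longrightarrow> x - y \<in> SV" using RI_SV by (simp add: cong_def)

lemma SV_subspace: "FA.subspace SV"
proof (rule FA.subspaceI)
  fix x c assume "x \<in> SV"
  thus "sc c x \<in> SV" using SV_left(3)[of "sc c 1" x] by (simp add: sc_one_mult)
qed (use SV_left in auto)

text \<open>For a torus generator \<open>g\<close>, \<open>g - \<Lambda> g\<close> lies in the left
  ideal \<open>SV\<close>, hence so does its product with \<open>u\<close> on the left; commuting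
  \<open>g\<close> past \<open>u\<close> produces the remaining factor of the eigenvalue.\<close>

lemma K_act_SV:
  assumes a: "a \<in> ZPi N" and u: "u \<in> VFw N \<mu>"
  shows "gK a * u - act (GenK a) u \<in> SV" "gL a * u - act (GenL a) u \<in> SV"
proof -
  have uw: "u \<in> Aw N \<mu>" using u VFw_Aw by blast
  have uA: "u \<in> A" using graded_A(3)[OF uw] .
  have step: "g * u - sc (c * d) u \<in> SV" if g: "g \<in> Uzero" "\<Lambda> (uc g) = d" "g * u \<approx> sc c (u * g)" for g c d
  proof -
    have "u * (g - sc d 1) \<in> SV" using SV_left(3)[OF uA SV(6)[OF g(1)]] g(2) by simp
    hence "sc c (u * (g - sc d 1)) \<in> SV" by (rule FA.subspace_scale[OF SV_subspace])
    moreover have "sc c (u * (g - sc d 1)) = sc c (u * g) - sc (c * d) u"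
      by (simp add: right_diff_distrib sc_mult_right FA.scale_right_diff_distrib)
    ultimately show ?thesis using SV_trans[OF cong_SV[OF g(3)]] by simp
  qed
  show "gK a * u - act (GenK a) u \<in> SV"
    unfolding act_K[OF u] kev_def using step[OF Uzero_closed(2)[OF a] _ K_move(1)[OF uw a]] kap_eq(1)[OF a]
    by (simp add: mult.commute)
  show "gL a * u - act (GenL a) u \<in> SV"
    unfolding act_L[OF u] lev_def using step[OF Uzero_closed(3)[OF a] _ K_move(2)[OF uw a]] kap_eq(2)[OF a]
    by (simp add: divide_inverse mult.commute)
qed

lemma E_act_SV:
  assumes "w \<in> fwords N" and i: "i \<in> {1..N}"
  shows "gE i * mon w - act (GenE i) (mon w) \<in> SV"
  using assms(1)
proof (induction rule: fwords_induct)
  case Nil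
  show ?case using SV(5)[OF i] act_E_1 unfolding mon_Word_Nil by (simp del: act.simps)
next
  case (Cons j gs)
  let ?u = "mon (Word gs) :: 'k walg"
  have uw: "?u \<in> VFw N (word_weight (Word gs))"
    unfolding VFw_def using Cons(2) by (intro FA.span_base) auto
  have uA: "?u \<in> A" using graded_A(2)[OF uw] .
  have F: "gF j \<in> A" using Cons(1) by simp
  have act: "act (GenE i) (mon (Word (GenF j # gs))) =
      gF j * act (GenE i) ?u + (if i = j then act (GenL (\<alpha> i)) ?u - act (GenK (\<alpha> i)) ?u else 0)"
    unfolding act_K[OF uw] act_L[OF uw] by (simp add: FA.scale_left_diff_distrib)
  have 1: "(gE i * gF j) * ?u - (gF j * gE i + (if i = j then gL (\<alpha> i) - gK (\<alpha> i) else 0)) * ?u \<in> SV"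
    by (rule cong_SV[OF cong_mult_right[OF uA rel_cong(10)[OF i Cons(1)]]])
  have 2: "gF j * (gE i * ?u - act (GenE i) ?u) \<in> SV" by (rule SV_left(3)[OF F Cons.IH])
  have 3: "(if i = j then (gL (\<alpha> i) * ?u - act (GenL (\<alpha> i)) ?u) - (gK (\<alpha> i) * ?u - act (GenK (\<alpha> i)) ?u) else 0) \<in> SV"
    using SV_left(5)[OF K_act_SV(2)[OF ZPi_closed(5)[OF i] uw] K_act_SV(1)[OF ZPi_closed(5)[OF i] uw]] SV_left(6) by (cases "i = j") (simp_all only: if_True if_False simp_thms)
  have "gE i * mon (Word (GenF j # gs)) - act (GenE i) (mon (Word (GenF j # gs))) =
    ((gE i * gF j) * ?u - (gF j * gE i + (if i = j then gL (\<alpha> i) - gK (\<alpha> i) else 0)) * ?u) +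
    (gF j * (gE i * ?u - act (GenE i) ?u) +
     (if i = j then (gL (\<alpha> i) * ?u - act (GenL (\<alpha> i)) ?u) - (gK (\<alpha> i) * ?u - act (GenK (\<alpha> i)) ?u) else 0))"
    unfolding act unfolding mon_Word_Cons[of "GenF j" gs]
    by (cases "i = j") (simp_all only: if_True if_False simp_thms left_diff_distrib right_diff_distrib distrib_left distrib_right mult.assoc
      add_0_right add_0_left diff_add_eq diff_diff_eq add.assoc ac_simps, simp_all add: algebra_simps del: act.simps mult_single)
  thus ?case using SV_left(4)[OF 1 SV_left(4)[OF 2 3]] by simp
qed

lemma gen_act_SV:
  assumes g: "g \<in> generators N" and u: "u \<in> VF N"
  shows "gen g * u - act g u \<in> SV"
proof -
  have w: "gen g * mon w - act g (mon w) \<in> SV" if w: "w \<in> fwords N" for w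
  proof -
    have u: "mon w \<in> VFw N (word_weight w)" unfolding VFw_def using w by (intro FA.span_base) auto
    show ?thesis
      using g
    proof (cases g)
      case (GenF j)
      thus ?thesis using SV_left(6) by simp
    qed (use K_act_SV[OF _ u] E_act_SV[OF w] in \<open>auto simp del: act.simps mult_single\<close>)
  qed
  show ?thesis
    by (rule span_linear_mem[where f = "\<lambda>u. gen g * u - act g u", OF _ _ w SV_subspace u[unfolded VF_def]])
      (simp_all add: distrib_left act_add sc_mult_right act_sc FA.scale_right_diff_distrib)
qed

text \<open>This identifies the Verma module defined as a quotient with the concrete one: every
  class modulo \<open>SV\<close> has the representative \<open>rho x 1\<close> in
  \<open>VF N\<close>.\<close>

lemma act_SV: assumes "x \<in> A" and u: "u \<in> VF N" shows "x * u - rho x u \<in> SV"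
proof -
  have "Word gs \<in> words N \<Longrightarrow> mon (Word gs) * u - rho (mon (Word gs)) u \<in> SV" for gs
  proof (induction gs)
    case Nil
    show ?case unfolding mon_Word_Nil using SV_left(6) by simp
  next
    case (Cons g gs)
    hence g: "g \<in> generators N" "Word gs \<in> words N" by (simp_all add: words_simps del: generators.simps)
    have v: "rho (mon (Word gs)) u \<in> VF N" by (rule rho_VF[OF _ u]) (use g(2) in simp)
    have "gen g * (mon (Word gs) * u - rho (mon (Word gs)) u) + (gen g * rho (mon (Word gs)) u - act g (rho (mon (Word gs)) u)) \<in> SV"
      by (rule SV_left(4)[OF SV_left(3)[OF gen_Acar[OF g(1)] Cons.IH[OF g(2)]] gen_act_SV[OF g(1) v]])
    thus ?case unfolding mon_Word_Cons[of g gs] rho_mult rho_gen by (simp add: right_diff_distrib mult.assoc del: mult_single act.simps rho_mon)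
  qed
  hence w: "mon w * u - rho (mon w) u \<in> SV" if "w \<in> words N" for w using that by (cases w) blast
  show ?thesis
    by (rule span_linear_mem[where f = "\<lambda>x. x * u - rho x u", OF _ _ w SV_subspace assms(1)[unfolded Acar_span]])
      (simp_all add: distrib_right rho_add sc_mult_left rho_sc FA.scale_right_diff_distrib)
qed

lemma act_SV_1: "x \<in> A \<Longrightarrow> x - rho x 1 \<in> SV" using act_SV[OF _ VF_1', of x] by simp

abbreviation vc :: "'k walg \<Rightarrow> 'k walg set set set" where
  "vc x \<equiv> Verma_ideal N \<chi> \<Lambda> +>\<^bsub>regular_module (U N \<chi>)\<^esub> uc x"

lemma presents_Verma: "presents_module (Verma N \<chi> \<Lambda>) vc SV"
  unfolding Verma_def SV(1) by (rule presents_module_quot[OF presents_module_regular SV(2,3)])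

lemmas Verma_add = presentsD[OF conjunct1[OF presents_Verma[unfolded presents_module_def]]]

lemma Verma_smult: "a \<in> A \<Longrightarrow> x \<in> A \<Longrightarrow> uc a \<odot>\<^bsub>Verma N \<chi> \<Lambda>\<^esub> vc x = vc (a * x)"
  using presents_Verma by (simp add: presents_module_def)

lemma Verma_vector_eq: "Verma_vector N \<chi> \<Lambda> = vc 1"
  by (simp add: Verma_vector_def U_ring(2) a_r_coset_def r_coset_def regular_module_def with_smult_def)

lemma Verma_component_eq: "Verma_component N \<chi> \<Lambda> b = {vc x |x. x \<in> VF N \<and> (\<exists>y\<in>Aw N b. uc x = uc y)}"
proof -
  have "uc x \<odot>\<^bsub>Verma N \<chi> \<Lambda>\<^esub> vc 1 = vc x" if "x \<in> VF N" for x
    using Verma_smult[OF graded_A(1)[OF that], of 1] by simp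
  thus ?thesis unfolding Verma_component_def Verma_vector_eq U_minus_eq U_component_eq by (auto simp: image_iff)
qed

abbreviation Vs :: "('k, 'k walg set set set) module" where
  "Vs \<equiv> underlying_space (U N \<chi>) (Verma N \<chi> \<Lambda>)"

lemma vc_eq: "x \<in> A \<Longrightarrow> y \<in> A \<Longrightarrow> vc x = vc y \<longleftrightarrow> x - y \<in> SV"
  by (rule Verma_add(7))

lemma radical_A: "x \<in> radical \<Longrightarrow> x \<in> A" by (simp add: radical_def)

lemma radical_vc_iff: "x \<in> A \<Longrightarrow> vc x \<in> vc ` radical \<longleftrightarrow> x \<in> radical"
proof
  assume x: "x \<in> A" and "vc x \<in> vc ` radical"
  then obtain y where y: "y \<in> radical" "vc x = vc y" by blast
  hence "x - y \<in> radical" using vc_eq[OF x radical_A[OF y(1)]] SV(4) by blast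
  from FA.subspace_add[OF radical_subspace this y(1)] show "x \<in> radical" by simp
qed blast

lemma radical_submodule: "submodule (vc ` radical) (U N \<chi>) (Verma N \<chi> \<Lambda>)"
  by (rule presents_module_submodule[OF presents_Verma radical_left_ideal SV(4)])

lemma kspan_radical: "kspan Vs (vc ` G) \<subseteq> vc ` radical" if G: "G \<subseteq> radical"
proof -
  have "FA.span G \<subseteq> radical" by (rule FA.span_minimal[OF G radical_subspace])
  thus ?thesis using kspan_image[OF presents_module_space[OF presents_Verma], of G] G radical_A by blast
qed

text \<open>The representative \<open>rho x 1\<close> is a combination of words in the
  \<open>F_i\<close>, so its homogeneous components define elements of
  \<open>Verma_component\<close>; by \<open>radical_proj\<close> they stay in the radical.\<close>

lemma radical_graded: "graded_submodule N \<chi> \<Lambda> (vc ` radical)"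
  unfolding graded_submodule_def
proof (intro conjI radical_submodule equalityI)
  let ?W = "vc ` radical"
  define H where "H = (\<Union>b\<in>ZPi N. ?W \<inter> Verma_component N \<chi> \<Lambda> b)"
  define G where "G = {x \<in> radical. vc x \<in> H}"
  have HT: "H = vc ` G" by (auto simp: H_def G_def)
  have TA: "G \<subseteq> A" using radical_A by (auto simp: G_def)
  have ks: "kspan Vs H = vc ` FA.span G"
    unfolding HT by (rule kspan_image[OF presents_module_space[OF presents_Verma] TA])
  have "?W \<subseteq> kspan Vs H"
    unfolding ks
  proof (rule image_subsetI)
    fix x assume x: "x \<in> radical"
    define u where "u = rho x 1"
    have xA: "x \<in> A" using radical_A[OF x] .
    have u: "u \<in> VF N" unfolding u_def by (rule rho_VF[OF xA VF_1'])
    have uA: "u \<in> A" using graded_A(1)[OF u] .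
    have xu: "x - u \<in> SV" unfolding u_def by (rule act_SV_1[OF xA])
    have ur: "u \<in> radical" using FA.subspace_diff[OF radical_subspace x subsetD[OF SV(4) xu]] by simp
    define B where "B = word_weight ` Poly_Mapping.keys u"
    have "proj b u \<in> G" if b: "b \<in> B" for b
    proof -
      have "Poly_Mapping.keys u \<subseteq> fwords N" using u by (simp add: VF_def span_mon)
      hence bZ: "b \<in> ZPi N" using b word_weight_ZPi fwords_words by (auto simp: B_def)
      have p: "proj b u \<in> radical" by (rule radical_proj[OF ur])
      have "proj b u \<in> VF N" using proj_VF[OF u] VFw_VF by blast
      hence "vc (proj b u) \<in> Verma_component N \<chi> \<Lambda> b"
        unfolding Verma_component_eq using proj_VF_Aw[OF u] by blast
      thus ?thesis using p bZ by (auto simp: G_def H_def)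
    qed
    hence "(\<Sum>b\<in>B. proj b u) \<in> FA.span G" by (intro FA.span_sum FA.span_base)
    moreover have "u = (\<Sum>b\<in>B. proj b u)" by (rule proj_sum) (auto simp: B_def)
    ultimately have "u \<in> FA.span G" by simp
    moreover have "vc x = vc u" using vc_eq[OF xA uA] xu by simp
    ultimately show "vc x \<in> vc ` FA.span G" by blast
  qed
  thus "?W \<subseteq> kspan Vs (\<Union>b\<in>ZPi N. ?W \<inter> Verma_component N \<chi> \<Lambda> b)" by (simp add: H_def)
  have "kspan Vs H \<subseteq> ?W" unfolding HT by (rule kspan_radical) (auto simp: G_def)
  thus "kspan Vs (\<Union>b\<in>ZPi N. ?W \<inter> Verma_component N \<chi> \<Lambda> b) \<subseteq> ?W" by (simp add: H_def)
qed

lemma radical_proper: "vc ` radical \<noteq> carrier (Verma N \<chi> \<Lambda>)"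
proof
  assume "vc ` radical = carrier (Verma N \<chi> \<Lambda>)"
  hence "vc 1 \<in> vc ` radical" by (simp add: Verma_add(4))
  thus False using radical_vc_iff[of 1] one_notin_radical by simp
qed

text \<open>If a homogeneous element \<open>y\<close> of \<open>W\<close> lay outside the radical,
  some word \<open>w\<close> would carry it to weight zero with nonzero \<open>eps\<close>. Modulo
  \<open>SV\<close> the result is a nonzero multiple of the highest weight vector, which generates
  everything.\<close>

lemma graded_proper_radical:
  assumes W: "graded_submodule N \<chi> \<Lambda> W" and proper: "W \<noteq> carrier (Verma N \<chi> \<Lambda>)"
  shows "W \<subseteq> vc ` radical"
proof -
  define S where "S = {x \<in> A. vc x \<in> W}"
  have sub: "submodule W (U N \<chi>) (Verma N \<chi> \<Lambda>)"
    and gr: "W = kspan Vs (\<Union>b\<in>ZPi N. W \<inter> Verma_component N \<chi> \<Lambda> b)"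
    using W by (auto simp: graded_submodule_def)
  note pb = submodule_pullback[OF presents_Verma sub, folded S_def]
  note L = left_ideal_setD[OF pb(2)]
  have one: "1 \<notin> S"
  proof
    assume "1 \<in> S"
    hence "A \<subseteq> S" using L(3)[of _ 1] by auto
    hence "S = A" using L(2) by blast
    thus False using proper pb(1) by (simp add: Verma_add(4))
  qed
  have hom: "C \<in> vc ` radical" if C: "C \<in> W" "C \<in> Verma_component N \<chi> \<Lambda> b" for C b
  proof -
    obtain x y where xy: "C = vc x" "x \<in> VF N" "y \<in> Aw N b" "uc x = uc y"
      using C(2) unfolding Verma_component_eq by blast
    have yA: "y \<in> A" using graded_A(3)[OF xy(3)] .
    have Cy: "C = vc y" using xy by simp
    have yS: "y \<in> S" using yA C(1) Cy by (simp add: S_def)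
    have "y \<in> radical"
    proof (rule radical_words[OF yA])
      fix w assume w: "w \<in> words N"
      let ?z = "mon w * y"
      show "eps ?z = 0"
      proof (rule ccontr)
        assume e: "eps ?z \<noteq> 0"
        have zw: "?z \<in> Aw N (word_weight w + b)" by (rule Aw_mon_mult[OF w xy(3)])
        hence "word_weight w + b = 0" using eps_weight e by blast
        hence z0: "?z \<in> Aw N 0" using zw by simp
        have "rho ?z 1 \<in> VFw N 0" using rho_VFw[OF z0 VF_1] by simp
        from VFw_0[OF this] have r: "rho ?z 1 = sc (eps ?z) 1" by (simp add: eps_def)
        have zS: "?z \<in> S" by (rule L(3)[OF _ yS]) (use w in simp)
        have zA: "?z \<in> A" using L(2) zS by blast
        have "?z - (?z - sc (eps ?z) 1) \<in> S"
          by (rule L(5)[OF zS]) (use act_SV_1[OF zA] pb(3) r in auto)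
        hence "sc (eps ?z) 1 \<in> S" by simp
        from L(3)[OF _ this, of "sc (inverse (eps ?z)) 1"] have "1 \<in> S" using e by (simp add: sc_one_mult)
        thus False using one by blast
      qed
    qed
    thus ?thesis using Cy by blast
  qed
  define G where "G = {x \<in> radical. vc x \<in> (\<Union>b\<in>ZPi N. W \<inter> Verma_component N \<chi> \<Lambda> b)}"
  have eq: "(\<Union>b\<in>ZPi N. W \<inter> Verma_component N \<chi> \<Lambda> b) = vc ` G" using hom unfolding G_def by blast
  have "G \<subseteq> radical" by (auto simp: G_def)
  from kspan_radical[OF this] show ?thesis unfolding gr[unfolded eq, symmetric] .
qed

lemma maximal_graded_submodule_eq: "maximal_graded_submodule N \<chi> \<Lambda> = vc ` radical"
  unfolding maximal_graded_submodule_def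
proof (rule the_equality)
  show "graded_submodule N \<chi> \<Lambda> (vc ` radical) \<and> vc ` radical \<noteq> carrier (Verma N \<chi> \<Lambda>) \<and>
    (\<forall>W'. graded_submodule N \<chi> \<Lambda> W' \<and> W' \<noteq> carrier (Verma N \<chi> \<Lambda>) \<longrightarrow> W' \<subseteq> vc ` radical)"
    using radical_graded radical_proper graded_proper_radical by blast
next
  fix W assume "graded_submodule N \<chi> \<Lambda> W \<and> W \<noteq> carrier (Verma N \<chi> \<Lambda>) \<and>
    (\<forall>W'. graded_submodule N \<chi> \<Lambda> W' \<and> W' \<noteq> carrier (Verma N \<chi> \<Lambda>) \<longrightarrow> W' \<subseteq> W)"
  thus "W = vc ` radical" using radical_graded radical_proper graded_proper_radical by blast
qed

lemma simple_module_finite_dimensional: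
  "finite_dimensional (underlying_space (U N \<chi>) (simple_module N \<chi> \<Lambda>)) \<longleftrightarrow>
     (\<exists>G. finite G \<and> G \<subseteq> A \<and> (\<forall>x\<in>A. \<exists>t\<in>FA.span G. x - t \<in> radical))"
proof -
  have "presents_module (simple_module N \<chi> \<Lambda>)
    (\<lambda>x. vc ` radical +>\<^bsub>Verma N \<chi> \<Lambda>\<^esub> vc x) radical"
    unfolding simple_module_def maximal_graded_submodule_eq
    by (rule presents_module_quot[OF presents_Verma radical_left_ideal SV(4)])
  from finite_dimensional_iff[OF presents_module_space[OF this]] show ?thesis .
qed

end

subsection \<open>Irreducible graded representations\<close>

text \<open>Holds what survives a change of base: weight spaces, torus operators and characters.
  Since the weights form a ring, integer multiples can be written \<open>of_nat n * \<beta>\<close>;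
  for the root lattice the product is convolution.\<close>

locale graded_rep = vector_space scale
  for scale :: "'k::field_char_0 \<Rightarrow> 'v::ab_group_add \<Rightarrow> 'v" (infixr \<open>*s\<close> 75) +
  fixes Lw :: "'w::comm_ring_1 \<Rightarrow> 'v set"
    and KK LL :: "'w \<Rightarrow> 'v \<Rightarrow> 'v"
    and \<chi> :: "'w \<Rightarrow> 'w \<Rightarrow> 'k"
    and \<kappa> \<eta> :: "'w \<Rightarrow> 'k"
  assumes subspace_Lw: "subspace (Lw \<mu>)"
    and KK_add: "KK a (x + y) = KK a x + KK a y" and KK_scale: "KK a (c *s x) = c *s KK a x"
    and LL_add: "LL a (x + y) = LL a x + LL a y" and LL_scale: "LL a (c *s x) = c *s LL a x"
    and KK_eigen: "x \<in> Lw \<mu> \<Longrightarrow> KK a x = (\<kappa> a * \<chi> a \<mu>) *s x"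
    and LL_eigen: "x \<in> Lw \<mu> \<Longrightarrow> LL a x = (\<eta> a / \<chi> \<mu> a) *s x"
    and chi_add_left: "\<chi> (a + b) d = \<chi> a d * \<chi> b d"
    and chi_add_right: "\<chi> a (b + d) = \<chi> a b * \<chi> a d"
    and chi_nz: "\<chi> a b \<noteq> 0"
    and kappa_add: "\<kappa> (a + b) = \<kappa> a * \<kappa> b" and kappa_nz: "\<kappa> a \<noteq> 0"
    and ell_add: "\<eta> (a + b) = \<eta> a * \<eta> b" and ell_nz: "\<eta> a \<noteq> 0"
begin

lemma chi_0 [simp]: "\<chi> 0 a = 1" "\<chi> a 0 = 1"
proof -
  have "\<chi> 0 a * \<chi> 0 a = \<chi> 0 a" using chi_add_left[of 0 0 a] by simp
  thus "\<chi> 0 a = 1" using chi_nz[of 0 a] by simp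
  have "\<chi> a 0 * \<chi> a 0 = \<chi> a 0" using chi_add_right[of a 0 0] by simp
  thus "\<chi> a 0 = 1" using chi_nz[of a 0] by simp
qed

lemma chi_minus: "\<chi> (- a) b = inverse (\<chi> a b)" "\<chi> a (- b) = inverse (\<chi> a b)"
proof -
  have "\<chi> a b * \<chi> (- a) b = 1" using chi_add_left[of a "-a" b] by simp
  thus "\<chi> (- a) b = inverse (\<chi> a b)" using inverse_unique by metis
  have "\<chi> a b * \<chi> a (- b) = 1" using chi_add_right[of a b "-b"] by simp
  thus "\<chi> a (- b) = inverse (\<chi> a b)" using inverse_unique by metis
qed

lemma chi_diff: "\<chi> (a - b) c = \<chi> a c / \<chi> b c" "\<chi> c (a - b) = \<chi> c a / \<chi> c b"
  using chi_add_left[of a "-b" c] chi_add_right[of c a "-b"]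
  by (auto simp: chi_minus divide_inverse)

lemma kappa_0 [simp]: "\<kappa> 0 = 1" and ell_0 [simp]: "\<eta> 0 = 1"
  using kappa_add[of 0 0] kappa_nz[of 0] ell_add[of 0 0] ell_nz[of 0] by auto

lemma kappa_minus: "\<kappa> (- a) = inverse (\<kappa> a)" and ell_minus: "\<eta> (- a) = inverse (\<eta> a)"
  using kappa_add[of a "-a"] ell_add[of a "-a"] inverse_unique by (metis add.right_inverse kappa_0 ell_0)+

lemma LL_0 [simp]: "LL a 0 = 0"
  using LL_scale[of a 0 0] by simp

lemma zero_Lw [simp]: "0 \<in> Lw \<mu>" by (rule subspace_0[OF subspace_Lw])
lemma diff_Lw: "x \<in> Lw \<mu> \<Longrightarrow> y \<in> Lw \<mu> \<Longrightarrow> x - y \<in> Lw \<mu>" by (rule subspace_diff[OF subspace_Lw])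
lemma scale_Lw: "x \<in> Lw \<mu> \<Longrightarrow> c *s x \<in> Lw \<mu>" by (rule subspace_scale[OF subspace_Lw])

lemma KK_Lw: "x \<in> Lw \<mu> \<Longrightarrow> KK a x \<in> Lw \<mu>" by (simp add: KK_eigen scale_Lw)
lemma LL_Lw: "x \<in> Lw \<mu> \<Longrightarrow> LL a x \<in> Lw \<mu>" by (simp add: LL_eigen scale_Lw)

definition qform :: "'w \<Rightarrow> 'w \<Rightarrow> 'k" where "qform a b = \<chi> a b * \<chi> b a"

text \<open>The eigenvalue of \<open>K\<^sub>a L\<^sub>-\<^sub>a\<close> on the weight space of weight \<open>\<mu>\<close>.\<close>

definition lam :: "'w \<Rightarrow> 'w \<Rightarrow> 'k" where "lam a \<mu> = \<kappa> a / \<eta> a * qform a \<mu>"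

lemma qform_commute: "qform a b = qform b a" by (simp add: qform_def)
lemma qform_add: "qform (a + b) c = qform a c * qform b c" "qform a (b + c) = qform a b * qform a c"
  by (simp_all add: qform_def chi_add_left chi_add_right)
lemma qform_0 [simp]: "qform 0 a = 1" "qform a 0 = 1" by (simp_all add: qform_def)
lemma qform_minus: "qform (- a) b = inverse (qform a b)" "qform a (- b) = inverse (qform a b)"
  by (simp_all add: qform_def chi_minus)
lemma qform_diff: "qform (a - b) c = qform a c / qform b c" "qform c (a - b) = qform c a / qform c b"
  by (simp_all add: qform_def chi_diff)
lemma lam_add: "lam (a + b) \<mu> = lam a \<mu> * lam b \<mu>"
  by (simp add: lam_def kappa_add ell_add qform_add)
lemma lam_shift: "lam a (\<mu> + \<nu>) = lam a \<mu> * qform a \<nu>"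
  by (simp add: lam_def qform_add)
lemma lam_shift_diff: "lam a (\<mu> - \<nu>) = lam a \<mu> / qform a \<nu>"
  by (simp add: lam_def qform_diff)

end

text \<open>An irreducible graded highest weight module with respect to the base
  \<open>\<beta>\<close>, with positivity measured by \<open>h\<close>. Irreducibility speaks of
  families \<open>W\<close> of subspaces of the weight spaces stable under all \<open>E i\<close>
  and \<open>F i\<close>; the torus acts on such families by scalars. The base is a parameter, so
  that an odd reflection gives a second instance on the same weight spaces.\<close>

locale chamber = graded_rep scale Lw KK LL \<chi> \<kappa> \<eta>
  for scale :: "'k::field_char_0 \<Rightarrow> 'v::ab_group_add \<Rightarrow> 'v" (infixr \<open>*s\<close> 75)
    and Lw :: "'w::comm_ring_1 \<Rightarrow> 'v set"
    and KK LL :: "'w \<Rightarrow> 'v \<Rightarrow> 'v"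
    and \<chi> :: "'w \<Rightarrow> 'w \<Rightarrow> 'k"
    and \<kappa> \<eta> :: "'w \<Rightarrow> 'k" +
  fixes I :: "nat set" and \<beta> :: "nat \<Rightarrow> 'w" and E F :: "nat \<Rightarrow> 'v \<Rightarrow> 'v"
    and h :: "'w \<Rightarrow> int" and v :: 'v and \<mu>0 :: 'w
  assumes E_add: "i \<in> I \<Longrightarrow> E i (x + y) = E i x + E i y" and E_scale: "i \<in> I \<Longrightarrow> E i (c *s x) = c *s E i x"
    and F_add: "i \<in> I \<Longrightarrow> F i (x + y) = F i x + F i y" and F_scale: "i \<in> I \<Longrightarrow> F i (c *s x) = c *s F i x"
    and E_Lw: "i \<in> I \<Longrightarrow> x \<in> Lw \<mu> \<Longrightarrow> E i x \<in> Lw (\<mu> + \<beta> i)"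
    and F_Lw: "i \<in> I \<Longrightarrow> x \<in> Lw \<mu> \<Longrightarrow> F i x \<in> Lw (\<mu> - \<beta> i)"
    and EF: "i \<in> I \<Longrightarrow> j \<in> I \<Longrightarrow> x \<in> Lw \<mu> \<Longrightarrow>
      E i (F j x) = F j (E i x) + (if i = j then LL (\<beta> i) x - KK (\<beta> i) x else 0)"
    and h_add: "h (a + b) = h a + h b" and h_pos: "i \<in> I \<Longrightarrow> 0 < h (\<beta> i)"
    and v_Lw: "v \<in> Lw \<mu>0" and v_nz: "v \<noteq> 0" and E_v: "i \<in> I \<Longrightarrow> E i v = 0"
    and irreducible: "\<And>W. (\<And>\<mu>. subspace (W \<mu>)) \<Longrightarrow> (\<And>\<mu>. W \<mu> \<subseteq> Lw \<mu>) \<Longrightarrow>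
      (\<And>i \<mu> x. i \<in> I \<Longrightarrow> x \<in> W \<mu> \<Longrightarrow> E i x \<in> W (\<mu> + \<beta> i) \<and> F i x \<in> W (\<mu> - \<beta> i)) \<Longrightarrow>
      (\<exists>\<mu>. \<exists>x \<in> W \<mu>. x \<noteq> 0) \<Longrightarrow> W \<nu> = Lw \<nu>"
begin

lemma E_0 [simp]: "i \<in> I \<Longrightarrow> E i 0 = 0" using E_scale[of i 0 0] by simp
lemma F_0 [simp]: "i \<in> I \<Longrightarrow> F i 0 = 0" using F_scale[of i 0 0] by simp
lemma E_diff: "i \<in> I \<Longrightarrow> E i (x - y) = E i x - E i y"
  using E_add[of i x "(-1) *s y"] E_scale[of i "-1" y] by simp
lemma F_diff: "i \<in> I \<Longrightarrow> F i (x - y) = F i x - F i y"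
  using F_add[of i x "(-1) *s y"] F_scale[of i "-1" y] by simp

lemma h_0 [simp]: "h 0 = 0" using h_add[of 0 0] by simp
lemma h_minus: "h (- a) = - h a" using h_add[of a "-a"] by simp
lemma h_diff: "h (a - b) = h a - h b" using h_add[of a "-b"] h_minus by simp

lemma EF_same:
  assumes "i \<in> I" "x \<in> Lw \<mu>"
  shows "E i (F i x) = F i (E i x) + (\<eta> (\<beta> i) / \<chi> \<mu> (\<beta> i) - \<kappa> (\<beta> i) * \<chi> (\<beta> i) \<mu>) *s x"
  using EF[OF assms(1) assms(1) assms(2)] assms by (simp add: KK_eigen LL_eigen scale_left_diff_distrib)

lemma EF_other: "i \<in> I \<Longrightarrow> j \<in> I \<Longrightarrow> i \<noteq> j \<Longrightarrow> x \<in> Lw \<mu> \<Longrightarrow> E i (F j x) = F j (E i x)"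
  using EF[of i j x \<mu>] by simp

definition wt :: "nat list \<Rightarrow> 'w" where "wt w = sum_list (map \<beta> w)"

lemma wt_simps [simp]: "wt [] = 0" "wt (i # w) = \<beta> i + wt w" "wt (u @ w) = wt u + wt w"
  by (simp_all add: wt_def)

lemma h_wt: "set w \<subseteq> I \<Longrightarrow> 0 \<le> h (wt w) \<and> (h (wt w) = 0 \<longrightarrow> w = [])"
proof (induction w)
  case (Cons i w)
  thus ?case using h_pos[of i] by (auto simp: h_add)
qed simp

lemma foldr_F_Lw: "set w \<subseteq> I \<Longrightarrow> x \<in> Lw \<mu> \<Longrightarrow> foldr F w x \<in> Lw (\<mu> - wt w)"
proof (induction w)
  case (Cons i w)
  hence "F i (foldr F w x) \<in> Lw (\<mu> - wt w - \<beta> i)" by (intro F_Lw) auto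
  thus ?case by (simp add: algebra_simps)
qed simp

text \<open>The span of all words in the \<open>F i\<close> applied to \<open>x\<close> is stable
  under the \<open>E i\<close>, which can be commuted to the right until they kill \<open>x\<close>.
  It is nonzero, so irreducibility makes it everything.\<close>

lemma singular_generates:
  assumes x: "x \<in> Lw \<mu>" "x \<noteq> 0" "\<And>i. i \<in> I \<Longrightarrow> E i x = 0"
  shows "Lw \<nu> = span {foldr F w x |w. set w \<subseteq> I \<and> \<nu> = \<mu> - wt w}"
proof -
  define W where "W \<nu> = span {foldr F w x |w. set w \<subseteq> I \<and> \<nu> = \<mu> - wt w}" for \<nu>
  have sub: "W \<nu> \<subseteq> Lw \<nu>" for \<nu>
    unfolding W_def by (rule span_minimal) (auto intro: foldr_F_Lw x subspace_Lw)
  have F: "F i y \<in> W (\<nu> - \<beta> i)" if i: "i \<in> I" and y: "y \<in> W \<nu>" for i y \<nu>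
    using y unfolding W_def
  proof (induction rule: span_induct_alt)
    case base
    show ?case using i by (simp add: span_zero)
  next
    case (step c y z)
    then obtain w where w: "set w \<subseteq> I" "\<nu> = \<mu> - wt w" "y = foldr F w x" by auto
    have "F i y \<in> span {foldr F w x |w. set w \<subseteq> I \<and> \<nu> - \<beta> i = \<mu> - wt w}"
      by (rule span_base) (use w i in \<open>auto intro!: exI[of _ "i # w"] simp: algebra_simps\<close>)
    thus ?case using step i by (simp add: F_add F_scale span_add span_scale)
  qed
  have base: "E i (foldr F w x) \<in> W (\<mu> - wt w + \<beta> i)" if i: "i \<in> I" and w: "set w \<subseteq> I" for i w
    using w
  proof (induction w)
    case Nil
    thus ?case using x i by (simp add: W_def span_zero)
  next
    case (Cons j w)
    hence j: "j \<in> I" "set w \<subseteq> I" by auto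
    have in_W: "foldr F w x \<in> W (\<mu> - wt w)"
      unfolding W_def using j by (intro span_base) auto
    have in_L: "foldr F w x \<in> Lw (\<mu> - wt w)" using j x by (intro foldr_F_Lw)
    have 1: "F j (E i (foldr F w x)) \<in> W (\<mu> - wt (j # w) + \<beta> i)"
      using F[OF j(1) Cons.IH[OF j(2)]] by (simp add: algebra_simps)
    show ?case
    proof (cases "i = j")
      case False
      thus ?thesis using 1 EF_other[OF i j(1) False in_L] by simp
    next
      case True
      have "(c *s foldr F w x) \<in> W (\<mu> - wt (j # w) + \<beta> i)" for c
        using in_W True unfolding W_def by (auto intro: span_scale simp: algebra_simps)
      thus ?thesis using 1 EF_same[OF i in_L] True unfolding W_def by (simp add: span_add)
    qed
  qed
  have E: "E i y \<in> W (\<nu> + \<beta> i)" if i: "i \<in> I" and y: "y \<in> W \<nu>" for i y \<nu>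
    using y unfolding W_def[of \<nu>]
  proof (induction rule: span_induct_alt)
    case base
    show ?case using i by (simp add: W_def span_zero)
  next
    case (step c y z)
    then obtain w where w: "set w \<subseteq> I" "\<nu> = \<mu> - wt w" "y = foldr F w x" by auto
    have "E i y \<in> W (\<nu> + \<beta> i)" using base[OF i w(1)] w by simp
    thus ?case using step i by (simp add: E_add E_scale W_def span_add span_scale)
  qed
  have x_W: "x \<in> W \<mu>" unfolding W_def by (rule span_base) (auto intro!: exI[of _ "[]"])
  have "W \<nu> = Lw \<nu>"
  proof (rule irreducible)
    show "\<exists>\<mu>. \<exists>x\<in>W \<mu>. x \<noteq> 0" using x_W x(2) by blast
  qed (use sub E F in \<open>auto simp: W_def\<close>)
  thus ?thesis by (simp add: W_def)
qed

lemma Lw_span: "Lw \<nu> = span {foldr F w v |w. set w \<subseteq> I \<and> \<nu> = \<mu>0 - wt w}"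
  by (rule singular_generates) (use v_Lw v_nz E_v in auto)

lemma Lw_nonzero_wt:
  assumes "x \<in> Lw \<nu>" "x \<noteq> 0"
  obtains w where "set w \<subseteq> I" "\<nu> = \<mu>0 - wt w"
proof -
  have "Lw \<nu> \<noteq> {0}" using assms by auto
  hence "{foldr F w v |w. set w \<subseteq> I \<and> \<nu> = \<mu>0 - wt w} \<noteq> {}"
    using Lw_span[of \<nu>] by (metis span_empty)
  thus ?thesis using that by blast
qed

lemma h_le:
  assumes "x \<in> Lw \<nu>" "x \<noteq> 0"
  shows "h \<nu> \<le> h \<mu>0"
proof -
  obtain w where "set w \<subseteq> I" "\<nu> = \<mu>0 - wt w" using Lw_nonzero_wt[OF assms] .
  thus ?thesis using h_wt[of w] by (simp add: h_diff)
qed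

text \<open>A nonzero singular \<open>x\<close> generates the module, so its weight is both below
  and above the highest weight \<open>\<mu>0\<close>. The two difference words have heights adding
  to zero, hence are empty.\<close>

lemma singular_zero:
  assumes "x \<in> Lw \<mu>" "\<And>i. i \<in> I \<Longrightarrow> E i x = 0" "\<mu> \<noteq> \<mu>0"
  shows "x = 0"
proof (rule ccontr)
  assume nz: "x \<noteq> 0"
  obtain w where w: "set w \<subseteq> I" "\<mu> = \<mu>0 - wt w" using Lw_nonzero_wt[OF assms(1) nz] .
  have "Lw \<mu>0 = span {foldr F w x |w. set w \<subseteq> I \<and> \<mu>0 = \<mu> - wt w}"
    by (rule singular_generates) (use assms nz in auto)
  moreover have "Lw \<mu>0 \<noteq> {0}" using v_Lw v_nz by auto
  ultimately have "{foldr F w x |w. set w \<subseteq> I \<and> \<mu>0 = \<mu> - wt w} \<noteq> {}"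
    by (metis span_empty)
  then obtain u where u: "set u \<subseteq> I" "\<mu>0 = \<mu> - wt u" by blast
  have "wt w + wt u = 0" using w u by (simp add: algebra_simps)
  hence "h (wt w) + h (wt u) = 0" by (metis h_0 h_add)
  hence "w = []" using h_wt[OF w(1)] h_wt[OF u(1)] by linarith
  thus False using w assms(3) by simp
qed

text \<open>Heights of weights are bounded by \<open>h \<mu>0\<close>, so raising terminates. The
  zero vector is a separate case because \<open>E i x\<close> may vanish.\<close>

lemma height_induct [consumes 1, case_names step]:
  assumes "x \<in> Lw \<mu>"
    and "\<And>\<mu> x. x \<in> Lw \<mu> \<Longrightarrow> (\<And>i. i \<in> I \<Longrightarrow> P (\<mu> + \<beta> i) (E i x)) \<Longrightarrow> P \<mu> x"
    and "\<And>\<mu>. P \<mu> 0"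
  shows "P \<mu> x"
  using assms(1)
proof (induction "nat (h \<mu>0 - h \<mu>)" arbitrary: \<mu> x rule: less_induct)
  case less
  show ?case
  proof (cases "x = 0")
    case False
    show ?thesis
    proof (rule assms(2)[OF less.prems])
      fix i assume i: "i \<in> I"
      have "h \<mu> \<le> h \<mu>0" using h_le[OF less.prems False] .
      show "P (\<mu> + \<beta> i) (E i x)"
      proof (cases "E i x = 0")
        case False
        have "h (\<mu> + \<beta> i) \<le> h \<mu>0" using h_le[OF E_Lw[OF i less.prems] False] .
        thus ?thesis using h_pos[OF i] by (intro less.hyps E_Lw i less.prems) (auto simp: h_add)
      qed (simp add: assms(3))
    qed
  qed (simp add: assms(3))
qed

text \<open>An operator lowering the weight that commutes with all raising operators maps singular
  vectors to singular vectors of the wrong weight; hence it vanishes.\<close>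

lemma lowering_zero:
  assumes u_Lw: "\<And>\<mu> x. x \<in> Lw \<mu> \<Longrightarrow> u x \<in> Lw (\<mu> - \<gamma>)" and "0 < h \<gamma>" and u0: "u 0 = 0"
    and comm: "\<And>i \<mu> x. i \<in> I \<Longrightarrow> x \<in> Lw \<mu> \<Longrightarrow> E i (u x) = u (E i x)"
    and x: "x \<in> Lw \<mu>"
  shows "u x = 0"
  using x
proof (induction rule: height_induct)
  case (step \<mu> x)
  show ?case
  proof (cases "x = 0")
    case False
    have "h \<mu> \<le> h \<mu>0" using h_le step False by blast
    hence "\<mu> - \<gamma> \<noteq> \<mu>0" using assms(2) by (auto simp: h_diff)
    thus ?thesis using step by (intro singular_zero[OF u_Lw]) (auto simp: comm)
  qed (simp add: u0)
qed (rule u0)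

text \<open>The dual of \<open>lowering_zero\<close>: the image of \<open>v\<close> would have a
  weight above \<open>\<mu>0\<close>, so it vanishes, and commuting past the \<open>F i\<close>
  carries this to the whole module.\<close>

lemma raising_zero:
  assumes u_Lw: "\<And>\<mu> x. x \<in> Lw \<mu> \<Longrightarrow> u x \<in> Lw (\<mu> + \<gamma>)" and "0 < h \<gamma>"
    and add: "\<And>x y. u (x + y) = u x + u y" and scale: "\<And>c x. u (c *s x) = c *s u x"
    and comm: "\<And>i \<mu> x. i \<in> I \<Longrightarrow> x \<in> Lw \<mu> \<Longrightarrow> u (F i x) = F i (u x)"
    and x: "x \<in> Lw \<mu>"
  shows "u x = 0"
proof -
  have u0: "u 0 = 0" using scale[of 0 0] by simp
  have uv: "u v = 0"
  proof (rule ccontr)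
    assume "u v \<noteq> 0"
    hence "h (\<mu>0 + \<gamma>) \<le> h \<mu>0" using h_le[OF u_Lw[OF v_Lw]] by simp
    thus False using assms(2) by (simp add: h_add)
  qed
  have w: "u (foldr F w v) = 0" if "set w \<subseteq> I" for w
    using that
  proof (induction w)
    case (Cons i w)
    thus ?case using comm[of i "foldr F w v"] foldr_F_Lw[OF _ v_Lw] by auto
  qed (simp add: uv)
  have "x \<in> span {foldr F w v |w. set w \<subseteq> I \<and> \<mu> = \<mu>0 - wt w}" using x Lw_span by simp
  thus ?thesis
    by (induction rule: span_induct_alt) (auto simp: u0 add scale w)
qed

definition keig :: "nat \<Rightarrow> 'w \<Rightarrow> 'k" where "keig i \<mu> = \<kappa> (\<beta> i) * \<chi> (\<beta> i) \<mu>"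
definition leig :: "nat \<Rightarrow> 'w \<Rightarrow> 'k" where "leig i \<mu> = \<eta> (\<beta> i) / \<chi> \<mu> (\<beta> i)"

lemma eig_shift:
  "keig i (\<mu> + \<nu>) = keig i \<mu> * \<chi> (\<beta> i) \<nu>" "keig i (\<mu> - \<nu>) = keig i \<mu> / \<chi> (\<beta> i) \<nu>"
  "leig i (\<mu> + \<nu>) = leig i \<mu> / \<chi> \<nu> (\<beta> i)" "leig i (\<mu> - \<nu>) = leig i \<mu> * \<chi> \<nu> (\<beta> i)"
  by (simp_all add: keig_def leig_def chi_add_left chi_add_right chi_diff)

lemma eig_nz: "keig i \<mu> \<noteq> 0" "leig i \<mu> \<noteq> 0"
  by (simp_all add: keig_def leig_def kappa_nz ell_nz chi_nz)

lemma lam_eig: "lam (\<beta> i) \<mu> = keig i \<mu> / leig i \<mu>"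
  by (simp add: lam_def keig_def leig_def qform_def)

lemma EF_eig:
  assumes "i \<in> I" "x \<in> Lw \<mu>"
  shows "E i (F i x) = F i (E i x) + (leig i \<mu> - keig i \<mu>) *s x"
  using EF_same[OF assms] by (simp add: keig_def leig_def)

lemma KK_minus: "x \<in> Lw \<mu> \<Longrightarrow> KK (- \<beta> i) x = inverse (keig i \<mu>) *s x"
  by (simp add: KK_eigen keig_def kappa_minus chi_minus field_simps)

lemma LL_minus: "x \<in> Lw \<mu> \<Longrightarrow> LL (- \<beta> i) x = inverse (leig i \<mu>) *s x"
  by (simp add: LL_eigen leig_def ell_minus chi_minus field_simps)

text \<open>\<open>Gop\<close> and \<open>Dop\<close> are the root vectors of
  \<open>\<beta> i + \<beta> j\<close> as twisted commutators. With these coefficients the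
  \<open>L\<close> parts cancel in the commutator of \<open>E i\<close> with \<open>Gop\<close> and
  the \<open>K\<close> parts in that of \<open>E j\<close>.\<close>

definition Gop :: "nat \<Rightarrow> nat \<Rightarrow> 'v \<Rightarrow> 'v" where
  "Gop i j x = F i (F j x) - \<chi> (\<beta> j) (\<beta> i) *s F j (F i x)"

definition Dop :: "nat \<Rightarrow> nat \<Rightarrow> 'v \<Rightarrow> 'v" where
  "Dop i j x = E i (E j x) - \<chi> (\<beta> i) (\<beta> j) *s E j (E i x)"

lemmas lin_simps = E_add E_diff E_scale F_add F_diff F_scale
lemmas scale_simps = scale_left_distrib scale_right_distrib scale_left_diff_distrib scale_right_diff_distrib

context
  fixes i j assumes i: "i \<in> I" and j: "j \<in> I"
begin

lemma Gop_lin: "Gop i j (x + y) = Gop i j x + Gop i j y" "Gop i j (c *s x) = c *s Gop i j x" "Gop i j 0 = 0"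
  using i j by (simp_all add: Gop_def lin_simps scale_simps algebra_simps scale_left_commute)

lemma Dop_lin: "Dop i j (x + y) = Dop i j x + Dop i j y" "Dop i j (c *s x) = c *s Dop i j x" "Dop i j 0 = 0"
  using i j by (simp_all add: Dop_def lin_simps scale_simps algebra_simps scale_left_commute)

lemma Gop_Lw: assumes "x \<in> Lw \<mu>" shows "Gop i j x \<in> Lw (\<mu> - (\<beta> i + \<beta> j))"
  using F_Lw[OF i F_Lw[OF j assms]] F_Lw[OF j F_Lw[OF i assms]]
  unfolding Gop_def by (intro diff_Lw scale_Lw) (simp_all add: algebra_simps)

lemma Dop_Lw: assumes "x \<in> Lw \<mu>" shows "Dop i j x \<in> Lw (\<mu> + (\<beta> i + \<beta> j))"
  using E_Lw[OF i E_Lw[OF j assms]] E_Lw[OF j E_Lw[OF i assms]]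
  unfolding Dop_def by (intro diff_Lw scale_Lw) (simp_all add: algebra_simps)

lemma E_Gop_i:
  assumes x: "x \<in> Lw \<mu>" and "i \<noteq> j"
  shows "E i (Gop i j x) = Gop i j (E i x) +
    ((\<chi> (\<beta> j) (\<beta> i) - inverse (\<chi> (\<beta> i) (\<beta> j))) * keig i \<mu>) *s F j x"
proof -
  have "E i (Gop i j x) = Gop i j (E i x) + ((leig i (\<mu> - \<beta> j) - keig i (\<mu> - \<beta> j)) *s F j x
      - (\<chi> (\<beta> j) (\<beta> i) * (leig i \<mu> - keig i \<mu>)) *s F j x)"
    using i j assms F_Lw[OF j x] F_Lw[OF i x]
    by (simp add: Gop_def lin_simps EF_eig[where i=i and \<mu>="\<mu> - \<beta> j"] EF_eig[where i=i and \<mu>=\<mu>]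
        EF_other[where \<mu>=\<mu>] EF_other[where \<mu>="\<mu> - \<beta> i"] scale_simps algebra_simps)
  also have "(leig i (\<mu> - \<beta> j) - keig i (\<mu> - \<beta> j)) *s F j x
      - (\<chi> (\<beta> j) (\<beta> i) * (leig i \<mu> - keig i \<mu>)) *s F j x =
      ((\<chi> (\<beta> j) (\<beta> i) - inverse (\<chi> (\<beta> i) (\<beta> j))) * keig i \<mu>) *s F j x"
    unfolding scale_left_diff_distrib[symmetric] by (simp add: eig_shift field_simps)
  finally show ?thesis .
qed

lemma E_Gop_j:
  assumes x: "x \<in> Lw \<mu>" and "i \<noteq> j"
  shows "E j (Gop i j x) = Gop i j (E j x) + ((1 - qform (\<beta> i) (\<beta> j)) * leig j \<mu>) *s F i x"
proof -
  have "E j (Gop i j x) = Gop i j (E j x) + ((leig j \<mu> - keig j \<mu>) *s F i x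
      - (\<chi> (\<beta> j) (\<beta> i) * (leig j (\<mu> - \<beta> i) - keig j (\<mu> - \<beta> i))) *s F i x)"
    using i j assms F_Lw[OF j x] F_Lw[OF i x]
    by (simp add: Gop_def lin_simps EF_eig[where i=j and \<mu>="\<mu> - \<beta> i"] EF_eig[where i=j and \<mu>=\<mu>]
        EF_other[where \<mu>=\<mu>] EF_other[where \<mu>="\<mu> - \<beta> j"] scale_simps algebra_simps)
  also have "(leig j \<mu> - keig j \<mu>) *s F i x
      - (\<chi> (\<beta> j) (\<beta> i) * (leig j (\<mu> - \<beta> i) - keig j (\<mu> - \<beta> i))) *s F i x =
      ((1 - qform (\<beta> i) (\<beta> j)) * leig j \<mu>) *s F i x"
    unfolding scale_left_diff_distrib[symmetric]
    by (simp add: eig_shift qform_def field_simps chi_nz)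
  finally show ?thesis .
qed

lemma E_Gop_other:
  assumes x: "x \<in> Lw \<mu>" and k: "k \<in> I" "k \<noteq> i" "k \<noteq> j"
  shows "E k (Gop i j x) = Gop i j (E k x)"
  using i j k F_Lw[OF j x] F_Lw[OF i x] x
  by (simp add: Gop_def lin_simps EF_other[where \<mu>="\<mu> - \<beta> i"] EF_other[where \<mu>="\<mu> - \<beta> j"]
      EF_other[where \<mu>="\<mu>"])

lemma Dop_F_i:
  assumes x: "x \<in> Lw \<mu>" and "i \<noteq> j"
  shows "Dop i j (F i x) = F i (Dop i j x) +
    ((inverse (\<chi> (\<beta> j) (\<beta> i)) - \<chi> (\<beta> i) (\<beta> j)) * leig i \<mu>) *s E j x"
proof -
  have "Dop i j (F i x) = F i (Dop i j x) + ((leig i (\<mu> + \<beta> j) - keig i (\<mu> + \<beta> j)) *s E j x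
      - (\<chi> (\<beta> i) (\<beta> j) * (leig i \<mu> - keig i \<mu>)) *s E j x)"
    using i j assms E_Lw[OF j x] E_Lw[OF i x]
    by (simp add: Dop_def lin_simps EF_eig[where i=i and \<mu>="\<mu> + \<beta> j"] EF_eig[where i=i and \<mu>=\<mu>]
        EF_other[where \<mu>=\<mu>] EF_other[where \<mu>="\<mu> + \<beta> i"] scale_simps algebra_simps)
  also have "(leig i (\<mu> + \<beta> j) - keig i (\<mu> + \<beta> j)) *s E j x
      - (\<chi> (\<beta> i) (\<beta> j) * (leig i \<mu> - keig i \<mu>)) *s E j x =
      ((inverse (\<chi> (\<beta> j) (\<beta> i)) - \<chi> (\<beta> i) (\<beta> j)) * leig i \<mu>) *s E j x"
    unfolding scale_left_diff_distrib[symmetric] by (simp add: eig_shift field_simps)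
  finally show ?thesis .
qed

lemma Dop_F_j:
  assumes x: "x \<in> Lw \<mu>" and "i \<noteq> j"
  shows "Dop i j (F j x) = F j (Dop i j x) + ((qform (\<beta> i) (\<beta> j) - 1) * keig j \<mu>) *s E i x"
proof -
  have "Dop i j (F j x) = F j (Dop i j x) + ((leig j \<mu> - keig j \<mu>) *s E i x
      - (\<chi> (\<beta> i) (\<beta> j) * (leig j (\<mu> + \<beta> i) - keig j (\<mu> + \<beta> i))) *s E i x)"
    using i j assms E_Lw[OF j x] E_Lw[OF i x]
    by (simp add: Dop_def lin_simps EF_eig[where i=j and \<mu>="\<mu> + \<beta> i"] EF_eig[where i=j and \<mu>=\<mu>]
        EF_other[where \<mu>=\<mu>] EF_other[where \<mu>="\<mu> + \<beta> j"] scale_simps algebra_simps)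
  also have "(leig j \<mu> - keig j \<mu>) *s E i x
      - (\<chi> (\<beta> i) (\<beta> j) * (leig j (\<mu> + \<beta> i) - keig j (\<mu> + \<beta> i))) *s E i x =
      ((qform (\<beta> i) (\<beta> j) - 1) * keig j \<mu>) *s E i x"
  proof -
    have "(leig j \<mu> - keig j \<mu>) - \<chi> (\<beta> i) (\<beta> j) * (leig j (\<mu> + \<beta> i) - keig j (\<mu> + \<beta> i))
        = (qform (\<beta> i) (\<beta> j) - 1) * keig j \<mu>"
      by (simp add: eig_shift qform_def field_simps chi_nz)
    thus ?thesis unfolding scale_left_diff_distrib[symmetric] by simp
  qed
  finally show ?thesis .
qed

lemma Dop_F_other:
  assumes x: "x \<in> Lw \<mu>" and k: "k \<in> I" "k \<noteq> i" "k \<noteq> j"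
  shows "Dop i j (F k x) = F k (Dop i j x)"
  using i j k E_Lw[OF j x] E_Lw[OF i x] x
  by (simp add: Dop_def lin_simps EF_other[where \<mu>="\<mu> + \<beta> i"] EF_other[where \<mu>="\<mu> + \<beta> j"]
      EF_other[where \<mu>="\<mu>"])

text \<open>The two root vectors satisfy the relation of a raising and a lowering operator for the
  root \<open>\<beta> i + \<beta> j\<close>, up to the factor
  \<open>1 - qform (\<beta> i) (\<beta> j)\<close>; \<open>refl_F\<close> divides by it. The mixed
  terms with coefficients \<open>c1\<close> and \<open>c2\<close> cancel by the choice of the
  scalars in \<open>Dop\<close> and \<open>Gop\<close>.\<close>

lemma Dop_Gop:
  assumes x: "x \<in> Lw \<mu>" and ij: "i \<noteq> j"
  shows "Dop i j (Gop i j x) = Gop i j (Dop i j x) +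
    ((1 - qform (\<beta> i) (\<beta> j)) * (leig i \<mu> * leig j \<mu> - keig i \<mu> * keig j \<mu>)) *s x"
proof -
  define a b where "a = \<chi> (\<beta> i) (\<beta> j)" and "b = \<chi> (\<beta> j) (\<beta> i)"
  have nz: "a \<noteq> 0" "b \<noteq> 0" by (auto simp: a_def b_def chi_nz)
  have Q: "qform (\<beta> i) (\<beta> j) = a * b" by (simp add: qform_def a_def b_def)
  define y1 y2 where "y1 = F j (E j x)" and "y2 = F i (E i x)"
  define c1 where "c1 = ((b - inverse a) * keig i (\<mu> + \<beta> j)) - a * ((b - inverse a) * keig i \<mu>)"
  define c2 where "c2 = (1 - a * b) * leig j \<mu> - a * ((1 - a * b) * leig j (\<mu> + \<beta> i))"
  define c3 where "c3 = (1 - a * b) * leig j \<mu> * (leig i \<mu> - keig i \<mu>)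
      - a * ((b - inverse a) * keig i \<mu>) * (leig j \<mu> - keig j \<mu>)"
  have Ej: "E j (Gop i j x) = Gop i j (E j x) + ((1 - a * b) * leig j \<mu>) *s F i x"
    using E_Gop_j[OF x ij] Q by simp
  have Ei: "E i (Gop i j x) = Gop i j (E i x) + ((b - inverse a) * keig i \<mu>) *s F j x"
    using E_Gop_i[OF x ij] by (simp add: a_def b_def)
  have EiEj: "E i (Gop i j (E j x)) = Gop i j (E i (E j x)) + ((b - inverse a) * keig i (\<mu> + \<beta> j)) *s y1"
    using E_Gop_i[OF E_Lw[OF j x] ij] by (simp add: a_def b_def y1_def)
  have EjEi: "E j (Gop i j (E i x)) = Gop i j (E j (E i x)) + ((1 - a * b) * leig j (\<mu> + \<beta> i)) *s y2"
    using E_Gop_j[OF E_Lw[OF i x] ij] by (simp add: Q y2_def)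
  have Gd: "Gop i j (y - z) = Gop i j y - Gop i j z" for y z
    using Gop_lin(1)[of y "-1 *s z"] Gop_lin(2)[of "-1" z] by simp
  have e1: "E i (F i x) = y2 + (leig i \<mu> - keig i \<mu>) *s x"
    using EF_eig[OF i x] by (simp add: y2_def)
  have e2: "E j (F j x) = y1 + (leig j \<mu> - keig j \<mu>) *s x"
    using EF_eig[OF j x] by (simp add: y1_def)
  have "Dop i j (Gop i j x) = Gop i j (Dop i j x) + c1 *s y1 + c2 *s y2 + c3 *s x"
    unfolding Dop_def Ej Ei c1_def c2_def c3_def
    using i j
    by (simp add: e1 e2 lin_simps EiEj EjEi a_def[symmetric]
        Gd Gop_lin scale_simps algebra_simps)
  moreover have "c1 = 0" using nz by (simp add: c1_def eig_shift a_def[symmetric])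
  moreover have "c2 = 0" using nz by (simp add: c2_def eig_shift a_def[symmetric])
  moreover have "c3 = (1 - a * b) * (leig i \<mu> * leig j \<mu> - keig i \<mu> * keig j \<mu>)"
    using nz by (simp add: c3_def field_simps)
  ultimately show ?thesis by (simp add: Q)
qed

end

lemma Gop_diff: "i \<in> I \<Longrightarrow> j \<in> I \<Longrightarrow> Gop i j (y - z) = Gop i j y - Gop i j z"
  using Gop_lin(1)[of i j y "-1 *s z"] Gop_lin(2)[of i j "-1" z] by simp

text \<open>For two different neighbours \<open>j\<close>, \<open>k\<close> of the reflected root
  the new operators have to commute. They do because applying \<open>E j\<close> first changes the
  eigenvalue \<open>keig i\<close> by exactly the coefficient occurring in
  \<open>Dop\<close>.\<close>

lemma Dop_Gop_other:
  assumes x: "x \<in> Lw \<mu>" and ijk: "i \<in> I" "j \<in> I" "k \<in> I" "k \<noteq> i" "k \<noteq> j" "i \<noteq> j"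
  shows "Dop i j (Gop i k x) = Gop i k (Dop i j x)"
proof -
  define a where "a = \<chi> (\<beta> i) (\<beta> j)"
  define t where "t = \<chi> (\<beta> k) (\<beta> i) - inverse (\<chi> (\<beta> i) (\<beta> k))"
  have nz: "a \<noteq> 0" by (simp add: a_def chi_nz)
  have Ej: "E j (Gop i k y) = Gop i k (E j y)" if "y \<in> Lw \<nu>" for y \<nu>
    by (rule E_Gop_other) (use that ijk in auto)
  have Ei: "E i (Gop i k y) = Gop i k (E i y) + (t * keig i \<nu>) *s F k y" if "y \<in> Lw \<nu>" for y \<nu>
    unfolding t_def by (rule E_Gop_i) (use that ijk in auto)
  have EjF: "E j (F k x) = F k (E j x)" by (rule EF_other) (use x ijk in auto)
  show ?thesis
    unfolding Dop_def using ijk nz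
    by (simp add: Ej[OF x] Ei[OF x] Ei[OF E_Lw[OF _ x]] Ej[OF E_Lw[OF _ x]] EjF Gop_diff Gop_lin
        lin_simps eig_shift a_def[symmetric] scale_simps mult_ac)
qed

end

section \<open>Odd reflections at an isotropic simple root\<close>

context chamber
begin

text \<open>For orthogonal roots both error terms of \<open>E_Gop_i\<close> and
  \<open>E_Gop_j\<close> vanish, so \<open>Gop\<close> commutes with all raising operators and
  \<open>lowering_zero\<close> applies. The two lowering operators thus commute up to a
  scalar.\<close>

lemma Gop_zero:
  assumes "i \<in> I" "j \<in> I" "i \<noteq> j" "qform (\<beta> i) (\<beta> j) = 1" "x \<in> Lw \<mu>"
  shows "Gop i j x = 0"
proof (rule lowering_zero[of "Gop i j" "\<beta> i + \<beta> j"])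
  have "\<chi> (\<beta> j) (\<beta> i) - inverse (\<chi> (\<beta> i) (\<beta> j)) = 0"
    using assms(4) chi_nz[of "\<beta> i" "\<beta> j"] by (simp add: qform_def field_simps)
  thus "E k (Gop i j x) = Gop i j (E k x)" if "k \<in> I" "x \<in> Lw \<mu>" for k x \<mu>
    using E_Gop_i[of i j x \<mu>] E_Gop_j[of i j x \<mu>] E_Gop_other[of i j x \<mu> k] assms that
    by (cases "k = i"; cases "k = j") auto
qed (use assms Gop_Lw Gop_lin h_pos in \<open>auto simp: h_add intro: add_pos_pos\<close>)

lemma Dop_zero:
  assumes "i \<in> I" "j \<in> I" "i \<noteq> j" "qform (\<beta> i) (\<beta> j) = 1" "x \<in> Lw \<mu>"
  shows "Dop i j x = 0"
proof (rule raising_zero[of "Dop i j" "\<beta> i + \<beta> j"])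
  have "inverse (\<chi> (\<beta> j) (\<beta> i)) - \<chi> (\<beta> i) (\<beta> j) = 0"
    using assms(4) chi_nz[of "\<beta> j" "\<beta> i"] by (simp add: qform_def field_simps)
  thus "Dop i j (F k x) = F k (Dop i j x)" if "k \<in> I" "x \<in> Lw \<mu>" for k x \<mu>
    using Dop_F_i[of i j x \<mu>] Dop_F_j[of i j x \<mu>] Dop_F_other[of i j x \<mu> k] assms that
    by (cases "k = i"; cases "k = j") auto
qed (use assms Dop_Lw Dop_lin h_pos in \<open>auto simp: h_add intro: add_pos_pos\<close>)

lemma E_minus: "i \<in> I \<Longrightarrow> E i (- x) = - E i x" and F_minus: "i \<in> I \<Longrightarrow> F i (- x) = - F i x"
  using E_diff[of i 0 x] F_diff[of i 0 x] by simp_all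

lemma Dop_minus: "i \<in> I \<Longrightarrow> j \<in> I \<Longrightarrow> Dop i j (- x) = - Dop i j x"
  by (simp add: Dop_def E_minus)

lemma isotropic_eig:
  assumes "\<chi> (\<beta> i) (\<beta> i) = -1"
  shows "keig i (\<mu> + \<beta> i) = - keig i \<mu>" "keig i (\<mu> - \<beta> i) = - keig i \<mu>"
    "leig i (\<mu> + \<beta> i) = - leig i \<mu>" "leig i (\<mu> - \<beta> i) = - leig i \<mu>"
  using assms by (simp_all add: eig_shift)

text \<open>\<open>\<chi> (\<beta> i) (\<beta> i) = -1\<close> reverses the sign of both eigenvalues
  under a shift by \<open>\<beta> i\<close>. The two terms created by \<open>E i\<close> on
  \<open>F i (F i x)\<close> therefore cancel.\<close>

lemma isotropic_F_F:
  assumes i: "i \<in> I" and iso: "\<chi> (\<beta> i) (\<beta> i) = -1" and "x \<in> Lw \<mu>"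
  shows "F i (F i x) = 0"
proof (rule lowering_zero[of "\<lambda>x. F i (F i x)" "\<beta> i + \<beta> i"])
  fix k x \<mu> assume k: "k \<in> I" and x: "x \<in> Lw \<mu>"
  show "E k (F i (F i x)) = F i (F i (E k x))"
  proof (cases "k = i")
    case True
    have "E i (F i (F i x)) = F i (F i (E i x)) + (leig i \<mu> - keig i \<mu>) *s F i x
       + (leig i (\<mu> - \<beta> i) - keig i (\<mu> - \<beta> i)) *s F i x"
      using i x EF_eig[OF i F_Lw[OF i x]] EF_eig[OF i x] by (simp add: F_add F_scale)
    thus ?thesis by (simp add: isotropic_eig[OF iso] scale_left_diff_distrib True)
  next
    case False
    thus ?thesis using EF_other[OF k i False x] EF_other[OF k i False F_Lw[OF i x]] by simp
  qed
next
  show "F i (F i x) \<in> Lw (\<mu> - (\<beta> i + \<beta> i))" if "x \<in> Lw \<mu>" for x \<mu>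
    using F_Lw[OF i F_Lw[OF i that]] by (simp add: algebra_simps)
qed (use assms h_pos[OF i] h_add[of "\<beta> i" "\<beta> i", folded mult_2] in auto)

lemma isotropic_E_E:
  assumes i: "i \<in> I" and iso: "\<chi> (\<beta> i) (\<beta> i) = -1" and "x \<in> Lw \<mu>"
  shows "E i (E i x) = 0"
proof (rule raising_zero[of "\<lambda>x. E i (E i x)" "\<beta> i + \<beta> i"])
  fix k x \<mu> assume k: "k \<in> I" and x: "x \<in> Lw \<mu>"
  show "E i (E i (F k x)) = F k (E i (E i x))"
  proof (cases "k = i")
    case True
    have "E i (E i (F i x)) = F i (E i (E i x)) + (leig i (\<mu> + \<beta> i) - keig i (\<mu> + \<beta> i)) *s E i x
       + (leig i \<mu> - keig i \<mu>) *s E i x"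
      using i x EF_eig[OF i E_Lw[OF i x]] EF_eig[OF i x] by (simp add: E_add E_scale)
    thus ?thesis by (simp add: isotropic_eig[OF iso] scale_left_diff_distrib True)
  next
    case False
    thus ?thesis using EF_other[OF i k _ x] EF_other[OF i k _ E_Lw[OF i x]] by simp
  qed
next
  show "E i (E i x) \<in> Lw (\<mu> + (\<beta> i + \<beta> i))" if "x \<in> Lw \<mu>" for x \<mu>
    using E_Lw[OF i E_Lw[OF i that]] by (simp add: algebra_simps)
qed (use assms h_pos[OF i] h_add[of "\<beta> i" "\<beta> i", folded mult_2] E_add E_scale in auto)

text \<open>The base and the operators after the odd reflection at \<open>\<beta>\<^sub>i\<close>.\<close>

definition refl_base :: "nat \<Rightarrow> nat \<Rightarrow> 'w" where
  "refl_base i j = (if j = i then - \<beta> i else if qform (\<beta> i) (\<beta> j) = 1 then \<beta> j else \<beta> i + \<beta> j)"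

definition refl_E :: "nat \<Rightarrow> nat \<Rightarrow> 'v \<Rightarrow> 'v" where
  "refl_E i j = (if j = i then (\<lambda>x. F i (LL (- \<beta> i) x))
     else if qform (\<beta> i) (\<beta> j) = 1 then E j else Dop i j)"

definition refl_F :: "nat \<Rightarrow> nat \<Rightarrow> 'v \<Rightarrow> 'v" where
  "refl_F i j = (if j = i then (\<lambda>x. KK (- \<beta> i) (E i x))
     else if qform (\<beta> i) (\<beta> j) = 1 then F j
     else (\<lambda>x. inverse (1 - qform (\<beta> i) (\<beta> j)) *s Gop i j x))"

context
  fixes i assumes i: "i \<in> I" and iso: "\<chi> (\<beta> i) (\<beta> i) = -1"
begin

lemma refl_E_i: "x \<in> Lw \<mu> \<Longrightarrow> refl_E i i x = inverse (leig i \<mu>) *s F i x"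
  using i by (simp add: refl_E_def LL_minus F_scale)

lemma refl_F_i: "x \<in> Lw \<mu> \<Longrightarrow> refl_F i i x = (- inverse (keig i \<mu>)) *s E i x"
  using KK_minus[OF E_Lw[OF i], of x \<mu> i] by (simp add: refl_F_def isotropic_eig[OF iso])

lemma refl_E_Lw: assumes "j \<in> I" "x \<in> Lw \<mu>" shows "refl_E i j x \<in> Lw (\<mu> + refl_base i j)"
  using F_Lw[OF i LL_Lw[OF assms(2)]] E_Lw[OF assms] Dop_Lw[OF i assms]
  by (simp add: refl_E_def refl_base_def)

lemma refl_F_Lw: assumes "j \<in> I" "x \<in> Lw \<mu>" shows "refl_F i j x \<in> Lw (\<mu> - refl_base i j)"
  using KK_Lw[OF E_Lw[OF i assms(2)]] F_Lw[OF assms] scale_Lw[OF Gop_Lw[OF i assms]]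
  by (simp add: refl_F_def refl_base_def)

lemma refl_E_lin: "j \<in> I \<Longrightarrow> refl_E i j (x + y) = refl_E i j x + refl_E i j y"
    "j \<in> I \<Longrightarrow> refl_E i j (c *s x) = c *s refl_E i j x"
  using i by (auto simp: refl_E_def LL_add LL_scale F_add F_scale E_add E_scale Dop_lin)

lemma refl_F_lin: "j \<in> I \<Longrightarrow> refl_F i j (x + y) = refl_F i j x + refl_F i j y"
    "j \<in> I \<Longrightarrow> refl_F i j (c *s x) = c *s refl_F i j x"
  using i by (auto simp: refl_F_def KK_add KK_scale F_add F_scale E_add E_scale Gop_lin
      scale_right_distrib scale_left_commute)

lemma refl_E_minus: "j \<in> I \<Longrightarrow> refl_E i j (- x) = - refl_E i j x"
    and refl_F_minus: "j \<in> I \<Longrightarrow> refl_F i j (- x) = - refl_F i j x"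
  using refl_E_lin(2)[of j "-1" x] refl_F_lin(2)[of j "-1" x] by auto

text \<open>With \<open>k\<close>, \<open>l\<close> the eigenvalues at \<open>\<mu>\<close>, the
  torus factors turn the term \<open>l - k\<close> of the \<open>EF\<close> relation into
  \<open>1 / k - 1 / l\<close>, up to sign the difference of eigenvalues for the opposite root
  \<open>- \<beta> i\<close>. Isotropy enters through the sign of the shifted eigenvalues.\<close>

lemma refl_EF_ii:
  assumes x: "x \<in> Lw \<mu>"
  shows "refl_E i i (refl_F i i x) = refl_F i i (refl_E i i x) + (LL (refl_base i i) x - KK (refl_base i i) x)"
proof -
  define k l where "k = keig i \<mu>" and "l = leig i \<mu>"
  have nz: "k \<noteq> 0" "l \<noteq> 0" by (auto simp: k_def l_def eig_nz)
  have 1: "refl_E i i (refl_F i i x) = inverse (k * l) *s F i (E i x)"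
    using i refl_E_i[OF E_Lw[OF i x]] nz
    by (simp add: refl_F_i[OF x] refl_E_lin refl_E_minus isotropic_eig[OF iso] k_def l_def)
  have 2: "refl_F i i (refl_E i i x) = inverse (k * l) *s E i (F i x)"
    using i refl_F_i[OF F_Lw[OF i x]] nz
    by (simp add: refl_E_i[OF x] refl_F_lin refl_F_minus isotropic_eig[OF iso] k_def l_def mult.commute)
  have 3: "refl_F i i (refl_E i i x) = inverse (k * l) *s F i (E i x) + (inverse (k * l) * (l - k)) *s x"
    using EF_eig[OF i x] by (simp add: 2 k_def l_def scale_right_distrib)
  have "inverse (k * l) * (l - k) = inverse k - inverse l" using nz by (simp add: field_simps)
  thus ?thesis using 1 3
    by (simp add: refl_base_def LL_minus[OF x] KK_minus[OF x] k_def l_def scale_left_diff_distrib)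
qed

text \<open>If the roots are orthogonal, \<open>F i\<close> and \<open>F j\<close> commute up to the
  scalar absorbed by the shifted eigenvalue. Otherwise vanishing of the square of \<open>F i\<close>
  reduces both sides to multiples of \<open>F i (F j (F i x))\<close>.\<close>

lemma refl_EF_ij:
  assumes x: "x \<in> Lw \<mu>" and j: "j \<in> I" "j \<noteq> i"
  shows "refl_E i i (refl_F i j x) = refl_F i j (refl_E i i x)"
proof (cases "qform (\<beta> i) (\<beta> j) = 1")
  case True
  have "F i (F j x) = \<chi> (\<beta> j) (\<beta> i) *s F j (F i x)"
    using Gop_zero[OF i j(1) _ True x] j by (simp add: Gop_def)
  thus ?thesis using True j refl_E_i[OF F_Lw[OF j(1) x]] refl_E_i[OF x]
    by (simp add: refl_F_def eig_shift F_scale chi_nz)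
next
  case False
  have "F i (Gop i j x) = - \<chi> (\<beta> j) (\<beta> i) *s F i (F j (F i x))"
    using i j isotropic_F_F[OF i iso F_Lw[OF j(1) x]] by (simp add: Gop_def F_diff F_scale)
  moreover have "Gop i j (F i x) = F i (F j (F i x))"
    using j isotropic_F_F[OF i iso x] by (simp add: Gop_def)
  moreover have "leig i (\<mu> - (\<beta> i + \<beta> j)) = - leig i \<mu> * \<chi> (\<beta> j) (\<beta> i)"
    by (simp add: eig_shift chi_add_left iso)
  ultimately show ?thesis
    using False j i refl_E_i[OF Gop_Lw[OF i j(1) x]] refl_E_i[OF x] refl_E_lin(2)[OF i]
    by (simp add: refl_F_def Gop_lin chi_nz scale_left_commute)
qed

lemma refl_EF_ji:
  assumes x: "x \<in> Lw \<mu>" and j: "j \<in> I" "j \<noteq> i"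
  shows "refl_E i j (refl_F i i x) = refl_F i i (refl_E i j x)"
proof (cases "qform (\<beta> i) (\<beta> j) = 1")
  case True
  have "E i (E j x) = \<chi> (\<beta> i) (\<beta> j) *s E j (E i x)"
    using Dop_zero[OF i j(1) _ True x] j by (simp add: Dop_def)
  thus ?thesis using True j refl_F_i[OF E_Lw[OF j(1) x]] refl_F_i[OF x]
    by (simp add: refl_E_def eig_shift E_scale E_minus chi_nz)
next
  case False
  have "E i (Dop i j x) = - \<chi> (\<beta> i) (\<beta> j) *s E i (E j (E i x))"
    using i j isotropic_E_E[OF i iso E_Lw[OF j(1) x]] by (simp add: Dop_def E_diff E_scale)
  moreover have "Dop i j (E i x) = E i (E j (E i x))"
    using j isotropic_E_E[OF i iso x] by (simp add: Dop_def)
  moreover have "keig i (\<mu> + (\<beta> i + \<beta> j)) = - keig i \<mu> * \<chi> (\<beta> i) (\<beta> j)"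
    by (simp add: eig_shift chi_add_right iso)
  ultimately show ?thesis
    using False j i refl_F_i[OF Dop_Lw[OF i j(1) x]] refl_F_i[OF x]
    by (simp add: refl_E_def Dop_lin Dop_minus chi_nz)
qed

lemma refl_EF:
  assumes j: "j \<in> I" and k: "k \<in> I" and x: "x \<in> Lw \<mu>"
  shows "refl_E i j (refl_F i k x) = refl_F i k (refl_E i j x) +
    (if j = k then LL (refl_base i j) x - KK (refl_base i j) x else 0)"
proof -
  consider "j = i" "k = i" | "j = i" "k \<noteq> i" | "j \<noteq> i" "k = i" | "j \<noteq> i" "k \<noteq> i" by blast
  thus ?thesis
  proof cases
    case 4
    show ?thesis
    proof (cases "qform (\<beta> i) (\<beta> j) = 1")
      case True
      thus ?thesis using 4 EF[OF j k x] E_Gop_other[OF i k x j] j k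
        by (auto simp: refl_E_def refl_F_def refl_base_def E_scale)
    next
      case Qj: False
      show ?thesis
      proof (cases "j = k")
        case True
        have e: "leig i \<mu> * leig j \<mu> = \<eta> (\<beta> i + \<beta> j) / \<chi> \<mu> (\<beta> i + \<beta> j)"
          "keig i \<mu> * keig j \<mu> = \<kappa> (\<beta> i + \<beta> j) * \<chi> (\<beta> i + \<beta> j) \<mu>"
          by (simp_all add: leig_def keig_def ell_add kappa_add chi_add_left chi_add_right)
        define c d where "c = 1 - qform (\<beta> i) (\<beta> k)" and "d = leig i \<mu> * leig j \<mu> - keig i \<mu> * keig j \<mu>"
        have "Dop i j (Gop i j x) = Gop i j (Dop i j x) + (c * d) *s x"
          using Dop_Gop[OF i j x] 4 True by (simp add: c_def d_def)
        moreover have "c \<noteq> 0" using Qj True by (simp add: c_def)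
        hence "inverse c *s ((c * d) *s x) = d *s x" by simp
        moreover have "d *s x = LL (\<beta> i + \<beta> j) x - KK (\<beta> i + \<beta> j) x"
          by (simp add: d_def LL_eigen[OF x] KK_eigen[OF x] e scale_left_diff_distrib)
        ultimately show ?thesis using True 4 Qj i j
          by (simp add: refl_E_def refl_F_def refl_base_def Dop_lin scale_right_distrib c_def[symmetric]
              del: scale_scale)
      next
        case False
        thus ?thesis using 4 Qj Dop_Gop_other[OF x i j k] Dop_F_other[OF i j x k] i j k
          by (auto simp: refl_E_def refl_F_def Dop_lin)
      qed
    qed
  qed (use refl_EF_ii[OF x] refl_EF_ij[OF x] refl_EF_ji[OF x] j k in auto)
qed

text \<open>The new highest weight vector is \<open>F i v\<close> unless this is zero:
  \<open>F i\<close> kills it by isotropy, and the other new raising operators kill it because the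
  \<open>E j\<close> kill \<open>v\<close>. For irreducibility the old operators are recovered from
  the new ones.\<close>

lemma reflection_chamber:
  assumes h': "\<And>a b. h' (a + b) = h' a + h' b" "\<And>j. j \<in> I \<Longrightarrow> 0 < h' (refl_base i j)"
  shows "chamber scale Lw KK LL \<chi> \<kappa> \<eta> I (refl_base i) (refl_E i) (refl_F i) h'
    (if F i v = 0 then v else F i v) (if F i v = 0 then \<mu>0 else \<mu>0 - \<beta> i)"
proof unfold_locales
  show "refl_E i j (if F i v = 0 then v else F i v) = 0" if j: "j \<in> I" for j
  proof (cases "j = i")
    case True
    thus ?thesis using refl_E_i[OF v_Lw] refl_E_i[OF F_Lw[OF i v_Lw]] isotropic_F_F[OF i iso v_Lw] by auto
  next
    case False
    have "refl_E i j v = 0" using False i j E_v by (simp add: refl_E_def Dop_def)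
    moreover have "refl_E i j (F i v) = 0"
      using False i j E_v EF_other[OF j i False v_Lw] Dop_F_i[OF i j v_Lw]
      by (simp add: refl_E_def Dop_def)
    ultimately show ?thesis by simp
  qed
  show "W \<nu> = Lw \<nu>"
    if sub: "\<And>\<mu>. subspace (W \<mu>)" and W: "\<And>\<mu>. W \<mu> \<subseteq> Lw \<mu>"
      and stable: "\<And>j \<mu> x. j \<in> I \<Longrightarrow> x \<in> W \<mu> \<Longrightarrow>
         refl_E i j x \<in> W (\<mu> + refl_base i j) \<and> refl_F i j x \<in> W (\<mu> - refl_base i j)"
      and nz: "\<exists>\<mu>. \<exists>x\<in>W \<mu>. x \<noteq> 0" for W \<nu>
  proof (rule irreducible[OF sub W _ nz])
    have cancel: "y \<in> W \<mu>" if "c *s y \<in> W \<mu>" "c \<noteq> 0" for c y \<mu>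
      using subspace_scale[OF sub that(1), of "inverse c"] that(2) by simp
    have Fi: "F i x \<in> W (\<mu> - \<beta> i)" and Ei: "E i x \<in> W (\<mu> + \<beta> i)" if "x \<in> W \<mu>" for x \<mu>
    proof -
      have x: "x \<in> Lw \<mu>" using that W by blast
      show "F i x \<in> W (\<mu> - \<beta> i)"
        by (rule cancel[of "inverse (leig i \<mu>)"])
          (use stable[OF i that] eig_nz in \<open>simp_all add: refl_E_i[OF x] refl_base_def\<close>)
      show "E i x \<in> W (\<mu> + \<beta> i)"
        by (rule cancel[of "- inverse (keig i \<mu>)"])
          (use stable[OF i that] eig_nz in \<open>simp_all add: refl_F_i[OF x] refl_base_def\<close>)
    qed
    fix j \<mu> x assume j: "j \<in> I" and xW: "x \<in> W \<mu>"
    have x: "x \<in> Lw \<mu>" using xW W by blast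
    show "E j x \<in> W (\<mu> + \<beta> j) \<and> F j x \<in> W (\<mu> - \<beta> j)"
    proof (cases "j = i \<or> qform (\<beta> i) (\<beta> j) = 1")
      case True
      thus ?thesis using Fi[OF xW] Ei[OF xW] stable[OF j xW]
        by (auto simp: refl_E_def refl_F_def refl_base_def split: if_splits)
    next
      case False
      \<comment> \<open>These scalars are nonzero for non-orthogonal roots, so \<open>E j x\<close>
        and \<open>F j x\<close> are obtained, up to nonzero scalars, from the commutators of
        \<open>Dop\<close> with \<open>F i\<close> and of \<open>E i\<close> with
        \<open>Gop\<close>.\<close>
      have nz: "inverse (\<chi> (\<beta> j) (\<beta> i)) - \<chi> (\<beta> i) (\<beta> j) \<noteq> 0"
          "\<chi> (\<beta> j) (\<beta> i) - inverse (\<chi> (\<beta> i) (\<beta> j)) \<noteq> 0"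
        using False chi_nz[of "\<beta> i" "\<beta> j"] chi_nz[of "\<beta> j" "\<beta> i"] by (auto simp: qform_def field_simps)
      have cancel2: "y \<in> W \<rho>" if "a - b \<in> W \<rho>" "a = b + c *s y" "c \<noteq> 0" for a b c y \<rho>
        using that cancel[of c y \<rho>] by simp
      have D: "Dop i j y \<in> W (\<rho> + (\<beta> i + \<beta> j))" and G: "Gop i j y \<in> W (\<rho> - (\<beta> i + \<beta> j))"
        if "y \<in> W \<rho>" for y \<rho>
        using stable[OF j that] False cancel[of "inverse (1 - qform (\<beta> i) (\<beta> j))" "Gop i j y"]
        by (auto simp: refl_E_def refl_F_def refl_base_def)
      have "Dop i j (F i x) - F i (Dop i j x) \<in> W (\<mu> + \<beta> j)"
        using D[OF Fi[OF xW]] Fi[OF D[OF xW]] by (intro subspace_diff[OF sub]) (simp_all add: algebra_simps)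
      hence "E j x \<in> W (\<mu> + \<beta> j)"
        by (rule cancel2[OF _ Dop_F_i[OF i j x]]) (use nz False eig_nz in auto)
      moreover have "E i (Gop i j x) - Gop i j (E i x) \<in> W (\<mu> - \<beta> j)"
        using G[OF Ei[OF xW]] Ei[OF G[OF xW]] by (intro subspace_diff[OF sub]) (simp_all add: algebra_simps)
      hence "F j x \<in> W (\<mu> - \<beta> j)"
        by (rule cancel2[OF _ E_Gop_i[OF i j x]]) (use nz False eig_nz in auto)
      ultimately show ?thesis by blast
    qed
  qed
qed (use refl_E_lin refl_F_lin refl_E_Lw refl_F_Lw refl_EF h' v_Lw v_nz F_Lw[OF i v_Lw] in auto)

end
end

context graded_rep
begin

lemma qform_of_nat: "qform a (of_nat n * b) = qform a b ^ n"
  by (induction n) (simp_all add: qform_add distrib_right)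

end

subsection \<open>Rank one\<close>

text \<open>Multiplying by \<open>(p - 1) * p ^ n\<close> sums the two opposite geometric series and
  factorises the result. If \<open>p\<close> is not a root of unity and \<open>l\<close> is nonzero,
  this exposes the only way to vanish: \<open>k / l = p ^ n\<close>.\<close>

lemma geometric_two_sided:
  fixes p l k :: "'a::field"
  assumes "p \<noteq> 0"
  shows "(p - 1) * p ^ n * (\<Sum>s\<le>n. l * p ^ s - k * inverse p ^ s) = (p ^ Suc n - 1) * (l * p ^ n - k)"
proof (induction n)
  case (Suc n)
  define S where "S = (\<Sum>s\<le>n. l * p ^ s - k * inverse p ^ s)"
  have 1: "p ^ Suc n * inverse p ^ Suc n = 1" using assms by (simp add: power_inverse del: power_Suc)
  have "(p - 1) * p ^ Suc n * (S + (l * p ^ Suc n - k * inverse p ^ Suc n)) =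
     p * ((p - 1) * p ^ n * S) + (p - 1) * (l * p ^ Suc n * p ^ Suc n - k * (p ^ Suc n * inverse p ^ Suc n))"
    by (simp add: algebra_simps)
  also have "\<dots> = (p ^ Suc (Suc n) - 1) * (l * p ^ Suc n - k)"
    unfolding 1 Suc[folded S_def] by (simp add: algebra_simps)
  finally show ?case by (simp add: S_def)
qed simp

lemma two_sided_sum_zero_iff:
  fixes p l k :: "'a::field_char_0"
  assumes "not_root_of_unity p" "l \<noteq> 0"
  shows "(\<Sum>s\<le>n. l * p ^ s - k * inverse p ^ s) = 0 \<longleftrightarrow> k / l = p ^ n"
proof -
  have "p \<noteq> 0" "p ^ Suc n \<noteq> 1" "p \<noteq> 1" using assms(1)
    unfolding not_root_of_unity_def by (auto dest: spec[of _ 1])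
  hence "(\<Sum>s\<le>n. l * p ^ s - k * inverse p ^ s) = 0 \<longleftrightarrow> l * p ^ n - k = 0"
    (is "?S = 0 \<longleftrightarrow> _")
  proof -
    assume nz: "p \<noteq> 0" "p ^ Suc n \<noteq> 1" "p \<noteq> 1"
    hence "?S = 0 \<longleftrightarrow> (p - 1) * p ^ n * ?S = 0" by simp
    also have "\<dots> \<longleftrightarrow> (p ^ Suc n - 1) * (l * p ^ n - k) = 0"
      by (simp only: geometric_two_sided[OF nz(1)])
    also have "\<dots> \<longleftrightarrow> l * p ^ n - k = 0" using nz by (simp del: power_Suc)
    finally show ?thesis .
  qed
  thus ?thesis using assms(2) by (auto simp: field_simps)
qed

lemma not_root_of_unity_inj:
  assumes "not_root_of_unity p" "p powi m = p powi n"
  shows "m = n"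
proof -
  have p: "p \<noteq> 0" "\<And>n::nat. 0 < n \<Longrightarrow> p ^ n \<noteq> 1" using assms by (auto simp: not_root_of_unity_def)
  have False if "m < n" "p powi m = p powi n" for m n :: int
  proof -
    have "p powi (n - m) = 1" using that p by (simp add: power_int_diff)
    thus False using p(2)[of "nat (n - m)"] that by (simp add: power_int_def)
  qed
  note no = this
  show ?thesis using no[of m n] no[of n m] assms(2) by (cases m n rule: linorder_cases) auto
qed

section \<open>Quantum Serre relations and local nilpotency\<close>

context chamber
begin

text \<open>The iterated twisted commutator of \<open>F i\<close> with \<open>F j\<close>;
  \<open>Sop i j 1\<close> is \<open>Gop i j\<close>. The coefficient is \<open>\<chi>\<close> of
  the current root \<open>k * \<beta> i + \<beta> j\<close> against
  \<open>\<beta> i\<close>.\<close>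

fun Sop :: "nat \<Rightarrow> nat \<Rightarrow> nat \<Rightarrow> 'v \<Rightarrow> 'v" where
  "Sop i j 0 x = F j x"
| "Sop i j (Suc k) x = F i (Sop i j k x) - (\<chi> (\<beta> i) (\<beta> i) ^ k * \<chi> (\<beta> j) (\<beta> i)) *s Sop i j k (F i x)"

lemma funpow_F_Lw: "i \<in> I \<Longrightarrow> x \<in> Lw \<mu> \<Longrightarrow> (F i ^^ n) x \<in> Lw (\<mu> - of_nat n * \<beta> i)"
proof (induction n)
  case (Suc n)
  thus ?case using F_Lw[of i "(F i ^^ n) x" "\<mu> - of_nat n * \<beta> i"] by (simp add: algebra_simps)
qed simp

lemma funpow_E_Lw: "i \<in> I \<Longrightarrow> x \<in> Lw \<mu> \<Longrightarrow> (E i ^^ n) x \<in> Lw (\<mu> + of_nat n * \<beta> i)"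
proof (induction n)
  case (Suc n)
  thus ?case using E_Lw[of i "(E i ^^ n) x" "\<mu> + of_nat n * \<beta> i"] by (simp add: algebra_simps)
qed simp

lemma funpow_F_0: "i \<in> I \<Longrightarrow> (F i ^^ n) 0 = 0"
  by (induction n) auto

lemma funpow_F_lin: "i \<in> I \<Longrightarrow> (F i ^^ n) (x + y) = (F i ^^ n) x + (F i ^^ n) y"
    "i \<in> I \<Longrightarrow> (F i ^^ n) (c *s x) = c *s (F i ^^ n) x"
  by (induction n) (auto simp: F_add F_scale)

lemma eig_of_nat:
  "keig i (\<mu> + of_nat n * \<beta> i) = keig i \<mu> * \<chi> (\<beta> i) (\<beta> i) ^ n"
  "keig i (\<mu> - of_nat n * \<beta> i) = keig i \<mu> * inverse (\<chi> (\<beta> i) (\<beta> i)) ^ n"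
  "leig i (\<mu> + of_nat n * \<beta> i) = leig i \<mu> * inverse (\<chi> (\<beta> i) (\<beta> i)) ^ n"
  "leig i (\<mu> - of_nat n * \<beta> i) = leig i \<mu> * \<chi> (\<beta> i) (\<beta> i) ^ n"
proof -
  have "keig i (\<mu> + of_nat (Suc n) * \<beta> i) = keig i (\<mu> + of_nat n * \<beta> i) * \<chi> (\<beta> i) (\<beta> i)"
    "keig i (\<mu> - of_nat (Suc n) * \<beta> i) = keig i (\<mu> - of_nat n * \<beta> i) * inverse (\<chi> (\<beta> i) (\<beta> i))"
    "leig i (\<mu> + of_nat (Suc n) * \<beta> i) = leig i (\<mu> + of_nat n * \<beta> i) * inverse (\<chi> (\<beta> i) (\<beta> i))"
    "leig i (\<mu> - of_nat (Suc n) * \<beta> i) = leig i (\<mu> - of_nat n * \<beta> i) * \<chi> (\<beta> i) (\<beta> i)" for n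
    using eig_shift(1)[of i "\<mu> + of_nat n * \<beta> i" "\<beta> i"] eig_shift(2)[of i "\<mu> - of_nat n * \<beta> i" "\<beta> i"]
      eig_shift(3)[of i "\<mu> + of_nat n * \<beta> i" "\<beta> i"] eig_shift(4)[of i "\<mu> - of_nat n * \<beta> i" "\<beta> i"]
    by (simp_all add: algebra_simps divide_inverse)
  note step = this
  show "keig i (\<mu> + of_nat n * \<beta> i) = keig i \<mu> * \<chi> (\<beta> i) (\<beta> i) ^ n"
    by (induction n) (simp, subst step, simp add: mult_ac)
  show "keig i (\<mu> - of_nat n * \<beta> i) = keig i \<mu> * inverse (\<chi> (\<beta> i) (\<beta> i)) ^ n"
    by (induction n) (simp, subst step, simp add: mult_ac)
  show "leig i (\<mu> + of_nat n * \<beta> i) = leig i \<mu> * inverse (\<chi> (\<beta> i) (\<beta> i)) ^ n"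
    by (induction n) (simp, subst step, simp add: mult_ac)
  show "leig i (\<mu> - of_nat n * \<beta> i) = leig i \<mu> * \<chi> (\<beta> i) (\<beta> i) ^ n"
    by (induction n) (simp, subst step, simp add: mult_ac)
qed

context
  fixes i j assumes i: "i \<in> I" and j: "j \<in> I" and ij: "i \<noteq> j"
begin

lemma Sop_lin: "Sop i j k (x + y) = Sop i j k x + Sop i j k y" "Sop i j k (c *s x) = c *s Sop i j k x"
  by (induction k arbitrary: x y)
     (use i j in \<open>auto simp: F_add F_scale scale_simps algebra_simps scale_left_commute\<close>)

lemma Sop_0: "Sop i j k 0 = 0" using Sop_lin(2)[of k 0 0] by simp

lemma Sop_Lw: "x \<in> Lw \<mu> \<Longrightarrow> Sop i j k x \<in> Lw (\<mu> - (of_nat k * \<beta> i + \<beta> j))"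
proof (induction k arbitrary: x \<mu>)
  case 0
  thus ?case using F_Lw[OF j] by simp
next
  case (Suc k)
  have "F i (Sop i j k x) \<in> Lw (\<mu> - (of_nat (Suc k) * \<beta> i + \<beta> j))"
    using F_Lw[OF i Suc.IH[OF Suc.prems]] by (simp add: algebra_simps)
  moreover have "Sop i j k (F i x) \<in> Lw (\<mu> - (of_nat (Suc k) * \<beta> i + \<beta> j))"
    using Suc.IH[OF F_Lw[OF i Suc.prems]] by (simp add: algebra_simps)
  ultimately show ?case by (simp add: diff_Lw scale_Lw)
qed

lemma E_Sop_i:
  assumes "x \<in> Lw \<mu>"
  shows "E i (Sop i j k x) = Sop i j k (E i x) +
     ((\<Sum>s<k. \<chi> (\<beta> j) (\<beta> i) * \<chi> (\<beta> i) (\<beta> i) ^ s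
         - inverse (\<chi> (\<beta> i) (\<beta> j)) * inverse (\<chi> (\<beta> i) (\<beta> i)) ^ s) * keig i \<mu>) *s Sop i j (k - 1) x"
  using assms
proof (induction k arbitrary: x \<mu>)
  case 0
  thus ?case using EF_other[OF i j ij] by simp
next
  case (Suc k)
  define p a b where "p = \<chi> (\<beta> i) (\<beta> i)" and "a = \<chi> (\<beta> i) (\<beta> j)" and "b = \<chi> (\<beta> j) (\<beta> i)"
  define c where "c k = (\<Sum>s<k. b * p ^ s - inverse a * inverse p ^ s)" for k
  have nz: "p \<noteq> 0" "a \<noteq> 0" by (auto simp: p_def a_def chi_nz)
  let ?\<nu> = "\<mu> - (of_nat k * \<beta> i + \<beta> j)"
  note x = Suc.prems
  define T where "T = Sop i j (k - 1)"
  have IH: "E i (Sop i j k y) = Sop i j k (E i y) + (c k * keig i \<nu>) *s T y" if "y \<in> Lw \<nu>" for y \<nu>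
    using Suc.IH[OF that] by (simp add: T_def c_def p_def a_def b_def)
  have eig: "leig i ?\<nu> = (p ^ k * b) * leig i \<mu>" "keig i ?\<nu> = inverse p ^ k * inverse a * keig i \<mu>"
    "keig i (\<mu> - \<beta> i) = inverse p * keig i \<mu>"
    unfolding diff_diff_eq[symmetric] eig_shift(2,4)[of i _ "\<beta> j"] eig_of_nat
    by (simp_all add: p_def a_def b_def eig_shift(2)[of i \<mu> "\<beta> i"] field_simps)
  have 1: "E i (F i (Sop i j k x)) = F i (Sop i j k (E i x)) + (c k * keig i \<mu>) *s F i (T x)
      + ((p ^ k * b) * leig i \<mu> - inverse p ^ k * inverse a * keig i \<mu>) *s Sop i j k x"
    using EF_eig[OF i Sop_Lw[OF x]] IH[OF x] i by (simp add: eig F_add F_scale)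
  have 2: "E i (Sop i j k (F i x)) = Sop i j k (F i (E i x)) + (leig i \<mu> - keig i \<mu>) *s Sop i j k x
      + (c k * (inverse p * keig i \<mu>)) *s T (F i x)"
    using IH[OF F_Lw[OF i x]] EF_eig[OF i x] by (simp add: eig Sop_lin)
  \<comment> \<open>The recursion for \<open>Sop\<close> solved for \<open>F i (T x)\<close>. The
    factor \<open>c k\<close> makes it valid for \<open>k = 0\<close> too, where
    \<open>k - 1\<close> is truncated to \<open>0\<close> but \<open>c 0 = 0\<close>.\<close>
  have 3: "c k *s F i (T x) = c k *s Sop i j k x + (c k * ((p ^ k * b) * inverse p)) *s T (F i x)"
  proof (cases k)
    case (Suc k')
    thus ?thesis using nz by (simp add: T_def p_def[symmetric] b_def[symmetric] scale_right_diff_distrib mult_ac)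
  qed (simp add: c_def)
  have 4: "(c k * keig i \<mu>) *s F i (T x) = (c k * keig i \<mu>) *s Sop i j k x
      + (keig i \<mu> * (c k * ((p ^ k * b) * inverse p))) *s T (F i x)"
    using arg_cong[OF 3, of "\<lambda>z. keig i \<mu> *s z"] by (simp add: scale_right_distrib mult_ac)
  have 5: "c (Suc k) = c k + (b * p ^ k - inverse a * inverse p ^ k)" by (simp add: c_def)
  have "E i (Sop i j (Suc k) x) = Sop i j (Suc k) (E i x) + (c (Suc k) * keig i \<mu>) *s Sop i j k x"
    using i by (simp add: 5 E_diff E_scale 1 2 4 p_def[symmetric] b_def[symmetric] scale_simps algebra_simps)
  thus ?case by (simp add: c_def a_def b_def p_def del: Sop.simps)
qed

text \<open>\<open>F i\<close> commutes with \<open>E j\<close>, so a step only compares the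
  eigenvalue \<open>leig j\<close> before and after a shift by \<open>\<beta> i\<close>; this
  contributes one factor per step.\<close>

lemma E_Sop_j:
  assumes "x \<in> Lw \<mu>"
  shows "E j (Sop i j (Suc k) x) = Sop i j (Suc k) (E j x) +
     ((\<Prod>s\<le>k. 1 - \<chi> (\<beta> i) (\<beta> i) ^ s * qform (\<beta> i) (\<beta> j)) * leig j \<mu>) *s (F i ^^ Suc k) x"
  using assms
proof (induction k arbitrary: x \<mu>)
  case 0
  thus ?case using E_Gop_j[OF i j 0 ij] by (simp add: Gop_def)
next
  case (Suc k)
  define p b where "p = \<chi> (\<beta> i) (\<beta> i)" and "b = \<chi> (\<beta> j) (\<beta> i)"
  define e where "e k = (\<Prod>s\<le>k. 1 - p ^ s * qform (\<beta> i) (\<beta> j))" for k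
  note x = Suc.prems
  have IH: "E j (Sop i j (Suc k) y) = Sop i j (Suc k) (E j y) + (e k * leig j \<nu>) *s (F i ^^ Suc k) y"
    if "y \<in> Lw \<nu>" for y \<nu>
    using Suc.IH[OF that] by (simp only: e_def p_def)
  have 1: "E j (F i (Sop i j (Suc k) x)) = F i (Sop i j (Suc k) (E j x)) + (e k * leig j \<mu>) *s (F i ^^ Suc (Suc k)) x"
    using EF_other[OF j i _ Sop_Lw[OF x]] IH[OF x] ij i by (simp add: F_add F_scale del: Sop.simps)
  have 2: "E j (Sop i j (Suc k) (F i x)) = Sop i j (Suc k) (F i (E j x)) + (e k * leig j (\<mu> - \<beta> i)) *s (F i ^^ Suc (Suc k)) x"
    using IH[OF F_Lw[OF i x]] EF_other[OF j i _ x] ij by (simp del: Sop.simps funpow.simps add: funpow_Suc_right)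
  have 3: "e (Suc k) * leig j \<mu> = e k * leig j \<mu> - p ^ Suc k * b * (e k * leig j (\<mu> - \<beta> i))"
    by (simp add: e_def eig_shift qform_def b_def algebra_simps)
  have "E j (Sop i j (Suc (Suc k)) x) = Sop i j (Suc (Suc k)) (E j x) + (e (Suc k) * leig j \<mu>) *s (F i ^^ Suc (Suc k)) x"
    unfolding 3 Sop.simps(2)[of i j "Suc k"] p_def[symmetric] b_def[symmetric]
    using j by (simp add: E_diff E_scale 1 2 scale_simps del: Sop.simps funpow.simps power_Suc)
  thus ?case by (simp only: e_def p_def)
qed

lemma E_Sop_other:
  assumes "l \<in> I" "l \<noteq> i" "l \<noteq> j" "x \<in> Lw \<mu>"
  shows "E l (Sop i j k x) = Sop i j k (E l x)"
  using assms(4)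
proof (induction k arbitrary: x \<mu>)
  case 0
  thus ?case using EF_other[OF assms(1) j assms(3)] by simp
next
  case (Suc k)
  thus ?case using EF_other[OF assms(1) i assms(2) Sop_Lw[OF Suc.prems]] EF_other[OF assms(1) i assms(2) Suc.prems]
      Suc.IH[OF F_Lw[OF i Suc.prems]] Suc.IH[OF Suc.prems] assms(1) by (simp add: E_diff E_scale)
qed

text \<open>At this \<open>k\<close> both coefficients vanish: the sum in \<open>E_Sop_i\<close> by
  symmetry, the product in \<open>E_Sop_j\<close> through its last factor. So the operator commutes
  with all raising operators and \<open>lowering_zero\<close> kills it.\<close>

lemma quantum_Serre:
  assumes k: "\<chi> (\<beta> i) (\<beta> i) ^ k * qform (\<beta> i) (\<beta> j) = 1" and x: "x \<in> Lw \<mu>"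
  shows "Sop i j (Suc k) x = 0"
proof (rule lowering_zero[of "Sop i j (Suc k)" "of_nat (Suc k) * \<beta> i + \<beta> j"])
  define p a b where "p = \<chi> (\<beta> i) (\<beta> i)" and "a = \<chi> (\<beta> i) (\<beta> j)" and "b = \<chi> (\<beta> j) (\<beta> i)"
  have nz: "p \<noteq> 0" "a \<noteq> 0" by (auto simp: p_def a_def chi_nz)
  have b: "b = inverse p ^ k * inverse a"
    using k nz by (simp add: p_def[symmetric] qform_def a_def[symmetric] b_def[symmetric] field_simps)
  \<comment> \<open>The hypothesis on \<open>k\<close> makes the two series mirror images under the
    reversal \<open>s \<mapsto> k - s\<close>.\<close>
  have "(\<Sum>s<Suc k. b * p ^ s) = (\<Sum>s<Suc k. inverse a * inverse p ^ s)"
  proof (rule sum.reindex_bij_witness[of _ "\<lambda>s. k - s" "\<lambda>s. k - s"])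
    fix s assume "s \<in> {..<Suc k}"
    hence "inverse p ^ k = inverse p ^ (k - s) * inverse p ^ s" by (simp flip: power_add)
    thus "inverse a * inverse p ^ (k - s) = b * p ^ s" using nz by (simp add: b field_simps)
  qed auto
  hence c: "(\<Sum>s<Suc k. b * p ^ s - inverse a * inverse p ^ s) = 0"
    by (simp add: sum_subtractf del: sum.lessThan_Suc)
  have e: "(\<Prod>s\<le>k. 1 - p ^ s * qform (\<beta> i) (\<beta> j)) = 0"
    using k by (intro prod_zero) (auto simp: p_def)
  show "E l (Sop i j (Suc k) x) = Sop i j (Suc k) (E l x)" if "l \<in> I" "x \<in> Lw \<mu>" for l x \<mu>
  proof -
    consider "l = i" | "l = j" | "l \<noteq> i" "l \<noteq> j" by blast
    thus ?thesis
    proof cases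
      case 1
      thus ?thesis using E_Sop_i[OF that(2), of "Suc k"] c
        by (simp add: p_def a_def b_def del: Sop.simps sum.lessThan_Suc)
    next
      case 2
      thus ?thesis using E_Sop_j[OF that(2), of k] e by (simp add: p_def del: Sop.simps)
    next
      case 3
      thus ?thesis using E_Sop_other that by blast
    qed
  qed
  have "0 \<le> h (of_nat n * \<beta> i)" for n
    using h_pos[OF i] by (induction n) (auto simp: h_add distrib_right)
  thus "0 < h (of_nat (Suc k) * \<beta> i + \<beta> j)"
    using h_pos[OF j] by (metis h_add add_nonneg_pos)
qed (use x Sop_0 Sop_Lw in \<open>auto simp del: Sop.simps of_nat_Suc\<close>)

end

definition locally_nilpotent :: "nat \<Rightarrow> 'v \<Rightarrow> bool" where
  "locally_nilpotent i x \<longleftrightarrow> (\<exists>n. (F i ^^ n) x = 0)"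

lemma locally_nilpotent_F: "locally_nilpotent i (F i x) \<longleftrightarrow> locally_nilpotent i x" if "i \<in> I"
proof
  assume "locally_nilpotent i (F i x)"
  then obtain n where "(F i ^^ n) (F i x) = 0" by (auto simp: locally_nilpotent_def)
  hence "(F i ^^ Suc n) x = 0" by (simp add: funpow_swap1)
  thus "locally_nilpotent i x" unfolding locally_nilpotent_def by blast
next
  assume "locally_nilpotent i x"
  then obtain n where "(F i ^^ n) x = 0" by (auto simp: locally_nilpotent_def)
  hence "(F i ^^ n) (F i x) = 0" using that by (simp add: funpow_swap1[symmetric])
  thus "locally_nilpotent i (F i x)" unfolding locally_nilpotent_def by blast
qed

lemma locally_nilpotent_lin:
  assumes "i \<in> I" "locally_nilpotent i x" "locally_nilpotent i y"
  shows "locally_nilpotent i (x + c *s y)"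
proof -
  obtain m n where "(F i ^^ m) x = 0" "(F i ^^ n) y = 0"
    using assms by (auto simp: locally_nilpotent_def)
  hence "(F i ^^ (n + m)) x = 0" "(F i ^^ (m + n)) y = 0"
    using funpow_F_0[OF assms(1)] by (simp_all add: funpow_add)
  hence "(F i ^^ (m + n)) (x + c *s y) = 0"
    by (simp add: funpow_F_lin[OF assms(1)] add.commute)
  thus ?thesis unfolding locally_nilpotent_def by blast
qed

lemma locally_nilpotent_0: "locally_nilpotent i 0"
  by (auto simp: locally_nilpotent_def intro: exI[of _ 0])

text \<open>Rewriting the recursion as
  \<open>F i (Sop s x) = Sop (s + 1) x + c * Sop s (F i x)\<close> reduces to a higher order, which
  ends at the Serre relation, and to a vector killed by fewer powers of \<open>F i\<close>. Hence
  the induction on \<open>Suc k - s\<close> outside and on \<open>n\<close> inside.\<close>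

lemma locally_nilpotent_Sop:
  assumes i: "i \<in> I" and j: "j \<in> I" and ij: "i \<noteq> j"
    and k: "\<chi> (\<beta> i) (\<beta> i) ^ k * qform (\<beta> i) (\<beta> j) = 1"
    and "x \<in> Lw \<mu>" "(F i ^^ n) x = 0" "s \<le> Suc k"
  shows "locally_nilpotent i (Sop i j s x)"
  using assms(5-)
proof (induction "Suc k - s" arbitrary: s x n \<mu>)
  case 0
  hence "s = Suc k" by simp
  thus ?case using quantum_Serre[OF i j ij k 0(2)] locally_nilpotent_0 by simp
next
  case (Suc d)
  note hyp = Suc.hyps(1) and s = Suc.hyps(2)
  show ?case using Suc.prems
  proof (induction n arbitrary: x \<mu>)
    case 0
    thus ?case using Sop_0[OF i j ij] locally_nilpotent_0 by simp
  next
    case (Suc n)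
    have "locally_nilpotent i (Sop i j s (F i x))"
      by (rule Suc.IH[OF F_Lw[OF i Suc.prems(1)]]) (use Suc.prems in \<open>simp_all add: funpow_swap1\<close>)
    moreover have "locally_nilpotent i (Sop i j (Suc s) x)"
      by (rule hyp[OF _ Suc.prems(1,2)]) (use s in auto)
    ultimately have "locally_nilpotent i (Sop i j (Suc s) x
        + (\<chi> (\<beta> i) (\<beta> i) ^ s * \<chi> (\<beta> j) (\<beta> i)) *s Sop i j s (F i x))"
      by (intro locally_nilpotent_lin i)
    hence "locally_nilpotent i (F i (Sop i j s x))" by simp
    thus ?case using locally_nilpotent_F[OF i] by simp
  qed
qed

text \<open>The module is spanned by words in the lowering operators applied to \<open>v\<close>.
  Letters \<open>F j\<close> with \<open>j \<noteq> i\<close> preserve local nilpotency by the Serre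
  relation, being \<open>Sop i j 0\<close>.\<close>

lemma locally_nilpotent_all:
  assumes i: "i \<in> I" and Q: "\<And>j. j \<in> I \<Longrightarrow> j \<noteq> i \<Longrightarrow> \<exists>k. \<chi> (\<beta> i) (\<beta> i) ^ k * qform (\<beta> i) (\<beta> j) = 1"
    and v: "locally_nilpotent i v" and x: "x \<in> Lw \<mu>"
  shows "locally_nilpotent i x"
proof -
  have w: "locally_nilpotent i (foldr F w v)" if "set w \<subseteq> I" for w
    using that
  proof (induction w)
    case (Cons j w)
    hence y: "foldr F w v \<in> Lw (\<mu>0 - wt w)" using foldr_F_Lw v_Lw by simp
    show ?case
    proof (cases "j = i")
      case True
      thus ?thesis using Cons locally_nilpotent_F[OF i] by simp
    next
      case False
      obtain k where "\<chi> (\<beta> i) (\<beta> i) ^ k * qform (\<beta> i) (\<beta> j) = 1" using Q False Cons by auto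
      then show ?thesis
        using Cons False locally_nilpotent_Sop[OF i _ _ _ y, of j k _ 0] by (auto simp: locally_nilpotent_def)
    qed
  qed (simp add: v)
  have "x \<in> span {foldr F w v |w. set w \<subseteq> I \<and> \<mu> = \<mu>0 - wt w}" using x Lw_span by simp
  thus ?thesis
  proof (induction rule: span_induct_alt)
    case base
    show ?case by (rule locally_nilpotent_0)
  next
    case (step c y z)
    thus ?case using locally_nilpotent_lin[OF i, of z y c] w by (auto simp: add.commute)
  qed
qed

section \<open>Strings along one simple root and reflections of weights\<close>

lemma nilpotent_E:
  assumes i: "i \<in> I" and x: "x \<in> Lw \<mu>"
  shows "\<exists>n. (E i ^^ n) x = 0"
proof (rule ccontr)
  assume nz: "\<not> (\<exists>n. (E i ^^ n) x = 0)"
  have hn: "h (\<mu> + of_nat n * \<beta> i) \<ge> h \<mu> + int n" for n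
    using h_pos[OF i] by (induction n) (auto simp: h_add distrib_right)
  have "h (\<mu> + of_nat n * \<beta> i) \<le> h \<mu>0" for n
    using h_le[OF funpow_E_Lw[OF i x, of n]] nz by blast
  hence "h \<mu> + int (nat (h \<mu>0 - h \<mu> + 1)) \<le> h \<mu>0" using hn order_trans by blast
  thus False by linarith
qed

lemma E_funpow_F:
  assumes i: "i \<in> I" and y: "y \<in> Lw \<mu>" "E i y = 0"
  shows "E i ((F i ^^ Suc n) y) =
    (\<Sum>s\<le>n. leig i \<mu> * \<chi> (\<beta> i) (\<beta> i) ^ s - keig i \<mu> * inverse (\<chi> (\<beta> i) (\<beta> i)) ^ s) *s (F i ^^ n) y"
proof (induction n)
  case 0
  show ?case using EF_eig[OF i y(1)] y(2) i by simp
next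
  case (Suc n)
  show ?case
    using EF_eig[OF i funpow_F_Lw[OF i y(1), of "Suc n"]] Suc
    by (simp only: funpow.simps comp_apply eig_of_nat F_scale[OF i] scale_left_distrib[symmetric] sum.atMost_Suc)
qed

lemma F_funpow_E:
  assumes i: "i \<in> I" and y: "y \<in> Lw \<mu>" "F i y = 0"
  shows "F i ((E i ^^ Suc n) y) =
    (\<Sum>s\<le>n. keig i \<mu> * \<chi> (\<beta> i) (\<beta> i) ^ s - leig i \<mu> * inverse (\<chi> (\<beta> i) (\<beta> i)) ^ s) *s (E i ^^ n) y"
proof (induction n)
  case 0
  show ?case using EF_eig[OF i y(1)] y(2) i by (simp add: scale_left_diff_distrib algebra_simps)
next
  case (Suc n)
  have "F i (E i z) = E i (F i z) + (keig i \<nu> - leig i \<nu>) *s z" if "z \<in> Lw \<nu>" for z \<nu>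
    using EF_eig[OF i that] by (simp add: scale_left_diff_distrib)
  from this[OF funpow_E_Lw[OF i y(1), of "Suc n"]] show ?case
    using Suc
    by (simp only: funpow.simps comp_apply eig_of_nat E_scale[OF i] scale_left_distrib[symmetric] sum.atMost_Suc)
qed

context
  fixes i assumes i: "i \<in> I" and nru: "not_root_of_unity (\<chi> (\<beta> i) (\<beta> i))"
begin

lemma E_funpow_F_zero_iff:
  assumes "y \<in> Lw \<mu>" "E i y = 0" "(F i ^^ n) y \<noteq> 0"
  shows "E i ((F i ^^ Suc n) y) = 0 \<longleftrightarrow> lam (\<beta> i) \<mu> = \<chi> (\<beta> i) (\<beta> i) ^ n"
  unfolding E_funpow_F[OF i assms(1,2)] lam_eig using assms(3)
  by (simp add: two_sided_sum_zero_iff[OF nru eig_nz(2)] del: sum.atMost_Suc)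

lemma F_funpow_E_zero_iff:
  assumes "y \<in> Lw \<mu>" "F i y = 0" "(E i ^^ n) y \<noteq> 0"
  shows "F i ((E i ^^ Suc n) y) = 0 \<longleftrightarrow> inverse (lam (\<beta> i) \<mu>) = \<chi> (\<beta> i) (\<beta> i) ^ n"
  unfolding F_funpow_E[OF i assms(1,2)] lam_eig using assms(3)
  by (simp add: two_sided_sum_zero_iff[OF nru eig_nz(1)] del: sum.atMost_Suc)

lemma funpow_F_nonzero:
  assumes "y \<in> Lw \<mu>" "E i y = 0" "y \<noteq> 0" "\<And>m. m < n \<Longrightarrow> lam (\<beta> i) \<mu> \<noteq> \<chi> (\<beta> i) (\<beta> i) ^ m"
  shows "(F i ^^ n) y \<noteq> 0"
  using assms(4)
proof (induction n)
  case (Suc n)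
  thus ?case using E_funpow_F_zero_iff[OF assms(1,2), of n] i by (metis E_0 lessI less_SucI)
qed (simp add: assms)

lemma funpow_E_nonzero:
  assumes "y \<in> Lw \<mu>" "F i y = 0" "y \<noteq> 0" "\<And>m. m < n \<Longrightarrow> inverse (lam (\<beta> i) \<mu>) \<noteq> \<chi> (\<beta> i) (\<beta> i) ^ m"
  shows "(E i ^^ n) y \<noteq> 0"
  using assms(4)
proof (induction n)
  case (Suc n)
  thus ?case using F_funpow_E_zero_iff[OF assms(1,2), of n] i by (metis F_0 lessI less_SucI)
qed (simp add: assms)

lemma nilpotent_imp_lam:
  assumes "locally_nilpotent i v"
  shows "\<exists>r. lam (\<beta> i) \<mu>0 = \<chi> (\<beta> i) (\<beta> i) ^ r"
proof (rule ccontr)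
  assume "\<not> ?thesis"
  hence "(F i ^^ n) v \<noteq> 0" for n using funpow_F_nonzero[OF v_Lw E_v[OF i] v_nz] by blast
  thus False using assms by (auto simp: locally_nilpotent_def)
qed

text \<open>All other raising operators commute with \<open>F i\<close> and kill \<open>v\<close>;
  at the power \<open>Suc r\<close> the coefficient of \<open>E_funpow_F\<close> vanishes as well.
  The vector is singular of a weight different from \<open>\<mu>0\<close>, hence zero.\<close>

lemma lam_imp_nilpotent:
  assumes "lam (\<beta> i) \<mu>0 = \<chi> (\<beta> i) (\<beta> i) ^ r"
  shows "locally_nilpotent i v"
proof -
  have "E j ((F i ^^ n) v) = 0" if "j \<in> I" "j \<noteq> i" for j n
    by (induction n) (use that E_v EF_other[OF that(1) i that(2) funpow_F_Lw[OF i v_Lw]] i in auto)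
  moreover have "E i ((F i ^^ Suc r) v) = 0"
    using E_funpow_F_zero_iff[OF v_Lw E_v[OF i], of r] assms i by (cases "(F i ^^ r) v = 0") auto
  ultimately have E: "E j ((F i ^^ Suc r) v) = 0" if "j \<in> I" for j using that by metis
  have "h (of_nat n * \<beta> i) = int n * h (\<beta> i)" for n
    by (induction n) (auto simp: h_add distrib_right)
  hence "h (of_nat (Suc r) * \<beta> i) \<noteq> 0" using h_pos[OF i] by (simp del: of_nat_Suc)
  hence "\<mu>0 - of_nat (Suc r) * \<beta> i \<noteq> \<mu>0" by (metis diff_0_right diff_left_imp_eq h_0)
  hence "(F i ^^ Suc r) v = 0" using singular_zero[OF funpow_F_Lw[OF i v_Lw] E] by blast
  thus ?thesis unfolding locally_nilpotent_def by blast
qed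

text \<open>The rank one string argument: from \<open>x\<close> one goes to the end of its string
  and comes back by a known number of steps. An earlier break on the way back is excluded by
  injectivity of \<open>c \<mapsto> p powi c\<close>. For \<open>E i\<close> local nilpotency
  follows from the bounded height.\<close>

lemma weight_reflection:
  assumes x: "x \<in> Lw \<mu>" "x \<noteq> 0" and nil: "locally_nilpotent i x"
    and c: "lam (\<beta> i) \<mu> = \<chi> (\<beta> i) (\<beta> i) powi c"
  shows "\<exists>y \<in> Lw (\<mu> - of_int c * \<beta> i). y \<noteq> 0"
proof -
  define p where "p = \<chi> (\<beta> i) (\<beta> i)"
  have p: "p \<noteq> 0" by (simp add: p_def chi_nz)
  have qf: "qform (\<beta> i) (of_nat n * \<beta> i) = p powi (2 * int n)" for n
    unfolding qform_of_nat by (simp add: qform_def p_def power_int_mult power2_eq_square)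
  \<comment> \<open>The last nonzero vector of a string, used once for \<open>E i\<close> and once
    for \<open>F i\<close>.\<close>
  have last: "\<exists>n. (f ^^ n) x \<noteq> 0 \<and> f ((f ^^ n) x) = 0" if "\<exists>n. (f ^^ n) x = 0" for f :: "'v \<Rightarrow> 'v"
  proof -
    define n where "n = (LEAST n. (f ^^ n) x = 0)"
    have n: "(f ^^ n) x = 0" unfolding n_def using that by (rule LeastI_ex)
    hence "n \<noteq> 0" using x(2) by (metis funpow_0)
    then obtain m where m: "n = Suc m" using not0_implies_Suc by blast
    hence "m < (LEAST n. (f ^^ n) x = 0)" by (simp add: n_def)
    hence "(f ^^ m) x \<noteq> 0" by (rule not_less_Least)
    thus ?thesis using n m by auto
  qed
  show ?thesis
  proof (cases "0 \<le> c")
    case True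
    obtain k where k: "(E i ^^ k) x \<noteq> 0" "E i ((E i ^^ k) x) = 0"
      using last[OF nilpotent_E[OF i x(1)]] by blast
    \<comment> \<open>After \<open>k\<close> steps up the label is \<open>c + 2 * k\<close>, so the
      first \<open>c + 2 * k\<close> steps of the descent give nonzero vectors; \<open>c + k\<close>
      of them lead to \<open>\<mu> - c * \<beta> i\<close>.\<close>
    let ?y = "(E i ^^ k) x" and ?n = "nat c + k"
    have lam: "lam (\<beta> i) (\<mu> + of_nat k * \<beta> i) = p powi (c + 2 * int k)"
      using p by (simp add: lam_shift c qf p_def[symmetric] power_int_add)
    have nz: "(F i ^^ ?n) ?y \<noteq> 0"
    proof (rule funpow_F_nonzero[OF funpow_E_Lw[OF i x(1)] k(2,1)])
      fix m assume m: "m < ?n"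
      show "lam (\<beta> i) (\<mu> + of_nat k * \<beta> i) \<noteq> \<chi> (\<beta> i) (\<beta> i) ^ m"
      proof
        assume "lam (\<beta> i) (\<mu> + of_nat k * \<beta> i) = \<chi> (\<beta> i) (\<beta> i) ^ m"
        hence "p powi (c + 2 * int k) = p powi int m" by (simp add: lam p_def)
        hence "c + 2 * int k = int m" using not_root_of_unity_inj[OF nru] p_def by blast
        thus False using m True by linarith
      qed
    qed
    have mem: "(F i ^^ ?n) ?y \<in> Lw (\<mu> + of_nat k * \<beta> i - of_nat ?n * \<beta> i)"
      by (rule funpow_F_Lw[OF i funpow_E_Lw[OF i x(1)]])
    have w: "\<mu> - of_int c * \<beta> i = \<mu> + of_nat k * \<beta> i - of_nat ?n * \<beta> i"
      using True by (simp add: distrib_right)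
    show ?thesis unfolding w using nz mem by blast
  next
    case False
    obtain k where k: "(F i ^^ k) x \<noteq> 0" "F i ((F i ^^ k) x) = 0"
      using last[of "F i"] nil by (auto simp: locally_nilpotent_def)
    let ?y = "(F i ^^ k) x" and ?n = "nat (- c) + k"
    have lam: "lam (\<beta> i) (\<mu> - of_nat k * \<beta> i) = p powi (c - 2 * int k)"
      using p by (simp add: lam_shift_diff c qf p_def[symmetric] power_int_diff)
    have nz: "(E i ^^ ?n) ?y \<noteq> 0"
    proof (rule funpow_E_nonzero[OF funpow_F_Lw[OF i x(1)] k(2,1)])
      fix m assume m: "m < ?n"
      show "inverse (lam (\<beta> i) (\<mu> - of_nat k * \<beta> i)) \<noteq> \<chi> (\<beta> i) (\<beta> i) ^ m"
      proof
        assume "inverse (lam (\<beta> i) (\<mu> - of_nat k * \<beta> i)) = \<chi> (\<beta> i) (\<beta> i) ^ m"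
        hence "p powi (- (c - 2 * int k)) = p powi int m" by (simp only: lam p_def power_int_minus power_int_of_nat)
        hence "- (c - 2 * int k) = int m" using not_root_of_unity_inj[OF nru] p_def by blast
        thus False using m False by linarith
      qed
    qed
    have mem: "(E i ^^ ?n) ?y \<in> Lw (\<mu> - of_nat k * \<beta> i + of_nat ?n * \<beta> i)"
      by (rule funpow_E_Lw[OF i funpow_F_Lw[OF i x(1)]])
    have "(of_nat (nat (- c)) :: 'w) = - of_int c"
      using False by (simp add: of_nat_nat)
    hence w: "\<mu> - of_int c * \<beta> i = \<mu> - of_nat k * \<beta> i + of_nat ?n * \<beta> i"
      by (simp add: algebra_simps)
    show ?thesis unfolding w using nz mem by blast
  qed
qed

end

end

text \<open>A base is a function on all naturals, but only its values on \<open>I\<close> carry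
  meaning; reflected and explicit bases are compared there.\<close>

lemma chamber_cong_base:
  assumes "chamber scale Lw KK LL \<chi> \<kappa> \<eta> I \<beta> E F h v \<mu>0" "\<And>i. i \<in> I \<Longrightarrow> \<beta>' i = \<beta> i"
  shows "chamber scale Lw KK LL \<chi> \<kappa> \<eta> I \<beta>' E F h v \<mu>0"
proof -
  interpret chamber scale Lw KK LL \<chi> \<kappa> \<eta> I \<beta> E F h v \<mu>0 by fact
  show ?thesis
    by unfold_locales
      (use assms(2) E_add E_scale F_add F_scale E_Lw F_Lw EF h_add h_pos v_Lw v_nz E_v irreducible in \<open>auto simp: assms(2)\<close>)
qed

context chamber
begin

text \<open>\<open>E i\<close> kills \<open>F i v\<close> exactly when the eigenvalues of
  \<open>K\<close> and \<open>L\<close> agree, and the other raising operators always do; a singular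
  vector below the top is zero. This decides whether an odd reflection moves the highest
  weight.\<close>

lemma F_v_zero_iff: assumes "i \<in> I" shows "F i v = 0 \<longleftrightarrow> lam (\<beta> i) \<mu>0 = 1"
proof
  have E: "E i (F i v) = (leig i \<mu>0 - keig i \<mu>0) *s v"
    using EF_eig[OF assms v_Lw] E_v[OF assms] assms by simp
  show "lam (\<beta> i) \<mu>0 = 1" if "F i v = 0"
    using E that assms v_nz eig_nz by (simp add: lam_eig)
  assume "lam (\<beta> i) \<mu>0 = 1"
  hence "E i (F i v) = 0" using E eig_nz by (simp add: lam_eig)
  hence E': "E j (F i v) = 0" if "j \<in> I" for j
    using EF_other[OF that assms _ v_Lw] E_v[OF that] assms by (cases "i = j") auto
  have "\<mu>0 - \<beta> i \<noteq> \<mu>0" using h_pos[OF assms] by auto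
  thus "F i v = 0" using singular_zero[OF F_Lw[OF assms v_Lw] E'] by blast
qed

text \<open>Otherwise the vectors \<open>(F i ^^ n) v\<close> would have infinitely many distinct
  weights, separated by \<open>h\<close>.\<close>

lemma finite_weights_imp_nilpotent:
  assumes i: "i \<in> I" and fin: "finite {\<mu>. \<exists>x \<in> Lw \<mu>. x \<noteq> 0}"
  shows "locally_nilpotent i v"
proof (rule ccontr)
  assume "\<not> locally_nilpotent i v"
  hence nz: "(F i ^^ n) v \<noteq> 0" for n by (auto simp: locally_nilpotent_def)
  have hn: "h (of_nat n * \<beta> i) = int n * h (\<beta> i)" for n
    by (induction n) (auto simp: h_add distrib_right)
  have "inj (\<lambda>n. \<mu>0 - of_nat n * \<beta> i)"
  proof (rule injI)
    fix a b assume "\<mu>0 - of_nat a * \<beta> i = \<mu>0 - of_nat b * \<beta> i"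
    hence "h (of_nat a * \<beta> i) = h (of_nat b * \<beta> i)" by simp
    thus "a = b" using h_pos[OF i] by (simp add: hn)
  qed
  moreover have "range (\<lambda>n. \<mu>0 - of_nat n * \<beta> i) \<subseteq> {\<mu>. \<exists>x \<in> Lw \<mu>. x \<noteq> 0}"
    using nz funpow_F_Lw[OF i v_Lw] by blast
  ultimately show False using fin finite_subset finite_imageD by blast
qed

end

subsection \<open>Type B\<close>

text \<open>\<open>n\<close> stands for the position \<open>N - m\<close> of the isotropic simple
  root. The highest weight is placed at \<open>0\<close>; the actual one is carried by the
  characters \<open>\<kappa>\<close> and \<open>\<eta>\<close>.\<close>

locale typeB = chamber scale Lw KK LL \<chi> \<kappa> \<eta> "{1..N}" simple_root E F h v 0
  for scale :: "'k::field_char_0 \<Rightarrow> 'v::ab_group_add \<Rightarrow> 'v" (infixr \<open>*s\<close> 75)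
    and Lw :: "weight \<Rightarrow> 'v set"
    and KK LL :: "weight \<Rightarrow> 'v \<Rightarrow> 'v"
    and \<chi> :: "weight \<Rightarrow> weight \<Rightarrow> 'k"
    and \<kappa> \<eta> :: "weight \<Rightarrow> 'k"
    and N :: nat and E F :: "nat \<Rightarrow> 'v \<Rightarrow> 'v"
    and h :: "weight \<Rightarrow> int" and v :: 'v +
  fixes n m :: nat and qh :: 'k
  assumes n: "1 \<le> n" and m: "1 \<le> m" and N: "N = n + m"
    and nru: "not_root_of_unity qh"
    and chi_NN: "\<chi> (simple_root N) (simple_root N) = qh"
    and chi_less: "\<And>i. 1 \<le> i \<Longrightarrow> i < n \<Longrightarrow> \<chi> (simple_root i) (simple_root i) = qh powi (-2)"
    and chi_n: "\<chi> (simple_root n) (simple_root n) = -1"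
    and chi_greater: "\<And>i. n < i \<Longrightarrow> i < N \<Longrightarrow> \<chi> (simple_root i) (simple_root i) = qh powi 2"
    and edge_le: "\<And>i. 1 \<le> i \<Longrightarrow> i < n \<Longrightarrow> qform (simple_root i) (simple_root (Suc i)) = qh powi 2"
    and edge_ge: "\<And>i. n \<le> i \<Longrightarrow> i < N \<Longrightarrow> qform (simple_root i) (simple_root (Suc i)) = qh powi (-2)"
    and no_edge: "\<And>i j. i \<in> {1..N} \<Longrightarrow> j \<in> {1..N} \<Longrightarrow> Suc i < j \<Longrightarrow> qform (simple_root i) (simple_root j) = 1"
begin

lemma N_le: "n + m \<le> N" "N \<le> n + m" and n_less_N: "n < N" using N m by auto

lemma qh_nz: "qh \<noteq> 0" using nru by (simp add: not_root_of_unity_def)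

text \<open>The orthogonal basis behind the root system: consecutive differences are the simple
  roots, and \<open>\<xi> N\<close> is the last one. The value \<open>\<nu> t\<close> will be
  \<open>qform (\<xi> t) (\<xi> t)\<close>; its exponent changes sign after \<open>n\<close>, in
  accordance with the isotropy of the \<open>n\<close>-th simple root.\<close>

definition \<xi> :: "nat \<Rightarrow> weight" where "\<xi> t = (\<Sum>s\<in>{t..N}. simple_root s)"
definition \<nu> :: "nat \<Rightarrow> 'k" where "\<nu> t = (if t \<le> n then qh powi (-2) else qh powi 2)"

lemma nu_nz: "\<nu> t \<noteq> 0" using qh_nz by (simp add: \<nu>_def)

lemma nu_neq_1: "\<nu> t \<noteq> 1"
proof
  assume "\<nu> t = 1"
  hence "qh powi (if t \<le> n then -2 else 2) = qh powi 0" by (simp add: \<nu>_def split: if_splits)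
  thus False using not_root_of_unity_inj[OF nru] by (metis neg_equal_0_iff_equal zero_neq_numeral)
qed

lemma xi_Suc: "t \<le> N \<Longrightarrow> \<xi> t = simple_root t + \<xi> (Suc t)"
  by (simp add: \<xi>_def sum.atLeast_Suc_atMost)

lemma xi_beyond: "N < t \<Longrightarrow> \<xi> t = 0" by (simp add: \<xi>_def)

lemma simple_root_xi: "t \<le> N \<Longrightarrow> simple_root t = \<xi> t - \<xi> (Suc t)"
  by (simp add: xi_Suc)

text \<open>All data are expressed by \<open>\<nu>\<close>. The isotropic root fits the general
  diagonal formula since \<open>\<nu> n * \<nu> (Suc n) = 1\<close>, which is the square of
  \<open>-1\<close>.\<close>

lemma qform_simple:
  assumes "s \<in> {1..N}" "t \<in> {1..N}"
  shows "qform (simple_root s) (simple_root t) =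
    (if s = t then \<nu> s * (if s = N then 1 else \<nu> (Suc s)) else if t = Suc s then inverse (\<nu> t)
     else if s = Suc t then inverse (\<nu> s) else 1)"
proof -
  have edge: "qform (simple_root i) (simple_root (Suc i)) = inverse (\<nu> (Suc i))" if "1 \<le> i" "i < N" for i
    using that edge_le[of i] edge_ge[of i] by (cases "i < n") (auto simp: \<nu>_def power_int_minus)
  have diag: "qform (simple_root i) (simple_root i) = \<nu> i * (if i = N then 1 else \<nu> (Suc i))"
    if i: "1 \<le> i" "i \<le> N" for i
  proof -
    consider "i < n" | "i = n" | "n < i" "i < N" | "i = N" using i by linarith
    moreover have "inverse qh * inverse qh * (qh * qh) = 1" using qh_nz by (simp add: field_simps)
    ultimately show ?thesis
      by cases (use i n_less_N qh_nz in \<open>auto simp: qform_def \<nu>_def chi_less chi_n chi_greater chi_NN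
         power_int_minus power2_eq_square\<close>)
  qed
  consider "s = t" | "t = Suc s" | "s = Suc t" | "Suc s < t" | "Suc t < s" by linarith
  thus ?thesis
    by cases (use assms diag[of s] edge[of s] edge[of t] no_edge[of s t] no_edge[of t s]
        qform_commute[of "simple_root s" "simple_root t"] in auto)
qed

lemma qform_xi_simple:
  assumes "s \<in> {1..Suc N}" "t \<in> {1..N}"
  shows "qform (\<xi> s) (simple_root t) =
    (if s = Suc N then 1 else if t = s then \<nu> s else if s = Suc t then inverse (\<nu> s) else 1)"
proof -
  have "1 \<le> s \<Longrightarrow> qform (\<xi> s) (simple_root t) =
    (if s = Suc N then 1 else if t = s then \<nu> s else if s = Suc t then inverse (\<nu> s) else 1)"
    if "s \<le> Suc N"
    using that
  proof (induction s rule: inc_induct)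
    case base
    thus ?case by (simp add: xi_beyond)
  next
    case (step s)
    thus ?case using assms(2) qform_simple[of s t] nu_nz
      by (auto simp: xi_Suc qform_add)
  qed
  thus ?thesis using assms by simp
qed

lemma qform_xi:
  assumes "s \<in> {1..N}" "t \<in> {1..N}"
  shows "qform (\<xi> s) (\<xi> t) = (if s = t then \<nu> s else 1)"
proof -
  have "qform (\<xi> s) (\<xi> t) = (if t = s then \<nu> s else if t < s then 1 else 1)" if "t \<le> N" "1 \<le> t"
  proof -
    have "1 \<le> t \<Longrightarrow> qform (\<xi> s) (\<xi> t) = (if t \<le> s then (if t = s then \<nu> s else 1) else 1)"
      if "t \<le> Suc N"
      using that
    proof (induction t rule: inc_induct)
      case base
      thus ?case using assms(1) by (auto simp: xi_beyond)
    next
      case (step t)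
      thus ?case using assms(1) qform_xi_simple[of s t] nu_nz by (auto simp: xi_Suc qform_add)
    qed
    thus ?thesis using that by simp
  qed
  thus ?thesis using assms by auto
qed

text \<open>Coordinates with respect to the basis \<open>\<xi>\<^sub>1, \<dots>, \<xi>\<^sub>N\<close>.\<close>

definition coord :: "nat \<Rightarrow> weight \<Rightarrow> int" where
  "coord t w = Poly_Mapping.lookup w t - (if t = 1 then 0 else Poly_Mapping.lookup w (t - 1))"

lemma coord_add: "coord t (a + b) = coord t a + coord t b"
  by (simp add: coord_def lookup_add)

lemma coord_0 [simp]: "coord t 0 = 0" by (simp add: coord_def)

lemma coord_minus: "coord t (- a) = - coord t a"
  using coord_add[of t a "-a"] by simp

lemma coord_diff: "coord t (a - b) = coord t a - coord t b"
  using coord_add[of t a "-b"] by (simp add: coord_minus)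

lemma coord_of_int: "coord t (of_int c * a) = c * coord t a"
proof (cases c)
  have *: "coord t (of_nat k * a) = int k * coord t a" for k
    by (induction k) (auto simp: coord_add distrib_right)
  case (nonneg k)
  thus ?thesis using * by simp
next
  have *: "coord t (of_nat k * a) = int k * coord t a" for k
    by (induction k) (auto simp: coord_add distrib_right)
  case (neg k)
  thus ?thesis using *[of "Suc k"] by (simp add: coord_minus del: of_nat_Suc)
qed

lemma lookup_xi: "Poly_Mapping.lookup (\<xi> s) t = (if s \<le> t \<and> t \<le> N then 1 else 0)"
  by (auto simp: \<xi>_def lookup_sum simple_root_def lookup_single when_def)

lemma coord_xi: "s \<in> {1..N} \<Longrightarrow> t \<in> {1..N} \<Longrightarrow> coord t (\<xi> s) = (if s = t then 1 else 0)"
  by (auto simp: coord_def lookup_xi)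

lemma coord_simple: "s \<in> {1..N} \<Longrightarrow> t \<in> {1..N} \<Longrightarrow>
   coord t (simple_root s) = (if t = s then 1 else 0) - (if t = Suc s then 1 else 0)"
  by (auto simp: coord_def simple_root_def lookup_single when_def)

text \<open>The base obtained from \<open>\<xi>\<^sub>1, \<dots>, \<xi>\<^sub>N\<close> by moving \<open>\<xi>\<^sub>n\<close> to the right past \<open>j\<close> vectors.\<close>

definition zeta :: "nat \<Rightarrow> nat \<Rightarrow> weight" where
  "zeta j t = (if t < n then \<xi> t else if t < n + j then \<xi> (Suc t) else if t = n + j then \<xi> n else \<xi> t)"
definition base :: "nat \<Rightarrow> nat \<Rightarrow> weight" where
  "base j t = zeta j t - zeta j (Suc t)"
text \<open>The place of \<open>\<xi> t\<close> in the ordering \<open>zeta j\<close>, that is, the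
  inverse permutation.\<close>

definition pos :: "nat \<Rightarrow> nat \<Rightarrow> nat" where
  "pos j t = (if t < n then t else if t = n then n + j else if t \<le> n + j then t - 1 else t)"
text \<open>Chosen to assign \<open>Suc N - t\<close> to the \<open>t\<close>-th vector of the
  ordering, where \<open>zeta j (Suc N) = 0\<close>, so that for \<open>j \<le> m\<close> every root
  of \<open>base j\<close> gets height one.\<close>

definition height :: "nat \<Rightarrow> weight \<Rightarrow> int" where
  "height j w = (\<Sum>t\<in>{1..N}. (int (Suc N) - int (pos j t)) * coord t w)"

lemma height_add: "height j (a + b) = height j a + height j b"
  by (simp add: height_def coord_add distrib_left sum.distrib)

lemma height_diff: "height j (a - b) = height j a - height j b"
  using height_add[of j b "a - b"] by simp

lemma height_xi: "t \<in> {1..N} \<Longrightarrow> height j (\<xi> t) = int (Suc N) - int (pos j t)"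
  by (simp add: height_def coord_xi if_distrib[of "(*) _"] sum.delta cong: if_cong)

lemma height_zeta: "j \<le> m \<Longrightarrow> 1 \<le> t \<Longrightarrow> t \<le> Suc N \<Longrightarrow> height j (zeta j t) = int (Suc N) - int t"
proof -
  assume a: "j \<le> m" "1 \<le> t" "t \<le> Suc N"
  have 0: "height j 0 = 0" using height_add[of j 0 0] by simp
  consider "t < n" | "n \<le> t" "t < n + j" | "t = n + j" | "n + j < t" "t \<le> N" | "n + j < t" "t = Suc N"
    using a by linarith
  thus ?thesis
    by cases (use a n m N_le in \<open>auto simp: zeta_def height_xi pos_def xi_beyond 0\<close>)
qed

lemma height_base: "j \<le> m \<Longrightarrow> t \<in> {1..N} \<Longrightarrow> height j (base j t) = 1"
  by (auto simp: base_def height_diff height_zeta)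

lemma qform_zeta:
  assumes "j \<le> m" "s \<in> {1..N}" "t \<in> {1..Suc N}"
  shows "qform (zeta j s) (zeta j t) = 1 \<longleftrightarrow> s \<noteq> t"
proof -
  have "zeta j (Suc N) = 0" using assms(1) n n_less_N N_le by (simp add: zeta_def xi_beyond)
  moreover have "zeta j u = \<xi> (if u < n then u else if u < n + j then Suc u else if u = n + j then n else u)" for u
    by (simp add: zeta_def)
  ultimately show ?thesis using assms nu_neq_1 n N_le
    by (cases "t = Suc N") (auto simp: qform_xi)
qed

lemma base_0: "t \<in> {1..N} \<Longrightarrow> base 0 t = simple_root t"
  by (auto simp: base_def zeta_def simple_root_xi)

lemma base_node: "base j (n + j) = \<xi> n - \<xi> (Suc (n + j))"
  by (simp add: base_def zeta_def)

lemma base_last: "base m N = \<xi> n"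
  using xi_beyond[of "Suc N"] N_le by (simp add: base_def zeta_def)

text \<open>The odd reflection needs the value of \<open>\<chi>\<close> itself, not of
  \<open>qform\<close>. Passing from one node to the next adds an even root \<open>a\<close>: the
  factor \<open>\<chi> a a = qh powi 2\<close> is cancelled by
  \<open>qform g a = qh powi (-2)\<close>, so the value stays \<open>-1\<close>.\<close>

lemma chi_node:
  assumes "Suc j \<le> m"
  shows "\<chi> (\<xi> n - \<xi> (n + Suc j)) (\<xi> n - \<xi> (n + Suc j)) = -1"
  using assms
proof (induction j)
  case 0
  show ?case using simple_root_xi[of n] chi_n N by simp
next
  case (Suc j)
  define g a where "g = \<xi> n - \<xi> (n + Suc j)" and "a = simple_root (n + Suc j)"
  have e: "\<xi> n - \<xi> (n + Suc (Suc j)) = g + a"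
    using Suc.prems N by (simp add: g_def a_def simple_root_xi)
  have "qform g a = qh powi (-2)"
    using Suc.prems N_le n by (simp add: g_def a_def qform_diff qform_xi_simple \<nu>_def power_int_minus inverse_eq_divide)
  moreover have "\<chi> a a = qh powi 2" using Suc.prems N by (simp add: a_def chi_greater)
  moreover have "\<chi> g g = -1" using Suc by (simp add: g_def)
  ultimately show ?case using qh_nz unfolding e
    by (simp add: chi_add_left chi_add_right qform_def power_int_minus power2_eq_square field_simps)
qed

text \<open>Adding the short root \<open>simple_root N\<close> to the last isotropic root
  contributes \<open>qh\<close> from the diagonal and \<open>qh powi (-2)\<close> from the form. The
  sign and the inverse are the origin of the powers of \<open>- qh\<close> in condition
  (ii).\<close>

lemma chi_xi_n: "\<chi> (\<xi> n) (\<xi> n) = - inverse qh"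
proof -
  obtain j where j: "m = Suc j" using m by (cases m) auto
  define g a where "g = \<xi> n - \<xi> (n + Suc j)" and "a = simple_root N"
  have N': "n + Suc j = N" using j N by simp
  have e: "\<xi> n = g + a" unfolding g_def a_def N' by (simp add: simple_root_xi xi_beyond)
  have "qform g a = qh powi (-2)"
    unfolding g_def a_def N' using n n_less_N by (simp add: qform_diff qform_xi_simple \<nu>_def power_int_minus inverse_eq_divide)
  moreover have "\<chi> a a = qh" by (simp add: a_def chi_NN)
  moreover have "\<chi> g g = -1" using chi_node[of j] j by (simp add: g_def)
  ultimately show ?thesis using qh_nz unfolding e
    by (simp add: chi_add_left chi_add_right qform_def power_int_minus power2_eq_square field_simps)
qed

text \<open>The highest weight after \<open>j\<close> odd reflections; by
  \<open>F_v_zero_iff\<close> the case distinction tests whether the reflection leaves the highest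
  weight vector in place.\<close>

primrec hw :: "nat \<Rightarrow> weight" where
  "hw 0 = 0"
| "hw (Suc j) = (if lam (base j (n + j)) (hw j) = 1 then hw j else hw j - base j (n + j))"

text \<open>The operators, the height and the vector change at every step and are only asserted to
  exist; base and highest weight are explicit.\<close>

lemma chamber_chain:
  "j \<le> m \<Longrightarrow> \<exists>E F h v. chamber scale Lw KK LL \<chi> \<kappa> \<eta> {1..N} (base j) E F h v (hw j)"
proof (induction j)
  case 0
  have "chamber scale Lw KK LL \<chi> \<kappa> \<eta> {1..N} simple_root E F h v 0" by unfold_locales
  from chamber_cong_base[OF this base_0]
  have "chamber scale Lw KK LL \<chi> \<kappa> \<eta> {1..N} (base 0) E F h v (hw 0)" by simp
  thus ?case by blast
next
  case (Suc j)
  then obtain E' F' h' v' where "chamber scale Lw KK LL \<chi> \<kappa> \<eta> {1..N} (base j) E' F' h' v' (hw j)"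
    by auto
  then interpret C: chamber scale Lw KK LL \<chi> \<kappa> \<eta> "{1..N}" "base j" E' F' h' v' "hw j" .
  let ?i = "n + j"
  have i: "?i \<in> {1..N}" using Suc.prems n N by auto
  have iso: "\<chi> (base j ?i) (base j ?i) = -1"
    using chi_node[of j] Suc.prems by (simp add: base_node)
  have refl: "C.refl_base ?i t = base (Suc j) t" if t: "t \<in> {1..N}" for t
  proof -
    \<comment> \<open>The reflection at node \<open>?i\<close> interchanges two neighbouring vectors
      of the ordering.\<close>
    have z: "zeta (Suc j) u = (if u = ?i then zeta j (Suc ?i) else if u = Suc ?i then zeta j ?i else zeta j u)" for u
      by (auto simp: zeta_def)
    \<comment> \<open>The node is orthogonal to all but its neighbours, since of the four pairings
      of ordering vectors only those of equal vectors are nontrivial.\<close>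
    have Q: "qform (base j ?i) (base j t) = 1 \<longleftrightarrow> t \<noteq> Suc ?i \<and> Suc t \<noteq> ?i" if "t \<noteq> ?i"
    proof -
      have le: "j \<le> m" "?i \<in> {1..N}" "Suc ?i \<in> {1..N}" "t \<in> {1..Suc N}" "Suc t \<in> {1..Suc N}"
        using Suc.prems n N t by auto
      define A B C D where "A = qform (zeta j ?i) (zeta j t)" and "B = qform (zeta j ?i) (zeta j (Suc t))"
        and "C = qform (zeta j (Suc ?i)) (zeta j t)" and "D = qform (zeta j (Suc ?i)) (zeta j (Suc t))"
      have eq: "qform (base j ?i) (base j t) = (A / B) / (C / D)"
        by (simp add: base_def qform_diff A_def B_def C_def D_def)
      have iff: "A = 1 \<longleftrightarrow> ?i \<noteq> t" "B = 1 \<longleftrightarrow> ?i \<noteq> Suc t" "C = 1 \<longleftrightarrow> Suc ?i \<noteq> t" "D = 1 \<longleftrightarrow> ?i \<noteq> t"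
        using qform_zeta[OF le(1,2,4)] qform_zeta[OF le(1,2,5)] qform_zeta[OF le(1,3,4)] qform_zeta[OF le(1,3,5)]
        by (simp_all add: A_def B_def C_def D_def)
      have AD: "A = 1" "D = 1" using iff that by auto
      show ?thesis
      proof (cases "Suc ?i = t")
        case True
        hence "B = 1" "C \<noteq> 1" using iff by auto
        thus ?thesis using True by (simp add: eq AD)
      next
        case False
        hence "C = 1" using iff by auto
        thus ?thesis using False iff(2) by (auto simp: eq AD)
      qed
    qed
    consider "t = ?i" | "t = Suc ?i" | "Suc t = ?i" | "t \<noteq> ?i" "t \<noteq> Suc ?i" "Suc t \<noteq> ?i" by blast
    thus ?thesis
      by cases (use Q in \<open>simp_all add: C.refl_base_def base_def z\<close>)
  qed
  have "0 < height (Suc j) (C.refl_base ?i t)" if "t \<in> {1..N}" for t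
    using that Suc.prems by (simp add: refl height_base)
  note chamber_cong_base[OF C.reflection_chamber[OF i iso height_add this], of "base (Suc j)"]
  hence "chamber scale Lw KK LL \<chi> \<kappa> \<eta> {1..N} (base (Suc j)) (C.refl_E ?i) (C.refl_F ?i)
     (height (Suc j)) (if F' ?i v' = 0 then v' else F' ?i v') (hw (Suc j))"
    using refl C.F_v_zero_iff[OF i] by simp
  thus ?case by blast
qed

end

section \<open>Arithmetic of the chain of odd reflections\<close>

lemma minus_powi_eq:
  fixes q :: "'a::field_char_0"
  assumes "not_root_of_unity q" "(- q) powi a = q powi b"
  shows "a = b"
proof -
  have q: "q \<noteq> 0" using assms(1) by (simp add: not_root_of_unity_def)
  \<comment> \<open>Squaring removes the sign.\<close>
  have "((- q) powi a)\<^sup>2 = ((- q)\<^sup>2) powi a"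
    by (simp only: power_int_mult_distrib power2_eq_square)
  also have "\<dots> = (q powi a)\<^sup>2" by (simp add: power_int_mult_distrib power2_eq_square)
  finally have "(q powi b)\<^sup>2 = (q powi a)\<^sup>2" using assms(2) by simp
  hence "q powi (b + b) = q powi (a + a)"
    using power_int_add[of q b b] power_int_add[of q a a] q by (simp add: power2_eq_square)
  thus ?thesis using not_root_of_unity_inj[OF assms(1)] by fastforce
qed

text \<open>The arithmetic of the chain, detached from the module: \<open>G j\<close> is the
  eigenvalue at \<open>\<xi> n - \<xi> (n + j)\<close>, \<open>e j\<close> the exponent contributed
  by the even simple root \<open>n + j\<close>, and \<open>cnt j\<close> the number of reflections
  among the first \<open>j\<close> that move the highest weight. The left side is the rank one
  condition at the end of the chain.\<close>

lemma typeB_condition: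
  fixes qh :: "'a::field_char_0" and G :: "nat \<Rightarrow> 'a" and e cnt :: "nat \<Rightarrow> nat"
  assumes nru: "not_root_of_unity qh" and m: "1 \<le> m"
    and G_Suc: "\<And>j. 1 \<le> j \<Longrightarrow> j \<le> m \<Longrightarrow> G (Suc j) = G j * qh ^ e j"
    and cnt_0: "cnt 0 = 0"
    and cnt_Suc: "\<And>j. j < m \<Longrightarrow> cnt (Suc j) = cnt j + (if G (Suc j) * qh ^ (2 * cnt j) = 1 then 0 else 1)"
  shows "(\<exists>r::nat. G (Suc m) * qh ^ (2 * cnt m) = (- inverse qh) ^ r) \<longleftrightarrow>
    G (Suc m) \<in> {qh powi (-2 * int x) |x::nat. x \<le> m - 1} \<union> {(- qh) powi (- (int y + 2 * int m)) |y::nat. True} \<and>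
    (\<forall>x::nat. x \<le> m - 1 \<longrightarrow> G (Suc m) = qh powi (-2 * int x) \<longrightarrow> (\<forall>j. x < j \<and> j \<le> m \<longrightarrow> e j = 0))"
    (is "?L \<longleftrightarrow> ?R1 \<and> ?R2")
proof -
  have q: "qh \<noteq> 0" using nru by (simp add: not_root_of_unity_def)
  have inj: "a = b" if "qh powi a = qh powi b" for a b using not_root_of_unity_inj[OF nru that] .
  have neg: "(- inverse qh) ^ r = (- qh) powi (- int r)" for r :: nat
    by (simp add: power_int_minus power_inverse[symmetric])
  have G_sum: "G (Suc l) = G (Suc x) * qh ^ (\<Sum>u\<in>{Suc x..l}. e u)" if "x \<le> l" "l \<le> m" for x l
    using that
  proof (induction l rule: dec_induct)
    case (step l)
    thus ?case using G_Suc[of "Suc l"] by (simp add: power_add)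
  qed simp
  have cnt_le: "cnt x \<le> cnt l" if "x \<le> l" "l \<le> m" for x l
    using that
  proof (induction l rule: dec_induct)
    case (step l)
    thus ?case using cnt_Suc[of l] by auto
  qed simp
  show ?thesis
  proof (cases "\<exists>j<m. G (Suc j) * qh ^ (2 * cnt j) = 1")
    case True
    \<comment> \<open>The index of the first trivial reflection. The \<open>x\<close> steps before
      it are all effective, which fixes \<open>G (Suc x)\<close>.\<close>
    define x where "x = (LEAST j. j < m \<and> G (Suc j) * qh ^ (2 * cnt j) = 1)"
    have x: "x < m" "G (Suc x) * qh ^ (2 * cnt x) = 1"
      using LeastI_ex[OF True] unfolding x_def by blast+
    have less: "G (Suc j) * qh ^ (2 * cnt j) \<noteq> 1" if "j < x" for j
      using not_less_Least[of j] that x(1) unfolding x_def by force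
    have cnt_x: "cnt j = j" if "j \<le> x" for j
      using that
    proof (induction j)
      case (Suc j)
      have "j < m" "G (Suc j) * qh ^ (2 * cnt j) \<noteq> 1" using Suc less[of j] x(1) by auto
      thus ?case using Suc cnt_Suc[of j] by simp
    qed (rule cnt_0)
    have Gx: "G (Suc x) = qh powi (-2 * int x)"
      using x(2) q unfolding cnt_x[OF order_refl]
      by (simp add: power_int_minus power_int_mult power_mult field_simps)
    define S where "S l = (\<Sum>u\<in>{Suc x..l}. e u)" for l
    have GS: "G (Suc l) = qh powi (-2 * int x + int (S l))" if "x \<le> l" "l \<le> m" for l
      using G_sum[OF that, folded S_def] power_int_add[of qh "-2 * int x" "int (S l)"] q by (simp add: Gx)
    \<comment> \<open>As long as no even label intervenes, the eigenvalue stays at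
      \<open>qh powi (-2 * x)\<close> and every further reflection is trivial too.\<close>
    have cnt_S: "S l = 0 \<longrightarrow> cnt l = x" if "x \<le> l" "l \<le> m" for l
      using that
    proof (induction l rule: dec_induct)
      case base
      show ?case using cnt_x by simp
    next
      case (step l)
      show ?case
      proof
        assume "S (Suc l) = 0"
        hence 0: "S l = 0" using step by (simp add: S_def)
        hence "cnt l = x" "G (Suc l) = qh powi (-2 * int x)" using step GS[of l] by auto
        thus "cnt (Suc l) = x" using cnt_Suc[of l] step q
          by (simp add: power_int_minus power_int_mult power_mult)
      qed
    qed
    have xm: "x \<le> m" using x by simp
    have ge: "x \<le> cnt m" using cnt_le[OF xm order_refl] cnt_x by simp
    have tot: "G (Suc m) * qh ^ (2 * cnt m) = qh powi (-2 * int x + int (S m) + 2 * int (cnt m))"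
      using GS[OF xm order_refl] q by (simp add: power_int_add power_int_mult power_mult)
    \<comment> \<open>The total is a power of \<open>qh\<close>, and the rank one condition allows
      only exponents \<open>- r \<le> 0\<close>. The exponent is \<open>S m\<close> plus twice the
      surplus \<open>cnt m - x\<close>, both nonnegative, so both must vanish.\<close>
    have L: "?L \<longleftrightarrow> S m = 0"
    proof
      assume ?L
      then obtain r :: nat where "(- qh) powi (- int r) = qh powi (-2 * int x + int (S m) + 2 * int (cnt m))"
        unfolding tot neg by metis
      hence "- int r = -2 * int x + int (S m) + 2 * int (cnt m)" using minus_powi_eq[OF nru] by blast
      thus "S m = 0" using ge by linarith
    next
      assume 0: "S m = 0"
      hence "cnt m = x" using cnt_S xm by blast
      hence "G (Suc m) * qh ^ (2 * cnt m) = (- inverse qh) ^ 0" unfolding tot by (simp add: 0)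
      thus ?L by blast
    qed
    have S0: "S m = 0 \<longleftrightarrow> (\<forall>j. x < j \<and> j \<le> m \<longrightarrow> e j = 0)"
      by (auto simp: S_def Suc_le_eq)
    have GSm: "G (Suc m) = qh powi (-2 * int x + int (S m))" using GS[OF xm order_refl] .
    show ?thesis unfolding L
    proof
      assume 0: "S m = 0"
      hence "G (Suc m) = qh powi (-2 * int x)" using GSm by simp
      hence "?R1" using x by (auto intro!: exI[of _ x])
      moreover have ?R2
      proof (intro allI impI)
        fix x' j assume "G (Suc m) = qh powi (-2 * int x')" and j: "x' < j \<and> j \<le> m"
        hence "-2 * int x' = -2 * int x" using GSm 0 inj by (metis add.right_neutral of_nat_0)
        thus "e j = 0" using S0 0 j by auto
      qed
      ultimately show "?R1 \<and> ?R2" by blast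
    next
      assume R: "?R1 \<and> ?R2"
      from R consider x' where "x' \<le> m - 1" "G (Suc m) = qh powi (-2 * int x')"
        | y :: nat where "G (Suc m) = (- qh) powi (- (int y + 2 * int m))" by blast
      thus "S m = 0"
      proof cases
        case 1
        hence e0: "\<And>j. x' < j \<Longrightarrow> j \<le> m \<Longrightarrow> e j = 0" using R by blast
        \<comment> \<open>If \<open>x'\<close> is at least \<open>x\<close>, this equation leaves no
          room for a positive \<open>S m\<close>; if it is smaller, \<open>e0\<close> already covers
          every index after \<open>x\<close>.\<close>
        have eq: "-2 * int x + int (S m) = -2 * int x'" using 1 GSm inj by metis
        show ?thesis
        proof (cases "x' < x")
          case True
          thus ?thesis using e0 S0 by auto
        qed (use eq in linarith)
      next
        case 2
        \<comment> \<open>The exponent on the left is at most \<open>-2 * m\<close>, the one on the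
          right at least \<open>-2 * x\<close>, which is larger.\<close>
        hence "- (int y + 2 * int m) = -2 * int x + int (S m)" using minus_powi_eq[OF nru] GSm by metis
        thus ?thesis using x by linarith
      qed
    qed
  next
    case False
    have cnt: "cnt j = j" if "j \<le> m" for j
      using that by (induction j) (use cnt_0 cnt_Suc False in auto)
    have L: "?L \<longleftrightarrow> (\<exists>y::nat. G (Suc m) = (- qh) powi (- (int y + 2 * int m)))"
    proof -
      have "(- qh) powi (- (int r + 2 * int m)) * qh ^ (2 * m) = (- inverse qh) ^ r" for r :: nat
      proof -
        have "(- qh) powi (- (int r + 2 * int m)) * (- qh) ^ (2 * m) = (- qh) powi (- int r)"
          using power_int_add[of "- qh" "- (int r + 2 * int m)" "int (2 * m)"] q
          by (simp only: power_int_of_nat) simp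
        thus ?thesis by (simp add: neg)
      qed
      moreover have "a = b" if "a * qh ^ (2 * m) = b * qh ^ (2 * m)" for a b using that q by simp
      ultimately show ?thesis unfolding cnt[OF order_refl] by metis
    qed
    show ?thesis unfolding L
    proof
      assume "\<exists>y::nat. G (Suc m) = (- qh) powi (- (int y + 2 * int m))"
      then obtain y :: nat where y: "G (Suc m) = (- qh) powi (- (int y + 2 * int m))" by blast
      have ?R2
      proof (intro allI impI)
        fix x' j assume x': "x' \<le> m - 1" "G (Suc m) = qh powi (-2 * int x')" and j: "x' < j \<and> j \<le> m"
        hence "- (int y + 2 * int m) = -2 * int x'" using y minus_powi_eq[OF nru] by metis
        thus "e j = 0" using x' m by linarith
      qed
      thus "?R1 \<and> ?R2" using y by blast
    next
      assume R: "?R1 \<and> ?R2"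
      show "\<exists>y::nat. G (Suc m) = (- qh) powi (- (int y + 2 * int m))"
      proof (rule ccontr)
        assume "\<not> ?thesis"
        then obtain x' where x': "x' \<le> m - 1" "G (Suc m) = qh powi (-2 * int x')" using R by blast
        hence e0: "\<And>j. x' < j \<Longrightarrow> j \<le> m \<Longrightarrow> e j = 0" using R by blast
        have lt: "x' < m" using x' m by linarith
        \<comment> \<open>Vanishing of the later labels moves the value of \<open>g\<close> back to
          \<open>G (Suc x')\<close>, where it would make reflection \<open>x'\<close>
          trivial.\<close>
        have "(\<Sum>u\<in>{Suc x'..m}. e u) = 0" using e0 by auto
        hence "G (Suc m) = G (Suc x')" using G_sum[of x' m] lt by simp
        hence "G (Suc x') = inverse (qh ^ (2 * x'))"
          using x'(2) by (simp add: power_int_minus power_int_mult power_mult)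
        hence "G (Suc x') * qh ^ (2 * cnt x') = 1" using cnt[of x'] lt q by simp
        thus False using False lt by blast
      qed
    qed
  qed
qed

context typeB
begin

primrec odd_steps :: "nat \<Rightarrow> nat" where
  "odd_steps 0 = 0"
| "odd_steps (Suc j) = odd_steps j + (if lam (base j (n + j)) (hw j) = 1 then 0 else 1)"

text \<open>Every effective reflection subtracts a root pairing with \<open>a\<close> to
  \<open>qh powi (-2)\<close>, and so multiplies the eigenvalue by \<open>qh ^ 2\<close>.\<close>

lemma lam_hw:
  assumes "\<And>i. i < j \<Longrightarrow> qform a (\<xi> n - \<xi> (Suc (n + i))) = qh powi (-2)"
  shows "lam a (hw j) = lam a 0 * qh ^ (2 * odd_steps j)"
  using assms
proof (induction j)
  case (Suc j)
  have "qform a (base j (n + j)) = qh powi (-2)" using Suc.prems[of j] by (simp add: base_node)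
  thus ?case using qh_nz Suc
    by (simp add: lam_shift_diff power_int_minus power2_eq_square divide_inverse mult_ac)
qed simp

text \<open>The sequence \<open>G\<close> of \<open>typeB_condition\<close>; its value at
  \<open>Suc m\<close> is the product \<open>g\<close> of the theorem.\<close>

definition partial_lam :: "nat \<Rightarrow> 'k" where
  "partial_lam j = lam (\<xi> n - \<xi> (n + j)) 0"

lemma lam_node: "j < m \<Longrightarrow> lam (base j (n + j)) (hw j) = partial_lam (Suc j) * qh ^ (2 * odd_steps j)"
  unfolding partial_lam_def base_node
proof (simp, rule lam_hw)
  fix i assume "j < m" "i < j"
  thus "qform (\<xi> n - \<xi> (Suc (n + j))) (\<xi> n - \<xi> (Suc (n + i))) = qh powi (-2)"
    using n N_le n_less_N by (simp add: qform_diff qform_xi) (simp add: \<nu>_def)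
qed

lemma lam_last: "lam (\<xi> n) (hw m) = lam (\<xi> n) 0 * qh ^ (2 * odd_steps m)"
proof (rule lam_hw)
  fix i assume "i < m"
  thus "qform (\<xi> n) (\<xi> n - \<xi> (Suc (n + i))) = qh powi (-2)"
    using n N_le n_less_N by (simp add: qform_diff qform_xi) (simp add: \<nu>_def)
qed

lemma partial_lam_Suc: "j \<le> m \<Longrightarrow> partial_lam (Suc j) = partial_lam j * lam (simple_root (n + j)) 0"
  unfolding partial_lam_def lam_add[symmetric] using N_le by (simp add: simple_root_xi)

lemma partial_lam_last: "partial_lam (Suc m) = lam (\<xi> n) 0"
  using N_le by (simp add: partial_lam_def xi_beyond)

lemma lam_xi_n: "lam (\<xi> n) 0 = (\<Prod>i=n..N. lam (simple_root i) 0)"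
proof -
  have "lam 0 0 = 1" by (simp add: lam_def)
  have "finite A \<Longrightarrow> lam (\<Sum>i\<in>A. simple_root i) 0 = (\<Prod>i\<in>A. lam (simple_root i) 0)" for A
    by (induction A rule: finite_induct) (simp_all add: \<open>lam 0 0 = 1\<close> lam_add)
  thus ?thesis by (simp add: \<xi>_def)
qed

definition dominant :: "(nat \<Rightarrow> nat) \<Rightarrow> bool" where
  "dominant r \<longleftrightarrow> (\<forall>i \<in> {1..N} - {n}. lam (simple_root i) 0 = \<chi> (simple_root i) (simple_root i) ^ r i)"

lemma last_condition:
  assumes r: "dominant r"
  defines "g \<equiv> \<Prod>i=n..N. lam (simple_root i) 0"
  shows "(\<exists>s. lam (\<xi> n) (hw m) = \<chi> (\<xi> n) (\<xi> n) ^ s) \<longleftrightarrow>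
    g \<in> {qh powi (-2 * int x) |x::nat. x \<le> m - 1} \<union> {(- qh) powi (- (int y + 2 * int m)) |y::nat. True} \<and>
    (\<forall>x::nat. x \<le> m - 1 \<longrightarrow> g = qh powi (-2 * int x) \<longrightarrow>
       (\<forall>i. n + x + 1 \<le> i \<and> i \<le> N \<longrightarrow> lam (simple_root i) 0 = 1))"
proof -
  \<comment> \<open>Labels of the even roots as exponents of \<open>qh\<close>: the diagonal value
    is \<open>qh powi 2\<close> for the long roots and \<open>qh\<close> for the last, short
    one.\<close>
  define e where "e j = (if j < m then 2 * r (n + j) else r N)" for j
  have lam_e: "lam (simple_root (n + j)) 0 = qh ^ e j" if "1 \<le> j" "j \<le> m" for j
  proof (cases "j < m")
    case True
    hence j: "n + j \<in> {1..N} - {n}" "n < n + j" "n + j < N" using that n N_le by auto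
    thus ?thesis using r chi_greater[of "n + j"] True
      by (simp add: dominant_def e_def power_mult)
  next
    case False
    hence "n + j = N" "N \<in> {1..N} - {n}" using that N n m by auto
    thus ?thesis using r chi_NN False by (simp add: dominant_def e_def)
  qed
  have g: "partial_lam (Suc m) = g" by (simp add: partial_lam_last lam_xi_n g_def)
  have "(\<exists>s. g * qh ^ (2 * odd_steps m) = (- inverse qh) ^ s) \<longleftrightarrow>
    g \<in> {qh powi (-2 * int x) |x::nat. x \<le> m - 1} \<union> {(- qh) powi (- (int y + 2 * int m)) |y::nat. True} \<and>
    (\<forall>x::nat. x \<le> m - 1 \<longrightarrow> g = qh powi (-2 * int x) \<longrightarrow> (\<forall>j. x < j \<and> j \<le> m \<longrightarrow> e j = 0))"
    unfolding g[symmetric]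
    by (rule typeB_condition[OF nru m]) (use partial_lam_Suc lam_e lam_node in auto)
  moreover have "(\<forall>j. x < j \<and> j \<le> m \<longrightarrow> e j = 0) \<longleftrightarrow>
     (\<forall>i. n + x + 1 \<le> i \<and> i \<le> N \<longrightarrow> lam (simple_root i) 0 = 1)" for x
  proof -
    have "lam (simple_root (n + j)) 0 = 1 \<longleftrightarrow> e j = 0" if "1 \<le> j" "j \<le> m" for j
      using lam_e[OF that] nru by (cases "e j") (auto simp: not_root_of_unity_def simp del: power_Suc)
    note * = this
    show ?thesis
    proof (intro iffI allI impI)
      fix i assume a: "\<forall>j. x < j \<and> j \<le> m \<longrightarrow> e j = 0" "n + x + 1 \<le> i \<and> i \<le> N"
      hence i: "x < i - n \<and> i - n \<le> m" "n + (i - n) = i" using N_le by linarith+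
      hence "e (i - n) = 0" using a(1) by blast
      thus "lam (simple_root i) 0 = 1" using *[of "i - n"] i by simp
    next
      fix j assume a: "\<forall>i. n + x + 1 \<le> i \<and> i \<le> N \<longrightarrow> lam (simple_root i) 0 = 1" "x < j \<and> j \<le> m"
      thus "e j = 0" using *[of j] N_le by simp
    qed
  qed
  ultimately show ?thesis
    unfolding lam_last chi_xi_n lam_xi_n g_def[symmetric] by simp
qed

end

section \<open>The set of weights and its symmetries\<close>

lemma not_root_of_unity_powi:
  assumes "not_root_of_unity q" "k \<noteq> 0"
  shows "not_root_of_unity (q powi k)"
  unfolding not_root_of_unity_def
proof (intro conjI allI impI)
  show "q powi k \<noteq> 0" using assms by (simp add: not_root_of_unity_def)
  fix n :: nat assume n: "0 < n"
  show "(q powi k) ^ n \<noteq> 1"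
  proof
    assume "(q powi k) ^ n = 1"
    hence "q powi (k * int n) = q powi 0" by (simp add: power_int_mult)
    thus False using not_root_of_unity_inj[OF assms(1)] n assms(2) by fastforce
  qed
qed

lemma not_root_of_unity_minus_inverse:
  assumes "not_root_of_unity q" shows "not_root_of_unity (- inverse q)"
  unfolding not_root_of_unity_def
proof (intro conjI allI impI)
  show "- inverse q \<noteq> 0" using assms by (simp add: not_root_of_unity_def)
  fix n :: nat assume n: "0 < n"
  show "(- inverse q) ^ n \<noteq> 1"
  proof
    assume "(- inverse q) ^ n = 1"
    hence "(- q) powi (- int n) = q powi 0" by (simp add: power_int_minus power_inverse[symmetric])
    thus False using minus_powi_eq[OF assms] n by fastforce
  qed
qed

lemma finite_weights_box:
  "finite {w::weight. Poly_Mapping.keys w \<subseteq> {1..N} \<and> (\<forall>t \<in> {1..N}. Poly_Mapping.lookup w t \<in> {- B t..0})}"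
    (is "finite ?A")
proof (rule finite_imageD)
  let ?f = "\<lambda>w. \<lambda>t\<in>{1..N}. Poly_Mapping.lookup w t"
  have "?f ` ?A \<subseteq> PiE {1..N} (\<lambda>t. {- B t..0})" by (auto simp: PiE_def)
  thus "finite (?f ` ?A)" by (rule finite_subset) (intro finite_PiE, auto)
  show "inj_on ?f ?A"
  proof (rule inj_onI, rule poly_mapping_eqI)
    fix a b k assume a: "a \<in> ?A" "b \<in> ?A" "?f a = ?f b"
    show "Poly_Mapping.lookup a k = Poly_Mapping.lookup b k"
    proof (cases "k \<in> {1..N}")
      case True
      thus ?thesis using fun_cong[OF a(3), of k] by simp
    next
      case False
      hence "k \<notin> Poly_Mapping.keys a" "k \<notin> Poly_Mapping.keys b" using a by blast+
      thus ?thesis by (simp add: in_keys_iff)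
    qed
  qed
qed

context typeB
begin

definition weights :: "weight set" where "weights = {\<mu>. \<exists>x \<in> Lw \<mu>. x \<noteq> 0}"

lemma chi_simple_nu: "i \<in> {1..N} \<Longrightarrow> i \<noteq> n \<Longrightarrow> i \<noteq> N \<Longrightarrow> \<chi> (simple_root i) (simple_root i) = \<nu> i"
  using chi_less[of i] chi_greater[of i] by (auto simp: \<nu>_def)

lemma nru_simple:
  assumes "i \<in> {1..N}" "i \<noteq> n"
  shows "not_root_of_unity (\<chi> (simple_root i) (simple_root i))"
proof (cases "i = N")
  case False
  thus ?thesis using assms chi_simple_nu not_root_of_unity_powi[OF nru, of 2] not_root_of_unity_powi[OF nru, of "-2"]
    by (auto simp: \<nu>_def)
qed (simp add: chi_NN nru)

lemma nru_xi_n: "not_root_of_unity (\<chi> (\<xi> n) (\<xi> n))"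
  unfolding chi_xi_n by (rule not_root_of_unity_minus_inverse[OF nru])

text \<open>\<open>\<xi> n\<close> is the last simple root of \<open>base m\<close>, so the rank one
  criterion applies to it in that chamber.\<close>

lemma finite_weights_imp:
  assumes "finite weights"
  shows "(\<exists>r. dominant r) \<and> (\<exists>s. lam (\<xi> n) (hw m) = \<chi> (\<xi> n) (\<xi> n) ^ s)"
proof
  have "\<exists>r. lam (simple_root i) 0 = \<chi> (simple_root i) (simple_root i) ^ r" if "i \<in> {1..N} - {n}" for i
    using nilpotent_imp_lam[of i] finite_weights_imp_nilpotent[of i] nru_simple[of i] that assms
    by (auto simp: weights_def)
  thus "\<exists>r. dominant r" unfolding dominant_def by (intro bchoice) blast
  obtain E' F' h' v' where "chamber scale Lw KK LL \<chi> \<kappa> \<eta> {1..N} (base m) E' F' h' v' (hw m)"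
    using chamber_chain by blast
  then interpret C: chamber scale Lw KK LL \<chi> \<kappa> \<eta> "{1..N}" "base m" E' F' h' v' "hw m" .
  show "\<exists>s. lam (\<xi> n) (hw m) = \<chi> (\<xi> n) (\<xi> n) ^ s"
    using C.nilpotent_imp_lam[of N] C.finite_weights_imp_nilpotent[of N] nru_xi_n assms n_less_N
    by (auto simp: base_last weights_def)
qed

lemma weights_wt: assumes "\<mu> \<in> weights" obtains w where "set w \<subseteq> {1..N}" "\<mu> = - wt w"
  using assms Lw_nonzero_wt by (auto simp: weights_def)

lemma qform_xi_weight:
  assumes "t \<in> {1..N}" "\<mu> \<in> weights"
  shows "qform (\<xi> t) \<mu> = \<nu> t powi coord t \<mu>"
proof -
  have s: "qform (\<xi> t) (simple_root i) = \<nu> t powi coord t (simple_root i)" if "i \<in> {1..N}" for i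
    using that assms(1) by (auto simp: qform_xi_simple coord_simple power_int_minus)
  obtain w where w: "set w \<subseteq> {1..N}" "\<mu> = - wt w" using weights_wt assms by blast
  have "qform (\<xi> t) (wt w) = \<nu> t powi coord t (wt w)"
    using w(1) by (induction w) (simp_all add: qform_add coord_add s power_int_add nu_nz)
  thus ?thesis by (simp add: w(2) qform_minus coord_minus power_int_minus)
qed

lemma weights_keys:
  assumes "\<mu> \<in> weights"
  shows "Poly_Mapping.keys \<mu> \<subseteq> {1..N}" "Poly_Mapping.lookup \<mu> t \<le> 0"
proof -
  obtain w where w: "set w \<subseteq> {1..N}" "\<mu> = - wt w" using weights_wt assms by blast
  have "0 \<le> Poly_Mapping.lookup (wt w) t \<and> (t \<notin> {1..N} \<longrightarrow> Poly_Mapping.lookup (wt w) t = 0)" for t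
    using w(1) by (induction w) (auto simp: lookup_add simple_root_def lookup_single when_def)
  note * = this
  show "Poly_Mapping.lookup \<mu> t \<le> 0" using * w by simp
  show "Poly_Mapping.keys \<mu> \<subseteq> {1..N}"
  proof
    fix x assume "x \<in> Poly_Mapping.keys \<mu>"
    hence "Poly_Mapping.lookup (wt w) x \<noteq> 0" by (simp add: in_keys_iff w)
    thus "x \<in> {1..N}" using *[of x] by blast
  qed
qed

lemma lookup_coord: "1 \<le> t \<Longrightarrow> Poly_Mapping.lookup \<mu> t = (\<Sum>u\<in>{1..t}. coord u \<mu>)"
proof (induction t rule: dec_induct)
  case (step t)
  thus ?case by (simp add: coord_def)
qed (simp add: coord_def)

context
  fixes r :: "nat \<Rightarrow> nat" and b :: nat
  assumes dom: "dominant r" and last: "lam (\<xi> n) (hw m) = \<chi> (\<xi> n) (\<xi> n) ^ b"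
begin

text \<open>\<open>c\<close> is the label of the rank one string at \<open>\<mu>\<close>:
  \<open>r i\<close> comes from the highest weight, the rest from the pairing with
  \<open>\<mu>\<close> in orthogonal coordinates, where \<open>\<nu> i = \<nu> (Suc i)\<close> away
  from \<open>n\<close>.\<close>

lemma weights_reflect_simple:
  assumes i: "i \<in> {1..N} - {n}" and \<mu>: "\<mu> \<in> weights"
    and c: "c = int (r i) + (if i = N then 2 * coord N \<mu> else coord i \<mu> - coord (Suc i) \<mu>)"
  shows "\<mu> - of_int c * simple_root i \<in> weights"
proof -
  have i': "i \<in> {1..N}" "i \<noteq> n" "1 \<le> i" "i \<le> N" using i by auto
  let ?p = "\<chi> (simple_root i) (simple_root i)"
  have p: "?p \<noteq> 0" by (rule chi_nz)
  \<comment> \<open>The exponents \<open>1\<close>, \<open>2\<close> and \<open>0\<close> are the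
    negated Cartan integers of type B; \<open>2\<close> occurs only from the short root
    \<open>N\<close> to its neighbour.\<close>
  have Serre: "\<exists>k. ?p ^ k * qform (simple_root i) (simple_root j) = 1" if j: "j \<in> {1..N}" "j \<noteq> i" for j
  proof -
    consider "j = Suc i" | "i = Suc j" "i \<noteq> N" | "i = Suc j" "i = N" | "j \<noteq> Suc i" "i \<noteq> Suc j" by blast
    thus ?thesis
    proof cases
      case 1
      hence "\<nu> (Suc i) = ?p" using chi_simple_nu[of i] i' j by (auto simp: \<nu>_def)
      hence "?p ^ 1 * qform (simple_root i) (simple_root j) = 1"
        using 1 i' j p by (simp add: qform_simple)
      thus ?thesis by blast
    next
      case 2
      hence "\<nu> i = ?p" using chi_simple_nu[of i] i' j by auto
      hence "?p ^ 1 * qform (simple_root i) (simple_root j) = 1"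
        using 2 i' j p by (simp add: qform_simple)
      thus ?thesis by blast
    next
      case 3
      hence "?p = qh" "\<nu> i = qh ^ 2" using chi_NN n_less_N by (auto simp: \<nu>_def)
      hence "?p ^ 2 * qform (simple_root i) (simple_root j) = 1"
        using 3 i' j qh_nz by (simp add: qform_simple)
      thus ?thesis by blast
    next
      case 4
      hence "?p ^ 0 * qform (simple_root i) (simple_root j) = 1"
        using i' j by (simp add: qform_simple)
      thus ?thesis by blast
    qed
  qed
  have lam0: "lam (simple_root i) 0 = ?p ^ r i" using dom i by (simp add: dominant_def)
  have nil: "locally_nilpotent i v" by (rule lam_imp_nilpotent[OF i'(1) nru_simple[OF i'(1,2)] lam0])
  obtain x where x: "x \<in> Lw \<mu>" "x \<noteq> 0" using \<mu> by (auto simp: weights_def)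
  have nx: "locally_nilpotent i x" by (rule locally_nilpotent_all[OF i'(1) Serre nil x(1)])
  have "qform (simple_root i) \<mu> = ?p powi (if i = N then 2 * coord N \<mu> else coord i \<mu> - coord (Suc i) \<mu>)"
  proof (cases "i = N")
    case True
    have "\<xi> N = simple_root N" by (simp add: simple_root_xi xi_beyond)
    thus ?thesis using True qform_xi_weight[of N \<mu>] \<mu> i' n_less_N
      by (simp add: chi_NN \<nu>_def power_int_mult)
  next
    case False
    hence "\<nu> i = ?p" "\<nu> (Suc i) = ?p" using chi_simple_nu[of i] i' by (auto simp: \<nu>_def)
    thus ?thesis using qform_xi_weight[of i \<mu>] qform_xi_weight[of "Suc i" \<mu>] \<mu> i' False p
      by (simp add: simple_root_xi[of i] qform_diff power_int_diff)
  qed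
  hence "lam (simple_root i) \<mu> = ?p powi c"
    using lam_shift[of "simple_root i" 0 \<mu>] p by (simp add: c lam0 power_int_add)
  from weight_reflection[OF i'(1) nru_simple[OF i'(1,2)] x nx this]
  show ?thesis by (auto simp: weights_def)
qed

text \<open>Uses the last chamber of the chain, where \<open>\<xi> n\<close> is simple. Its lowering
  operators differ from the original ones, but they act on the same weight spaces, so the reflected
  weight belongs to \<open>weights\<close>.\<close>

lemma weights_reflect_xi_n:
  assumes \<mu>: "\<mu> \<in> weights" and c: "c = int (b + 2 * odd_steps m) + 2 * coord n \<mu>"
  shows "\<mu> - of_int c * \<xi> n \<in> weights"
proof -
  obtain E' F' h' v' where "chamber scale Lw KK LL \<chi> \<kappa> \<eta> {1..N} (base m) E' F' h' v' (hw m)"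
    using chamber_chain by blast
  then interpret C: chamber scale Lw KK LL \<chi> \<kappa> \<eta> "{1..N}" "base m" E' F' h' v' "hw m" .
  let ?p = "\<chi> (\<xi> n) (\<xi> n)"
  have p: "?p \<noteq> 0" by (rule chi_nz)
  have p2: "?p ^ 2 = \<nu> n" "?p ^ 2 * qh ^ 2 = 1"
    by (simp_all add: chi_xi_n \<nu>_def power_int_minus power_inverse[symmetric] qh_nz flip: power_mult_distrib)
  have i: "N \<in> {1..N}" using n_less_N by simp
  have Serre: "\<exists>k. \<chi> (base m N) (base m N) ^ k * qform (base m N) (base m j) = 1"
    if j: "j \<in> {1..N}" "j \<noteq> N" for j
  proof -
    have zN: "zeta m N = \<xi> n" using N_le by (simp add: zeta_def)
    have 1: "qform (\<xi> n) (zeta m j) = 1" using qform_zeta[of m N j] j i zN by auto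
    show ?thesis
    proof (cases "Suc j = N")
      case True
      hence "qform (\<xi> n) (base m j) = inverse (\<nu> n)"
        using qform_xi[of n n] n n_less_N 1 zN by (simp add: base_def qform_diff inverse_eq_divide)
      hence "?p ^ 2 * qform (\<xi> n) (base m j) = 1" using p2 nu_nz by simp
      thus ?thesis unfolding base_last by blast
    next
      case False
      hence "qform (\<xi> n) (base m j) = 1"
        using 1 qform_zeta[of m N "Suc j"] j i zN by (auto simp: base_def qform_diff)
      hence "?p ^ 0 * qform (\<xi> n) (base m j) = 1" by simp
      thus ?thesis unfolding base_last by blast
    qed
  qed
  have lam0: "lam (base m N) (hw m) = \<chi> (base m N) (base m N) ^ b" using last by (simp add: base_last)
  have nru': "not_root_of_unity (\<chi> (base m N) (base m N))" using nru_xi_n by (simp add: base_last)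
  have nil: "C.locally_nilpotent N v'" by (rule C.lam_imp_nilpotent[OF i nru' lam0])
  obtain x where x: "x \<in> Lw \<mu>" "x \<noteq> 0" using \<mu> by (auto simp: weights_def)
  have nx: "C.locally_nilpotent N x" by (rule C.locally_nilpotent_all[OF i Serre nil x(1)])
  \<comment> \<open>Transfers the eigenvalue from the end of the chain back to weight
    \<open>0\<close>. Since \<open>?p ^ 2 * qh ^ 2 = 1\<close>, the factor \<open>qh ^ 2\<close> of
    each effective reflection becomes two more powers of \<open>?p\<close>.\<close>
  have "lam (\<xi> n) 0 * qh ^ (2 * odd_steps m) = ?p ^ b" using last lam_last by simp
  hence "lam (\<xi> n) 0 * (?p ^ 2 * qh ^ 2) ^ odd_steps m = ?p ^ b * (?p ^ 2) ^ odd_steps m"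
    by (simp add: power_mult power_mult_distrib mult_ac)
  hence "lam (\<xi> n) 0 = ?p ^ (b + 2 * odd_steps m)"
    unfolding p2(2) by (simp add: power_add power_mult)
  moreover have "qform (\<xi> n) \<mu> = ?p powi (2 * coord n \<mu>)"
    using qform_xi_weight[of n \<mu>] \<mu> n n_less_N p2 by (simp add: power_int_mult)
  ultimately have "lam (base m N) \<mu> = \<chi> (base m N) (base m N) powi c"
    unfolding base_last using lam_shift[of "\<xi> n" 0 \<mu>] p by (simp add: c power_int_add del: of_nat_add flip: power_int_of_nat)
  from C.weight_reflection[OF i nru' x nx this]
  show ?thesis by (auto simp: weights_def base_last)
qed

text \<open>The shift centres the coordinates, so that the reflections act on them by permutations and sign changes.\<close>

definition shift :: "nat \<Rightarrow> int" where
  "shift t = (if t \<le> n then int (b + 2 * odd_steps m) + 2 * (\<Sum>s\<in>{t..<n}. int (r s))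
     else int (r N) + 2 * (\<Sum>s\<in>{t..<N}. int (r s)))"

text \<open>Doubled, since the centre of symmetry \<open>- shift t / 2\<close> may be half an
  integer.\<close>

definition ycoord :: "nat \<Rightarrow> weight \<Rightarrow> int" where "ycoord t \<mu> = 2 * coord t \<mu> + shift t"

lemma shift_Suc: "t < N \<Longrightarrow> t \<noteq> n \<Longrightarrow> shift t = shift (Suc t) + 2 * int (r t)"
  by (auto simp: shift_def sum.atLeast_Suc_lessThan)

lemma ycoord_reflect: "ycoord t (\<mu> - of_int c * a) = ycoord t \<mu> - 2 * (c * coord t a)"
  by (simp add: ycoord_def coord_diff coord_of_int)

text \<open>The label of the reflection is half the difference of the two shifted coordinates, so
  the reflection interchanges them. The index \<open>n\<close> is excluded because its root is
  isotropic.\<close>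

lemma ycoord_swap:
  assumes "i \<in> {1..<N} - {n}" "\<mu> \<in> weights"
  obtains \<mu>' where "\<mu>' \<in> weights" "ycoord i \<mu>' = ycoord (Suc i) \<mu>" "ycoord (Suc i) \<mu>' = ycoord i \<mu>"
    "\<And>u. u \<in> {1..N} \<Longrightarrow> u \<noteq> i \<Longrightarrow> u \<noteq> Suc i \<Longrightarrow> ycoord u \<mu>' = ycoord u \<mu>"
proof -
  define c where "c = int (r i) + (coord i \<mu> - coord (Suc i) \<mu>)"
  define \<mu>' where "\<mu>' = \<mu> - of_int c * simple_root i"
  have "\<mu>' \<in> weights"
    using assms unfolding \<mu>'_def by (intro weights_reflect_simple) (auto simp: c_def)
  moreover have "ycoord t \<mu>' = ycoord t \<mu> - 2 * (c * coord t (simple_root i))" for t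
    by (simp add: \<mu>'_def ycoord_reflect)
  ultimately show ?thesis
    using assms(1) shift_Suc[of i]
    by (intro that[of \<mu>']) (auto simp: coord_simple c_def ycoord_def)
qed

definition negatable :: "nat \<Rightarrow> bool" where
  "negatable t \<longleftrightarrow> (\<forall>\<mu> \<in> weights. \<exists>\<mu>' \<in> weights. ycoord t \<mu>' = - ycoord t \<mu> \<and>
     (\<forall>u \<in> {1..N} - {t}. ycoord u \<mu>' = ycoord u \<mu>))"

lemma negatable_N: "negatable N"
  unfolding negatable_def
proof
  fix \<mu> assume \<mu>: "\<mu> \<in> weights"
  define c where "c = int (r N) + 2 * coord N \<mu>"
  define \<mu>' where "\<mu>' = \<mu> - of_int c * simple_root N"
  have "\<mu>' \<in> weights"
    using \<mu> n_less_N unfolding \<mu>'_def by (intro weights_reflect_simple) (auto simp: c_def)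
  moreover have "ycoord t \<mu>' = ycoord t \<mu> - 2 * (c * coord t (simple_root N))" for t
    by (simp add: \<mu>'_def ycoord_reflect)
  ultimately show "\<exists>\<mu>'\<in>weights. ycoord N \<mu>' = - ycoord N \<mu> \<and> (\<forall>u\<in>{1..N} - {N}. ycoord u \<mu>' = ycoord u \<mu>)"
    using n_less_N
    by (intro bexI[of _ \<mu>']) (auto simp: ycoord_def coord_simple c_def shift_def)
qed

text \<open>The label in \<open>weights_reflect_xi_n\<close> equals \<open>ycoord n \<mu>\<close>,
  because the sum in \<open>shift n\<close> is empty.\<close>

lemma negatable_n: "negatable n"
  unfolding negatable_def
proof
  fix \<mu> assume \<mu>: "\<mu> \<in> weights"
  define c where "c = int (b + 2 * odd_steps m) + 2 * coord n \<mu>"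
  define \<mu>' where "\<mu>' = \<mu> - of_int c * \<xi> n"
  have "\<mu>' \<in> weights"
    using \<mu> unfolding \<mu>'_def by (intro weights_reflect_xi_n) (auto simp: c_def)
  moreover have "ycoord t \<mu>' = ycoord t \<mu> - 2 * (c * coord t (\<xi> n))" for t
    by (simp add: \<mu>'_def ycoord_reflect)
  ultimately show "\<exists>\<mu>'\<in>weights. ycoord n \<mu>' = - ycoord n \<mu> \<and> (\<forall>u\<in>{1..N} - {n}. ycoord u \<mu>' = ycoord u \<mu>)"
    using n_less_N n
    by (intro bexI[of _ \<mu>']) (auto simp: ycoord_def coord_xi c_def shift_def)
qed

text \<open>The sign change at \<open>i\<close> is the one at \<open>Suc i\<close> conjugated by the
  interchange of the two coordinates.\<close>

lemma negatable_step:
  assumes "i \<in> {1..<N} - {n}" "negatable (Suc i)"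
  shows "negatable i"
  unfolding negatable_def
proof
  fix \<mu> assume \<mu>: "\<mu> \<in> weights"
  obtain \<mu>1 where 1: "\<mu>1 \<in> weights" "ycoord i \<mu>1 = ycoord (Suc i) \<mu>" "ycoord (Suc i) \<mu>1 = ycoord i \<mu>"
    "\<And>u. u \<in> {1..N} \<Longrightarrow> u \<noteq> i \<Longrightarrow> u \<noteq> Suc i \<Longrightarrow> ycoord u \<mu>1 = ycoord u \<mu>"
    using ycoord_swap[OF assms(1) \<mu>] by blast
  obtain \<mu>2 where 2: "\<mu>2 \<in> weights" "ycoord (Suc i) \<mu>2 = - ycoord (Suc i) \<mu>1"
     "\<forall>u \<in> {1..N} - {Suc i}. ycoord u \<mu>2 = ycoord u \<mu>1"
    using assms(2) 1(1) unfolding negatable_def by blast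
  obtain \<mu>3 where 3: "\<mu>3 \<in> weights" "ycoord i \<mu>3 = ycoord (Suc i) \<mu>2" "ycoord (Suc i) \<mu>3 = ycoord i \<mu>2"
    "\<And>u. u \<in> {1..N} \<Longrightarrow> u \<noteq> i \<Longrightarrow> u \<noteq> Suc i \<Longrightarrow> ycoord u \<mu>3 = ycoord u \<mu>2"
    using ycoord_swap[OF assms(1) 2(1)] by blast
  have i: "i \<in> {1..N} - {Suc i}" using assms(1) by auto
  have "ycoord u \<mu>3 = ycoord u \<mu>" if "u \<in> {1..N} - {i}" for u
    using that 1 2(3) 3 i by (cases "u = Suc i") auto
  thus "\<exists>\<mu>'\<in>weights. ycoord i \<mu>' = - ycoord i \<mu> \<and> (\<forall>u\<in>{1..N} - {i}. ycoord u \<mu>' = ycoord u \<mu>)"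
    using 1 2 3 by (intro bexI[of _ \<mu>3]) auto
qed

text \<open>No interchange is available across the isotropic index, so the blocks up to
  \<open>n\<close> and after it are treated apart, descending from \<open>\<xi> n\<close> and from
  \<open>\<xi> N\<close>. The first block is where the chain of odd reflections is needed.\<close>

lemma negatable_all: assumes "t \<in> {1..N}" shows "negatable t"
proof (cases "t \<le> n")
  case True
  hence "1 \<le> t \<Longrightarrow> negatable t"
  proof (induction t rule: inc_induct)
    case (step t)
    thus ?case using negatable_step[of t] n_less_N by auto
  qed (rule negatable_n)
  thus ?thesis using assms by simp
next
  case False
  have "t \<le> N" using assms by simp
  hence "n < t \<Longrightarrow> negatable t"
  proof (induction t rule: inc_induct)
    case (step t)
    thus ?case using negatable_step[of t] by auto
  qed (rule negatable_N)
  thus ?thesis using False by simp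
qed

text \<open>The group generated by the reflections contains \<open>-1\<close>, so all weights lie between two cones.\<close>

lemma weights_negate:
  assumes "\<mu> \<in> weights"
  shows "\<exists>\<mu>' \<in> weights. \<forall>t \<in> {1..N}. ycoord t \<mu>' = - ycoord t \<mu>"
proof -
  have "k \<le> N \<Longrightarrow> \<exists>\<mu>' \<in> weights. \<forall>t \<in> {1..N}. ycoord t \<mu>' = (if t \<le> k then - ycoord t \<mu> else ycoord t \<mu>)" for k
  proof (induction k)
    case 0
    show ?case using assms by (intro bexI[of _ \<mu>]) auto
  next
    case (Suc k)
    then obtain \<mu>1 where 1: "\<mu>1 \<in> weights" "\<forall>t \<in> {1..N}. ycoord t \<mu>1 = (if t \<le> k then - ycoord t \<mu> else ycoord t \<mu>)"
      by auto
    obtain \<mu>2 where "\<mu>2 \<in> weights" "ycoord (Suc k) \<mu>2 = - ycoord (Suc k) \<mu>1"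
      "\<forall>u \<in> {1..N} - {Suc k}. ycoord u \<mu>2 = ycoord u \<mu>1"
      using negatable_all[of "Suc k"] 1(1) Suc.prems unfolding negatable_def by auto
    thus ?case using 1 Suc.prems by (intro bexI[of _ \<mu>2]) (auto simp: le_Suc_eq)
  qed
  from this[of N] show ?thesis by auto
qed

lemma finite_weights: "finite weights"
proof -
  define B where "B t = (\<Sum>u\<in>{1..t}. shift u)" for t
  have "weights \<subseteq> {w. Poly_Mapping.keys w \<subseteq> {1..N} \<and> (\<forall>t \<in> {1..N}. Poly_Mapping.lookup w t \<in> {- B t..0})}"
  proof
    fix \<mu> assume \<mu>: "\<mu> \<in> weights"
    then obtain \<mu>' where \<mu>': "\<mu>' \<in> weights" "\<forall>t \<in> {1..N}. ycoord t \<mu>' = - ycoord t \<mu>"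
      using weights_negate by blast
    \<comment> \<open>The weights \<open>\<mu>\<close> and \<open>\<mu>'\<close> have opposite
      centred coordinates, so their coefficients at the \<open>t\<close>-th simple root add up to
      the constant \<open>- B t\<close>; both coefficients are at most zero, which bounds each from
      below.\<close>
    have "- B t \<le> Poly_Mapping.lookup \<mu> t" if t: "t \<in> {1..N}" for t
    proof -
      have "coord u \<mu> + coord u \<mu>' = - shift u" if "u \<in> {1..t}" for u
        using \<mu>'(2) t that by (auto simp: ycoord_def dest!: bspec[of _ _ u])
      hence "(\<Sum>u\<in>{1..t}. coord u \<mu> + coord u \<mu>') = - B t"
        by (simp add: B_def sum_negf)
      hence "Poly_Mapping.lookup \<mu> t + Poly_Mapping.lookup \<mu>' t = - B t"
        using t by (simp add: lookup_coord sum.distrib)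
      thus ?thesis using weights_keys(2)[OF \<mu>'(1), of t] by linarith
    qed
    thus "\<mu> \<in> {w. Poly_Mapping.keys w \<subseteq> {1..N} \<and> (\<forall>t \<in> {1..N}. Poly_Mapping.lookup w t \<in> {- B t..0})}"
      using weights_keys[OF \<mu>] by auto
  qed
  thus ?thesis using finite_weights_box finite_subset by blast
qed

end

theorem finite_weights_iff:
  "finite weights \<longleftrightarrow> (\<exists>r. dominant r) \<and> (\<exists>s. lam (\<xi> n) (hw m) = \<chi> (\<xi> n) (\<xi> n) ^ s)"
  using finite_weights_imp finite_weights by blast

theorem finite_weights_iff_explicit:
  defines "g \<equiv> \<Prod>i=n..N. lam (simple_root i) 0"
  shows "finite weights \<longleftrightarrow>
    (\<forall>i \<in> {1..N} - {n}. \<exists>r::nat. lam (simple_root i) 0 = \<chi> (simple_root i) (simple_root i) ^ r) \<and>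
    g \<in> {qh powi (-2 * int x) |x::nat. x \<le> m - 1} \<union> {(- qh) powi (- (int y + 2 * int m)) |y::nat. True} \<and>
    (\<forall>x::nat. x \<le> m - 1 \<longrightarrow> g = qh powi (-2 * int x) \<longrightarrow>
       (\<forall>i. n + x + 1 \<le> i \<and> i \<le> N \<longrightarrow> lam (simple_root i) 0 = 1))"
proof -
  have "(\<exists>r. dominant r) \<longleftrightarrow>
    (\<forall>i \<in> {1..N} - {n}. \<exists>r::nat. lam (simple_root i) 0 = \<chi> (simple_root i) (simple_root i) ^ r)"
    unfolding dominant_def by (rule bchoice_iff[symmetric])
  thus ?thesis unfolding finite_weights_iff g_def using last_condition by blast
qed

end

subsection \<open>The simple module as a space of matrix coefficients\<close>

lemma length_fword: assumes "w \<in> fwords N" shows "int (length (letters w)) = - weight_height N (word_weight w)"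
  using assms
proof (induction rule: fwords_induct)
  case (Cons j gs)
  have "weight_height N (word_weight (Word (GenF j # gs))) + weight_height N (simple_root j) = weight_height N (word_weight (Word gs))"
    unfolding weight_height_add[symmetric] by simp
  thus ?case using Cons.IH weight_height_simple[OF Cons(1)] by simp
qed (simp add: weight_height_def)

text \<open>The weight determines the length of the word, and the alphabet is finite.\<close>

lemma finite_fwords_weight: "finite {w \<in> fwords N. word_weight w = b}"
proof -
  have "{w \<in> fwords N. word_weight w = b} \<subseteq>
      (\<lambda>js. Word (map GenF js)) ` {js. set js \<subseteq> {1..N} \<and> length js = nat (- weight_height N b)}"
  proof
    fix w assume w: "w \<in> {w \<in> fwords N. word_weight w = b}"
    then obtain js where js: "set js \<subseteq> {1..N}" "w = Word (map GenF js)" by (auto simp: fwords_def)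
    moreover have "length js = nat (- weight_height N b)" using length_fword[of w N] w js(2) by simp
    ultimately show "w \<in> (\<lambda>js. Word (map GenF js)) ` {js. set js \<subseteq> {1..N} \<and> length js = nat (- weight_height N b)}"
      by blast
  qed
  thus ?thesis by (rule finite_subset) (intro finite_imageI finite_lists_length_eq finite_atLeastAtMost)
qed

abbreviation fscale :: "'k::field_char_0 \<Rightarrow> (word \<Rightarrow> 'k) \<Rightarrow> word \<Rightarrow> 'k" where
  "fscale c \<phi> \<equiv> (\<lambda>w. c * \<phi> w)"

global_interpretation FW: vector_space "fscale :: 'k::field_char_0 \<Rightarrow> (word \<Rightarrow> 'k) \<Rightarrow> word \<Rightarrow> 'k"
  by unfold_locales (simp_all add: fun_eq_iff algebra_simps)

context highest_weight
begin

text \<open>The simple module is realised by matrix coefficients: \<open>Phi x\<close> is the function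
  \<open>w \<mapsto> eps (w * x)\<close> on words, on which letters act by right translation.\<close>

definition Phi :: "'k walg \<Rightarrow> word \<Rightarrow> 'k" where
  "Phi x = (\<lambda>w. if w \<in> words N then eps (mon w * x) else 0)"

definition translate :: "generator \<Rightarrow> (word \<Rightarrow> 'k) \<Rightarrow> word \<Rightarrow> 'k" where
  "translate g \<phi> = (\<lambda>w. if w \<in> words N then \<phi> (w + Word [g]) else 0)"

definition Lspace :: "weight \<Rightarrow> (word \<Rightarrow> 'k) set" where "Lspace \<mu> = Phi ` Aw N \<mu>"

lemma Phi_add: "Phi (x + y) = Phi x + Phi y" and Phi_diff: "Phi (x - y) = Phi x - Phi y"
  and Phi_sc: "Phi (sc c x) = fscale c (Phi x)" and Phi_0 [simp]: "Phi 0 = 0"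
  by (auto simp: Phi_def fun_eq_iff distrib_left right_diff_distrib sc_mult_right eps_add eps_diff eps_sc)

text \<open>The kernel is the radical, so the image is a copy of the simple module inside functions,
  a type with the additive structure that \<open>chamber\<close> expects of its vectors.\<close>

lemma Phi_eq_0: "x \<in> A \<Longrightarrow> Phi x = 0 \<longleftrightarrow> x \<in> radical"
proof
  assume x: "x \<in> A" and "Phi x = 0"
  hence "eps (mon w * x) = 0" if "w \<in> words N" for w using that by (auto simp: Phi_def fun_eq_iff dest: spec[of _ w])
  thus "x \<in> radical" by (rule radical_words[OF x])
qed (auto simp: Phi_def radical_def fun_eq_iff)

lemma Phi_eq: "x - y \<in> radical \<Longrightarrow> Phi x = Phi y"
  using Phi_eq_0[of "x - y"] radical_A by (simp add: Phi_diff)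

lemma Phi_cong: "x \<approx> y \<Longrightarrow> Phi x = Phi y"
  using Phi_eq RI_radical by (auto simp: cong_def)

lemma translate_Phi: "g \<in> generators N \<Longrightarrow> translate g (Phi x) = Phi (gen g * x)"
proof (rule ext)
  fix w assume g: "g \<in> generators N"
  have "w + Word [g] \<in> words N" if "w \<in> words N"
    using words_simps(3)[OF that, of "Word [g]"] words_simps(2,4) g by (simp del: generators.simps)
  thus "translate g (Phi x) w = Phi (gen g * x) w"
    by (simp add: translate_def Phi_def mult.assoc[symmetric] mon_mult del: generators.simps)
qed

lemma translate_linear: "translate g (\<phi> + \<psi>) = translate g \<phi> + translate g \<psi>"
  "translate g (fscale c \<phi>) = fscale c (translate g \<phi>)"
  by (auto simp: translate_def fun_eq_iff)

lemma Lspace_subspace: "FW.subspace (Lspace \<mu>)"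
proof (rule FW.subspaceI)
  note S = FA.subspace_0[OF subspaces(3)] FA.subspace_add[OF subspaces(3)] FA.subspace_scale[OF subspaces(3)]
  show "0 \<in> Lspace \<mu>" unfolding Lspace_def by (rule image_eqI[where f = Phi, OF Phi_0[symmetric] S(1)])
  fix x y c assume "x \<in> Lspace \<mu>" "y \<in> Lspace \<mu>"
  then obtain a b where *: "a \<in> Aw N \<mu>" "b \<in> Aw N \<mu>" "x = Phi a" "y = Phi b" by (auto simp: Lspace_def)
  show "x + y \<in> Lspace \<mu>" unfolding Lspace_def *(3,4) by (rule image_eqI[where f = Phi, OF Phi_add[symmetric] S(2)[OF *(1,2)]])
  show "fscale c x \<in> Lspace \<mu>" unfolding Lspace_def *(3) by (rule image_eqI[where f = Phi, OF Phi_sc[symmetric] S(3)[OF *(1)]])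
qed

definition LK :: "weight \<Rightarrow> (word \<Rightarrow> 'k) \<Rightarrow> word \<Rightarrow> 'k" where "LK a = translate (GenK (restrict_weight N a))"
definition LL :: "weight \<Rightarrow> (word \<Rightarrow> 'k) \<Rightarrow> word \<Rightarrow> 'k" where "LL a = translate (GenL (restrict_weight N a))"
definition LE :: "nat \<Rightarrow> (word \<Rightarrow> 'k) \<Rightarrow> word \<Rightarrow> 'k" where "LE i = translate (GenE i)"
definition LF :: "nat \<Rightarrow> (word \<Rightarrow> 'k) \<Rightarrow> word \<Rightarrow> 'k" where "LF i = translate (GenF i)"

lemma restrict_idem: "XX (restrict_weight N a) b = XX a b" "XX b (restrict_weight N a) = XX b a"
  "kap (restrict_weight N a) = kap a" "ell (restrict_weight N a) = ell a"
  by (simp_all add: XX_def kap_def ell_def)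

text \<open>For \<open>g\<close> in the torus, \<open>g - \<Lambda> g\<close> lies in the radical, a
  left ideal, so \<open>x * g\<close> and the multiple of \<open>x\<close> by
  \<open>\<Lambda> g\<close> have the same image under \<open>Phi\<close>; commuting
  \<open>g\<close> past \<open>x\<close> gives the second factor.\<close>

lemma torus_eigen:
  assumes "\<phi> \<in> Lspace \<mu>"
  shows "LK a \<phi> = fscale (kap a * XX a \<mu>) \<phi>" "LL a \<phi> = fscale (ell a / XX \<mu> a) \<phi>"
proof -
  let ?a = "restrict_weight N a"
  obtain x where x: "x \<in> Aw N \<mu>" "\<phi> = Phi x" using assms by (auto simp: Lspace_def)
  have xA: "x \<in> A" using graded_A(3)[OF x(1)] .
  have K: "Phi (g * x) = fscale (d * c) (Phi x)" if g: "g \<in> Uzero" "\<Lambda> (uc g) = d" "g * x \<approx> sc c (x * g)" for g c d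
  proof -
    have "g - sc d 1 \<in> radical" using subsetD[OF SV(4) SV(6)[OF g(1)]] g(2) by simp
    hence "x * (g - sc d 1) \<in> radical" by (rule radical_left[OF xA])
    hence "x * g - sc d x \<in> radical" unfolding right_diff_distrib sc_mult_right mult_1_right .
    from Phi_eq[OF this] have 1: "Phi (x * g) = fscale d (Phi x)" unfolding Phi_sc .
    show ?thesis unfolding Phi_cong[OF g(3)] Phi_sc 1 by (simp only: mult.assoc mult.commute mult.left_commute)
  qed
  have Z: "?a \<in> ZPi N" by simp
  have "LK a \<phi> = Phi (gK ?a * x)" unfolding LK_def x(2) by (rule translate_Phi) (use Z in simp)
  also have "\<dots> = fscale (kap ?a * XX ?a \<mu>) (Phi x)"
    by (rule K[OF Uzero_closed(2)[OF Z] kap_eq(1)[OF Z, symmetric] K_move(1)[OF x(1) Z]])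
  finally show "LK a \<phi> = fscale (kap a * XX a \<mu>) \<phi>" unfolding restrict_idem x(2) .
  have "LL a \<phi> = Phi (gL ?a * x)" unfolding LL_def x(2) by (rule translate_Phi) (use Z in simp)
  also have "\<dots> = fscale (ell ?a * inverse (XX \<mu> ?a)) (Phi x)"
    by (rule K[OF Uzero_closed(3)[OF Z] kap_eq(2)[OF Z, symmetric] K_move(2)[OF x(1) Z]])
  finally show "LL a \<phi> = fscale (ell a / XX \<mu> a) \<phi>" unfolding restrict_idem x(2) divide_inverse .
qed

lemma Lspace_mult: "x \<in> Aw N \<mu> \<Longrightarrow> Phi x \<in> Lspace \<mu>" by (simp add: Lspace_def)

lemma Lspace_stable:
  assumes "\<And>\<mu>. FW.subspace (W \<mu>)" "\<And>\<mu>. W \<mu> \<subseteq> Lspace \<mu>"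
    and EF: "\<And>i \<mu> \<phi>. i \<in> {1..N} \<Longrightarrow> \<phi> \<in> W \<mu> \<Longrightarrow> LE i \<phi> \<in> W (\<mu> + \<alpha> i) \<and> LF i \<phi> \<in> W (\<mu> - \<alpha> i)"
    and "w \<in> words N" and x: "Phi x \<in> W \<mu>"
  shows "Phi (mon w * x) \<in> W (\<mu> + word_weight w)"
proof -
  have "Word gs \<in> words N \<Longrightarrow> Phi (mon (Word gs) * x) \<in> W (\<mu> + word_weight (Word gs))" for gs
  proof (induction gs)
    case Nil
    show ?case unfolding mon_Word_Nil using x by simp
  next
    case (Cons g gs)
    hence g: "g \<in> generators N" "Word gs \<in> words N" by (simp_all add: words_simps del: generators.simps)
    let ?\<phi> = "Phi (mon (Word gs) * x)" and ?\<nu> = "\<mu> + word_weight (Word gs)"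
    have IH: "?\<phi> \<in> W ?\<nu>" by (rule Cons.IH[OF g(2)])
    have "translate g ?\<phi> \<in> W (?\<nu> + generator_weight g)"
    proof (cases g)
      case (GenK a)
      hence "translate g ?\<phi> = LK a ?\<phi>" using g by (auto simp: LK_def)
      hence "translate g ?\<phi> = fscale (kap a * XX a ?\<nu>) ?\<phi>" using torus_eigen(1)[OF subsetD[OF assms(2) IH], of a] by (simp only:)
      hence "translate g ?\<phi> \<in> W ?\<nu>" using FW.subspace_scale[OF assms(1) IH, of "kap a * XX a ?\<nu>"] by (simp only:)
      thus ?thesis by (simp only: GenK generator_weight.simps add_0_right)
    next
      case (GenL a)
      hence "translate g ?\<phi> = LL a ?\<phi>" using g by (auto simp: LL_def)
      hence "translate g ?\<phi> = fscale (ell a / XX ?\<nu> a) ?\<phi>" using torus_eigen(2)[OF subsetD[OF assms(2) IH], of a] by (simp only:)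
      hence "translate g ?\<phi> \<in> W ?\<nu>" using FW.subspace_scale[OF assms(1) IH, of "ell a / XX ?\<nu> a"] by (simp only:)
      thus ?thesis by (simp only: GenL generator_weight.simps add_0_right)
    qed (use g EF[OF _ IH] in \<open>auto simp: LE_def LF_def\<close>)
    thus ?case unfolding mon_Word_Cons[of g gs] using translate_Phi[OF g(1)] by (simp add: algebra_simps del: mult_single)
  qed
  thus ?thesis using assms(4) by (cases w) blast
qed

text \<open>For a nonzero \<open>Phi x\<close> in \<open>W\<close> some word has
  \<open>eps (mon w * x) \<noteq> 0\<close>. By weights, \<open>mon w * x\<close> is a nonzero
  multiple of \<open>1\<close> modulo the radical, so \<open>Phi 1\<close> lies in
  \<open>W 0\<close>, and it generates all weight spaces.\<close>

lemma Lspace_irreducible: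
  assumes "\<And>\<mu>. FW.subspace (W \<mu>)" "\<And>\<mu>. W \<mu> \<subseteq> Lspace \<mu>"
    and EF: "\<And>i \<mu> \<phi>. i \<in> {1..N} \<Longrightarrow> \<phi> \<in> W \<mu> \<Longrightarrow> LE i \<phi> \<in> W (\<mu> + \<alpha> i) \<and> LF i \<phi> \<in> W (\<mu> - \<alpha> i)"
    and "\<exists>\<mu>. \<exists>\<phi>\<in>W \<mu>. \<phi> \<noteq> 0"
  shows "W \<nu> = Lspace \<nu>"
proof
  obtain \<mu> x where x: "x \<in> Aw N \<mu>" "Phi x \<in> W \<mu>" "Phi x \<noteq> 0" using assms(2,4) by (fastforce simp: Lspace_def)
  have xA: "x \<in> A" using graded_A(3)[OF x(1)] .
  hence "x \<notin> radical" using Phi_eq_0 x(3) by blast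
  then obtain w where w: "w \<in> words N" "eps (mon w * x) \<noteq> 0" using radical_words[OF xA] by blast
  let ?z = "mon w * x"
  have z: "?z \<in> Aw N (word_weight w + \<mu>)" by (rule Aw_mon_mult[OF w(1) x(1)])
  hence wt: "word_weight w + \<mu> = 0" using eps_weight w(2) by blast
  have z0: "?z \<in> Aw N 0" using z wt by simp
  have "rho ?z 1 \<in> VFw N 0" using rho_VFw[OF z0 VF_1] by simp
  from VFw_0[OF this] have r: "rho ?z 1 = sc (eps ?z) 1" by (simp add: eps_def)
  have "?z - sc (eps ?z) 1 \<in> radical" using act_SV_1[OF graded_A(3)[OF z0]] SV(4) r by auto
  hence "Phi ?z = fscale (eps ?z) (Phi 1)" using Phi_eq Phi_sc by metis
  moreover have "Phi ?z \<in> W 0"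
    using Lspace_stable[OF assms(1,2) EF w(1) x(2)] wt by (simp add: add.commute)
  ultimately have "fscale (inverse (eps ?z)) (fscale (eps ?z) (Phi 1)) \<in> W 0"
    using FW.subspace_scale[OF assms(1)[of 0], of "Phi ?z"] by simp
  hence one: "Phi 1 \<in> W 0" using w(2) by (simp add: mult.assoc[symmetric])
  have "Phi y \<in> W \<nu>" if "y \<in> Aw N \<nu>" for y
    using that unfolding Aw_def
  proof (induction rule: FA.span_induct_alt)
    case base
    show ?case unfolding Phi_0 by (rule FW.subspace_0[OF assms(1)])
  next
    case (step c u y)
    then obtain w' where w': "w' \<in> words N" "word_weight w' = \<nu>" "u = mon w'" by auto
    have "Phi u \<in> W \<nu>" using Lspace_stable[OF assms(1,2) EF w'(1) one] w' by simp
    thus ?case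
      unfolding Phi_add Phi_sc by (intro FW.subspace_add[OF assms(1)] FW.subspace_scale[OF assms(1)] step)
  qed
  thus "Lspace \<nu> \<subseteq> W \<nu>" by (auto simp: Lspace_def)
qed (rule assms(2))

lemma Lspace_chamber:
  "chamber fscale Lspace LK LL XX kap ell {1..N} simple_root LE LF (weight_height N) (Phi 1) 0"
proof (intro chamber.intro graded_rep.intro graded_rep_axioms.intro chamber_axioms.intro)
  show "vector_space (fscale :: 'k \<Rightarrow> _)" by (rule FW.vector_space_axioms)
  show "FW.subspace (Lspace \<mu>)" for \<mu> by (rule Lspace_subspace)
  show "LK a (\<phi> + \<psi>) = LK a \<phi> + LK a \<psi>" "LK a (fscale c \<phi>) = fscale c (LK a \<phi>)"
    "LL a (\<phi> + \<psi>) = LL a \<phi> + LL a \<psi>" "LL a (fscale c \<phi>) = fscale c (LL a \<phi>)" for a c \<phi> \<psi>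
    unfolding LK_def LL_def by (rule translate_linear)+
  show "LE i (\<phi> + \<psi>) = LE i \<phi> + LE i \<psi>" "LE i (fscale c \<phi>) = fscale c (LE i \<phi>)"
    "LF i (\<phi> + \<psi>) = LF i \<phi> + LF i \<psi>" "LF i (fscale c \<phi>) = fscale c (LF i \<phi>)" for i c \<phi> \<psi>
    unfolding LE_def LF_def by (rule translate_linear)+
  show "\<phi> \<in> Lspace \<mu> \<Longrightarrow> LK a \<phi> = fscale (kap a * XX a \<mu>) \<phi>"
    "\<phi> \<in> Lspace \<mu> \<Longrightarrow> LL a \<phi> = fscale (ell a / XX \<mu> a) \<phi>" for a \<mu> \<phi>
    by (rule torus_eigen, assumption)+
  show "XX (a + b) d = XX a d * XX b d" "XX a (b + d) = XX a b * XX a d" "XX a b \<noteq> 0"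
    "kap (a + b) = kap a * kap b" "ell (a + b) = ell a * ell b" "kap a \<noteq> 0" "ell a \<noteq> 0" for a b d
    by (rule X_add X_nz kap_ell_hom kap_ell_nz)+
  show "weight_height N (a + b) = weight_height N a + weight_height N b" for a b by (rule weight_height_add)
  show "Phi 1 \<in> Lspace 0" by (rule Lspace_mult[OF Aw_1])
  show "Phi 1 \<noteq> 0" using Phi_eq_0[of 1] one_notin_radical by simp
  fix i assume i: "i \<in> {1..N}"
  hence g: "GenE i \<in> generators N" "GenF i \<in> generators N" by simp_all
  show "0 < weight_height N (\<alpha> i)" using weight_height_simple[OF i] by simp
  have "gE i \<in> radical" using SV(4,5) i by blast
  hence "Phi (gE i * 1) = 0" using Phi_eq_0[of "gE i"] gens_A(3)[OF i] by simp
  thus "LE i (Phi 1) = 0" unfolding LE_def translate_Phi[OF g(1)] .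
  show "LE i \<phi> \<in> Lspace (\<mu> + \<alpha> i)" "LF i \<phi> \<in> Lspace (\<mu> - \<alpha> i)" if \<phi>: "\<phi> \<in> Lspace \<mu>" for \<phi> \<mu>
  proof -
    obtain x where x: "x \<in> Aw N \<mu>" "\<phi> = Phi x" using \<phi> by (auto simp: Lspace_def)
    show "LE i \<phi> \<in> Lspace (\<mu> + \<alpha> i)" "LF i \<phi> \<in> Lspace (\<mu> - \<alpha> i)"
      using Lspace_mult[OF Aw_mult[OF gen_Aw'(3)[OF i] x(1)]] Lspace_mult[OF Aw_mult[OF gen_Aw'(4)[OF i] x(1)]]
      unfolding LE_def LF_def x(2) translate_Phi[OF g(1)] translate_Phi[OF g(2)] by (simp_all add: add.commute)
  qed
  fix j assume j: "j \<in> {1..N}"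
  hence gj: "GenF j \<in> generators N" by simp
  fix \<phi> \<mu> assume "\<phi> \<in> Lspace \<mu>"
  then obtain x where x: "x \<in> A" "\<phi> = Phi x" using graded_A(3) by (auto simp: Lspace_def)
  have K: "LK (\<alpha> i) \<phi> = Phi (gK (\<alpha> i) * x)" "LL (\<alpha> i) \<phi> = Phi (gL (\<alpha> i) * x)"
    using translate_Phi[of "GenK (\<alpha> i)" x] translate_Phi[of "GenL (\<alpha> i)" x] i by (simp_all add: LK_def LL_def x(2))
  have "LE i (LF j \<phi>) = Phi ((gE i * gF j) * x)"
    unfolding LE_def LF_def x(2) translate_Phi[OF g(1)] translate_Phi[OF gj] by (simp only: mult.assoc)
  also have "\<dots> = Phi ((gF j * gE i + (if i = j then gL (\<alpha> i) - gK (\<alpha> i) else 0)) * x)"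
    by (rule Phi_cong[OF cong_mult_right[OF x(1) rel_cong(10)[OF i j]]])
  also have "\<dots> = Phi (gF j * (gE i * x)) + Phi ((if i = j then gL (\<alpha> i) - gK (\<alpha> i) else 0) * x)"
    by (simp only: distrib_right Phi_add mult.assoc)
  also have "Phi ((if i = j then gL (\<alpha> i) - gK (\<alpha> i) else 0) * x) = (if i = j then LL (\<alpha> i) \<phi> - LK (\<alpha> i) \<phi> else 0)"
    unfolding K by (cases "i = j") (simp_all only: simp_thms if_True if_False left_diff_distrib Phi_diff mult_zero_left Phi_0)
  also have "Phi (gF j * (gE i * x)) = LF j (LE i \<phi>)"
    unfolding LE_def LF_def x(2) translate_Phi[OF g(1)] translate_Phi[OF gj] ..
  finally show "LE i (LF j \<phi>) = LF j (LE i \<phi>) + (if i = j then LL (\<alpha> i) \<phi> - LK (\<alpha> i) \<phi> else 0)" .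
next
  fix W :: "weight \<Rightarrow> (word \<Rightarrow> 'k) set" and \<nu>
  assume "\<And>\<mu>. FW.subspace (W \<mu>)" "\<And>\<mu>. W \<mu> \<subseteq> Lspace \<mu>"
    "\<And>i \<mu> \<phi>. i \<in> {1..N} \<Longrightarrow> \<phi> \<in> W \<mu> \<Longrightarrow> LE i \<phi> \<in> W (\<mu> + \<alpha> i) \<and> LF i \<phi> \<in> W (\<mu> - \<alpha> i)"
    "\<exists>\<mu>. \<exists>\<phi>\<in>W \<mu>. \<phi> \<noteq> 0"
  thus "W \<nu> = Lspace \<nu>" by (rule Lspace_irreducible)
qed

text \<open>The weights occurring in a finite spanning set are finite in number. Projection to any
  other weight kills the span and preserves the radical, so that weight space is zero.\<close>

lemma finite_dimensional_imp_finite_weights: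
  assumes "finite G" "G \<subseteq> A" "\<And>x. x \<in> A \<Longrightarrow> \<exists>t\<in>FA.span G. x - t \<in> radical"
  shows "finite {\<mu>. \<exists>\<phi>\<in>Lspace \<mu>. \<phi> \<noteq> 0}"
proof -
  define B where "B = (\<Union>t\<in>G. word_weight ` Poly_Mapping.keys t)"
  have "finite B" using assms(1) by (simp add: B_def)
  moreover have "\<mu> \<in> B" if \<phi>: "\<phi> \<in> Lspace \<mu>" "\<phi> \<noteq> 0" for \<mu> \<phi>
  proof (rule ccontr)
    assume \<mu>: "\<mu> \<notin> B"
    obtain x where x: "x \<in> Aw N \<mu>" "\<phi> = Phi x" using \<phi>(1) by (auto simp: Lspace_def)
    have xA: "x \<in> A" using graded_A(3)[OF x(1)] .
    obtain t where t: "t \<in> FA.span G" "x - t \<in> radical" using assms(3)[OF xA] by blast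
    have g0: "proj \<mu> g = 0" if "g \<in> G" for g
      using that \<mu> by (intro poly_mapping_eqI) (force simp: lookup_proj B_def in_keys_iff)
    have "proj \<mu> t = 0"
      using t(1) by (induction rule: FA.span_induct_alt) (simp_all add: proj_add proj_sc g0)
    hence "proj \<mu> (x - t) = x" using proj_Aw[OF x(1), of \<mu>] by (simp add: proj_diff)
    hence "x \<in> radical" using radical_proj[OF t(2), of \<mu>] by simp
    thus False using \<phi>(2) x(2) Phi_eq_0[OF xA] by simp
  qed
  ultimately show ?thesis by (auto intro: finite_subset[of _ B])
qed

text \<open>Each weight has finitely many words in the \<open>F_i\<close>; those of the occurring
  weights span, because the components of \<open>rho x 1\<close> of other weights lie in the
  radical.\<close>

lemma finite_weights_imp_finite_dimensional:
  assumes "finite {\<mu>. \<exists>\<phi>\<in>Lspace \<mu>. \<phi> \<noteq> 0}"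
  shows "\<exists>G. finite G \<and> G \<subseteq> A \<and> (\<forall>x\<in>A. \<exists>t\<in>FA.span G. x - t \<in> radical)"
proof -
  define P where "P = {\<mu>. \<exists>\<phi>\<in>Lspace \<mu>. \<phi> \<noteq> 0}"
  define G :: "'k walg set" where "G = (\<Union>\<mu>\<in>P. mon ` {w \<in> fwords N. word_weight w = \<mu>})"
  have fin: "finite G" using assms finite_fwords_weight by (simp add: G_def P_def)
  have GA: "G \<subseteq> A" using fwords_words by (auto simp: G_def)
  have "\<exists>t\<in>FA.span G. x - t \<in> radical" if x: "x \<in> A" for x
  proof -
    define u where "u = rho x 1"
    have u: "u \<in> VF N" unfolding u_def by (rule rho_VF[OF x VF_1'])
    define B where "B = word_weight ` Poly_Mapping.keys u"
    have B: "finite B" by (simp add: B_def)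
    define t where "t = (\<Sum>\<mu>\<in>B \<inter> P. proj \<mu> u)"
    have "proj \<mu> u \<in> FA.span G" if "\<mu> \<in> P" for \<mu>
    proof -
      have "FA.span (mon ` {w \<in> fwords N. word_weight w = \<mu>}) \<subseteq> FA.span G"
        using that by (intro FA.span_mono) (auto simp: G_def)
      thus ?thesis using proj_VF[OF u, of \<mu>] by (auto simp: VFw_def)
    qed
    hence t: "t \<in> FA.span G" unfolding t_def by (intro FA.span_sum) auto
    have "proj \<mu> u \<in> radical" if "\<mu> \<notin> P" for \<mu>
    proof -
      have w: "proj \<mu> u \<in> Aw N \<mu>" by (rule proj_VF_Aw[OF u])
      hence "Phi (proj \<mu> u) = 0" using that Lspace_mult[OF w] unfolding P_def by blast
      thus ?thesis using Phi_eq_0[OF graded_A(3)[OF w]] by simp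
    qed
    hence r: "(\<Sum>\<mu>\<in>B - P. proj \<mu> u) \<in> radical" by (intro FA.subspace_sum[OF radical_subspace]) auto
    have "u = (\<Sum>\<mu>\<in>B. proj \<mu> u)" by (rule proj_sum[OF B]) (simp add: B_def)
    also have "\<dots> = t + (\<Sum>\<mu>\<in>B - P. proj \<mu> u)"
      unfolding t_def using B by (subst sum.union_disjoint[symmetric]) (auto simp: Un_Diff_Int Int_Un_distrib intro: sum.cong)
    finally have "u - t \<in> radical" using r by (metis add_diff_cancel_left')
    from FA.subspace_add[OF radical_subspace subsetD[OF SV(4) act_SV_1[OF x]] this] have "x - t \<in> radical"
      by (simp add: u_def)
    thus ?thesis using t by blast
  qed
  thus ?thesis using fin GA by blast
qed

lemma simple_module_finite_weights:
  "finite_dimensional (underlying_space (U N \<chi>) (simple_module N \<chi> \<Lambda>)) \<longleftrightarrow>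
     finite {\<mu>. \<exists>\<phi>\<in>Lspace \<mu>. \<phi> \<noteq> 0}"
  unfolding simple_module_finite_dimensional
  using finite_dimensional_imp_finite_weights finite_weights_imp_finite_dimensional by blast

lemma Lambda_KL: assumes i: "i \<in> {1..N}" shows "\<Lambda> (KL N \<chi> i) = kap (\<alpha> i) / ell (\<alpha> i)"
proof -
  have Z: "\<alpha> i \<in> ZPi N" "- \<alpha> i \<in> ZPi N" using i by simp_all
  have "KL N \<chi> i = uc (gK (\<alpha> i) * gL (- \<alpha> i))"
    using U_ring(3)[of "gK (\<alpha> i)" "gL (- \<alpha> i)"] Z by (simp add: KL_def UK_def UL_def gen_class)
  hence "\<Lambda> (KL N \<chi> i) = kap (\<alpha> i) * ell (- \<alpha> i)"
    using Lambda_simps(3)[OF Uzero_closed(2)[OF Z(1)] Uzero_closed(3)[OF Z(2)]] Z by (simp only: kap_eq)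
  moreover have "ell (\<alpha> i) * ell (- \<alpha> i) = 1" using kap_ell_hom(2)[of "\<alpha> i" "- \<alpha> i"] kap_ell_hom(4) by simp
  ultimately show ?thesis using kap_ell_nz(2)[of "\<alpha> i"] by (simp add: field_simps)
qed

end

theorem theorem7p5:
  fixes N m :: nat
    and \<chi> :: "weight \<Rightarrow> weight \<Rightarrow> 'k::field_char_0"
    and q :: "nat \<Rightarrow> nat \<Rightarrow> 'k"
    and qh :: 'k
    and \<Lambda> :: "(word \<Rightarrow>\<^sub>0 'k) set set \<Rightarrow> 'k"
    and g :: 'k
  assumes "2 \<le> N" and "1 \<le> m" and "m \<le> N - 1"
    and "bihom N \<chi>"
    and q_def: "\<And>i j. q i j = \<chi> (simple_root i) (simple_root j)"
    and qh_def: "qh = q N N"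
    and "not_root_of_unity qh"
    and "\<And>i. 1 \<le> i \<Longrightarrow> i < N - m \<Longrightarrow> q i i = qh powi (-2)"
    and "q (N - m) (N - m) = -1"
    and "\<And>i. N - m < i \<Longrightarrow> i < N \<Longrightarrow> q i i = qh powi 2"
    and "\<And>i. 1 \<le> i \<Longrightarrow> i \<le> N - 1 \<Longrightarrow> i + 1 \<le> N - m \<Longrightarrow> q i (i + 1) * q (i + 1) i = qh powi 2"
    and "\<And>i. 1 \<le> i \<Longrightarrow> i \<le> N - 1 \<Longrightarrow> i + 1 > N - m \<Longrightarrow> q i (i + 1) * q (i + 1) i = qh powi (-2)"
    and "\<And>i j. i \<in> {1..N} \<Longrightarrow> j \<in> {1..N} \<Longrightarrow> 2 \<le> \<bar>int i - int j\<bar> \<Longrightarrow> q i j * q j i = 1"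
    and "\<Lambda> \<in> Ch N \<chi>"
    and g_def: "g = (\<Prod>i = N - m..N. \<Lambda> (KL N \<chi> i))"
  shows "finite_dimensional (underlying_space (U N \<chi>) (simple_module N \<chi> \<Lambda>)) \<longleftrightarrow>
    (\<forall>i \<in> {1..N} - {N - m}. \<exists>r::nat. \<Lambda> (KL N \<chi> i) = q i i ^ r) \<and>
    g \<in> {qh powi (-2 * int x) |x::nat. x \<le> m - 1}
       \<union> {(- qh) powi (- (int y + 2 * int m)) |y::nat. True} \<and>
    (\<forall>x::nat. x \<le> m - 1 \<longrightarrow> g = qh powi (-2 * int x) \<longrightarrow>
       (\<forall>i. N - m + x + 1 \<le> i \<and> i \<le> N \<longrightarrow> \<Lambda> (KL N \<chi> i) = 1))"
proof -
  interpret highest_weight N \<chi> \<Lambda> by unfold_locales fact+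
  have XX: "XX (simple_root i) (simple_root j) = q i j" if "i \<in> {1..N}" "j \<in> {1..N}" for i j
    using that X_eq by (simp add: q_def)
  interpret L: chamber fscale Lspace LK LL XX kap ell "{1..N}" simple_root LE LF "weight_height N" "Phi 1" 0
    by (rule Lspace_chamber)
  have form: "L.qform (simple_root i) (simple_root j) = q i j * q j i" if "i \<in> {1..N}" "j \<in> {1..N}" for i j
    unfolding L.qform_def using that by (simp only: XX)
  have n: "1 \<le> N - m" "N - m < N" and N1: "N \<in> {1..N}" using assms(1-3) by simp_all
  interpret B: typeB fscale Lspace LK LL XX kap ell N LE LF "weight_height N" "Phi 1" "N - m" m qh
  proof (intro typeB.intro typeB_axioms.intro Lspace_chamber)
    show "1 \<le> N - m" "1 \<le> m" "N = N - m + m" "not_root_of_unity qh" using n assms by simp_all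
    show "XX (simple_root N) (simple_root N) = qh" using XX[OF N1 N1] qh_def by simp
    show "XX (simple_root (N - m)) (simple_root (N - m)) = -1"
      using XX[of "N - m" "N - m"] n assms(9) by simp
    fix i
    show "XX (simple_root i) (simple_root i) = qh powi (-2)" if "1 \<le> i" "i < N - m"
      using XX[of i i] assms(8)[OF that] that by simp
    show "XX (simple_root i) (simple_root i) = qh powi 2" if "N - m < i" "i < N"
      using XX[of i i] assms(10)[OF that] that by simp
    show "L.qform (simple_root i) (simple_root (Suc i)) = qh powi 2" if "1 \<le> i" "i < N - m"
      using form[of i "Suc i"] assms(11)[of i] that by simp
    show "L.qform (simple_root i) (simple_root (Suc i)) = qh powi (-2)" if "N - m \<le> i" "i < N"
      using form[of i "Suc i"] assms(12)[of i] that n by simp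
    show "L.qform (simple_root i) (simple_root j) = 1" if "i \<in> {1..N}" "j \<in> {1..N}" "Suc i < j" for j
      using form[OF that(1,2)] assms(13)[OF that(1,2)] that(3) by simp
  qed
  have lam: "L.lam (simple_root i) 0 = \<Lambda> (KL N \<chi> i)" if "i \<in> {1..N}" for i
    using Lambda_KL[OF that] by (simp add: L.lam_def)
  have "(\<Prod>i = N - m..N. L.lam (simple_root i) 0) = g"
    unfolding g_def using lam n by (intro prod.cong) auto
  moreover have "(\<forall>i \<in> {1..N} - {N - m}. \<exists>r::nat. L.lam (simple_root i) 0 = XX (simple_root i) (simple_root i) ^ r) \<longleftrightarrow>
      (\<forall>i \<in> {1..N} - {N - m}. \<exists>r::nat. \<Lambda> (KL N \<chi> i) = q i i ^ r)"
    using lam XX by simp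
  moreover have "(\<forall>i. N - m + x + 1 \<le> i \<and> i \<le> N \<longrightarrow> L.lam (simple_root i) 0 = 1) \<longleftrightarrow>
      (\<forall>i. N - m + x + 1 \<le> i \<and> i \<le> N \<longrightarrow> \<Lambda> (KL N \<chi> i) = 1)" for x
    using lam by simp
  ultimately show ?thesis
    unfolding simple_module_finite_weights B.weights_def[symmetric] B.finite_weights_iff_explicit by simp
qed

end
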